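(* Let $n\in\{2,3\}$, fix $\rho_0\in(0,1)$, and let $T_{\max}:=\rho_0^2/(2(n-1))$. Let $\tau=\tau(\varepsilon)>0$ satisfy $\tau(\varepsilon)=o(\varepsilon^\mu)$ as $\varepsilon\to0^+$ for some (small) $\mu>0$, and let $F\in C^2(\mathbb{R})$ satisfy $F(\pm1)=F'(\pm1)=0$, $F''(\pm1)>0$, and $F(s)>0$ for $s\neq\pm1$. For each small $\varepsilon>0$ let $u^\varepsilon=u^\varepsilon(r,t)$ be the (radial) solution to $$\varepsilon^2\tau u^\varepsilon_{tt}+u^\varepsilon_t=u^\varepsilon_{rr}+\frac{n-1}{r}u^\varepsilon_r-\varepsilon^{-2}F'(u^\varepsilon),\qquad r\in(0,1),\ t>0,$$ with boundary conditions $u^\varepsilon(1,t)=1$, $u^\varepsilon_r(0,t)=0$ for all $t\ge0$, and initial data $u^\varepsilon(r,0)=u_0^\varepsilon(r)$, $u^\varepsilon_t(r,0)=u_1^\varepsilon(r)$. Assume the following. (i) $\displaystyle\lim_{\varepsilon\to0}\int_0^1|u_0^\varepsilon(r)-\bar u(r)|\,r^{n-1}dr=0$, where $\bar u(r)=-1$ for $r<\rho_0$ and $\bar u(r)=+1$ for $r>\rho_0$. (ii) There is a function $z:\mathbb{R}^+\to\mathbb{R}^+$ with $z(\varepsilon)=o(1)$ as $\varepsilon\to0^+$ such that $$\int_0^1\left[\frac{\varepsilon^3\tau}{2}(u_1^\varepsilon)^2+\frac{\varepsilon}{2}\big((u_0^\varepsilon)_r\big)^2+\varepsilon^{-1}F(u_0^\varepsilon)\right]\theta(r)\,dr\le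 c_0+z(\varepsilon),$$ where $c_0:=\int_{-1}^1\sqrt{2F(s)}\,ds$ and $\theta(r):=\exp\left\{-(n-1)\left(\frac{r}{\rho_0}-1\right)\right\}\left(\frac{r}{\rho_0}\right)^{n-1}$. (iii) There is a constant $C>0$, independent of $\varepsilon$ and $\tau$, such that, viewing $u_0^\varepsilon,u_1^\varepsilon$ as radial functions on $\Omega=B(0,1)\subset\mathbb{R}^n$, $$\varepsilon^{-2}\tau^{-1}\int_\Omega\left(\Delta u_0^\varepsilon-\varepsilon^{-2}F'(u_0^\varepsilon)-u_1^\varepsilon\right)^2dx+\int_\Omega|\nabla u_1^\varepsilon|^2dx\le C\varepsilon^{-5}\tau^{-1}.$$ (iv) There is a constant $C>0$, independent of $\varepsilon$, such that $\sup_{r\in(0,1)}|u^\varepsilon(r,t)|\le C$ for all $t\ge0$. Let $\rho^o(t)=\sqrt{\rho_0^2-2(n-1)t}$, and let $\omega^0(r,t)=-1$ if $r<\rho^o(t)$ and $\omega^0(r,t)=+1$ if $r>\rho^o(t)$. Then, for any $T\in(0,T_{\max})$, $$\lim_{\varepsilon\to0}\int_0^T\int_0^1\left|u^\varepsilon(r,t)-\omega^0(r,t)\right|r^{n-1}\,dr\,dt=0.$$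
   Context: The equation is the damped wave equation $\varepsilon^2\tau u_{tt}+u_t=\Delta u-\varepsilon^{-2}F'(u)$ in the unit ball $B(0,1)=\{x\in\mathbb{R}^n:|x|\le1\}$ restricted to radially symmetric functions, $r=|x|$. Standing assumption on the solution: viewed as a function of $x\in\Omega=B(0,1)$, $(u^\varepsilon,u^\varepsilon_t)\in C([0,\infty),H^2(\Omega)\times H^1_0(\Omega))$. *)

theory Defs
  imports "HOL-Analysis.Analysis" "HOL-Library.Landau_Symbols"
begin

text \<open>\<open>C\<^sup>\<infinity>\<close>: every iterated partial derivative exists and is Frechet differentiable, hence continuous.\<close>

definition smooth :: "('a::euclidean_space \<Rightarrow> real) \<Rightarrow> bool" where
  "smooth \<phi> \<longleftrightarrow> (\<forall>bs \<in> lists Basis.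
     foldr (\<lambda>b f x. frechet_derivative f (at x) b) bs \<phi> differentiable_on UNIV)"

definition test_function :: "'a::euclidean_space set \<Rightarrow> ('a \<Rightarrow> real) \<Rightarrow> bool" where
  "test_function \<Omega> \<phi> \<longleftrightarrow> smooth \<phi> \<and>
     compact (closure {x. \<phi> x \<noteq> 0}) \<and> closure {x. \<phi> x \<noteq> 0} \<subseteq> \<Omega>"

definition locally_integrable :: "'a::euclidean_space set \<Rightarrow> ('a \<Rightarrow> real) \<Rightarrow> bool" where
  "locally_integrable \<Omega> f \<longleftrightarrow> (\<forall>K. compact K \<and> K \<subseteq> \<Omega> \<longrightarrow> integrable (lebesgue_on K) f)"

definition has_weak_partial ::
  "'a::euclidean_space set \<Rightarrow> 'a \<Rightarrow> ('a \<Rightarrow> real) \<Rightarrow> ('a \<Rightarrow> real) \<Rightarrow> bool" where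
  "has_weak_partial \<Omega> b f g \<longleftrightarrow> locally_integrable \<Omega> f \<and> locally_integrable \<Omega> g \<and>
     (\<forall>\<phi>. test_function \<Omega> \<phi> \<longrightarrow>
        (LINT x|lebesgue_on \<Omega>. f x * frechet_derivative \<phi> (at x) b) =
        - (LINT x|lebesgue_on \<Omega>. g x * \<phi> x))"

text \<open>Weak derivatives are determined only up to null sets; \<open>weak_partial\<close> selects a version,
  and is used only where the result does not depend on the version.\<close>

definition weak_partial ::
  "'a::euclidean_space set \<Rightarrow> 'a \<Rightarrow> ('a \<Rightarrow> real) \<Rightarrow> 'a \<Rightarrow> real" where
  "weak_partial \<Omega> b f = (SOME g. has_weak_partial \<Omega> b f g)"

definition weak_laplacian ::
  "'a::euclidean_space set \<Rightarrow> ('a \<Rightarrow> real) \<Rightarrow> 'a \<Rightarrow> real" where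
  "weak_laplacian \<Omega> f x = (\<Sum>b\<in>Basis. weak_partial \<Omega> b (weak_partial \<Omega> b f) x)"

definition in_L2 :: "'a::euclidean_space set \<Rightarrow> ('a \<Rightarrow> real) \<Rightarrow> bool" where
  "in_L2 \<Omega> f \<longleftrightarrow> f \<in> borel_measurable (lebesgue_on \<Omega>) \<and>
     integrable (lebesgue_on \<Omega>) (\<lambda>x. (f x)\<^sup>2)"

definition L2_norm :: "'a::euclidean_space set \<Rightarrow> ('a \<Rightarrow> real) \<Rightarrow> real" where
  "L2_norm \<Omega> f = sqrt (LINT x|lebesgue_on \<Omega>. (f x)\<^sup>2)"

definition in_H1 :: "'a::euclidean_space set \<Rightarrow> ('a \<Rightarrow> real) \<Rightarrow> bool" where
  "in_H1 \<Omega> f \<longleftrightarrow> in_L2 \<Omega> f \<and> (\<forall>b\<in>Basis. \<exists>g. has_weak_partial \<Omega> b f g \<and> in_L2 \<Omega> g)"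

definition H1_norm :: "'a::euclidean_space set \<Rightarrow> ('a \<Rightarrow> real) \<Rightarrow> real" where
  "H1_norm \<Omega> f = sqrt ((L2_norm \<Omega> f)\<^sup>2 + (\<Sum>b\<in>Basis. (L2_norm \<Omega> (weak_partial \<Omega> b f))\<^sup>2))"

definition in_H2 :: "'a::euclidean_space set \<Rightarrow> ('a \<Rightarrow> real) \<Rightarrow> bool" where
  "in_H2 \<Omega> f \<longleftrightarrow> in_H1 \<Omega> f \<and> (\<forall>b\<in>Basis. in_H1 \<Omega> (weak_partial \<Omega> b f))"

definition H2_norm :: "'a::euclidean_space set \<Rightarrow> ('a \<Rightarrow> real) \<Rightarrow> real" where
  "H2_norm \<Omega> f = sqrt ((L2_norm \<Omega> f)\<^sup>2 + (\<Sum>b\<in>Basis. (H1_norm \<Omega> (weak_partial \<Omega> b f))\<^sup>2))"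

definition in_H10 :: "'a::euclidean_space set \<Rightarrow> ('a \<Rightarrow> real) \<Rightarrow> bool" where
  "in_H10 \<Omega> f \<longleftrightarrow> in_H1 \<Omega> f \<and>
     (\<exists>\<phi>. (\<forall>k::nat. test_function \<Omega> (\<phi> k)) \<and>
          (\<lambda>k. H1_norm \<Omega> (\<lambda>x. f x - \<phi> k x)) \<longlonglongrightarrow> 0)"

definition norm_continuous ::
  "(('a \<Rightarrow> real) \<Rightarrow> real) \<Rightarrow> (real \<Rightarrow> 'a \<Rightarrow> real) \<Rightarrow> bool" where
  "norm_continuous N U \<longleftrightarrow>
     (\<forall>t\<ge>0. ((\<lambda>s. N (\<lambda>x. U s x - U t x)) \<longlongrightarrow> 0) (at t within {0..}))"

text \<open>\<open>V\<close> is the time derivative of \<open>U\<close> at \<open>t\<close> (one-sided if \<open>t = 0\<close>), as a limit in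
  \<open>L\<^sup>2(\<Omega>)\<close>. This is meant for curves \<open>U\<close> with values in \<open>L\<^sup>2(\<Omega>)\<close> on \<open>[0,\<infinity>)\<close>.\<close>

definition has_L2_time_derivative ::
  "'a::euclidean_space set \<Rightarrow> (real \<Rightarrow> 'a \<Rightarrow> real) \<Rightarrow> ('a \<Rightarrow> real) \<Rightarrow> real \<Rightarrow> bool" where
  "has_L2_time_derivative \<Omega> U V t \<longleftrightarrow> in_L2 \<Omega> V \<and>
     ((\<lambda>s. L2_norm \<Omega> (\<lambda>x. (U s x - U t x) / (s - t) - V x)) \<longlongrightarrow> 0) (at t within {0..})"

abbreviation weak_deriv_r :: "(real \<Rightarrow> real) \<Rightarrow> real \<Rightarrow> real" where
  "weak_deriv_r \<equiv> weak_partial {0<..<1} 1"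

definition radial :: "(real \<Rightarrow> real) \<Rightarrow> 'a::real_normed_vector \<Rightarrow> real" where
  "radial f x = f (norm x)"

text \<open>
  The predicate below says that \<open>u r t\<close> solves
    \<open>\<epsilon>\<^sup>2 \<tau> u_tt + u_t = u_rr + (n-1)/r u_r - \<epsilon>^(-2) F'(u)\<close> for \<open>0 < r < 1\<close>, \<open>t > 0\<close>, with
    \<open>u(1,t) = 1\<close>, \<open>u_r(0,t) = 0\<close>, \<open>u(r,0) = u0(r)\<close>, \<open>u_t(r,0) = u1(r)\<close>,
  in the regularity class \<open>(u,u_t) \<in> C([0,\<infinity>), H\<^sup>2 \<times> H\<^sup>1\<^sub>0)\<close>, where \<open>n = CARD('n)\<close>.
  In this class \<open>u_tt\<close> is in general only a curve in \<open>L\<^sup>2\<close>, so \<open>v = u_t\<close> and \<open>w = u_tt\<close> are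
  derivatives in \<open>L\<^sup>2\<close>, and for every \<open>t > 0\<close> the equation holds for almost every \<open>r\<close>.
  Since \<open>H\<^sup>2\<close> embeds into the continuous functions on the closed ball for \<open>n \<le> 3\<close>, the
  continuous version of \<open>u\<close> is the one used, and its boundary values are taken pointwise.
  For \<open>n = 3\<close> membership in \<open>H\<^sup>2\<close> does not imply \<open>u_r(0,t) = 0\<close>.
\<close>

definition damped_radial_solution ::
  "'n::finite itself \<Rightarrow> (real \<Rightarrow> real) \<Rightarrow> real \<Rightarrow> real \<Rightarrow>
   (real \<Rightarrow> real) \<Rightarrow> (real \<Rightarrow> real) \<Rightarrow> (real \<Rightarrow> real \<Rightarrow> real) \<Rightarrow> bool" where
  "damped_radial_solution _ F' \<epsilon> \<tau> u0 u1 u \<longleftrightarrow>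
    (\<exists>v w :: real \<Rightarrow> real \<Rightarrow> real.
      let \<Omega> = ball 0 1 :: (real^'n) set;
          U = (\<lambda>t. radial (\<lambda>r. u r t));
          V = (\<lambda>t. radial (\<lambda>r. v r t));
          W = (\<lambda>t. radial (\<lambda>r. w r t))
      in
        (\<forall>t\<ge>0. in_H2 \<Omega> (U t)) \<and> norm_continuous (H2_norm \<Omega>) U \<and>
        (\<forall>t\<ge>0. in_H10 \<Omega> (V t)) \<and> norm_continuous (H1_norm \<Omega>) V \<and>
        (\<forall>t\<ge>0. has_L2_time_derivative \<Omega> U (V t) t) \<and>
        (\<forall>t>0. has_L2_time_derivative \<Omega> V (W t) t) \<and>
        (\<forall>t>0. AE r in lebesgue_on {0<..<1}.
           \<epsilon>\<^sup>2 * \<tau> * w r t + v r t =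
             weak_deriv_r (weak_deriv_r (\<lambda>s. u s t)) r
             + (real CARD('n) - 1) / r * weak_deriv_r (\<lambda>s. u s t) r
             - F' (u r t) / \<epsilon>\<^sup>2) \<and>
        (\<forall>t\<ge>0. continuous_on {0..1} (\<lambda>r. u r t) \<and> u 1 t = 1 \<and>
           ((\<lambda>r. u r t) has_real_derivative 0) (at 0 within {0..1})) \<and>
        (\<forall>r\<in>{0<..<1}. u r 0 = u0 r) \<and>
        (AE r in lebesgue_on {0<..<1}. v r 0 = u1 r))"

text \<open>The radial step profile with interface radius \<open>\<rho>\<close>; its value at \<open>r = \<rho>\<close> is irrelevant,
  since the profile only occurs under integrals in \<open>r\<close>.\<close>

definition step_profile :: "real \<Rightarrow> real \<Rightarrow> real" where
  "step_profile \<rho> r = (if r < \<rho> then -1 else 1)"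

definition interface_radius :: "nat \<Rightarrow> real \<Rightarrow> real \<Rightarrow> real" where
  "interface_radius n \<rho>0 t = sqrt (\<rho>0\<^sup>2 - 2 * (real n - 1) * t)"

definition interface_weight :: "nat \<Rightarrow> real \<Rightarrow> real \<Rightarrow> real" where
  "interface_weight n \<rho>0 r = exp (- (real n - 1) * (r / \<rho>0 - 1)) * (r / \<rho>0) ^ (n - 1)"

definition min_energy :: "(real \<Rightarrow> real) \<Rightarrow> real" where
  "min_energy F = (LINT s|lebesgue_on {-1..1}. sqrt (2 * F s))"

end

theory Submission
  imports Defs
begin

text \<open>
  The proof is a relative energy argument. With \<open>N = n - 1\<close> and \<open>\<rho>\<close> the interface radius, the weight
  \<open>\<theta>\<close> of the paper is transported along the motion, and the weighted energy is compared with
  \<open>\<integral> \<psi> W(u)\<close>, where \<open>W' = sqrt (2 F)\<close> and \<open>\<psi>\<close> is the divergence of a radial calibration field of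
  length at most \<open>1\<close> that has length \<open>1\<close> exactly on the interface. The resulting excess dominates both
  \<open>\<integral> (r/\<rho> - 1)\<^sup>2\<close> times the energy density and the weighted distance of \<open>W(u)\<close> to its value for
  the sharp profile. Differentiating it in time, adding a momentum term \<open>\<epsilon>\<^sup>3 \<tau> \<integral> b u_r u_t\<close> and completing the
  square in \<open>u_t + b u_r\<close>, where \<open>b\<close> extends the interface velocity, bounds the derivative by a constant
  times the excess plus \<open>o(1)\<close>. Gronwall's lemma keeps the excess small, and hence \<open>u\<close> is close to the
  wells away from a thin layer around the interface.
\<close>

subsection \<open>Smooth functions\<close>

text \<open>Smallness at time zero has two sources: the energy bound gives
  \<open>energy - c0\<close> small, and \<open>L1\<close> closeness to the step gives the position
  of the interface. The Gronwall argument closes because orders match: with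
  \<open>h = r / R - 1\<close>, every coefficient without a factor
  \<open>kap = eps^2 * \<tau>\<close> that survives the completed square is \<open>O(h^2)\<close>,
  and \<open>h^2\<close> is at most a constant times \<open>1 - r * wt_m\<close>, the defect of the
  calibration. The exponential in the weight cancels the first-order term in \<open>h\<close>; the
  cube in the velocity field makes its slope vanish to second order. The wave term is a
  perturbation, since the momentum is at most \<open>A * sqrt kap\<close> times the energy. The
  technical obstacle is regularity. \<open>u_r\<close> is only known to be continuous in time with
  values in \<open>L2\<close>, so time derivatives are taken of integrals, and differences of
  \<open>u_r\<close> are first moved by parts onto difference quotients of \<open>u\<close>. The
  long first half therefore turns the Sobolev formulation on the ball into one-dimensional
  statements with enough information at \<open>r = 0\<close> to discard boundary terms.\<close>

abbreviation partial :: "'a::euclidean_space => ('a => real) => 'a => real" where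
 "partial b f \<equiv> (%x. frechet_derivative f (at x) b)"

text \<open>By induction on the word of basis directions, all iterated partial derivatives of
  \<open>f\<close> stay in the invariant set \<open>S\<close>. Most smoothness proofs below exhibit
  such a set.\<close>

lemma smooth_coinduct:
 assumes S: "!!f. f \<in> S ==> (\<forall>x. f differentiable (at x)) & (\<forall>b\<in>Basis. partial b f \<in> S)"
  and "f \<in> S"
 shows "smooth f"
proof -
 have "foldr (%b f x. frechet_derivative f (at x) b) bs f \<in> S" if "bs \<in> lists Basis" for bs
  using that by (induction bs) (auto simp: S \<open>f \<in> S\<close>)
 then show ?thesis
  unfolding smooth_def differentiable_on_def using S by (metis iso_tuple_UNIV_I)
qed

lemma smooth_differentiable: "smooth f ==> f differentiable (at x)"
 unfolding smooth_def differentiable_on_def by (drule bspec[of _ _ "[]"]) auto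

lemma smooth_partial: "smooth f ==> b \<in> Basis ==> smooth (partial b f)"
 unfolding smooth_def
proof
 fix bs :: "'a list"
 assume f: "\<forall>bs\<in>lists Basis. foldr (%b f x. frechet_derivative f (at x) b) bs f differentiable_on UNIV"
  and b: "b \<in> Basis" "bs \<in> lists Basis"
 have "bs @ [b] \<in> lists Basis" using b by auto
 from bspec[OF f this]
 show "foldr (%b f x. frechet_derivative f (at x) b) bs (partial b f) differentiable_on UNIV"
  by simp
qed

lemma smoothI:
 assumes "!!x. f differentiable (at x)" "!!b. b \<in> Basis ==> smooth (partial b f)"
 shows "smooth f"
 by (rule smooth_coinduct[of "insert f {g. smooth g}"])
  (use assms in \<open>auto intro: smooth_differentiable smooth_partial\<close>)

lemma smooth_continuous: "smooth f ==> continuous_on A f"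
 by (meson continuous_at_imp_continuous_on differentiable_imp_continuous_within smooth_differentiable)

lemma smooth_has_derivative: "smooth f ==> (f has_derivative frechet_derivative f (at x)) (at x)"
 using smooth_differentiable frechet_derivative_works by blast

lemma partial_eq: "(f has_derivative f') (at x) ==> frechet_derivative f (at x) b = f' b"
 by (metis frechet_derivative_at)

text \<open>Sums and products are closed off together because differentiating a product yields a sum
  of products. To show that all elements are smooth it then suffices that the partial derivatives of
  the generators lie in the generated algebra; they need not be generators themselves.\<close>

inductive_set function_algebra :: "('a => real) set => ('a => real) set" for B where
 base: "f \<in> B ==> f \<in> function_algebra B"
| add: "f \<in> function_algebra B ==> g \<in> function_algebra B ==> (%x. f x + g x) \<in> function_algebra B"
| mult: "f \<in> function_algebra B ==> g \<in> function_algebra B ==> (%x. f x * g x) \<in> function_algebra B"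

lemma smooth_function_algebra:
 fixes B :: "('a::euclidean_space => real) set"
 assumes B: "!!f. f \<in> B ==> (\<forall>x. f differentiable (at x)) & (\<forall>b\<in>Basis. partial b f \<in> function_algebra B)"
  and f: "f \<in> function_algebra B"
 shows "smooth f"
proof (rule smooth_coinduct[OF _ f])
 fix f assume "f \<in> function_algebra B"
 then show "(\<forall>x. f differentiable (at x)) & (\<forall>b\<in>Basis. partial b f \<in> function_algebra B)"
 proof induction
  case (base f) then show ?case using B by blast
 next
  case (add f g)
  have "((%x. f x + g x) has_derivative (%h. frechet_derivative f (at x) h + frechet_derivative g (at x) h)) (at x)" for x
   using add by (intro has_derivative_add) (auto simp: frechet_derivative_works[symmetric])
  note d = this
  have "partial b (%x. f x + g x) = (%x. partial b f x + partial b g x)" for b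
   using partial_eq[OF d] by auto
  then show ?case using add d by (auto simp: differentiable_def intro!: function_algebra.add)
 next
  case (mult f g)
  have "((%x. f x * g x) has_derivative (%h. f x * frechet_derivative g (at x) h + frechet_derivative f (at x) h * g x)) (at x)" for x
   using mult by (intro has_derivative_mult) (auto simp: frechet_derivative_works[symmetric])
  note d = this
  have "partial b (%x. f x * g x) = (%x. f x * partial b g x + partial b f x * g x)" for b
   using partial_eq[OF d] by auto
  then show ?case using mult d
   by (auto simp: differentiable_def intro!: function_algebra.add function_algebra.mult)
 qed
qed

lemma smooth_alg: 
 assumes "f \<in> function_algebra {f. smooth f}" shows "smooth f"
 by (rule smooth_function_algebra[OF _ assms])
   (auto intro: smooth_differentiable smooth_partial function_algebra.base)

lemma smooth_add: "smooth f ==> smooth g ==> smooth (%x. f x + g x)"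
 by (intro smooth_alg function_algebra.add function_algebra.base) auto

lemma smooth_mult: "smooth f ==> smooth g ==> smooth (%x. f x * g x)"
 by (intro smooth_alg function_algebra.mult function_algebra.base) auto

lemma smooth_const: "smooth (%x. c)"
 by (rule smooth_coinduct[of "range (%c x. c)"]) (auto simp: partial_eq[OF has_derivative_const])

lemma smooth_cmult: "smooth f ==> smooth (%x. c * f x)"
 by (intro smooth_mult smooth_const)

lemma smooth_diff: "smooth f ==> smooth g ==> smooth (%x. f x - g x)"
 using smooth_add[OF _ smooth_cmult[of g "-1"]] by auto

lemma smooth_prod: "(!!i. i \<in> I ==> smooth (f i)) ==> smooth (%x. \<Prod>i\<in>I. f i x)"
 by (induction I rule: infinite_finite_induct) (auto intro: smooth_mult smooth_const)

lemma smooth_inner: "smooth (%x. x \<bullet> c)"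
proof -
 have d: "((%x. x \<bullet> c) has_derivative (%h. h \<bullet> c)) (at x)" for x
  by (auto intro!: derivative_eq_intros)
 show ?thesis
 proof (rule smoothI)
  show "(%x. x \<bullet> c) differentiable at x" for x using d differentiable_def by blast
  show "smooth (partial b (%x. x \<bullet> c))" for b by (simp add: partial_eq[OF d] smooth_const)
 qed
qed

lemma smooth_real_deriv:
 fixes f :: "real => real"
 assumes "smooth f"
 shows "(f has_real_derivative partial 1 f x) (at x)"
proof -
 have "(f has_derivative frechet_derivative f (at x)) (at x)" using assms smooth_has_derivative by blast
 then have "(f has_real_derivative frechet_derivative f (at x) 1) (at x)"
  by (rule has_derivative_imp_has_field_derivative)
   (metis (no_types, lifting) \<open>(f has_derivative frechet_derivative f (at x)) (at x)\<close> has_derivative_bounded_linear mult.right_neutral real_bounded_linear mult.commute mult_1)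
 then show ?thesis .
qed

lemma partial_real_eq:
 fixes f :: "real => real"
 shows "(f has_real_derivative d) (at x) ==> partial 1 f x = d"
 by (simp add: has_field_derivative_def partial_eq)

lemma smooth_realI:
 fixes f :: "real => real"
 assumes "!!x. (f has_real_derivative g x) (at x)" "smooth g"
 shows "smooth f"
proof (rule smoothI)
 show "f differentiable at x" for x
  using assms(1) by (meson differentiable_def has_field_derivative_imp_has_derivative)
 have "partial 1 f = g" using partial_real_eq[OF assms(1)] by auto
 then show "smooth (partial b f)" if "b \<in> Basis" for b using that assms(2) by auto
qed

lemma smooth_compose_affine:
 fixes \<phi> :: "real => real"
 assumes "smooth \<phi>"
 shows "smooth (%x. \<phi> (\<alpha> * (x \<bullet> c) + \<beta>))"
proof -
 define S where "S = {(%x::'a. \<phi> (\<alpha> * (x \<bullet> c) + \<beta>)) |\<phi>. smooth \<phi>}"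
 have "smooth f" if "f \<in> S" for f
 proof (rule smooth_coinduct[OF _ that])
  fix f assume "f \<in> S"
  then obtain \<phi> where f: "f = (%x. \<phi> (\<alpha> * (x \<bullet> c) + \<beta>))" and \<phi>: "smooth \<phi>" by (auto simp: S_def)
  have d: "(f has_derivative (%h. (\<alpha> * (h \<bullet> c)) * partial 1 \<phi> (\<alpha> * (x \<bullet> c) + \<beta>))) (at x)" for x
   unfolding f
   by (rule DERIV_compose_FDERIV[OF smooth_real_deriv[OF \<phi>]]) (auto intro!: derivative_eq_intros)
  have "partial b f \<in> S" for b
   unfolding S_def mem_Collect_eq
   by (rule exI[of _ "%y. (\<alpha> * (b \<bullet> c)) * partial 1 \<phi> y"]) (use \<phi> in \<open>auto simp: partial_eq[OF d] intro!: smooth_cmult smooth_partial\<close>)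
  with d show "(\<forall>x. f differentiable (at x)) & (\<forall>b\<in>Basis. partial b f \<in> S)"
   using differentiable_def by blast
 qed
 then show ?thesis using assms unfolding S_def by blast
qed

section \<open>Bump functions built from \<open>exp (- (1/x))\<close> extended by zero\<close>

definition flat_exp :: "real poly => real => real" where
 "flat_exp P x = (if x <= 0 then 0 else poly P (1/x) * exp (- (1/x)))"

lemma poly_exp_tendsto_0: "((%y. poly P y * exp (-y)) \<longlongrightarrow> 0) (at_top::real filter)"
proof -
 have "((%y. (\<Sum>i\<le>degree P. coeff P i * (y ^ i * exp (- y)))) \<longlongrightarrow> (\<Sum>i\<le>degree P. coeff P i * 0)) (at_top::real filter)"
  by (intro tendsto_intros) (simp add: exp_minus divide_inverse[symmetric] tendsto_power_div_exp_0)
 then show ?thesis by (simp add: poly_altdef sum_distrib_right mult.assoc)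
qed

text \<open>The family is closed under differentiation: the chain rule produces
  \<open>(1/x)^2 * (P - pderiv P)\<close> evaluated at \<open>1/x\<close>, times the exponential,
  and the two \<open>pCons 0\<close> encode the factor \<open>(1/x)^2\<close>. At the origin the
  difference quotient is again a polynomial in \<open>1/x\<close> times \<open>exp (- (1/x))\<close>
  and tends to zero.\<close>

lemma flat_exp_deriv:
 "(flat_exp P has_real_derivative flat_exp (pCons 0 (pCons 0 (P - pderiv P))) x) (at x)"
proof -
 consider "x > 0" | "x < 0" | "x = 0" by linarith
 then show ?thesis
 proof cases
  case 1
  have "((%x. poly P (1/x) * exp (- (1/x))) has_real_derivative
    poly (pCons 0 (pCons 0 (P - pderiv P))) (1/x) * exp (-(1/x))) (at x)"
   using 1 by (auto intro!: derivative_eq_intros DERIV_chain2[OF poly_DERIV] simp: field_simps power2_eq_square)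
  then have "(flat_exp P has_real_derivative
    poly (pCons 0 (pCons 0 (P - pderiv P))) (1/x) * exp (-(1/x))) (at x)"
   by (rule has_field_derivative_transform_within_open[of _ _ _ "{0<..}"]) (use 1 in \<open>auto simp: flat_exp_def\<close>)
  then show ?thesis using 1 by (simp add: flat_exp_def)
 next
  case 2
  have "((%x. 0) has_real_derivative 0) (at x)" by simp
  then have "(flat_exp P has_real_derivative 0) (at x)"
   by (rule has_field_derivative_transform_within_open[of _ _ _ "{..<0}"]) (use 2 in \<open>auto simp: flat_exp_def\<close>)
  then show ?thesis using 2 by (simp add: flat_exp_def)
 next
  case 3
  have r: "((%h. flat_exp P h / h) \<longlongrightarrow> 0) (at_right 0)"
  proof -
   have "((%h. poly (pCons 0 P) (1/h) * exp (-(1/h))) \<longlongrightarrow> 0) (at_right 0)"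
    by (rule filterlim_compose[OF poly_exp_tendsto_0]) 
     (simp add: divide_inverse filterlim_inverse_at_top_right)
   moreover have "eventually (%h::real. poly (pCons 0 P) (1/h) * exp (-(1/h)) = flat_exp P h / h) (at_right 0)"
    using eventually_at_right_less[of "0::real"]
   proof eventually_elim
    case (elim h)
    then have "flat_exp P h = poly P (1/h) * exp (-(1/h))" unfolding flat_exp_def by (meson not_le)
    then show ?case by (simp only: poly_pCons add_0_left divide_inverse ac_simps mult_1_left)
   qed
   ultimately show ?thesis by (rule Lim_transform_eventually)
  qed
  have l: "((%h. flat_exp P h / h) \<longlongrightarrow> 0) (at_left 0)"
  proof -
   have "eventually (%h::real. 0 = flat_exp P h / h) (at_left 0)"
    unfolding eventually_at_filter
    by (intro always_eventually allI impI) (simp only: flat_exp_def lessThan_iff less_imp_le if_True div_0)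
   with tendsto_const show ?thesis by (rule Lim_transform_eventually)
  qed
  have "((%h. flat_exp P h / h) \<longlongrightarrow> 0) (at 0)" using l r by (simp add: filterlim_split_at)
  then show ?thesis using 3 by (simp add: has_field_derivative_iff flat_exp_def)
 qed
qed

lemma smooth_flat_exp: "smooth (flat_exp P)"
proof (rule smooth_coinduct[of "range flat_exp"])
 fix f assume "f \<in> range flat_exp"
 then obtain P where f: "f = flat_exp P" by auto
 have "partial 1 f = flat_exp (pCons 0 (pCons 0 (P - pderiv P)))"
  using partial_real_eq[OF flat_exp_deriv] f by auto
 then show "(\<forall>x. f differentiable at x) & (\<forall>b\<in>Basis. partial b f \<in> range flat_exp)"
  using f flat_exp_deriv by (auto simp: differentiable_def has_field_derivative_def)
qed auto

definition bump :: "real => real" where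
 "bump x = flat_exp 1 x * flat_exp 1 (1 - x)"

lemma smooth_bump: "smooth bump"
proof -
 have "smooth (%x::real. flat_exp 1 (1 - x))"
  using smooth_compose_affine[OF smooth_flat_exp, of 1 "-1" "1::real" 1] by (simp add: algebra_simps)
 then show ?thesis unfolding bump_def[abs_def] by (intro smooth_mult smooth_flat_exp)
qed

lemma bump_pos: "0 < x ==> x < 1 ==> bump x > 0"
 and bump_zero: "x <= 0 \<or> 1 <= x ==> bump x = 0"
 and bump_nonneg: "bump x >= 0"
 by (auto simp: bump_def flat_exp_def)

text \<open>The integral over \<open>{0..x}\<close> is \<open>0\<close> for negative
  \<open>x\<close>. Since \<open>f\<close> vanishes on the left half-line, this convention agrees
  with the primitive started at \<open>-1\<close>, so the formula is differentiable across the
  origin.\<close>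

lemma smooth_primitive:
 fixes f :: "real => real"
 assumes "smooth f" "!!x. x <= 0 ==> f x = 0"
 shows "((%x. integral {0..x} f) has_real_derivative f x) (at x)"
  "smooth (%x. integral {0..x} f)"
proof -
 show 1: "((%x. integral {0..x} f) has_real_derivative f x) (at x)" for x
 proof (cases "x < 0")
  case True
  have "((%x. 0) has_real_derivative 0) (at x)" by simp
  then have "((%x. integral {0..x} f) has_real_derivative 0) (at x)"
   by (rule has_field_derivative_transform_within_open[of _ _ _ "{..<0}"]) (use True in auto)
  then show ?thesis using True assms by simp
 next
  case False
  have "((%x. integral {-1..x} f) has_real_derivative f x) (at x within {-1..x+1})"
   using False by (intro integral_has_real_derivative smooth_continuous assms) auto
  then have "((%x. integral {-1..x} f) has_real_derivative f x) (at x)"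
   using False by (subst (asm) at_within_Icc_at) auto
  moreover have "integral {-1..y} f = integral {0..y} f" if "y > -1" for y
  proof (cases "y >= 0")
   case True
   have "integral {-1..0} f + integral {0..y} f = integral {-1..y} f"
    using True by (intro Henstock_Kurzweil_Integration.integral_combine integrable_continuous_real smooth_continuous assms) auto
   moreover have "integral {-1..0} f = integral {-1..0} (%x::real. 0::real)"
    by (rule Henstock_Kurzweil_Integration.integral_cong) (use assms in auto)
   ultimately show ?thesis by simp
  next
   case False
   have "integral {-1..y} f = integral {-1..y} (%x::real. 0::real)"
    by (rule Henstock_Kurzweil_Integration.integral_cong) (use assms False in auto)
   then show ?thesis using False by simp
  qed
  ultimately show ?thesis
   using False by (intro has_field_derivative_transform_within_open[of "%x. integral {-1..x} f" _ _ "{-1<..}" "%x. integral {0..x} f"]) auto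
 qed
 show "smooth (%x. integral {0..x} f)"
  using smooth_realI[OF 1 assms(1)] .
qed

subsection \<open>Test functions and the fundamental lemma of the calculus of variations\<close>

lemma integrable_lebesgue_on_iff:
 fixes f :: "'a::euclidean_space => real"
 assumes "S \<in> sets lebesgue"
 shows "integrable (lebesgue_on S) f \<longleftrightarrow> f absolutely_integrable_on S"
 using assms by (simp add: set_integrable_def integrable_restrict_space)

lemma integrable_lebesgue_on_subset:
 fixes f :: "'a::euclidean_space => real"
 assumes "integrable (lebesgue_on T) f" "S \<subseteq> T" "S \<in> sets lebesgue" "T \<in> sets lebesgue"
 shows "integrable (lebesgue_on S) f"
 using assms set_integrable_subset[of lebesgue T f S] by (simp add: integrable_lebesgue_on_iff)

lemma integral_lebesgue_on_mono_support:
 fixes f :: "'a::euclidean_space => real"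
 assumes "S \<subseteq> T" "S \<in> sets lebesgue" "T \<in> sets lebesgue" "!!x. x \<in> T - S ==> f x = 0"
 shows "integrable (lebesgue_on S) f \<longleftrightarrow> integrable (lebesgue_on T) f"
  and "integral\<^sup>L (lebesgue_on S) f = integral\<^sup>L (lebesgue_on T) f"
proof -
 have eq: "(%x. if x \<in> S then f x else 0) = (%x. if x \<in> T then f x else 0)"
  by (rule ext) (use assms in \<open>auto simp: subset_iff\<close>)
 show "integrable (lebesgue_on S) f \<longleftrightarrow> integrable (lebesgue_on T) f"
  using Lebesgue_Measure.integrable_restrict_UNIV[of S f] Lebesgue_Measure.integrable_restrict_UNIV[of T f] assms eq by simp
 show "integral\<^sup>L (lebesgue_on S) f = integral\<^sup>L (lebesgue_on T) f"
  using Lebesgue_Measure.integral_restrict_UNIV[of S f] Lebesgue_Measure.integral_restrict_UNIV[of T f] assms eq by simp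
qed

lemma closed_borel_lebesgue: "closed S ==> S \<in> sets lebesgue"
 by (simp add: borel_closed sets_completionI_sets)

lemma open_borel_lebesgue: "open S ==> S \<in> sets lebesgue"
 by (simp add: borel_open sets_completionI_sets)

lemma test_functionI:
 assumes "smooth \<phi>" "compact K" "K \<subseteq> \<Omega>" "!!x. x \<notin> K ==> \<phi> x = 0"
 shows "test_function \<Omega> \<phi>"
proof -
 have "closure {x. \<phi> x ~= 0} \<subseteq> K"
  by (rule closure_minimal) (use assms compact_imp_closed in auto)
 then show ?thesis using assms compact_Int_closed[of K "closure {x. \<phi> x ~= 0}"] unfolding test_function_def
  by (simp add: Int_absorb1 Int_absorb2 order_trans)
qed

lemma test_function_smooth: "test_function \<Omega> \<phi> ==> smooth \<phi>"
 unfolding test_function_def by blast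

lemma test_function_support:
 assumes "test_function \<Omega> \<phi>"
 shows "\<exists>K. compact K & K \<subseteq> \<Omega> & (\<forall>x. x \<notin> K --> \<phi> x = 0 & (\<forall>b. partial b \<phi> x = 0))"
proof -
 define K where "K = closure {x. \<phi> x ~= 0}"
 have K: "compact K" "K \<subseteq> \<Omega>" using assms by (auto simp: test_function_def K_def)
 have z: "\<phi> x = 0" if "x \<notin> K" for x
  using that closure_subset[of "{x. \<phi> x ~= 0}"] unfolding K_def by blast
 have "partial b \<phi> x = 0" if x: "x \<notin> K" for x b
 proof -
  have "((%x. 0) has_derivative (%h. 0)) (at x)" by simp
  then have "(\<phi> has_derivative (%h. 0)) (at x)"
   by (rule has_derivative_transform_within_open[of _ _ _ _ "- K"])
    (use x z K compact_imp_closed in auto)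
  from partial_eq[OF this] show ?thesis .
 qed
 with K z show ?thesis by blast
qed

lemma test_function_partial:
 assumes "test_function \<Omega> \<phi>" "b \<in> Basis"
 shows "test_function \<Omega> (partial b \<phi>)"
proof -
 obtain K where K: "compact K" "K \<subseteq> \<Omega>" "!!x b. x \<notin> K ==> partial b \<phi> x = 0"
  using test_function_support[OF assms(1)] by auto
 show ?thesis
  by (rule test_functionI[OF smooth_partial[OF test_function_smooth[OF assms(1)] assms(2)] K])
qed

lemma test_function_mult:
 assumes "test_function \<Omega> \<phi>" "smooth \<psi>"
 shows "test_function \<Omega> (%x. \<psi> x * \<phi> x)"
proof -
 obtain K where "compact K" "K \<subseteq> \<Omega>" "!!x. x \<notin> K ==> \<phi> x = 0"
  using test_function_support[OF assms(1)] by auto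
 then show ?thesis
  by (intro test_functionI[of _ K] smooth_mult assms(2) test_function_smooth[OF assms(1)]) auto
qed

lemma test_function_diff:
 assumes "test_function \<Omega> \<phi>" "test_function \<Omega> \<psi>"
 shows "test_function \<Omega> (%x. \<phi> x - \<psi> x)"
proof -
 obtain K where "compact K" "K \<subseteq> \<Omega>" "!!x. x \<notin> K ==> \<phi> x = 0"
  using test_function_support[OF assms(1)] by auto
 moreover obtain L where "compact L" "L \<subseteq> \<Omega>" "!!x. x \<notin> L ==> \<psi> x = 0"
  using test_function_support[OF assms(2)] by auto
 ultimately show ?thesis
  by (intro test_functionI[of _ "K \<union> L"] smooth_diff test_function_smooth[OF assms(1)] 
    test_function_smooth[OF assms(2)]) auto
qed

lemma test_function_bounded:
 fixes \<phi> :: "'a::euclidean_space => real"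
 assumes "test_function \<Omega> \<phi>"
 obtains B where "!!x. \<bar>\<phi> x\<bar> <= B" "B >= 0"
proof -
 obtain K where K: "compact K" "!!x. x \<notin> K ==> \<phi> x = 0"
  using test_function_support[OF assms(1)] by auto
 have "compact (\<phi> ` K)"
  using K test_function_smooth[OF assms] by (intro compact_continuous_image smooth_continuous)
 then obtain B where B: "!!x. x \<in> K ==> \<bar>\<phi> x\<bar> <= B"
  by (metis compact_imp_bounded bounded_iff imageI real_norm_def)
 show ?thesis
 proof (rule that[of "max B 0"])
  show "\<bar>\<phi> x\<bar> <= max B 0" for x
   using B[of x] K(2)[of x] by (cases "x \<in> K") auto
 qed simp
qed

lemma smooth_borel: "smooth \<phi> ==> \<phi> \<in> borel_measurable borel"
 by (intro borel_measurable_continuous_onI smooth_continuous)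

lemma smooth_lebesgue_on: "smooth \<phi> ==> \<phi> \<in> borel_measurable (lebesgue_on S)"
 by (intro measurable_restrict_space1 measurable_completion) (simp add: smooth_borel)

lemma locally_integrable_times_test:
 assumes h: "locally_integrable \<Omega> h" and \<phi>: "test_function \<Omega> \<phi>" and \<Omega>: "open \<Omega>"
 shows "integrable (lebesgue_on \<Omega>) (%x. h x * \<phi> x)"
proof -
 obtain K where K: "compact K" "K \<subseteq> \<Omega>" "!!x. x \<notin> K ==> \<phi> x = 0"
  using test_function_support[OF \<phi>] by auto
 obtain B where B: "!!x. \<bar>\<phi> x\<bar> <= B" using test_function_bounded[OF \<phi>] by metis
 have hK: "integrable (lebesgue_on K) h"
  using h K unfolding locally_integrable_def by blast
 have "integrable (lebesgue_on K) (%x. h x * \<phi> x)"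
 proof (rule Bochner_Integration.integrable_bound[OF integrable_mult_left[OF hK, of B]])
  show "(%x. h x * \<phi> x) \<in> borel_measurable (lebesgue_on K)"
   using hK smooth_lebesgue_on[OF test_function_smooth[OF \<phi>]] by (intro borel_measurable_times) auto
  show "AE x in lebesgue_on K. norm (h x * \<phi> x) <= norm (h x * B)"
   using B by (intro always_eventually allI) (auto simp: abs_mult intro!: mult_left_mono order_trans[OF B])
 qed
 moreover have "integrable (lebesgue_on K) (%x. h x * \<phi> x) \<longleftrightarrow> integrable (lebesgue_on \<Omega>) (%x. h x * \<phi> x)"
  using K \<Omega> by (intro integral_lebesgue_on_mono_support(1)) (auto simp: closed_borel_lebesgue compact_imp_closed open_borel_lebesgue)
 ultimately show ?thesis by simp
qed

lemma integral_bump_pos: "integral {0..1} bump > 0"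
proof -
 have c: "continuous_on {0..1} bump" by (intro smooth_continuous smooth_bump)
 have "integral {0..1} bump ~= 0"
 proof
  assume "integral {0..1} bump = 0"
  then have "bump (1/2) = 0"
   using integral_eq_0_iff[OF c] bump_nonneg by auto
  then show False using bump_pos[of "1/2"] by simp
 qed
 moreover have "integral {0..1} bump >= 0"
  by (rule integral_nonneg) (auto intro: bump_nonneg integrable_continuous_real c)
 ultimately show ?thesis by simp
qed

section \<open>Smooth cutoffs of boxes and the fundamental lemma\<close>

definition smooth_step :: "real => real" where
 "smooth_step x = integral {0..x} bump / integral {0..1} bump"

lemma smooth_smooth_step: "smooth smooth_step"
proof -
 have "smooth (%x. inverse (integral {0..1} bump) * integral {0..x} bump)"
  by (intro smooth_cmult smooth_primitive smooth_bump) (simp add: bump_zero)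
 then show ?thesis by (simp add: smooth_step_def[abs_def] divide_inverse mult.commute)
qed

lemma smooth_step_zero: "x <= 0 ==> smooth_step x = 0"
 by (cases "x = 0") (simp_all add: smooth_step_def)

lemma smooth_step_one: "1 <= x ==> smooth_step x = 1"
proof -
 assume x: "1 <= x"
 have "integral {0..1} bump + integral {1..x} bump = integral {0..x} bump"
  by (intro Henstock_Kurzweil_Integration.integral_combine integrable_continuous_real smooth_continuous smooth_bump) (use x in auto)
 moreover have "integral {1..x} bump = integral {1..x} (%x::real. 0::real)"
  by (rule Henstock_Kurzweil_Integration.integral_cong) (auto simp: bump_zero)
 ultimately show ?thesis using integral_bump_pos by (simp add: smooth_step_def)
qed

lemma smooth_step_range: "0 <= smooth_step x" "smooth_step x <= 1"
proof -
 have m: "smooth_step x <= smooth_step y" if "x <= y" for x y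
 proof (rule DERIV_nonneg_imp_nondecreasing[OF that])
  fix z :: real
  have "((%x. integral {0..x} bump) has_real_derivative bump z) (at z)"
   by (rule smooth_primitive(1)[OF smooth_bump]) (simp add: bump_zero)
  then have "(smooth_step has_real_derivative bump z / integral {0..1} bump) (at z)"
   unfolding smooth_step_def[abs_def] by (rule DERIV_cdivide)
  moreover have "bump z / integral {0..1} bump >= 0"
   using integral_bump_pos bump_nonneg[of z] by (simp add: divide_simps)
  ultimately show "\<exists>d. (smooth_step has_real_derivative d) (at z) & 0 <= d" by blast
 qed
 show "0 <= smooth_step x" using m[of "min x 0" x] smooth_step_zero[of "min x 0"] by simp
 show "smooth_step x <= 1" using m[of x "max x 1"] smooth_step_one[of "max x 1"] by simp
qed

text \<open>The slope \<open>k\<close> sharpens the ramps: a factor is \<open>1\<close> as soon as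
  the coordinate is at distance \<open>1/k\<close> from the corresponding face. As \<open>k\<close>
  grows, the cutoffs converge pointwise to the indicator of the open box while their supports stay
  in the closed box.\<close>

definition box_cutoff :: "'a::euclidean_space => 'a => nat => 'a => real" where
 "box_cutoff a c k x = (\<Prod>b\<in>Basis. smooth_step (real k * (x \<bullet> b) + (- real k * (a \<bullet> b)))
   * smooth_step (- real k * (x \<bullet> b) + real k * (c \<bullet> b)))"

lemma box_cutoff_outside: "x \<notin> box a c ==> box_cutoff a c k x = 0"
proof -
 assume "x \<notin> box a c"
 then obtain b where b: "b \<in> Basis" "x \<bullet> b <= a \<bullet> b \<or> c \<bullet> b <= x \<bullet> b"
  by (auto simp: mem_box not_less)
 then have "real k * (x \<bullet> b) + (- real k * (a \<bullet> b)) <= 0 \<or> - real k * (x \<bullet> b) + real k * (c \<bullet> b) <= 0"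
  by (auto simp: mult_left_mono)
 then show ?thesis
  unfolding box_cutoff_def by (intro prod_zero bexI[OF _ b(1)]) (auto simp: smooth_step_zero)
qed

lemma box_cutoff_range: "0 <= box_cutoff a c k x" "box_cutoff a c k x <= 1"
 unfolding box_cutoff_def
 by (auto intro!: prod_nonneg prod_le_1 mult_nonneg_nonneg mult_le_one smooth_step_range)

lemma box_cutoff_tendsto: "(%k. box_cutoff a c k x) \<longlonglongrightarrow> indicator (box a c) x"
proof (cases "x \<in> box a c")
 case False then show ?thesis by (simp add: box_cutoff_outside)
next
 case True
 have s: "(%k. smooth_step (real k * d)) \<longlonglongrightarrow> 1" if "d > 0" for d
 proof -
  have "eventually (%k::nat. 1 <= real k * d) sequentially"
   using eventually_ge_at_top[of "nat \<lceil>1/d\<rceil>"]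
  proof eventually_elim
   case (elim k) then have "1/d <= real k" by linarith
   then show ?case using that by (simp add: field_simps)
  qed
  then have "eventually (%k::nat. 1 = smooth_step (real k * d)) sequentially"
   by eventually_elim (simp add: smooth_step_one)
  with tendsto_const show ?thesis by (rule Lim_transform_eventually)
 qed
 have "(%k. \<Prod>b\<in>Basis. smooth_step (real k * (x \<bullet> b - a \<bullet> b)) * smooth_step (real k * (c \<bullet> b - x \<bullet> b)))
   \<longlonglongrightarrow> (\<Prod>b\<in>(Basis::'a set). 1 * 1)"
  using True by (intro tendsto_intros s) (auto simp: mem_box)
 moreover have "box_cutoff a c k x = (\<Prod>b\<in>Basis. smooth_step (real k * (x \<bullet> b - a \<bullet> b)) * smooth_step (real k * (c \<bullet> b - x \<bullet> b)))" for k
  unfolding box_cutoff_def by (simp add: algebra_simps)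
 ultimately show ?thesis using True by simp
qed

lemma box_cutoff_test:
 assumes "cbox a c \<subseteq> \<Omega>"
 shows "test_function \<Omega> (box_cutoff a c k)"
proof (rule test_functionI[of _ "cbox a c"])
 show "smooth (box_cutoff a c k)"
  unfolding box_cutoff_def[abs_def]
  by (intro smooth_prod smooth_mult smooth_compose_affine smooth_smooth_step)
 show "!!x. x \<notin> cbox a c ==> box_cutoff a c k x = 0"
  using box_cutoff_outside box_subset_cbox by blast
qed (use assms in auto)

text \<open>The box cutoffs are admissible test functions, and dominated convergence with majorant
  \<open>\<bar>h x\<bar>\<close> passes to the indicator of the open box, whose boundary carries no
  integral.\<close>

lemma test_orthogonal_imp_box_integral:
 fixes h :: "'a::euclidean_space => real"
 assumes h: "locally_integrable \<Omega> h" and \<Omega>: "open \<Omega>"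
  and 0: "!!\<phi>. test_function \<Omega> \<phi> ==> (LINT x|lebesgue_on \<Omega>. h x * \<phi> x) = 0"
  and sub: "cbox a c \<subseteq> \<Omega>"
 shows "integral (cbox a c) h = 0"
proof -
 have hi: "integrable (lebesgue_on (cbox a c)) h"
  using h sub unfolding locally_integrable_def by auto
 have z: "(LINT x|lebesgue_on (cbox a c). h x * box_cutoff a c k x) = 0" for k
 proof -
  have "(LINT x|lebesgue_on (cbox a c). h x * box_cutoff a c k x) = (LINT x|lebesgue_on \<Omega>. h x * box_cutoff a c k x)"
  proof (rule integral_lebesgue_on_mono_support(2)[OF sub])
   show "x \<in> \<Omega> - cbox a c ==> h x * box_cutoff a c k x = 0" for x
    using box_cutoff_outside[of x a c k] box_subset_cbox[of a c] by auto
  qed (use \<Omega> in \<open>auto simp: open_borel_lebesgue\<close>)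
  then show ?thesis using 0[OF box_cutoff_test[OF sub]] by simp
 qed
 have "(%k. LINT x|lebesgue_on (cbox a c). h x * box_cutoff a c k x) \<longlonglongrightarrow>
   (LINT x|lebesgue_on (cbox a c). h x * indicator (box a c) x)"
 proof (rule integral_dominated_convergence[where w="%x. \<bar>h x\<bar>"])
  have [measurable]: "h \<in> borel_measurable (lebesgue_on (cbox a c))" using hi by auto
  have "(%x. indicator (box a c) x :: real) \<in> borel_measurable (lebesgue_on (cbox a c))"
   by (intro measurable_restrict_space1 borel_measurable_indicator) auto
  then show "(%x. h x * indicator (box a c) x) \<in> borel_measurable (lebesgue_on (cbox a c))" by measurable
  show "(%x. h x * box_cutoff a c k x) \<in> borel_measurable (lebesgue_on (cbox a c))" for k
   using smooth_lebesgue_on test_function_smooth[OF box_cutoff_test[OF sub]] hi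
   by (intro borel_measurable_times) auto
  show "integrable (lebesgue_on (cbox a c)) (%x. \<bar>h x\<bar>)" using hi by auto
  show "AE x in lebesgue_on (cbox a c). (%k. h x * box_cutoff a c k x) \<longlonglongrightarrow> h x * indicator (box a c) x"
   by (intro always_eventually allI tendsto_intros box_cutoff_tendsto)
  show "AE x in lebesgue_on (cbox a c). norm (h x * box_cutoff a c k x) <= \<bar>h x\<bar>" for k
   by (intro always_eventually allI) 
     (use box_cutoff_range[of a c k] in \<open>auto simp: abs_mult intro!: mult_right_le_one_le\<close>)
 qed
 then have "(%k::nat. 0) \<longlonglongrightarrow> (LINT x|lebesgue_on (cbox a c). h x * indicator (box a c) x)"
  unfolding z .
 from LIMSEQ_unique[OF this tendsto_const]
 have "(LINT x|lebesgue_on (cbox a c). h x * indicator (box a c) x) = 0" .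
 moreover have "(LINT x|lebesgue_on (cbox a c). h x * indicator (box a c) x) = (LINT x|lebesgue_on (cbox a c). (if x \<in> box a c then h x else 0))"
  by (rule Bochner_Integration.integral_cong) auto
 moreover have "\<dots> = integral\<^sup>L (lebesgue_on (box a c)) h"
  by (rule integral_restrict) (auto simp: box_subset_cbox)
 moreover have "integrable (lebesgue_on (box a c)) h"
  using hi by (rule integrable_lebesgue_on_subset) (auto simp: box_subset_cbox)
 then have "integral\<^sup>L (lebesgue_on (box a c)) h = integral (box a c) h"
  by (intro lebesgue_integral_eq_integral) auto
 ultimately show ?thesis by (simp add: integral_open_interval)
qed

text \<open>Lebesgue differentiation: outside a negligible set the means of \<open>h\<close> over
  small cubes with corner \<open>x\<close> converge to \<open>h x\<close>, while the preceding lemma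
  makes all these means zero. Countably many closed boxes exhaust \<open>\<Omega>\<close>.\<close>

lemma test_orthogonal_imp_zero:
 fixes h :: "'a::euclidean_space => real"
 assumes h: "locally_integrable \<Omega> h" and \<Omega>: "open \<Omega>"
  and 0: "!!\<phi>. test_function \<Omega> \<phi> ==> (LINT x|lebesgue_on \<Omega>. h x * \<phi> x) = 0"
 shows "AE x in lebesgue_on \<Omega>. h x = 0"
proof -
 have box0: "negligible {x \<in> box a c. h x ~= 0}" if sub: "cbox a c \<subseteq> \<Omega>" for a c
 proof -
  let ?g = "%x. if x \<in> cbox a c then h x else 0"
  have hi: "integrable (lebesgue_on (cbox a c)) h"
   using h sub unfolding locally_integrable_def by auto
  have g: "?g integrable_on cbox p q" for p q
  proof -
   have "h integrable_on cbox a c" using integrable_on_lebesgue_on[OF hi] by simp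
   then have "?g integrable_on UNIV" by (simp only: Henstock_Kurzweil_Integration.integrable_restrict_UNIV)
   then show ?thesis by (rule integrable_on_subcbox) simp
  qed
  obtain N where N: "negligible N"
   "!!x e. [|x \<notin> N; 0 < e|] ==> \<exists>d>0. \<forall>\<delta>. 0 < \<delta> & \<delta> < d -->
     norm (integral (cbox x (x + \<delta> *\<^sub>R One)) ?g /\<^sub>R \<delta> ^ DIM('a) - ?g x) < e"
   by (rule integrable_ccontinuous_explicit[OF g]) blast
  have "h x = 0" if x: "x \<in> box a c" "x \<notin> N" for x
  proof (rule ccontr)
   assume hx: "h x ~= 0"
   obtain d where d: "d > 0" "!!\<delta>. 0 < \<delta> ==> \<delta> < d ==>
     norm (integral (cbox x (x + \<delta> *\<^sub>R One)) ?g /\<^sub>R \<delta> ^ DIM('a) - ?g x) < \<bar>h x\<bar>"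
    using N(2)[OF x(2), of "\<bar>h x\<bar>"] hx by auto
   obtain e where e: "e > 0" "ball x e \<subseteq> box a c"
    using x(1) open_box open_contains_ball by blast
   \<comment> \<open>A point of the cube of side \<open>\<delta>\<close> is within
     \<open>DIM('a) * \<delta>\<close> of the corner in the \<open>l1\<close> norm; this choice
     makes that at most \<open>e/2\<close> and keeps the cube in the ball.\<close>
   define \<delta> where "\<delta> = min (d/2) (e / (2 * real DIM('a)))"
   have \<delta>: "\<delta> > 0" "\<delta> < d" using d e by (auto simp: \<delta>_def)
   have "y \<in> ball x e" if y: "y \<in> cbox x (x + \<delta> *\<^sub>R One)" for y
   proof -
    have "norm (y - x) <= (\<Sum>b\<in>Basis. \<bar>(y - x) \<bullet> b\<bar>)" by (rule norm_le_l1)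
    also have "\<dots> <= (\<Sum>b\<in>(Basis::'a set). \<delta>)"
     using y by (intro sum_mono) (auto simp: mem_box inner_diff_left inner_add_left)
    also have "\<dots> = real DIM('a) * \<delta>" by simp
    also have "\<dots> <= real DIM('a) * (e / (2 * real DIM('a)))"
     by (intro mult_left_mono) (auto simp: \<delta>_def)
    also have "\<dots> = e/2" by simp
    also have "\<dots> < e" using e by simp
    finally show ?thesis by (simp add: dist_norm norm_minus_commute)
   qed
   then have sub2: "cbox x (x + \<delta> *\<^sub>R One) \<subseteq> cbox a c" using e box_subset_cbox by blast
   have "integral (cbox x (x + \<delta> *\<^sub>R One)) ?g = integral (cbox x (x + \<delta> *\<^sub>R One)) h"
    by (rule Henstock_Kurzweil_Integration.integral_cong) (use sub2 in auto)
   also have "\<dots> = 0"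
    by (rule test_orthogonal_imp_box_integral[OF h \<Omega> 0]) (use sub2 sub in auto)
   finally have "norm (?g x) < \<bar>h x\<bar>" using d(2)[OF \<delta>] by simp
   then show False using x(1) box_subset_cbox by (auto split: if_splits)
  qed
  then have "{x \<in> box a c. h x ~= 0} \<subseteq> N" by auto
  then show ?thesis using N(1) negligible_subset by blast
 qed
 obtain \<D> where \<D>: "countable \<D>" "\<D> \<subseteq> Pow \<Omega>" "!!X. X \<in> \<D> ==> \<exists>a b. X = cbox a b" "\<Union>\<D> = \<Omega>"
  using open_countable_Union_open_cbox[OF \<Omega>] by metis
 have "negligible {x \<in> X. h x ~= 0}" if "X \<in> \<D>" for X
 proof -
  obtain a c where X: "X = cbox a c" using \<D>(3)[OF \<open>X \<in> \<D>\<close>] by blast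
  have "negligible ({x \<in> box a c. h x ~= 0} \<union> (cbox a c - box a c))"
   using box0[of a c] \<D>(2) that X by (intro negligible_Un negligible_frontier_interval) auto
  then show ?thesis by (rule negligible_subset) (use X in auto)
 qed
 then have "negligible (\<Union>X\<in>\<D>. {x \<in> X. h x ~= 0})"
  using \<D>(1) by (intro negligible_countable_Union) auto
 then have "negligible {x \<in> \<Omega>. h x ~= 0}"
  by (rule negligible_subset) (use \<D>(4) in auto)
 then have "AE x in lebesgue. x \<in> \<Omega> --> h x = 0"
  using AE_not_in[of "{x \<in> \<Omega>. h x ~= 0}" lebesgue] by (auto simp: negligible_iff_null_sets)
 then show ?thesis
  using \<Omega> by (subst AE_restrict_space_iff) (auto simp: open_borel_lebesgue)
qed

subsection \<open>Weak derivatives\<close>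

lemma AE_lebesgue_on_iff:
 assumes "S \<in> sets lebesgue"
 shows "(AE x in lebesgue_on S. P x) \<longleftrightarrow> (AE x in lebesgue. x \<in> S --> P x)"
 using assms by (subst AE_restrict_space_iff) auto

lemma AE_lebesgue_on_subset:
 assumes "AE x in lebesgue_on T. P x" "S \<subseteq> T" "S \<in> sets lebesgue" "T \<in> sets lebesgue"
 shows "AE x in lebesgue_on S. P x"
 using assms by (auto simp: AE_lebesgue_on_iff elim!: eventually_mono)

lemma borel_measurable_AE_lebesgue_on:
 fixes f g :: "'a::euclidean_space => real"
 assumes "f \<in> borel_measurable (lebesgue_on S)" "AE x in lebesgue_on S. f x = g x" "S \<in> sets lebesgue"
 shows "g \<in> borel_measurable (lebesgue_on S)"
proof -
 have "(%x. if x \<in> S then f x else 0) \<in> borel_measurable lebesgue"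
  using assms by (simp add: borel_measurable_if)
 moreover have "AE x in lebesgue. (if x \<in> S then f x else 0) = (if x \<in> S then g x else 0)"
  using assms by (auto simp: AE_lebesgue_on_iff elim!: eventually_mono)
 ultimately have "(%x. if x \<in> S then g x else 0) \<in> borel_measurable lebesgue"
  by (rule borel_measurable_AE)
 then show ?thesis using assms by (simp add: borel_measurable_if)
qed

lemma integrable_AE_lebesgue_on:
 fixes f g :: "'a::euclidean_space => real"
 assumes "integrable (lebesgue_on S) f" "AE x in lebesgue_on S. f x = g x" "S \<in> sets lebesgue"
 shows "integrable (lebesgue_on S) g" "integral\<^sup>L (lebesgue_on S) g = integral\<^sup>L (lebesgue_on S) f"
proof -
 have g: "g \<in> borel_measurable (lebesgue_on S)"
  by (rule borel_measurable_AE_lebesgue_on[OF _ assms(2,3)]) (use assms in auto)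
 show "integrable (lebesgue_on S) g"
  using integrable_cong_AE[OF borel_measurable_integrable[OF assms(1)] g assms(2)] assms(1) by simp
 show "integral\<^sup>L (lebesgue_on S) g = integral\<^sup>L (lebesgue_on S) f"
  using integral_cong_AE[OF borel_measurable_integrable[OF assms(1)] g assms(2)] by simp
qed

lemma locally_integrable_AE:
 assumes "locally_integrable \<Omega> f" "AE x in lebesgue_on \<Omega>. f x = g x" "open \<Omega>"
 shows "locally_integrable \<Omega> g"
 unfolding locally_integrable_def
proof (intro allI impI)
 fix K assume K: "compact K & K \<subseteq> \<Omega>"
 have Km: "K \<in> sets lebesgue" using K closed_borel_lebesgue compact_imp_closed by blast
 have "AE x in lebesgue_on K. f x = g x"
  by (rule AE_lebesgue_on_subset[OF assms(2)]) (use K Km assms open_borel_lebesgue in auto)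
 then show "integrable (lebesgue_on K) g"
  using integrable_AE_lebesgue_on(1)[of K f g] assms K Km unfolding locally_integrable_def by blast
qed

lemma locally_integrable_diff:
 assumes "locally_integrable \<Omega> f" "locally_integrable \<Omega> g"
 shows "locally_integrable \<Omega> (%x. f x - g x)"
 using assms unfolding locally_integrable_def by auto

lemma has_weak_partial_unique:
 assumes f: "has_weak_partial \<Omega> b f g" "has_weak_partial \<Omega> b f g'" and \<Omega>: "open \<Omega>"
 shows "AE x in lebesgue_on \<Omega>. g x = g' x"
proof -
 have li: "locally_integrable \<Omega> g" "locally_integrable \<Omega> g'"
  using f unfolding has_weak_partial_def by auto
 have "AE x in lebesgue_on \<Omega>. g x - g' x = 0"
 proof (rule test_orthogonal_imp_zero[OF locally_integrable_diff[OF li] \<Omega>])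
  fix \<phi> :: "'a => real" assume \<phi>: "test_function \<Omega> \<phi>"
  have "(LINT x|lebesgue_on \<Omega>. (g x - g' x) * \<phi> x) =
   (LINT x|lebesgue_on \<Omega>. g x * \<phi> x) - (LINT x|lebesgue_on \<Omega>. g' x * \<phi> x)"
   using li[THEN locally_integrable_times_test[OF _ \<phi> \<Omega>]]
   by (simp add: left_diff_distrib)
  also have "\<dots> = 0" using f \<phi> unfolding has_weak_partial_def by auto
  finally show "(LINT x|lebesgue_on \<Omega>. (g x - g' x) * \<phi> x) = 0" .
 qed
 then show ?thesis by auto
qed

lemma has_weak_partial_AE:
 assumes f: "has_weak_partial \<Omega> b f g" and \<Omega>: "open \<Omega>"
  and ae: "AE x in lebesgue_on \<Omega>. f x = f' x" "AE x in lebesgue_on \<Omega>. g x = g' x"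
  and b: "b \<in> Basis"
 shows "has_weak_partial \<Omega> b f' g'"
proof -
 have li: "locally_integrable \<Omega> f" "locally_integrable \<Omega> g"
  using f unfolding has_weak_partial_def by auto
 have S: "\<Omega> \<in> sets lebesgue" using \<Omega> open_borel_lebesgue by blast
 have eq: "(LINT x|lebesgue_on \<Omega>. h' x * \<phi> x) = (LINT x|lebesgue_on \<Omega>. h x * \<phi> x)"
  if "locally_integrable \<Omega> h" "AE x in lebesgue_on \<Omega>. h x = h' x" "test_function \<Omega> \<phi>" for h h' \<phi>
  by (rule integrable_AE_lebesgue_on(2)[OF locally_integrable_times_test[OF that(1,3) \<Omega>] _ S])
    (use that in auto)
 have "(LINT x|lebesgue_on \<Omega>. f' x * partial b \<phi> x) = - (LINT x|lebesgue_on \<Omega>. g' x * \<phi> x)"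
  if \<phi>: "test_function \<Omega> \<phi>" for \<phi>
  unfolding eq[OF li(1) ae(1) test_function_partial[OF \<phi> b]] eq[OF li(2) ae(2) \<phi>]
  using f \<phi> unfolding has_weak_partial_def by simp
 then show ?thesis
  using locally_integrable_AE[OF li(1) ae(1) \<Omega>] locally_integrable_AE[OF li(2) ae(2) \<Omega>]
  unfolding has_weak_partial_def by simp
qed

lemma has_weak_partial_diff:
 assumes f: "has_weak_partial \<Omega> b f g" "has_weak_partial \<Omega> b f' g'" and \<Omega>: "open \<Omega>"
  and b: "b \<in> Basis"
 shows "has_weak_partial \<Omega> b (%x. f x - f' x) (%x. g x - g' x)"
proof -
 have li: "locally_integrable \<Omega> f" "locally_integrable \<Omega> g" "locally_integrable \<Omega> f'" "locally_integrable \<Omega> g'"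
  using f unfolding has_weak_partial_def by auto
 have "(LINT x|lebesgue_on \<Omega>. (f x - f' x) * partial b \<phi> x) = - (LINT x|lebesgue_on \<Omega>. (g x - g' x) * \<phi> x)"
  if \<phi>: "test_function \<Omega> \<phi>" for \<phi>
 proof -
  note i = locally_integrable_times_test[OF _ \<phi> \<Omega>] locally_integrable_times_test[OF _ test_function_partial[OF \<phi> b] \<Omega>]
  show ?thesis using f \<phi> i[OF li(1)] i[OF li(2)] i[OF li(3)] i[OF li(4)]
   unfolding has_weak_partial_def by (simp add: left_diff_distrib)
 qed
 then show ?thesis using li locally_integrable_diff unfolding has_weak_partial_def by blast
qed

lemma weak_partial_works: "has_weak_partial \<Omega> b f g ==> has_weak_partial \<Omega> b f (weak_partial \<Omega> b f)"
 unfolding weak_partial_def by (rule someI[of "has_weak_partial \<Omega> b f"])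

subsection \<open>Functions with an integrable derivative on the unit interval\<close>

definition ac :: "(real => real) => (real => real) => bool" where
 "ac f f' \<longleftrightarrow> (\<forall>a b. 0 < a --> a <= b --> b < 1 -->
   f' absolutely_integrable_on {a..b} & integral {a..b} f' = f b - f a)"

lemma acD:
 assumes "ac f f'" "0 < a" "a <= b" "b < 1"
 shows "f' absolutely_integrable_on {a..b}" "integral {a..b} f' = f b - f a" "f' integrable_on {a..b}"
 using assms unfolding ac_def by (auto intro: set_lebesgue_integral_eq_integral(1))

lemma ac_C1:
 assumes "!!x. 0 < x ==> x < 1 ==> (f has_real_derivative f' x) (at x)" "continuous_on {0<..<1} f'"
 shows "ac f f'"
 unfolding ac_def
proof (intro allI impI conjI)
 fix a b :: real assume ab: "0 < a" "a <= b" "b < 1"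
 show "f' absolutely_integrable_on {a..b}"
  using assms(2) by (rule absolutely_integrable_continuous_real[OF continuous_on_subset]) (use ab in auto)
 have "(f has_vector_derivative f' x) (at x within {a..b})" if "x \<in> {a..b}" for x
  using has_field_derivative_at_within[OF assms(1)[of x]] that ab
  unfolding has_real_derivative_iff_has_vector_derivative by simp
 then have "(f' has_integral (f b - f a)) {a..b}"
  by (rule fundamental_theorem_of_calculus[OF ab(2)])
 then show "integral {a..b} f' = f b - f a" by (rule integral_unique)
qed

lemma ac_continuous: 
 assumes "ac f f'" shows "continuous_on {0<..<1} f"
proof -
 have "isCont f x" if x: "0 < x" "x < 1" for x
 proof -
  define a b where "a = x/2" and "b = (1+x)/2"
  have ab: "0 < a" "a < x" "x < b" "b < 1" using x by (auto simp: a_def b_def)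
  have "continuous_on {a..b} (%y. f a + integral {a..y} f')"
   using acD(3)[OF assms, of a b] ab by (intro continuous_intros indefinite_integral_continuous_1) auto
  then have "continuous_on {a..b} f"
   by (rule continuous_on_eq) (use acD(2)[OF assms, of a] ab in auto)
  then have "continuous_on {a<..<b} f" by (rule continuous_on_subset) auto
  then show ?thesis using ab by (simp add: continuous_on_eq_continuous_at)
 qed
 then show ?thesis by (simp add: continuous_at_imp_continuous_on)
qed

lemma ac_add: "ac f f' ==> ac g g' ==> ac (%x. f x + g x) (%x. f' x + g' x)"
 unfolding ac_def by (auto simp: Henstock_Kurzweil_Integration.integral_add absolutely_integrable_on_def[symmetric] set_lebesgue_integral_eq_integral(1))

lemma ac_cong_AE:
 assumes "ac f f'" "AE x in lebesgue_on {0<..<1}. f' x = g' x" "!!x. 0 < x ==> x < 1 ==> f x = g x"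
 shows "ac g g'"
 unfolding ac_def
proof (intro allI impI conjI)
 fix a b :: real assume ab: "0 < a" "a <= b" "b < 1"
 have ae: "AE x in lebesgue_on {a..b}. f' x = g' x"
  by (rule AE_lebesgue_on_subset[OF assms(2)]) (use ab in auto)
 have i: "integrable (lebesgue_on {a..b}) f'"
  using acD(1)[OF assms(1) ab] by (simp add: integrable_lebesgue_on_iff)
 show "g' absolutely_integrable_on {a..b}"
  using integrable_AE_lebesgue_on(1)[OF i ae] by (simp add: integrable_lebesgue_on_iff)
 show "integral {a..b} g' = g b - g a"
  using integrable_AE_lebesgue_on[OF i ae] acD(2)[OF assms(1) ab] assms(3)[of a] assms(3)[of b] ab i
  by (simp add: lebesgue_integral_eq_integral)
qed

text \<open>The product of the two integrals is an integral over the plane, split along the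
  diagonal; one inequality is strict so that the diagonal is counted once. This is the core of the
  product rule for \<open>ac\<close>.\<close>

lemma Fubini_triangle:
 fixes \<alpha> \<beta> :: "real => real"
 assumes \<alpha>: "integrable lborel \<alpha>" and \<beta>: "integrable lborel \<beta>"
 shows "(LINT x|lborel. \<alpha> x * (LINT y|lborel. indicator {..x} y * \<beta> y))
   + (LINT y|lborel. \<beta> y * (LINT x|lborel. indicator {..<y} x * \<alpha> x)) = (LINT x|lborel. \<alpha> x) * (LINT x|lborel. \<beta> x)"
proof -
 have [measurable]: "\<alpha> \<in> borel_measurable borel" "\<beta> \<in> borel_measurable borel"
  using borel_measurable_integrable[OF \<alpha>] borel_measurable_integrable[OF \<beta>] by simp_all
 have P: "integrable (lborel \<Otimes>\<^sub>M lborel) (%(x,y). \<alpha> x * \<beta> y)"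
 proof (rule lborel_pair.Fubini_integrable)
  show "(%(x, y). \<alpha> x * \<beta> y) \<in> borel_measurable (lborel \<Otimes>\<^sub>M lborel)" by measurable
  show "integrable lborel (%x. LINT y|lborel. norm (case (x, y) of (x, y) => \<alpha> x * \<beta> y))"
   using \<alpha> by (simp add: abs_mult)
  show "AE x in lborel. integrable lborel (%y. case (x, y) of (x, y) => \<alpha> x * \<beta> y)"
   using \<beta> by simp
 qed
 have P1: "integrable (lborel \<Otimes>\<^sub>M lborel) (%(x,y). \<alpha> x * (indicator {..x} y * \<beta> y))"
 proof (rule Bochner_Integration.integrable_bound[OF P])
  have "(%(x, y). \<alpha> x * (indicator {..x} y * \<beta> y)) = (%(x, y). if y <= x then \<alpha> x * \<beta> y else 0)"
   by (auto simp: fun_eq_iff indicator_def)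
  then show "(%(x, y). \<alpha> x * (indicator {..x} y * \<beta> y)) \<in> borel_measurable (lborel \<Otimes>\<^sub>M lborel)"
   by (simp only:) measurable
 qed (auto simp: indicator_def)
 have P2: "integrable (lborel \<Otimes>\<^sub>M lborel) (%(x,y). \<beta> y * (indicator {..<y} x * \<alpha> x))"
 proof (rule Bochner_Integration.integrable_bound[OF P])
  have "(%(x, y). \<beta> y * (indicator {..<y} x * \<alpha> x)) = (%(x, y). if x < y then \<beta> y * \<alpha> x else 0)"
   by (auto simp: fun_eq_iff indicator_def)
  then show "(%(x, y). \<beta> y * (indicator {..<y} x * \<alpha> x)) \<in> borel_measurable (lborel \<Otimes>\<^sub>M lborel)"
   by (simp only:) measurable
 qed (auto simp: indicator_def abs_mult)
 have "(LINT x|lborel. \<alpha> x * (LINT y|lborel. indicator {..x} y * \<beta> y))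
   = integral\<^sup>L (lborel \<Otimes>\<^sub>M lborel) (%(x,y). \<alpha> x * (indicator {..x} y * \<beta> y))"
  using lborel_pair.integral_fst[OF P1] by simp
 moreover have "(LINT y|lborel. \<beta> y * (LINT x|lborel. indicator {..<y} x * \<alpha> x))
   = integral\<^sup>L (lborel \<Otimes>\<^sub>M lborel) (%(x,y). \<beta> y * (indicator {..<y} x * \<alpha> x))"
  using lborel_pair.integral_snd[OF P2] by simp
 moreover have "integral\<^sup>L (lborel \<Otimes>\<^sub>M lborel) (%(x,y). \<alpha> x * (indicator {..x} y * \<beta> y))
   + integral\<^sup>L (lborel \<Otimes>\<^sub>M lborel) (%(x,y). \<beta> y * (indicator {..<y} x * \<alpha> x))
   = integral\<^sup>L (lborel \<Otimes>\<^sub>M lborel) (%(x,y). \<alpha> x * \<beta> y)"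
  unfolding Bochner_Integration.integral_add[OF P1 P2, symmetric]
  by (rule Bochner_Integration.integral_cong) (auto simp: indicator_def)
 moreover have "integral\<^sup>L (lborel \<Otimes>\<^sub>M lborel) (%(x,y). \<alpha> x * \<beta> y) = (LINT x|lborel. \<alpha> x) * (LINT x|lborel. \<beta> x)"
  using lborel_pair.integral_fst[OF P] by simp
 ultimately show ?thesis by simp
qed

text \<open>Fubini is applied on \<open>lborel \<Otimes>\<^sub>M lborel\<close>, so Lebesgue
  integrands are replaced by Borel versions first. Closed and open half-lines give the same value
  because a point is null; the two triangles of the square need one each.\<close>

lemma absolutely_integrable_borel_version:
 fixes f :: "real => real"
 assumes "f absolutely_integrable_on {a..b}"
 shows "\<exists>\<alpha>. integrable lborel \<alpha> & (AE x in lebesgue. \<alpha> x = (if x \<in> {a..b} then f x else 0)) \<and>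
  (\<forall>x. a <= x --> x <= b --> (LINT y|lborel. indicator {..x} y * \<alpha> y) = integral {a..x} f) \<and>
  (\<forall>x. a <= x --> x <= b --> (LINT y|lborel. indicator {..<x} y * \<alpha> y) = integral {a..x} f) \<and>
  (LINT y|lborel. \<alpha> y) = integral {a..b} f"
proof -
 define g where "g x = (if x \<in> {a..b} then f x else 0)" for x
 have gi: "integrable lebesgue g"
  using assms Lebesgue_Measure.integrable_restrict_UNIV[of "{a..b}" f]
  by (simp add: g_def[abs_def] integrable_lebesgue_on_iff)
 obtain \<alpha> where \<alpha>[measurable]: "\<alpha> \<in> borel_measurable borel" and ae: "AE x in lborel. g x = \<alpha> x"
  using completion_ex_borel_measurable_real[of g lborel] borel_measurable_integrable[OF gi] by auto
 have ae': "AE x in lebesgue. \<alpha> x = g x" using AE_completion[OF ae] by (auto elim!: eventually_mono)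
 have \<alpha>m: "\<alpha> \<in> borel_measurable lebesgue" using \<alpha> by (simp add: measurable_completion)
 have "integrable lebesgue \<alpha>"
  using integrable_cong_AE[OF \<alpha>m borel_measurable_integrable[OF gi] ae'] gi by simp
 then have ai: "integrable lborel \<alpha>" using \<alpha> by (simp add: integrable_completion)
 have int: "(LINT y|lborel. indicator A y * \<alpha> y) = integral {a..x} f"
  if x: "a <= x" "x <= b" and A: "A \<in> sets borel" "AE y in lebesgue. y \<in> A \<inter> {a..b} \<longleftrightarrow> y \<in> {a..x}" for x A
 proof -
  have [measurable]: "A \<in> sets borel" by fact
  have fi: "integrable (lebesgue_on {a..x}) f"
  proof (rule integrable_lebesgue_on_subset)
   show "integrable (lebesgue_on {a..b}) f" using assms by (simp add: integrable_lebesgue_on_iff)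
  qed (use x in auto)
  have "(LINT y|lborel. indicator A y * \<alpha> y) = (LINT y|lebesgue. indicator A y * \<alpha> y)"
   by (rule integral_completion[symmetric]) measurable
  also have "\<dots> = (LINT y|lebesgue. (if y \<in> {a..x} then f y else 0))"
  proof (rule integral_cong_AE)
   show "(%y. indicator A y * \<alpha> y) \<in> borel_measurable lebesgue"
    by (intro measurable_completion) measurable
   show "(%y. if y \<in> {a..x} then f y else 0) \<in> borel_measurable lebesgue"
    by (rule borel_measurable_if_I[OF borel_measurable_integrable[OF fi]]) simp
   show "AE y in lebesgue. indicator A y * \<alpha> y = (if y \<in> {a..x} then f y else 0)"
    using ae' A(2) by eventually_elim (use x in \<open>auto simp: g_def indicator_def split: if_splits\<close>)
  qed
  also have "\<dots> = integral\<^sup>L (lebesgue_on {a..x}) f"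
   by (rule Lebesgue_Measure.integral_restrict_UNIV) simp
  also have "\<dots> = integral {a..x} f" by (rule lebesgue_integral_eq_integral[OF fi]) simp
  finally show ?thesis .
 qed
 show ?thesis
 proof (intro exI[of _ \<alpha>] conjI allI impI)
  show "AE x in lebesgue. \<alpha> x = (if x \<in> {a..b} then f x else 0)" using ae' by (simp add: g_def)
  show "(LINT y|lborel. indicator {..x} y * \<alpha> y) = integral {a..x} f" if "a <= x" "x <= b" for x
   using that by (intro int) auto
  show "(LINT y|lborel. indicator {..<x} y * \<alpha> y) = integral {a..x} f" if "a <= x" "x <= b" for x
  proof (rule int[OF that])
   have "AE y in lebesgue. y ~= x" using AE_completion[OF AE_lborel_singleton[of x]] .
   then show "AE y in lebesgue. y \<in> {..<x} \<inter> {a..b} \<longleftrightarrow> y \<in> {a..x}"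
    by eventually_elim (use that in auto)
  qed simp
  show "(LINT y|lborel. \<alpha> y) = integral {a..b} f"
  proof (cases "a <= b")
   case True
   have "(LINT y|lborel. indicator UNIV y * \<alpha> y) = integral {a..b} f"
    using True by (intro int) auto
   then show ?thesis by simp
  next
   case False
   have "integral\<^sup>L lborel \<alpha> = integral\<^sup>L lebesgue \<alpha>" by (rule integral_completion[symmetric]) simp
   also have "\<dots> = integral\<^sup>L lebesgue (%x::real. 0)"
    by (rule integral_cong_AE) (use \<alpha>m ae' False in \<open>auto simp: g_def elim!: eventually_mono\<close>)
   finally show ?thesis using False by simp
  qed
 qed (rule ai)
qed

text \<open>\<open>(f b - f a) * (g b - g a)\<close> is the double integral of
  \<open>f' x * g' y\<close> over a square. On the two triangles the inner integrals are
  \<open>g x - g a\<close> and \<open>f y - f a\<close>; expanding both outer integrals leaves the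
  product rule.\<close>

lemma ac_mult:
 assumes f: "ac f f'" and g: "ac g g'"
 shows "ac (%x. f x * g x) (%x. f' x * g x + f x * g' x)"
 unfolding ac_def
proof (intro allI impI)
 fix a b :: real assume ab: "0 < a" "a <= b" "b < 1"
 note F = acD[OF f ab] and G = acD[OF g ab]
 have prod: "u absolutely_integrable_on {a..b} ==> continuous_on {a..b} c ==> (%x. u x * c x) absolutely_integrable_on {a..b}" for u c :: "real => real"
 proof -
  assume u: "u absolutely_integrable_on {a..b}" and c: "continuous_on {a..b} c"
  have "(%x. c x * u x) absolutely_integrable_on {a..b}"
  proof (rule absolutely_integrable_bounded_measurable_product_real)
   show "c \<in> borel_measurable (lebesgue_on {a..b})"
    using c by (rule continuous_imp_measurable_on_sets_lebesgue) simp
   show "bounded (c ` {a..b})"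
    using c by (intro compact_imp_bounded compact_continuous_image) auto
  qed (use u in auto)
  then show ?thesis by (simp add: mult.commute)
 qed
 have cf: "continuous_on {a..b} f" by (rule continuous_on_subset[OF ac_continuous[OF f]]) (use ab in auto)
 have cg: "continuous_on {a..b} g" by (rule continuous_on_subset[OF ac_continuous[OF g]]) (use ab in auto)
 have i1: "(%x. f' x * g x) absolutely_integrable_on {a..b}" using prod[OF F(1) cg] .
 have i2: "(%x. f x * g' x) absolutely_integrable_on {a..b}" using prod[OF G(1) cf] by (simp add: mult.commute)
 obtain \<alpha> where \<alpha>: "integrable lborel \<alpha>" "AE x in lebesgue. \<alpha> x = (if x \<in> {a..b} then f' x else 0)"
  "!!x. a <= x ==> x <= b ==> (LINT y|lborel. indicator {..<x} y * \<alpha> y) = integral {a..x} f'"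
  "(LINT y|lborel. \<alpha> y) = integral {a..b} f'"
  using absolutely_integrable_borel_version[OF F(1)] by auto
 obtain \<beta> where \<beta>: "integrable lborel \<beta>" "AE x in lebesgue. \<beta> x = (if x \<in> {a..b} then g' x else 0)"
  "!!x. a <= x ==> x <= b ==> (LINT y|lborel. indicator {..x} y * \<beta> y) = integral {a..x} g'"
  "(LINT y|lborel. \<beta> y) = integral {a..b} g'"
  using absolutely_integrable_borel_version[OF G(1)] by auto
 have [measurable]: "\<alpha> \<in> borel_measurable borel" "\<beta> \<in> borel_measurable borel"
  using borel_measurable_integrable[OF \<alpha>(1)] borel_measurable_integrable[OF \<beta>(1)] by simp_all
 have sub: "integral {a..x} f' = f x - f a" "integral {a..x} g' = g x - g a" if "a <= x" "x <= b" for x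
  using acD(2)[OF f, of a x] acD(2)[OF g, of a x] ab that by auto
 have conv: "(LINT x|lborel. u x * U x) = integral {a..b} (%x. k x * (h x - h a))"
  if u: "u \<in> borel_measurable borel" "AE x in lebesgue. u x = (if x \<in> {a..b} then k x else 0)"
   and U: "U \<in> borel_measurable borel" "!!x. a <= x ==> x <= b ==> U x = h x - h a"
   and k: "k absolutely_integrable_on {a..b}" and h: "continuous_on {a..b} h" for u U h k :: "real => real"
 proof -
  have ki: "integrable (lebesgue_on {a..b}) (%x. k x * (h x - h a))"
   using prod[OF k continuous_on_diff[OF h continuous_on_const[of _ "h a"]]] by (simp add: integrable_lebesgue_on_iff)
  have uU: "(%x. u x * U x) \<in> borel_measurable lborel"
   using borel_measurable_times[OF u(1) U(1)] by simp
  have "(LINT x|lborel. u x * U x) = (LINT x|lebesgue. u x * U x)"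
   by (rule integral_completion[symmetric, OF uU])
  also have "\<dots> = (LINT x|lebesgue. (if x \<in> {a..b} then k x * (h x - h a) else 0))"
  proof (rule integral_cong_AE)
   show "(%x. u x * U x) \<in> borel_measurable lebesgue"
    by (rule measurable_completion[OF uU])
   show "(%x. if x \<in> {a..b} then k x * (h x - h a) else 0) \<in> borel_measurable lebesgue"
    by (rule borel_measurable_if_I[OF borel_measurable_integrable[OF ki]]) simp
   show "AE x in lebesgue. u x * U x = (if x \<in> {a..b} then k x * (h x - h a) else 0)"
    using u(2) by eventually_elim (use U in auto)
  qed
  also have "\<dots> = integral\<^sup>L (lebesgue_on {a..b}) (%x. k x * (h x - h a))"
   by (rule Lebesgue_Measure.integral_restrict_UNIV) simp
  also have "\<dots> = integral {a..b} (%x. k x * (h x - h a))"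
   by (rule lebesgue_integral_eq_integral[OF ki]) simp
  finally show ?thesis .
 qed
 have T1: "(LINT x|lborel. \<alpha> x * (LINT y|lborel. indicator {..x} y * \<beta> y)) = integral {a..b} (%x. f' x * (g x - g a))"
 proof (rule conv[OF _ \<alpha>(2) _ _ F(1) cg])
  have "(%x. \<integral>y. indicator {..x} y * \<beta> y \<partial>lborel) = (%x. \<integral>y. (if y <= x then \<beta> y else 0) \<partial>lborel)"
   by (intro ext Bochner_Integration.integral_cong) (auto simp: indicator_def)
  then show "(%x. \<integral>y. indicator {..x} y * \<beta> y \<partial>lborel) \<in> borel_measurable borel"
   by (simp only:) measurable
 qed (use \<beta>(3) sub in auto)
 have T2: "(LINT y|lborel. \<beta> y * (LINT x|lborel. indicator {..<y} x * \<alpha> x)) = integral {a..b} (%x. g' x * (f x - f a))"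
 proof (rule conv[OF _ \<beta>(2) _ _ G(1) cf])
  have "(%x. \<integral>y. indicator {..<x} y * \<alpha> y \<partial>lborel) = (%x. \<integral>y. (if y < x then \<alpha> y else 0) \<partial>lborel)"
   by (intro ext Bochner_Integration.integral_cong) (auto simp: indicator_def)
  then show "(%x. \<integral>y. indicator {..<x} y * \<alpha> y \<partial>lborel) \<in> borel_measurable borel"
   by (simp only:) measurable
 qed (use \<alpha>(3) sub in auto)
 have eq: "integral {a..b} (%x. f' x * (g x - g a)) + integral {a..b} (%x. g' x * (f x - f a))
   = (f b - f a) * (g b - g a)"
  using Fubini_triangle[OF \<alpha>(1) \<beta>(1)] unfolding T1 T2 \<alpha>(4) \<beta>(4) F(2) G(2) .
 have I1: "integral {a..b} (%x. f' x * (g x - g a)) = integral {a..b} (%x. f' x * g x) - (f b - f a) * g a"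
 proof -
  have "integral {a..b} (%x. f' x * g x - f' x * g a) = integral {a..b} (%x. f' x * g x) - integral {a..b} (%x. f' x * g a)"
   using i1 F(3) by (intro Henstock_Kurzweil_Integration.integral_diff integrable_on_mult_left) (auto simp: absolutely_integrable_on_def)
  then show ?thesis using F(2) by (simp add: right_diff_distrib)
 qed
 have I2: "integral {a..b} (%x. g' x * (f x - f a)) = integral {a..b} (%x. f x * g' x) - (g b - g a) * f a"
 proof -
  have "integral {a..b} (%x. f x * g' x - g' x * f a) = integral {a..b} (%x. f x * g' x) - integral {a..b} (%x. g' x * f a)"
   using i2 G(3) by (intro Henstock_Kurzweil_Integration.integral_diff integrable_on_mult_left) (auto simp: absolutely_integrable_on_def)
  then show ?thesis using G(2) by (simp add: right_diff_distrib mult.commute)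
 qed
 have "integral {a..b} (%x. f' x * g x + f x * g' x) = integral {a..b} (%x. f' x * g x) + integral {a..b} (%x. f x * g' x)"
  using i1 i2 by (intro Henstock_Kurzweil_Integration.integral_add) (auto simp: absolutely_integrable_on_def)
 also have "\<dots> = f b * g b - f a * g a"
  using eq unfolding I1 I2 by (simp add: algebra_simps)
 finally show "(%x. f' x * g x + f x * g' x) absolutely_integrable_on {a..b} \<and>
   integral {a..b} (%x. f' x * g x + f x * g' x) = f b * g b - f a * g a"
  using set_integral_add(1)[OF i1 i2] by simp
qed

lemma compact_subset_unit_interval:
 fixes K :: "real set"
 assumes "compact K" "K \<subseteq> {0<..<1}"
 shows "\<exists>a b. 0 < a & a < b & b < 1 & K \<subseteq> {a<..<b}"
proof (cases "K = {}")
 case True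
 then show ?thesis by (intro exI[of _ "1/3"] exI[of _ "2/3"]) auto
next
 case False
 obtain l where l: "l \<in> K" "!!x. x \<in> K ==> l <= x" using compact_attains_inf[OF assms(1) False] by blast
 obtain u where u: "u \<in> K" "!!x. x \<in> K ==> x <= u" using compact_attains_sup[OF assms(1) False] by blast
 have lu: "0 < l" "l <= u" "u < 1" using l u assms(2) by auto
 have "l/2 < x & x < (1+u)/2" if "x \<in> K" for x using l(2)[OF that] u(2)[OF that] lu by simp
 then show ?thesis using lu by (intro exI[of _ "l/2"] exI[of _ "(1+u)/2"]) auto
qed

lemma test_function_unit_interval_support:
 fixes \<phi> :: "real => real"
 assumes "test_function {0<..<1} \<phi>"
 shows "\<exists>a b. 0 < a & a < b & b < 1 & (\<forall>x. x <= a \<or> b <= x --> \<phi> x = 0 & partial 1 \<phi> x = 0)"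
proof -
 obtain K where K: "compact K" "K \<subseteq> {0<..<1}" "!!x. x \<notin> K ==> \<phi> x = 0 & (\<forall>b. partial b \<phi> x = 0)"
  using test_function_support[OF assms] by blast
 obtain a b where ab: "0 < a" "a < b" "b < 1" "K \<subseteq> {a<..<b}"
  using compact_subset_unit_interval[OF K(1,2)] by blast
 have "\<phi> x = 0 & partial 1 \<phi> x = 0" if x: "x <= a \<or> b <= x" for x
 proof -
  have "x \<notin> K" using x ab(4) by auto
  from K(3)[OF this] show ?thesis by simp
 qed
 with ab show ?thesis by blast
qed

lemma ac_locally_integrable:
 assumes "ac f f'"
 shows "locally_integrable {0<..<1} f" "locally_integrable {0<..<1} f'"
proof -
 have "integrable (lebesgue_on K) f & integrable (lebesgue_on K) f'" if K: "compact K" "K \<subseteq> {0<..<1}" for K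
 proof -
  obtain a b where ab: "0 < a" "a < b" "b < 1" "K \<subseteq> {a<..<b}"
   using compact_subset_unit_interval[OF K] by blast
  have "integrable (lebesgue_on {a..b}) f"
  proof -
   have "continuous_on {a..b} f"
    by (rule continuous_on_subset[OF ac_continuous[OF assms]]) (use ab in auto)
   then show ?thesis by (simp add: integrable_lebesgue_on_iff absolutely_integrable_continuous_real)
  qed
  moreover have "integrable (lebesgue_on {a..b}) f'"
   using acD(1)[OF assms, of a b] ab by (simp add: integrable_lebesgue_on_iff)
  moreover have "K \<subseteq> {a..b}" using ab(4) by auto
  moreover have "K \<in> sets lebesgue" using K(1) compact_imp_closed closed_borel_lebesgue by blast
  ultimately show ?thesis using integrable_lebesgue_on_subset[of "{a..b}" _ K] by auto
 qed
 then show "locally_integrable {0<..<1} f" "locally_integrable {0<..<1} f'"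
  unfolding locally_integrable_def by blast+
qed

lemma ac_has_weak_partial:
 assumes f: "ac f f'"
 shows "has_weak_partial {0<..<1} 1 f f'"
 unfolding has_weak_partial_def
proof (intro conjI allI impI ac_locally_integrable[OF f])
 fix \<phi> :: "real => real" assume \<phi>: "test_function {0<..<1} \<phi>"
 obtain a b where ab: "0 < a" "a < b" "b < 1" and z: "!!x. x <= a \<or> b <= x ==> \<phi> x = 0 & partial 1 \<phi> x = 0"
  using test_function_unit_interval_support[OF \<phi>] by blast
 have b1: "(1::real) \<in> Basis" by simp
 have sm: "smooth \<phi>" "smooth (partial 1 \<phi>)"
  using test_function_smooth[OF \<phi>] smooth_partial[OF test_function_smooth[OF \<phi>] b1] by auto
 have "ac \<phi> (partial 1 \<phi>)"
  by (rule ac_C1) (auto intro: smooth_real_deriv sm smooth_continuous)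
 from acD[OF ac_mult[OF f this], of a b] ab z
 have I: "integral {a..b} (%x. f' x * \<phi> x + f x * partial 1 \<phi> x) = 0" by simp
 have S: "{a..b} \<subseteq> {0<..<1}" using ab by auto
 have i1: "integrable (lebesgue_on {0<..<1}) (%x. f' x * \<phi> x)"
  by (rule locally_integrable_times_test[OF ac_locally_integrable(2)[OF f] \<phi>]) simp
 have i2: "integrable (lebesgue_on {0<..<1}) (%x. f x * partial 1 \<phi> x)"
  by (rule locally_integrable_times_test[OF ac_locally_integrable(1)[OF f] test_function_partial[OF \<phi> b1]]) simp
 have i3: "integrable (lebesgue_on {0<..<1}) (%x. f' x * \<phi> x + f x * partial 1 \<phi> x)"
  using i1 i2 by simp
 have i4: "integrable (lebesgue_on {a..b}) (%x. f' x * \<phi> x + f x * partial 1 \<phi> x)"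
  by (rule integrable_lebesgue_on_subset[OF i3 S]) auto
 have "integral\<^sup>L (lebesgue_on {a..b}) (%x. f' x * \<phi> x + f x * partial 1 \<phi> x)
   = integral\<^sup>L (lebesgue_on {0<..<1}) (%x. f' x * \<phi> x + f x * partial 1 \<phi> x)"
 proof (rule integral_lebesgue_on_mono_support(2)[OF S])
  fix x assume "x \<in> {0<..<1} - {a..b}"
  then have "x <= a \<or> b <= x" by auto
  then show "f' x * \<phi> x + f x * partial 1 \<phi> x = 0" using z[of x] by simp
 qed auto
 then have "integral\<^sup>L (lebesgue_on {0<..<1}) (%x. f' x * \<phi> x + f x * partial 1 \<phi> x) = 0"
  using lebesgue_integral_eq_integral[OF i4] I by simp
 then show "(LINT x|lebesgue_on {0<..<1}. f x * partial 1 \<phi> x) = - (LINT x|lebesgue_on {0<..<1}. f' x * \<phi> x)"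
  using Bochner_Integration.integral_add[OF i1 i2] by simp
qed

text \<open>Du Bois-Reymond: a test function with zero mean is the derivative of a test function,
  hence orthogonal to \<open>h\<close>. Subtracting from an arbitrary \<open>\<psi>\<close> the
  multiple of one fixed \<open>\<psi>0\<close> with the same mean shows that \<open>h - c\<close> is
  orthogonal to every test function.\<close>

lemma weak_derivative_zero_imp_const:
 fixes h :: "real => real"
 assumes h: "has_weak_partial {0<..<1} 1 h (%x. 0)"
 shows "\<exists>c. AE x in lebesgue_on {0<..<1}. h x = c"
proof -
 have hl: "locally_integrable {0<..<1} h" using h by (simp add: has_weak_partial_def)
 define \<psi>0 where "\<psi>0 = box_cutoff (1/4::real) (3/4) 1"
 have \<psi>0: "test_function {0<..<1} \<psi>0"
  unfolding \<psi>0_def by (rule box_cutoff_test) auto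
 have t_int: "integral\<^sup>L (lebesgue_on {0<..<1}) \<psi> = integral {0..1} \<psi>" 
  and t_able: "integrable (lebesgue_on {0<..<1}) \<psi>" if "test_function {0<..<1} \<psi>" for \<psi> :: "real => real"
 proof -
  have "integrable (lebesgue_on {0..1}) \<psi>"
   using smooth_continuous[OF test_function_smooth[OF that]]
   by (simp add: integrable_lebesgue_on_iff absolutely_integrable_continuous_real)
  then show i: "integrable (lebesgue_on {0<..<1}) \<psi>"
   by (rule integrable_lebesgue_on_subset) auto
  show "integral\<^sup>L (lebesgue_on {0<..<1}) \<psi> = integral {0..1} \<psi>"
   using lebesgue_integral_eq_integral[OF i] integral_open_interval_real[of 0 1 \<psi>] by simp
 qed
 have sp: "smooth_step x > 0" if "x > 0" for x
 proof (cases "x < 1")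
  case True
  have c: "continuous_on {0..x} bump" by (intro smooth_continuous smooth_bump)
  have "integral {0..x} bump ~= 0"
  proof
   assume "integral {0..x} bump = 0"
   then have "bump (x/2) = 0" using integral_eq_0_iff[OF c] bump_nonneg that by auto
   then show False using bump_pos[of "x/2"] that True by simp
  qed
  moreover have "integral {0..x} bump >= 0"
   by (rule integral_nonneg) (auto intro: bump_nonneg integrable_continuous_real c)
  ultimately show ?thesis using integral_bump_pos by (simp add: smooth_step_def)
 qed (simp add: smooth_step_one)
 have I0: "integral {0..1} \<psi>0 ~= 0"
 proof
  assume *: "integral {0..1} \<psi>0 = 0"
  have "continuous_on {0..1} \<psi>0" by (rule smooth_continuous[OF test_function_smooth[OF \<psi>0]])
  then have "\<psi>0 (1/2) = 0"
   using integral_eq_0_iff[of 0 1 \<psi>0] * box_cutoff_range(1)[of "1/4::real" "3/4" 1] by (auto simp: \<psi>0_def)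
  moreover have "\<psi>0 (1/2) > 0" unfolding \<psi>0_def box_cutoff_def by (auto intro!: mult_pos_pos sp)
  ultimately show False by simp
 qed
 define c where "c = (LINT x|lebesgue_on {0<..<1}. h x * \<psi>0 x) / integral {0..1} \<psi>0"
 have key: "(LINT x|lebesgue_on {0<..<1}. (h x - c) * \<psi> x) = 0" if \<psi>: "test_function {0<..<1} \<psi>" for \<psi> :: "real => real"
 proof -
  define s where "s = integral {0..1} \<psi> / integral {0..1} \<psi>0"
  define \<xi> where "\<xi> x = \<psi> x - s * \<psi>0 x" for x
  have s\<psi>: "test_function {0<..<1} (%x. s * \<psi>0 x)"
   by (rule test_function_mult[OF \<psi>0 smooth_const])
  have \<xi>: "test_function {0<..<1} \<xi>"
   unfolding \<xi>_def[abs_def] by (rule test_function_diff[OF \<psi> s\<psi>])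
  obtain a b where ab: "0 < a" "a < b" "b < 1" and z: "!!x. x <= a \<or> b <= x ==> \<xi> x = 0"
   using test_function_unit_interval_support[OF \<xi>] by blast
  have cont: "continuous_on A \<xi>" for A by (rule smooth_continuous[OF test_function_smooth[OF \<xi>]])
  have I\<xi>: "integral {0..1} \<xi> = 0"
  proof -
   have "integral {0..1} \<xi> = integral {0..1} \<psi> - integral {0..1} (%x. s * \<psi>0 x)"
    unfolding \<xi>_def[abs_def]
    by (intro Henstock_Kurzweil_Integration.integral_diff integrable_continuous_real smooth_continuous 
      test_function_smooth[OF \<psi>] test_function_smooth[OF s\<psi>])
   then show ?thesis using I0 by (simp add: s_def)
  qed
  define \<eta> where "\<eta> x = integral {0..x} \<xi>" for x
  have d\<eta>: "(\<eta> has_real_derivative \<xi> x) (at x)" and s\<eta>: "smooth \<eta>" for x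
   unfolding \<eta>_def[abs_def] using ab z
   by (auto intro!: smooth_primitive test_function_smooth[OF \<xi>])
  have zero: "integral {p..q} \<xi> = 0" if "!!x. p <= x ==> x <= q ==> \<xi> x = 0" for p q
  proof -
   have "integral {p..q} \<xi> = integral {p..q} (%x::real. 0)"
    by (rule Henstock_Kurzweil_Integration.integral_cong) (use that in auto)
   then show ?thesis by simp
  qed
  have \<eta>t: "test_function {0<..<1} \<eta>"
  proof (rule test_functionI[OF s\<eta>, of "{a..b}"])
   fix x assume "x \<notin> {a..b}"
   then consider "x <= a" | "b <= x" "x <= 1" | "1 <= x" using ab by fastforce
   then show "\<eta> x = 0"
   proof cases
    case 1 then show ?thesis unfolding \<eta>_def by (intro zero) (use z in auto)
   next
    case 2
    have "integral {0..x} \<xi> + integral {x..1} \<xi> = integral {0..1} \<xi>"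
     by (intro Henstock_Kurzweil_Integration.integral_combine integrable_continuous_real cont) (use ab 2 in auto)
    moreover have "integral {x..1} \<xi> = 0" by (intro zero) (use z 2 in auto)
    ultimately show ?thesis using I\<xi> by (simp add: \<eta>_def)
   next
    case 3
    have "integral {0..1} \<xi> + integral {1..x} \<xi> = integral {0..x} \<xi>"
     by (intro Henstock_Kurzweil_Integration.integral_combine integrable_continuous_real cont) (use ab 3 in auto)
    moreover have "integral {1..x} \<xi> = 0" by (intro zero) (use z 3 ab in auto)
    ultimately show ?thesis using I\<xi> by (simp add: \<eta>_def)
   qed
  qed (use ab in auto)
  have p\<eta>: "partial 1 \<eta> x = \<xi> x" for x using partial_real_eq[OF d\<eta>] .
  have "(LINT x|lebesgue_on {0<..<1}. h x * partial 1 \<eta> x) = - (LINT x|lebesgue_on {0<..<1}. 0 * \<eta> x)"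
   using h \<eta>t unfolding has_weak_partial_def by blast
  then have h0: "(LINT x|lebesgue_on {0<..<1}. h x * \<xi> x) = 0"
   by (simp add: p\<eta>)
  have i1: "integrable (lebesgue_on {0<..<1}) (%x. h x * \<psi> x)" by (rule locally_integrable_times_test[OF hl \<psi>]) simp
  have i2: "integrable (lebesgue_on {0<..<1}) (%x. h x * \<psi>0 x)" by (rule locally_integrable_times_test[OF hl \<psi>0]) simp
  have "(LINT x|lebesgue_on {0<..<1}. h x * \<xi> x) = (LINT x|lebesgue_on {0<..<1}. h x * \<psi> x - s * (h x * \<psi>0 x))"
   by (rule Bochner_Integration.integral_cong) (auto simp: \<xi>_def algebra_simps)
  also have "\<dots> = (LINT x|lebesgue_on {0<..<1}. h x * \<psi> x) - s * (LINT x|lebesgue_on {0<..<1}. h x * \<psi>0 x)"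
   using i1 i2 by simp
  finally have "(LINT x|lebesgue_on {0<..<1}. h x * \<psi> x) = s * (LINT x|lebesgue_on {0<..<1}. h x * \<psi>0 x)"
   using h0 by simp
  also have "\<dots> = c * integral {0..1} \<psi>" by (simp add: s_def c_def)
  finally have e: "(LINT x|lebesgue_on {0<..<1}. h x * \<psi> x) = c * integral {0..1} \<psi>" .
  have "(LINT x|lebesgue_on {0<..<1}. (h x - c) * \<psi> x) = (LINT x|lebesgue_on {0<..<1}. h x * \<psi> x - c * \<psi> x)"
   by (rule Bochner_Integration.integral_cong) (auto simp: algebra_simps)
  also have "\<dots> = 0" using i1 t_able[OF \<psi>] e t_int[OF \<psi>] by simp
  finally show ?thesis .
 qed
 have "locally_integrable {0<..<1::real} (%x. c)"
  unfolding locally_integrable_def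
  by (auto simp: integrable_lebesgue_on_iff compact_imp_closed closed_borel_lebesgue intro!: absolutely_integrable_on_const lmeasurable_compact)
 then have "AE x in lebesgue_on {0<..<1}. h x - c = 0"
  by (intro test_orthogonal_imp_zero locally_integrable_diff hl key) auto
 then have "AE x in lebesgue_on {0<..<1}. h x = c" by auto
 then show ?thesis by blast
qed

lemma has_weak_partial_imp_ac:
 assumes f: "has_weak_partial {0<..<1} 1 f f'"
 shows "\<exists>g. ac g f' & (AE x in lebesgue_on {0<..<1}. f x = g x)"
proof -
 have li: "locally_integrable {0<..<1} f'" using f by (simp add: has_weak_partial_def)
 have ai: "f' absolutely_integrable_on {a..b}" if "0 < a" "b < 1" for a b
 proof -
  have "integrable (lebesgue_on {a..b}) f'"
  proof -
   have "{a..b} \<subseteq> {0<..<1}" using that by (auto simp: subset_iff)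
   then show ?thesis using li unfolding locally_integrable_def by simp
  qed
  then show ?thesis by (simp add: integrable_lebesgue_on_iff)
 qed
 \<comment> \<open>The primitive starts at the interior point \<open>1/2\<close>, since
   \<open>f'\<close> is only integrable on compact subintervals. Then \<open>f - G\<close> has weak
   derivative zero.\<close>
 define G where "G x = (if x >= 1/2 then integral {1/2..x} f' else - integral {x..1/2} f')" for x
 have G: "ac G f'"
  unfolding ac_def
 proof (intro allI impI conjI)
  fix a b :: real assume ab: "0 < a" "a <= b" "b < 1"
  show "f' absolutely_integrable_on {a..b}" using ai ab by simp
  have c: "integral {p..q} f' + integral {q..r} f' = integral {p..r} f'"
   if "0 < p" "p <= q" "q <= r" "r < 1" for p q r
   using that ai[of p r]
   by (intro Henstock_Kurzweil_Integration.integral_combine) (auto simp: set_lebesgue_integral_eq_integral(1))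
  consider "1/2 <= a" | "a < 1/2" "1/2 <= b" | "b < 1/2" by linarith
  then show "integral {a..b} f' = G b - G a"
  proof cases
   case 1 then show ?thesis using c[of "1/2" a b] ab by (simp add: G_def)
  next
   case 2 then show ?thesis using c[of a "1/2" b] ab by (simp add: G_def)
  next
   case 3 then show ?thesis using c[of a b "1/2"] ab by (simp add: G_def)
  qed
 qed
 have "has_weak_partial {0<..<1} 1 (%x. f x - G x) (%x. f' x - f' x)"
  by (rule has_weak_partial_diff[OF f ac_has_weak_partial[OF G]]) auto
 then obtain c where c: "AE x in lebesgue_on {0<..<1}. f x - G x = c"
  using weak_derivative_zero_imp_const by auto
 have "ac (%x. G x + c) f'" using G unfolding ac_def by simp
 moreover have "AE x in lebesgue_on {0<..<1}. f x = G x + c" using c by (auto elim!: eventually_mono)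
 ultimately show ?thesis by blast
qed

lemma AE_eq_continuous_imp_eq:
 fixes f g :: "real => real"
 assumes "AE x in lebesgue_on {0<..<1}. f x = g x" "continuous_on {0<..<1} f" "continuous_on {0<..<1} g"
  and x: "0 < x" "x < 1"
 shows "f x = g x"
proof (rule ccontr)
 assume ne: "f x ~= g x"
 have "open {y \<in> {0<..<1}. f y - g y ~= 0}"
 proof -
  have "open ({0<..<1} \<inter> (%y. f y - g y) -` (- {0}))"
   by (intro continuous_open_preimage continuous_on_diff assms open_Compl) auto
  then show ?thesis by (simp add: Int_def vimage_def)
 qed
 moreover have "x \<in> {y \<in> {0<..<1}. f y - g y ~= 0}" using ne x by simp
 moreover have "negligible {y \<in> {0<..<1}. f y - g y ~= 0}"
 proof -
  have "AE x in lebesgue. x \<in> {0<..<1} --> f x = g x" using assms(1) by (simp add: AE_lebesgue_on_iff)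
  then show ?thesis
   by (auto simp: eventually_ae_filter_negligible elim!: negligible_subset)
 qed
 ultimately show False using open_not_negligible by blast
qed

lemma has_weak_partial_continuous_imp_ac:
 assumes f: "has_weak_partial {0<..<1} 1 f f'" and c: "continuous_on {0<..<1} f"
 shows "ac f f'"
proof -
 obtain g where g: "ac g f'" "AE x in lebesgue_on {0<..<1}. f x = g x"
  using has_weak_partial_imp_ac[OF f] by blast
 have "g x = f x" if "0 < x" "x < 1" for x
  using AE_eq_continuous_imp_eq[OF g(2) c ac_continuous[OF g(1)] that] by simp
 then show ?thesis using ac_cong_AE[OF g(1), of f' f] by simp
qed

lemma ac_real_derivative:
 assumes "ac f f'" "continuous_on {0<..<1} f'" "0 < x" "x < 1"
 shows "(f has_real_derivative f' x) (at x)"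
proof -
 define a b where "a = x/2" and "b = (1+x)/2"
 have ab: "0 < a" "a < x" "x < b" "b < 1" using assms by (auto simp: a_def b_def)
 have "((%y. integral {a..y} f') has_real_derivative f' x) (at x within {a..b})"
  by (rule integral_has_real_derivative[OF continuous_on_subset[OF assms(2)]]) (use ab in auto)
 then have "((%y. f a + integral {a..y} f') has_real_derivative f' x) (at x)"
  using ab by (auto simp: at_within_Icc_at intro!: derivative_eq_intros)
 then show ?thesis
  by (rule has_field_derivative_transform_within_open[of _ _ _ "{a<..<b}"])
   (use ab acD(2)[OF assms(1), of a] in auto)
qed

subsection \<open>Integration of radial functions\<close>

abbreviation unit_ball :: "'a::euclidean_space set" where "unit_ball \<equiv> ball 0 1"

lemma unit_ball_indicator [simp, measurable]:
 "(indicator (unit_ball :: 'a::euclidean_space set) :: 'a => 'b::{zero_less_one,second_countable_topology,t2_space}) \<in> borel_measurable borel"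
 by (intro borel_measurable_indicator) auto

text \<open>The area of the unit sphere, written as dimension times volume so that it is the
  constant produced by differentiating the volume of a ball in its radius.\<close>

definition sphere_area :: "'a::euclidean_space itself => real" where
 "sphere_area _ = real DIM('a) * measure lborel (unit_ball :: 'a set)"

lemma sphere_area_pos: "sphere_area TYPE('a::euclidean_space) > 0"
 unfolding sphere_area_def by (simp add: content_ball_pos)

lemma emeasure_lborel_ball_scale:
 fixes c :: "'a::euclidean_space"
 assumes "0 <= r"
 shows "emeasure lborel (cball (0::'a) r) = ennreal (measure lborel (unit_ball :: 'a set) * r ^ DIM('a))"
proof -
 have "emeasure lborel (cball (0::'a) r) = ennreal (measure lborel (cball (0::'a) r))"
  using emeasure_lborel_cball_finite[of "0::'a" r] by (subst emeasure_eq_ennreal_measure) auto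
 also have "measure lborel (cball (0::'a) r) = measure lborel (ball (0::'a) r)"
  using content_cball_conv_ball[of "0::'a" r] by simp
 also have "\<dots> = measure lborel (unit_ball :: 'a set) * r ^ DIM('a)"
  using content_ball_conv_unit_ball[OF assms, of "0::'a"] by simp
 finally show ?thesis .
qed

text \<open>Polar coordinates for radial functions. Both measures are finite on the rays
  \<open>{x<..}\<close>, where they agree because the ball of radius \<open>r\<close> has volume
  proportional to \<open>r ^ DIM('a)\<close>, and rays determine such a measure.\<close>

lemma distr_norm_unit_ball:
 "distr (density lborel (indicator (unit_ball :: 'a::euclidean_space set))) borel norm =
  density lborel (%r. ennreal (sphere_area TYPE('a) * r ^ (DIM('a) - 1)) * indicator {0<..<1} r)"
 (is "?M = ?N")
proof (rule measure_eqI_lessThan)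
 let ?kap = "measure lborel (unit_ball :: 'a set)"
 have norm_m: "norm -` {x<..} \<in> sets (borel :: 'a measure)" for x
  using measurable_sets[of norm "borel :: 'a measure" borel "{x<..}"] by simp
 have emM: "emeasure ?M {x<..} = ennreal (?kap * (1 - (min 1 (max x 0)) ^ DIM('a)))" for x
 proof -
  have "emeasure ?M {x<..} = emeasure (density lborel (indicator (unit_ball :: 'a set))) (norm -` {x<..})"
   by (subst emeasure_distr) auto
  also have "\<dots> = (\<integral>\<^sup>+y. indicator (unit_ball :: 'a set) y * indicator (norm -` {x<..}) y \<partial>lborel)"
   by (subst emeasure_density) (auto simp: norm_m)
  also have "\<dots> = (\<integral>\<^sup>+y. indicator (unit_ball \<inter> norm -` {x<..} :: 'a set) y \<partial>lborel)"
   by (intro nn_integral_cong) (auto simp: indicator_def)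
  also have "\<dots> = emeasure lborel (unit_ball \<inter> norm -` {x<..} :: 'a set)"
   by (rule nn_integral_indicator) (auto simp: norm_m)
  also have "\<dots> = ennreal (?kap * (1 - (min 1 (max x 0)) ^ DIM('a)))"
  proof -
   consider "x < 0" | "0 <= x" "x < 1" | "1 <= x" by linarith
   then show ?thesis
   proof cases
    case 1
    have "unit_ball \<inter> norm -` {x<..} = (unit_ball :: 'a set)"
     using 1 by (auto intro: less_le_trans[OF _ norm_ge_zero])
    moreover have "emeasure lborel (unit_ball :: 'a set) = ennreal ?kap"
     using emeasure_lborel_ball_finite[of "0::'a" 1] by (subst emeasure_eq_ennreal_measure) auto
    ultimately show ?thesis using 1 by (simp add: zero_power)
   next
    case 2
    have "unit_ball \<inter> norm -` {x<..} = (unit_ball :: 'a set) - cball 0 x" by (auto simp: not_le)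
    moreover have "emeasure lborel ((unit_ball :: 'a set) - cball 0 x) = emeasure lborel (unit_ball :: 'a set) - emeasure lborel (cball (0::'a) x)"
     using 2 emeasure_lborel_cball_finite[of "0::'a" x] by (intro emeasure_Diff) auto
    moreover have "emeasure lborel (unit_ball :: 'a set) = ennreal ?kap"
     using emeasure_lborel_ball_finite[of "0::'a" 1] by (subst emeasure_eq_ennreal_measure) auto
    moreover have "ennreal ?kap - ennreal (?kap * x ^ DIM('a)) = ennreal (?kap - ?kap * x ^ DIM('a))"
     using 2 by (intro ennreal_minus) simp
    ultimately show ?thesis
     using 2 emeasure_lborel_ball_scale[of x, where 'a='a] by (simp add: algebra_simps)
   next
    case 3
    have "unit_ball \<inter> norm -` {x<..} = ({} :: 'a set)" using 3 by auto
    then show ?thesis using 3 by simp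
   qed
  qed
  finally show ?thesis .
 qed
 have emN: "emeasure ?N {x<..} = ennreal (?kap * (1 - (min 1 (max x 0)) ^ DIM('a)))" for x
 proof -
  let ?a = "min 1 (max x 0)"
  have d: "0 < DIM('a)" by simp
  have "emeasure ?N {x<..} = (\<integral>\<^sup>+r. ennreal (sphere_area TYPE('a) * r ^ (DIM('a) - 1)) * indicator {0<..<1} r * indicator {x<..} r \<partial>lborel)"
   by (subst emeasure_density) auto
  also have "\<dots> = (\<integral>\<^sup>+r. ennreal (sphere_area TYPE('a) * r ^ (DIM('a) - 1)) * indicator {?a..1} r \<partial>lborel)"
  proof (rule nn_integral_cong_AE)
   show "AE r in lborel. ennreal (sphere_area TYPE('a) * r ^ (DIM('a) - 1)) * indicator {0<..<1} r * indicator {x<..} r =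
     ennreal (sphere_area TYPE('a) * r ^ (DIM('a) - 1)) * indicator {?a..1} r"
    using AE_lborel_singleton[of 0] AE_lborel_singleton[of 1] AE_lborel_singleton[of x]
    by eventually_elim (auto simp: indicator_def min_def max_def)
  qed
  also have "\<dots> = ennreal (?kap * 1 ^ DIM('a) - ?kap * ?a ^ DIM('a))"
  proof (rule nn_integral_FTC_Icc)
   fix r :: real assume r: "r \<in> {?a..1}"
   show "((%r. ?kap * r ^ DIM('a)) has_real_derivative sphere_area TYPE('a) * r ^ (DIM('a) - 1)) (at r)"
    by (auto intro!: derivative_eq_intros simp: sphere_area_def)
   show "0 <= sphere_area TYPE('a) * r ^ (DIM('a) - 1)"
    using r sphere_area_pos[where 'a='a] by (intro mult_nonneg_nonneg) auto
  qed auto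
  finally show ?thesis by (simp add: algebra_simps)
 qed
 show "emeasure ?M {x<..} < \<infinity>" for x unfolding emM by simp
 show "emeasure ?M {x<..} = emeasure ?N {x<..}" for x unfolding emM emN ..
qed auto

lemma nn_integral_radial:
 fixes f :: "real => ennreal"
 assumes [measurable]: "f \<in> borel_measurable borel"
 shows "(\<integral>\<^sup>+x. indicator unit_ball x * f (norm (x::'a::euclidean_space)) \<partial>lborel) =
  (\<integral>\<^sup>+r. ennreal (sphere_area TYPE('a) * r ^ (DIM('a) - 1)) * indicator {0<..<1} r * f r \<partial>lborel)"
proof -
 have "(\<integral>\<^sup>+x. indicator unit_ball x * f (norm (x::'a)) \<partial>lborel) = (\<integral>\<^sup>+x. f (norm (x::'a)) \<partial>density lborel (indicator unit_ball))"
  by (subst nn_integral_density) auto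
 also have "\<dots> = (\<integral>\<^sup>+r. f r \<partial>distr (density lborel (indicator (unit_ball :: 'a set))) borel norm)"
  by (subst nn_integral_distr) auto
 also have "\<dots> = (\<integral>\<^sup>+r. ennreal (sphere_area TYPE('a) * r ^ (DIM('a) - 1)) * indicator {0<..<1} r * f r \<partial>lborel)"
  unfolding distr_norm_unit_ball by (subst nn_integral_density) auto
 finally show ?thesis .
qed

lemma radial_null_borel_iff:
 assumes [measurable]: "A \<in> sets borel"
 shows "{x \<in> unit_ball. norm (x::'a::euclidean_space) \<in> A} \<in> null_sets lborel \<longleftrightarrow> A \<inter> {0<..<1} \<in> null_sets lborel"
proof -
 have m1: "{x \<in> unit_ball. norm (x::'a) \<in> A} \<in> sets borel" by measurable
 have "emeasure lborel {x \<in> unit_ball. norm (x::'a) \<in> A} = (\<integral>\<^sup>+x. indicator unit_ball x * indicator A (norm (x::'a)) \<partial>lborel)"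
 proof -
  have "emeasure lborel {x \<in> unit_ball. norm (x::'a) \<in> A} = (\<integral>\<^sup>+x. indicator {x \<in> unit_ball. norm (x::'a) \<in> A} x \<partial>lborel)"
   by (rule nn_integral_indicator[symmetric]) (use m1 in simp)
  then show ?thesis by (simp add: indicator_def of_bool_conj)
 qed
 also have "\<dots> = (\<integral>\<^sup>+r. ennreal (sphere_area TYPE('a) * r ^ (DIM('a) - 1)) * indicator {0<..<1} r * indicator A r \<partial>lborel)"
  by (rule nn_integral_radial) measurable
 finally have eq: "emeasure lborel {x \<in> unit_ball. norm (x::'a) \<in> A} = \<dots>" .
 have pos: "\<not> sphere_area TYPE('a) * r ^ (DIM('a) - Suc 0) <= 0" if "0 < r" for r
  using mult_pos_pos[OF sphere_area_pos[where 'a='a] zero_less_power[OF that, of "DIM('a) - Suc 0"]] by simp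
 have "(\<integral>\<^sup>+r. ennreal (sphere_area TYPE('a) * r ^ (DIM('a) - 1)) * indicator {0<..<1} r * indicator A r \<partial>lborel) = 0
  \<longleftrightarrow> (AE r in lborel. ennreal (sphere_area TYPE('a) * r ^ (DIM('a) - 1)) * indicator {0<..<1} r * indicator A r = 0)"
  by (rule nn_integral_0_iff_AE) measurable
 also have "\<dots> \<longleftrightarrow> (AE r in lborel. r \<notin> A \<inter> {0<..<1})"
  by (intro AE_cong) (auto simp: indicator_def ennreal_eq_0_iff pos)
 also have "\<dots> \<longleftrightarrow> A \<inter> {0<..<1} \<in> null_sets lborel"
  by (subst AE_iff_null_sets[symmetric]) auto
 finally show ?thesis using eq m1 by (auto simp: null_sets_def)
qed

lemma compact_union_norm_borel:
 fixes C :: "'a::euclidean_space set"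
 assumes "fsigma C" shows "norm ` C \<in> sets borel"
proof -
 obtain F :: "nat => 'a set" where F: "range F \<subseteq> Collect compact" "C = \<Union>(F ` UNIV)"
  using assms unfolding fsigma_Union_compact by blast
 have eq: "norm ` C = (\<Union>i. norm ` F i)" using F by auto
 have "compact (norm ` F i)" for i
  using F by (intro compact_continuous_image continuous_intros) auto
 then show ?thesis unfolding eq by (intro sets.countable_UN) (auto intro: borel_compact)
qed

lemma negligible_lborel_null: "N \<in> null_sets lborel ==> N \<in> null_sets lebesgue"
 by (rule null_sets_completionI)

text \<open>The radial preimages of \<open>A\<close> and of its complement are approximated from
  inside by F-sigma sets. Their images under \<open>norm\<close> are countable unions of compact
  sets, hence Borel. What both images miss has a null radial preimage and is therefore null by the
  criterion for Borel sets.\<close>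

lemma radial_set_structure:
 fixes A :: "real set"
 assumes A: "A \<subseteq> {0<..<1}" and m: "{x \<in> unit_ball. norm (x::'a::euclidean_space) \<in> A} \<in> sets lebesgue"
 shows "\<exists>C1 Z. C1 \<in> sets borel & Z \<in> null_sets lborel & C1 \<subseteq> A & A \<subseteq> C1 \<union> Z"
proof -
 let ?B = "{x \<in> unit_ball. norm (x::'a) \<in> A}" and ?B' = "{x \<in> unit_ball. norm (x::'a) \<in> {0<..<1} - A}"
 have "?B' = unit_ball - {0} - ?B" by (rule set_eqI) (auto simp only: Diff_iff mem_Collect_eq greaterThanLessThan_iff mem_ball_0 zero_less_norm_iff singleton_iff)
 moreover have "unit_ball - {0} \<in> sets (lebesgue :: 'a measure)" by (intro sets.Diff) auto
 ultimately have m': "?B' \<in> sets lebesgue" using sets.Diff[OF _ m] by simp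
 obtain C T where C: "fsigma C" "T \<in> null_sets lebesgue" "C \<union> T = ?B"
  by (rule lebesgue_set_almost_fsigma[OF m]) blast
 obtain C' T' where C': "fsigma C'" "T' \<in> null_sets lebesgue" "C' \<union> T' = ?B'"
  by (rule lebesgue_set_almost_fsigma[OF m']) blast
 define Z where "Z = {0<..<1} - norm ` C - norm ` C'"
 have mb: "norm ` C \<in> sets borel" "norm ` C' \<in> sets borel" "Z \<in> sets borel"
  using compact_union_norm_borel[OF C(1)] compact_union_norm_borel[OF C'(1)] unfolding Z_def by (blast intro: sets.Diff borel_open open_greaterThanLessThan)+
 have CB: "C \<subseteq> ?B" "C' \<subseteq> ?B'" unfolding C(3)[symmetric] C'(3)[symmetric] by (rule Un_upper1)+
 then have s1: "norm ` C \<subseteq> A" "norm ` C' \<subseteq> {0<..<1} - A" by blast+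
 have "{x \<in> unit_ball. norm (x::'a) \<in> Z} \<subseteq> T \<union> T'"
 proof
  fix x :: 'a assume x: "x \<in> {x \<in> unit_ball. norm x \<in> Z}"
  show "x \<in> T \<union> T'"
  proof (cases "norm x \<in> A")
   case True
   then have "x \<in> C \<union> T" unfolding C(3) using x by simp
   moreover have "x \<notin> C" using x unfolding Z_def by blast
   ultimately show ?thesis by blast
  next
   case False
   then have "x \<in> C' \<union> T'" unfolding C'(3) using x by (simp add: Z_def)
   moreover have "x \<notin> C'" using x unfolding Z_def by blast
   ultimately show ?thesis by blast
  qed
 qed
 moreover have "T \<union> T' \<in> null_sets lebesgue" using C(2) C'(2) by (rule null_sets.Un)
 moreover have Zm: "{x \<in> unit_ball. norm (x::'a) \<in> Z} \<in> sets borel" using mb(3) by measurable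
 ultimately have "{x \<in> unit_ball. norm (x::'a) \<in> Z} \<in> null_sets lebesgue"
  using null_sets_completion_subset by blast
 then have "{x \<in> unit_ball. norm (x::'a) \<in> Z} \<in> null_sets lborel"
  using Zm by (subst (asm) null_sets_completion_iff) auto
 then have "Z \<inter> {0<..<1} \<in> null_sets lborel" using radial_null_borel_iff[OF mb(3), where 'a='a] by simp
 moreover have "Z \<inter> {0<..<1} = Z" by (auto simp: Z_def)
 moreover have "A \<subseteq> norm ` C \<union> Z" using A s1 unfolding Z_def by blast
 ultimately show ?thesis using mb s1 by (intro exI[of _ "norm ` C"] exI[of _ Z]) auto
qed

lemma radial_set_measurable:
 assumes A: "A \<subseteq> {0<..<1}" and m: "{x \<in> unit_ball. norm (x::'a::euclidean_space) \<in> A} \<in> sets lebesgue"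
 shows "A \<in> sets lebesgue"
proof -
 obtain C1 Z where C: "C1 \<in> sets borel" "Z \<in> null_sets lborel" "C1 \<subseteq> A" "A \<subseteq> C1 \<union> Z"
  using radial_set_structure[OF A m] by blast
 have "A - C1 \<in> null_sets lebesgue"
  using null_sets_completion_subset[of "A - C1" Z lborel] negligible_lborel_null[OF C(2)] C by blast
 from null_setsD2[OF this] have "C1 \<union> (A - C1) \<in> sets lebesgue" using C(1) by (intro sets.Un) auto
 moreover have "C1 \<union> (A - C1) = A" using C by auto
 ultimately show ?thesis by simp
qed

lemma radial_set_null:
 assumes A: "A \<subseteq> {0<..<1}" and m: "{x \<in> unit_ball. norm (x::'a::euclidean_space) \<in> A} \<in> null_sets lebesgue"
 shows "A \<in> null_sets lebesgue"
proof -
 obtain C1 Z where C: "C1 \<in> sets borel" "Z \<in> null_sets lborel" "C1 \<subseteq> A" "A \<subseteq> C1 \<union> Z"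
  using radial_set_structure[OF A null_setsD2[OF m]] by blast
 have C1m: "{x \<in> unit_ball. norm (x::'a) \<in> C1} \<in> sets borel" using C(1) by measurable
 have "{x \<in> unit_ball. norm (x::'a) \<in> C1} \<in> null_sets lebesgue"
  by (rule null_sets_completion_subset[OF _ m]) (use C in auto)
 then have "{x \<in> unit_ball. norm (x::'a) \<in> C1} \<in> null_sets lborel"
  using C1m by (subst (asm) null_sets_completion_iff) auto
 then have "C1 \<inter> {0<..<1} \<in> null_sets lborel" using radial_null_borel_iff[OF C(1), where 'a='a] by simp
 moreover have "C1 \<inter> {0<..<1} = C1" using C A by auto
 ultimately have "C1 \<union> Z \<in> null_sets lebesgue" using C(2) by (intro negligible_lborel_null) auto
 then show ?thesis using C(4) null_sets_completion_subset by blast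
qed

text \<open>Null sets correspond in both directions; the origin, which is represented by no
  \<open>r\<close> in \<open>(0,1)\<close>, is a null point of the ball.\<close>

lemma AE_radial_iff:
 "(AE x in lebesgue_on unit_ball. P (norm (x::'a::euclidean_space))) \<longleftrightarrow> (AE r in lebesgue_on {0<..<1}. P r)"
proof
 assume "AE x in lebesgue_on unit_ball. P (norm (x::'a))"
 then have "AE x in lebesgue. x \<in> unit_ball --> P (norm (x::'a))"
  by (simp add: AE_lebesgue_on_iff)
 then obtain N where N: "N \<in> null_sets lebesgue" "{x. \<not> (x \<in> unit_ball --> P (norm (x::'a)))} \<subseteq> N"
  by (auto simp: eventually_ae_filter)
 have "{x \<in> unit_ball. norm (x::'a) \<in> {r \<in> {0<..<1}. \<not> P r}} \<in> null_sets lebesgue"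
  by (rule null_sets_completion_subset[OF _ N(1)]) (use N(2) in auto)
 then have "{r \<in> {0<..<1}. \<not> P r} \<in> null_sets lebesgue"
  by (intro radial_set_null[where 'a='a]) auto
 then have "AE r in lebesgue. r \<notin> {r \<in> {0<..<1}. \<not> P r}" by (rule AE_not_in)
 then show "AE r in lebesgue_on {0<..<1}. P r"
  by (auto simp: AE_lebesgue_on_iff elim!: eventually_mono)
next
 assume "AE r in lebesgue_on {0<..<1}. P r"
 then have "AE r in lborel. r \<in> {0<..<1} --> P r"
  by (simp add: AE_lebesgue_on_iff AE_completion_iff)
 then obtain N where N: "N \<in> null_sets lborel" "{r. \<not> (r \<in> {0<..<1} --> P r)} \<subseteq> N"
  by (auto simp: eventually_ae_filter)
 have Nb: "N \<in> sets borel" using N(1) by auto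
 have "N \<inter> {0<..<1} \<in> null_sets lborel" using N(1) by (intro null_set_Int2) auto
 then have "{x \<in> unit_ball. norm (x::'a) \<in> N} \<in> null_sets lborel"
  using radial_null_borel_iff[OF Nb, where 'a='a] by simp
 then have "AE x in lebesgue. x \<notin> {x \<in> unit_ball. norm (x::'a) \<in> N}"
  by (intro AE_not_in negligible_lborel_null)
 moreover have "AE x in lebesgue. x ~= (0::'a)" using AE_completion[OF AE_lborel_singleton[of "0::'a"]] .
 ultimately have "AE x in lebesgue. x \<in> unit_ball --> P (norm (x::'a))"
 proof eventually_elim
  case (elim x)
  show ?case
  proof
   assume "x \<in> unit_ball"
   then have "norm x \<in> {0<..<1}" "norm x \<notin> N" using elim by auto
   then show "P (norm x)" using N(2) by blast
  qed
 qed
 then show "AE x in lebesgue_on unit_ball. P (norm (x::'a))" by (simp add: AE_lebesgue_on_iff)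
qed

lemma borel_measurable_radialD:
 assumes "(%x. \<phi> (norm (x::'a::euclidean_space)) :: real) \<in> borel_measurable (lebesgue_on unit_ball)"
 shows "\<phi> \<in> borel_measurable (lebesgue_on {0<..<1})"
proof (rule measurableI)
 fix A :: "real set" assume A: "A \<in> sets borel"
 have "(%x. \<phi> (norm (x::'a))) -` A \<inter> unit_ball \<in> sets (lebesgue_on unit_ball)"
  using measurable_sets[OF assms A] by simp
 then have "(%x. \<phi> (norm (x::'a))) -` A \<inter> unit_ball \<in> sets lebesgue"
  by (subst (asm) sets_restrict_space_iff) auto
 then have "((%x. \<phi> (norm (x::'a))) -` A \<inter> unit_ball) - {0} \<in> sets lebesgue" by auto
 moreover have "((%x. \<phi> (norm (x::'a))) -` A \<inter> unit_ball) - {0} = {x \<in> unit_ball. norm x \<in> \<phi> -` A \<inter> {0<..<1}}"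
  by auto
 ultimately have "\<phi> -` A \<inter> {0<..<1} \<in> sets lebesgue"
  by (intro radial_set_measurable[where 'a='a]) auto
 then show "\<phi> -` A \<inter> space (lebesgue_on {0<..<1}) \<in> sets (lebesgue_on {0<..<1})"
  by (subst sets_restrict_space_iff) auto
qed auto

section \<open>Polar coordinates for integrals of Lebesgue measurable radial functions\<close>

lemma lebesgue_on_borel_version:
 fixes f :: "'a::euclidean_space => real"
 assumes "f \<in> borel_measurable (lebesgue_on S)" "S \<in> sets lebesgue"
 shows "\<exists>g \<in> borel_measurable borel. AE x in lebesgue_on S. f x = g x"
proof -
 have "(%x. if x \<in> S then f x else 0) \<in> borel_measurable lebesgue"
  by (rule borel_measurable_if_I[OF assms])
 then obtain g where g: "g \<in> borel_measurable lborel" "AE x in lborel. (if x \<in> S then f x else 0) = g x"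
  using completion_ex_borel_measurable_real[of _ lborel] by blast
 have "AE x in lebesgue. x \<in> S --> f x = g x"
  using AE_completion[OF g(2)] by eventually_elim auto
 then show ?thesis using g(1) assms(2) by (auto simp: AE_lebesgue_on_iff)
qed

lemma lebesgue_on_borel_integral:
 fixes f :: "'a::euclidean_space => real"
 assumes [measurable]: "f \<in> borel_measurable borel" "S \<in> sets borel"
 shows "integrable (lebesgue_on S) f \<longleftrightarrow> integrable lborel (%x. indicator S x * f x)"
  "integral\<^sup>L (lebesgue_on S) f = integral\<^sup>L lborel (%x. indicator S x * f x)"
proof -
 have m: "(%x. indicator S x *\<^sub>R f x) \<in> borel_measurable lborel" by measurable
 have S: "S \<inter> space lebesgue \<in> sets lebesgue" by simp
 show "integrable (lebesgue_on S) f \<longleftrightarrow> integrable lborel (%x. indicator S x * f x)"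
  using integrable_completion[OF m] integrable_restrict_space[OF S, of f] by simp
 show "integral\<^sup>L (lebesgue_on S) f = integral\<^sup>L lborel (%x. indicator S x * f x)"
  using integral_completion[OF m] integral_restrict_space[OF S, of f] by simp
qed

lemma radial_integral_borel:
 fixes f :: "real => real"
 assumes [measurable]: "f \<in> borel_measurable borel"
 shows "integrable (lebesgue_on unit_ball) (%x. f (norm (x::'a::euclidean_space))) \<longleftrightarrow>
   integrable (lebesgue_on {0<..<1}) (%r. r ^ (DIM('a) - 1) * f r)"
  "(LINT x|lebesgue_on unit_ball. f (norm (x::'a))) =
   sphere_area TYPE('a) * (LINT r|lebesgue_on {0<..<1}. r ^ (DIM('a) - 1) * f r)"
proof -
 let ?D = "density lborel (indicator (unit_ball :: 'a set))" and ?c = "sphere_area TYPE('a)"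
 let ?w = "%r. ?c * r ^ (DIM('a) - 1) * indicator {0<..<1} r"
 have D: "?D = density lborel (%x. ennreal (indicator unit_ball x))" by (simp add: ennreal_indicator)
 have N: "distr ?D borel norm = density lborel (%r. ennreal (?w r))"
  unfolding distr_norm_unit_ball by (intro arg_cong[of _ _ "density lborel"] ext) (auto simp: indicator_def)
 have w0: "0 <= ?w r" for r using sphere_area_pos[where 'a='a] by (auto simp: indicator_def)
 have c0: "?c ~= 0" using sphere_area_pos[where 'a='a] by simp
 have "integrable (lebesgue_on unit_ball) (%x. f (norm (x::'a))) \<longleftrightarrow> integrable lborel (%x. indicator unit_ball x * f (norm (x::'a)))"
  by (rule lebesgue_on_borel_integral) auto
 also have "\<dots> \<longleftrightarrow> integrable ?D (%x. f (norm x))"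
  unfolding D by (subst integrable_real_density) auto
 also have "\<dots> \<longleftrightarrow> integrable (distr ?D borel norm) f"
  by (rule integrable_distr_eq[symmetric]) auto
 also have "\<dots> \<longleftrightarrow> integrable lborel (%r. ?w r * f r)"
  unfolding N by (rule integrable_real_density) (use w0 in auto)
 also have "\<dots> \<longleftrightarrow> integrable lborel (%r. ?c * (indicator {0<..<1} r * (r ^ (DIM('a) - 1) * f r)))"
  by (rule Bochner_Integration.integrable_cong) (auto simp: algebra_simps)
 also have "\<dots> \<longleftrightarrow> integrable lborel (%r. indicator {0<..<1} r * (r ^ (DIM('a) - 1) * f r))"
  using c0 by simp
 also have "\<dots> \<longleftrightarrow> integrable (lebesgue_on {0<..<1}) (%r. r ^ (DIM('a) - 1) * f r)"
  by (rule lebesgue_on_borel_integral(1)[symmetric]) auto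
 finally show "integrable (lebesgue_on unit_ball) (%x. f (norm (x::'a))) \<longleftrightarrow>
   integrable (lebesgue_on {0<..<1}) (%r. r ^ (DIM('a) - 1) * f r)" .
 have "(LINT x|lebesgue_on unit_ball. f (norm (x::'a))) = integral\<^sup>L lborel (%x. indicator unit_ball x * f (norm (x::'a)))"
  by (rule lebesgue_on_borel_integral) auto
 also have "\<dots> = integral\<^sup>L ?D (%x. f (norm x))"
  unfolding D by (subst integral_real_density) auto
 also have "\<dots> = integral\<^sup>L (distr ?D borel norm) f"
  by (rule integral_distr[symmetric]) auto
 also have "\<dots> = integral\<^sup>L lborel (%r. ?w r * f r)"
  unfolding N by (rule integral_real_density) (use w0 in auto)
 also have "\<dots> = integral\<^sup>L lborel (%r. ?c * (indicator {0<..<1} r * (r ^ (DIM('a) - 1) * f r)))"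
  by (rule Bochner_Integration.integral_cong) (auto simp: algebra_simps)
 also have "\<dots> = ?c * integral\<^sup>L lborel (%r. indicator {0<..<1} r * (r ^ (DIM('a) - 1) * f r))"
  by simp
 also have "\<dots> = ?c * (LINT r|lebesgue_on {0<..<1}. r ^ (DIM('a) - 1) * f r)"
  by (subst lebesgue_on_borel_integral(2)) auto
 finally show "(LINT x|lebesgue_on unit_ball. f (norm (x::'a))) = ?c * (LINT r|lebesgue_on {0<..<1}. r ^ (DIM('a) - 1) * f r)" .
qed

lemma radial_integral:
 fixes f :: "real => real"
 assumes f: "f \<in> borel_measurable (lebesgue_on {0<..<1})"
 shows "(%x. f (norm (x::'a::euclidean_space))) \<in> borel_measurable (lebesgue_on unit_ball)"
  "integrable (lebesgue_on unit_ball) (%x. f (norm (x::'a))) \<longleftrightarrow>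
   integrable (lebesgue_on {0<..<1}) (%r. r ^ (DIM('a) - 1) * f r)"
  "(LINT x|lebesgue_on unit_ball. f (norm (x::'a))) =
   sphere_area TYPE('a) * (LINT r|lebesgue_on {0<..<1}. r ^ (DIM('a) - 1) * f r)"
proof -
 obtain g where g: "g \<in> borel_measurable borel" "AE r in lebesgue_on {0<..<1}. f r = g r"
  using lebesgue_on_borel_version[OF f] by auto
 have ae: "AE x in lebesgue_on unit_ball. f (norm (x::'a)) = g (norm x)"
  using g(2) unfolding AE_radial_iff[where 'a='a, of "%r. f r = g r"] .
 have gm: "(%x. g (norm (x::'a))) \<in> borel_measurable (lebesgue_on unit_ball)"
 proof -
  note [measurable] = g(1)
  have "(%x. g (norm (x::'a))) \<in> borel_measurable lborel" by measurable
  then show ?thesis by (intro measurable_restrict_space1 measurable_completion)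
 qed
 show fm: "(%x. f (norm (x::'a))) \<in> borel_measurable (lebesgue_on unit_ball)"
  by (rule borel_measurable_AE_lebesgue_on[OF gm]) (use ae in \<open>auto elim!: eventually_mono\<close>)
 have pm: "(%r. r ^ (DIM('a) - 1)) \<in> borel_measurable (lebesgue_on {0<..<1::real})"
  by (intro measurable_restrict_space1 measurable_completion) measurable
 have g1: "g \<in> borel_measurable (lebesgue_on {0<..<1})"
  using g(1) by (intro measurable_restrict_space1 measurable_completion) simp
 have rf: "(%r. r ^ (DIM('a) - 1) * f r) \<in> borel_measurable (lebesgue_on {0<..<1})"
  "(%r. r ^ (DIM('a) - 1) * g r) \<in> borel_measurable (lebesgue_on {0<..<1})"
  using f g1 pm by simp_all
 have ae2: "AE r in lebesgue_on {0<..<1}. r ^ (DIM('a) - 1) * f r = r ^ (DIM('a) - 1) * g r"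
  using g(2) by (auto elim!: eventually_mono)
 show "integrable (lebesgue_on unit_ball) (%x. f (norm (x::'a))) \<longleftrightarrow>
   integrable (lebesgue_on {0<..<1}) (%r. r ^ (DIM('a) - 1) * f r)"
  using integrable_cong_AE[OF fm gm ae] integrable_cong_AE[OF rf ae2] radial_integral_borel(1)[OF g(1), where 'a='a] by simp
 show "(LINT x|lebesgue_on unit_ball. f (norm (x::'a))) =
   sphere_area TYPE('a) * (LINT r|lebesgue_on {0<..<1}. r ^ (DIM('a) - 1) * f r)"
  using integral_cong_AE[OF fm gm ae] integral_cong_AE[OF rf ae2] radial_integral_borel(2)[OF g(1), where 'a='a] by simp
qed

subsection \<open>Square integrable functions\<close>

text \<open>Stated for an arbitrary measure, so that one calculus serves both Lebesgue measure on
  the ball and the weighted measure on the interval.\<close>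

definition sqint :: "'a measure => ('a => real) => bool" where
 "sqint M f \<longleftrightarrow> f \<in> borel_measurable M & integrable M (%x. (f x)^2)"

definition l2norm :: "'a measure => ('a => real) => real" where
 "l2norm M f = sqrt (LINT x|M. (f x)^2)"

lemma sqintD: "sqint M f ==> f \<in> borel_measurable M" "sqint M f ==> integrable M (%x. (f x)^2)"
 by (auto simp: sqint_def)

lemma l2norm_nonneg [simp]: "0 <= l2norm M f"
 by (simp add: l2norm_def)

lemma l2norm_sq: "(l2norm M f)^2 = (LINT x|M. (f x)^2)"
 by (simp add: l2norm_def)

lemma sqint_times:
 assumes f: "sqint M f" and g: "sqint M g"
 shows "integrable M (%x. f x * g x)"
proof (rule Bochner_Integration.integrable_bound)
 show "integrable M (%x. (f x)^2 + (g x)^2)" using sqintD(2)[OF f] sqintD(2)[OF g] by simp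
 show "(%x. f x * g x) \<in> borel_measurable M" using sqintD(1)[OF f] sqintD(1)[OF g] by simp
 have "\<bar>a * b\<bar> <= a^2 + b^2" for a b :: real
 proof -
  have "2 * (\<bar>a\<bar> * \<bar>b\<bar>) <= \<bar>a\<bar>\<^sup>2 + \<bar>b\<bar>\<^sup>2" using sum_squares_bound[of "\<bar>a\<bar>" "\<bar>b\<bar>"] by (simp add: algebra_simps)
  moreover have "0 <= \<bar>a\<bar> * \<bar>b\<bar>" by simp
  ultimately show ?thesis unfolding abs_mult power2_abs by linarith
 qed
 then show "AE x in M. norm (f x * g x) <= norm ((f x)^2 + (g x)^2)" by simp
qed

lemma sqint_add:
 assumes f: "sqint M f" and g: "sqint M g"
 shows "sqint M (%x. f x + g x)"
proof -
 have "integrable M (%x. (f x)^2 + 2 * (f x * g x) + (g x)^2)"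
  using sqintD(2)[OF f] sqintD(2)[OF g] sqint_times[OF f g] by simp
 then show ?thesis using sqintD(1)[OF f] sqintD(1)[OF g]
  by (simp add: sqint_def power2_sum algebra_simps)
qed

lemma sqint_bounded_mult:
 assumes f: "sqint M f" and c: "c \<in> borel_measurable M" "!!x. x \<in> space M ==> \<bar>c x\<bar> <= B"
 shows "sqint M (%x. c x * f x)"
proof -
 have "integrable M (%x. (c x * f x)^2)"
 proof (rule Bochner_Integration.integrable_bound)
  show "integrable M (%x. B\<^sup>2 * (f x)^2)" using sqintD(2)[OF f] by simp
  show "(%x. (c x * f x)^2) \<in> borel_measurable M" using sqintD(1)[OF f] c(1) by simp
  have "(c x * f x)^2 <= B^2 * (f x)^2" if "x \<in> space M" for x
  proof -
   have "\<bar>c x\<bar> <= \<bar>B\<bar>" using c(2)[OF that] by linarith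
   then have "(c x)^2 <= B^2" by (simp only: abs_le_square_iff)
   then show ?thesis by (simp add: power_mult_distrib mult_right_mono)
  qed
  then show "AE x in M. norm ((c x * f x)^2) <= norm (B^2 * (f x)^2)" by (intro AE_I2) simp
 qed
 then show ?thesis using sqintD(1)[OF f] c(1) by (simp add: sqint_def)
qed

lemma sqint_cmult: "sqint M f ==> sqint M (%x. c * f x)"
 by (rule sqint_bounded_mult[of _ _ _ "\<bar>c\<bar>"]) auto

lemma sqint_diff:
 assumes f: "sqint M f" and g: "sqint M g"
 shows "sqint M (%x. f x - g x)"
 using sqint_add[OF f sqint_cmult[OF g, of "-1"]] by simp

lemma sqint_bounded:
 assumes "finite_measure M" "f \<in> borel_measurable M" "!!x. x \<in> space M ==> \<bar>f x\<bar> <= B"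
 shows "sqint M f"
proof -
 interpret finite_measure M by fact
 have "sqint M (%x. 1)" by (simp add: sqint_def)
 from sqint_bounded_mult[OF this assms(2,3)] show ?thesis by simp
qed

lemma sqint_integrable: "finite_measure M ==> sqint M f ==> integrable M f"
 using sqint_times[OF _ sqint_bounded[of M "%x. 1" 1]] by simp

lemma sqint_sum: "(!!i. i \<in> I ==> sqint M (f i)) ==> sqint M (%x. \<Sum>i\<in>I. f i x)"
proof (induction I rule: infinite_finite_induct)
 case (insert i I)
 then show ?case using sqint_add[of M "f i" "%x. \<Sum>i\<in>I. f i x"] by simp
qed (auto simp: sqint_def)

lemma sqint_AE:
 fixes f g :: "'a::euclidean_space => real"
 assumes "sqint (lebesgue_on S) f" "AE x in lebesgue_on S. f x = g x" "S \<in> sets lebesgue"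
 shows "sqint (lebesgue_on S) g"
 unfolding sqint_def
proof
 show "g \<in> borel_measurable (lebesgue_on S)"
  by (rule borel_measurable_AE_lebesgue_on[OF sqintD(1)[OF assms(1)] assms(2,3)])
 show "integrable (lebesgue_on S) (%x. (g x)^2)"
  by (rule integrable_AE_lebesgue_on(1)[OF sqintD(2)[OF assms(1)] _ assms(3)])
    (use assms(2) in \<open>auto elim!: eventually_mono\<close>)
qed

lemma Cauchy_Schwarz_integral:
 assumes f: "sqint M f" and g: "sqint M g"
 shows "\<bar>\<integral>x. f x * g x \<partial>M\<bar> <= l2norm M f * l2norm M g"
proof -
 let ?a = "\<integral>x. (f x)^2 \<partial>M" and ?b = "\<integral>x. (g x)^2 \<partial>M" and ?c = "\<integral>x. f x * g x \<partial>M"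
 have q: "0 <= ?a * t^2 + 2 * ?c * t + ?b" for t
 proof -
  have "0 <= (LINT x|M. (t * f x + g x)^2)" by simp
  also have "\<dots> = (LINT x|M. t\<^sup>2 * (f x)^2 + 2 * t * (f x * g x) + (g x)^2)"
   by (rule Bochner_Integration.integral_cong) (auto simp: power2_eq_square algebra_simps)
  also have "\<dots> = t^2 * ?a + 2 * t * ?c + ?b"
   using sqintD(2)[OF f] sqintD(2)[OF g] sqint_times[OF f g] by simp
  finally show ?thesis by (simp add: algebra_simps)
 qed
 have nn: "0 <= ?a" "0 <= ?b" by simp_all
 have "?c\<^sup>2 <= ?a * ?b"
 proof (cases "?a = 0")
  case True
  have "?c = 0"
  proof (rule ccontr)
   assume "?c ~= 0"
   then show False using q[of "- (?b + 1) / (2 * ?c)"] True by (simp add: field_simps)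
  qed
  then show ?thesis using nn by simp
 next
  case False
  then have "?a > 0" using nn(1) by (simp only: less_le) auto
  have "?a * (- ?c / ?a)^2 + 2 * ?c * (- ?c / ?a) + ?b = ?b - ?c\<^sup>2 / ?a"
   using \<open>?a > 0\<close> by (simp add: field_simps power2_eq_square)
  then have "?c\<^sup>2 / ?a <= ?b" using q[of "- ?c / ?a"] by simp
  then show ?thesis using \<open>?a > 0\<close> by (simp add: field_simps)
 qed
 then have "sqrt (?c\<^sup>2) <= sqrt (?a * ?b)" by (rule real_sqrt_le_mono)
 then show ?thesis by (simp add: l2norm_def real_sqrt_mult)
qed

lemma l2norm_triangle:
 assumes f: "sqint M f" and g: "sqint M g"
 shows "l2norm M (%x. f x + g x) <= l2norm M f + l2norm M g"
proof -
 have "(LINT x|M. (f x + g x)^2) = (LINT x|M. (f x)^2 + 2 * (f x * g x) + (g x)^2)"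
  by (rule Bochner_Integration.integral_cong) (auto simp: power2_eq_square algebra_simps)
 also have "\<dots> = (l2norm M f)^2 + 2 * (LINT x|M. f x * g x) + (l2norm M g)^2"
  using sqintD(2)[OF f] sqintD(2)[OF g] sqint_times[OF f g] by (simp add: l2norm_sq)
 also have "\<dots> <= (l2norm M f + l2norm M g)^2"
  using Cauchy_Schwarz_integral[OF f g] by (simp add: power2_sum)
 finally show ?thesis unfolding l2norm_def[of M "%x. f x + g x"] by (intro real_le_lsqrt) simp_all
qed

text \<open>Eventual square integrability is part of the notion: a Bochner integral that tends to
  zero would not by itself exclude non-integrable squares, whose integral is \<open>0\<close> by
  convention.\<close>

definition L2lim :: "'a measure => ('s => 'a => real) => ('a => real) => 's filter => bool" where
 "L2lim M f f0 F \<longleftrightarrow> sqint M f0 & eventually (%s. sqint M (f s)) F \<and>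
   ((%s. l2norm M (%x. f s x - f0 x)) \<longlongrightarrow> 0) F"

lemma L2limD:
 assumes "L2lim M f f0 F"
 shows "sqint M f0" "eventually (%s. sqint M (f s)) F"
  "((%s. l2norm M (%x. f s x - f0 x)) \<longlongrightarrow> 0) F"
 using assms by (auto simp: L2lim_def)

lemma L2lim_const: "sqint M f ==> L2lim M (%s. f) f F"
 by (simp add: L2lim_def l2norm_def)

lemma l2norm_cong: "(!!x. x \<in> space M ==> f x = g x) ==> l2norm M f = l2norm M g"
 unfolding l2norm_def by (simp cong: Bochner_Integration.integral_cong)

lemma L2lim_le:
 assumes "sqint M f0" "eventually (%s. sqint M (f s)) F"
  and "eventually (%s. l2norm M (%x. f s x - f0 x) <= B s) F" "(B \<longlongrightarrow> 0) F"
 shows "L2lim M f f0 F"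
 unfolding L2lim_def
proof (intro conjI assms(1,2))
 show "((%s. l2norm M (%x. f s x - f0 x)) \<longlongrightarrow> 0) F"
  by (rule tendsto_sandwich[OF _ assms(3) tendsto_const assms(4)]) simp
qed

lemma L2lim_add:
 assumes f: "L2lim M f f0 F" and g: "L2lim M g g0 F"
 shows "L2lim M (%s x. f s x + g s x) (%x. f0 x + g0 x) F"
proof (rule L2lim_le[where B="%s. l2norm M (%x. f s x - f0 x) + l2norm M (%x. g s x - g0 x)"])
 show "sqint M (%x. f0 x + g0 x)" using L2limD(1)[OF f] L2limD(1)[OF g] by (rule sqint_add)
 show "eventually (%s. sqint M (%x. f s x + g s x)) F"
  using L2limD(2)[OF f] L2limD(2)[OF g] by eventually_elim (rule sqint_add)
 show "eventually (%s. l2norm M (%x. f s x + g s x - (f0 x + g0 x)) <= l2norm M (%x. f s x - f0 x) + l2norm M (%x. g s x - g0 x)) F"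
  using L2limD(2)[OF f] L2limD(2)[OF g]
 proof eventually_elim
  case (elim s)
  have "l2norm M (%x. f s x + g s x - (f0 x + g0 x)) = l2norm M (%x. (f s x - f0 x) + (g s x - g0 x))"
   by (rule l2norm_cong) simp
  then show ?case
   using l2norm_triangle[OF sqint_diff[OF elim(1) L2limD(1)[OF f]] sqint_diff[OF elim(2) L2limD(1)[OF g]]] by simp
 qed
 show "((%s. l2norm M (%x. f s x - f0 x) + l2norm M (%x. g s x - g0 x)) \<longlongrightarrow> 0) F"
  using tendsto_add[OF L2limD(3)[OF f] L2limD(3)[OF g]] by simp
qed

lemma l2norm_bounded_mult:
 assumes f: "sqint M f" and c: "c \<in> borel_measurable M" "!!x. x \<in> space M ==> \<bar>c x\<bar> <= B"
 shows "l2norm M (%x. c x * f x) <= \<bar>B\<bar> * l2norm M f"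
proof -
 have "(LINT x|M. (c x * f x)^2) <= (LINT x|M. B\<^sup>2 * (f x)^2)"
 proof (rule integral_mono)
  show "integrable M (%x. (c x * f x)^2)" using sqint_bounded_mult[OF f c] by (simp add: sqint_def)
  show "integrable M (%x. B\<^sup>2 * (f x)^2)" using sqintD(2)[OF f] by simp
  fix x assume "x \<in> space M"
  then have "\<bar>c x\<bar> <= \<bar>B\<bar>" using c(2)[of x] by linarith
  then have "(c x)^2 <= B^2" by (simp only: abs_le_square_iff)
  then show "(c x * f x)^2 <= B^2 * (f x)^2" by (simp add: power_mult_distrib mult_right_mono)
 qed
 also have "\<dots> = (\<bar>B\<bar> * l2norm M f)^2" by (simp add: power_mult_distrib l2norm_sq)
 finally show ?thesis unfolding l2norm_def[of M "%x. c x * f x"] by (intro real_le_lsqrt) simp_all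
qed

lemma L2lim_weight:
 assumes f: "L2lim M f f0 F" and c: "!!s. c s \<in> borel_measurable M" "c0 \<in> borel_measurable M"
  and B: "!!x. x \<in> space M ==> \<bar>c0 x\<bar> <= B"
  and e: "eventually (%s. \<forall>x\<in>space M. \<bar>c s x - c0 x\<bar> <= e s) F" "(e \<longlongrightarrow> 0) F"
 shows "L2lim M (%s x. c s x * f s x) (%x. c0 x * f0 x) F"
proof (rule L2lim_le[where B="%s. \<bar>e s\<bar> * (l2norm M (%x. f s x - f0 x) + l2norm M f0) + \<bar>B\<bar> * l2norm M (%x. f s x - f0 x)"])
 show "sqint M (%x. c0 x * f0 x)" by (rule sqint_bounded_mult[OF L2limD(1)[OF f] c(2) B])
 have cs: "sqint M (%x. (c s x - c0 x) * f s x)" "l2norm M (%x. (c s x - c0 x) * f s x) <= \<bar>e s\<bar> * l2norm M (f s)"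
  if "sqint M (f s)" "\<forall>x\<in>space M. \<bar>c s x - c0 x\<bar> <= e s" for s
  using sqint_bounded_mult[OF that(1), of "%x. c s x - c0 x" "e s"] l2norm_bounded_mult[OF that(1), of "%x. c s x - c0 x" "e s"]
   c that(2) by auto
 show "eventually (%s. sqint M (%x. c s x * f s x)) F"
  using L2limD(2)[OF f] e(1)
 proof eventually_elim
  case (elim s)
  have "sqint M (%x. (c s x - c0 x) * f s x + c0 x * f s x)"
   by (rule sqint_add[OF cs(1)[OF elim] sqint_bounded_mult[OF elim(1) c(2) B]])
  then show ?case by (simp add: algebra_simps)
 qed
 show "eventually (%s. l2norm M (%x. c s x * f s x - c0 x * f0 x) \<le>
   \<bar>e s\<bar> * (l2norm M (%x. f s x - f0 x) + l2norm M f0) + \<bar>B\<bar> * l2norm M (%x. f s x - f0 x)) F"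
  using L2limD(2)[OF f] e(1)
 proof eventually_elim
  case (elim s)
  note d = sqint_diff[OF elim(1) L2limD(1)[OF f]]
  have "l2norm M (%x. c s x * f s x - c0 x * f0 x) = l2norm M (%x. (c s x - c0 x) * f s x + c0 x * (f s x - f0 x))"
   by (rule l2norm_cong) (simp add: algebra_simps)
  also have "\<dots> <= l2norm M (%x. (c s x - c0 x) * f s x) + l2norm M (%x. c0 x * (f s x - f0 x))"
   by (rule l2norm_triangle[OF cs(1)[OF elim] sqint_bounded_mult[OF d c(2) B]])
  also have "\<dots> <= \<bar>e s\<bar> * l2norm M (f s) + \<bar>B\<bar> * l2norm M (%x. f s x - f0 x)"
   by (rule add_mono[OF cs(2)[OF elim] l2norm_bounded_mult[OF d c(2) B]])
  also have "l2norm M (f s) <= l2norm M (%x. f s x - f0 x) + l2norm M f0"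
   using l2norm_triangle[OF d L2limD(1)[OF f]] by simp
  then have "\<bar>e s\<bar> * l2norm M (f s) + \<bar>B\<bar> * l2norm M (%x. f s x - f0 x) \<le>
   \<bar>e s\<bar> * (l2norm M (%x. f s x - f0 x) + l2norm M f0) + \<bar>B\<bar> * l2norm M (%x. f s x - f0 x)"
   by (intro add_right_mono mult_left_mono) simp_all
  finally show ?case .
 qed
 have "((%s. \<bar>e s\<bar> * (l2norm M (%x. f s x - f0 x) + l2norm M f0) + \<bar>B\<bar> * l2norm M (%x. f s x - f0 x)) \<longlongrightarrow>
   \<bar>0\<bar> * (0 + l2norm M f0) + \<bar>B\<bar> * 0) F"
  by (intro tendsto_intros e(2) L2limD(3)[OF f])
 then show "((%s. \<bar>e s\<bar> * (l2norm M (%x. f s x - f0 x) + l2norm M f0) + \<bar>B\<bar> * l2norm M (%x. f s x - f0 x)) \<longlongrightarrow> 0) F"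
  by simp
qed

lemma L2lim_bounded_mult:
 assumes f: "L2lim M f f0 F" and c: "c0 \<in> borel_measurable M"
  and B: "!!x. x \<in> space M ==> \<bar>c0 x\<bar> <= B"
 shows "L2lim M (%s x. c0 x * f s x) (%x. c0 x * f0 x) F"
 by (rule L2lim_weight[OF f, where c="%s. c0" and e="%s. 0"]) (use c B in auto)

lemma L2lim_times:
 assumes f: "L2lim M f f0 F" and g: "L2lim M g g0 F"
 shows "((%s. \<integral>x. f s x * g s x \<partial>M) \<longlongrightarrow> (LINT x|M. f0 x * g0 x)) F"
proof -
 let ?a = "%s. l2norm M (%x. f s x - f0 x)" and ?b = "%s. l2norm M (%x. g s x - g0 x)"
 have ev: "eventually (%s. \<bar>(LINT x|M. f s x * g s x) - (LINT x|M. f0 x * g0 x)\<bar> <= ?a s * (?b s + l2norm M g0) + l2norm M f0 * ?b s) F"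
  using L2limD(2)[OF f] L2limD(2)[OF g]
 proof eventually_elim
  case (elim s)
  note df = sqint_diff[OF elim(1) L2limD(1)[OF f]] and dg = sqint_diff[OF elim(2) L2limD(1)[OF g]]
  have "(LINT x|M. f s x * g s x) - (LINT x|M. f0 x * g0 x) = (LINT x|M. f s x * g s x - f0 x * g0 x)"
   using sqint_times[OF elim] sqint_times[OF L2limD(1)[OF f] L2limD(1)[OF g]] by simp
  also have "\<dots> = (LINT x|M. (f s x - f0 x) * g s x + f0 x * (g s x - g0 x))"
   by (rule Bochner_Integration.integral_cong) (auto simp: algebra_simps)
  also have "\<dots> = (LINT x|M. (f s x - f0 x) * g s x) + (LINT x|M. f0 x * (g s x - g0 x))"
   by (rule Bochner_Integration.integral_add[OF sqint_times[OF df elim(2)] sqint_times[OF L2limD(1)[OF f] dg]])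
  finally have "\<bar>(LINT x|M. f s x * g s x) - (LINT x|M. f0 x * g0 x)\<bar> <= ?a s * l2norm M (g s) + l2norm M f0 * ?b s"
   using Cauchy_Schwarz_integral[OF df elim(2)] Cauchy_Schwarz_integral[OF L2limD(1)[OF f] dg] by linarith
  moreover have "l2norm M (g s) <= ?b s + l2norm M g0"
   using l2norm_triangle[OF dg L2limD(1)[OF g]] by simp
  then have "?a s * l2norm M (g s) <= ?a s * (?b s + l2norm M g0)" by (intro mult_left_mono) simp_all
  ultimately show ?case by linarith
 qed
 have "((%s. ?a s * (?b s + l2norm M g0) + l2norm M f0 * ?b s) \<longlongrightarrow> 0 * (0 + l2norm M g0) + l2norm M f0 * 0) F"
  by (intro tendsto_intros L2limD(3)[OF f] L2limD(3)[OF g])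
 then have "((%s. ?a s * (?b s + l2norm M g0) + l2norm M f0 * ?b s) \<longlongrightarrow> 0) F" by simp
 then have "((%s. (LINT x|M. f s x * g s x) - (LINT x|M. f0 x * g0 x)) \<longlongrightarrow> 0) F"
  by (rule Lim_null_comparison[rotated]) (use ev in simp)
 then show ?thesis by (simp add: Lim_null[symmetric])
qed

subsection \<open>The radial measure\<close>

text \<open>For \<open>N = DIM('a) - 1\<close> this is, up to the factor \<open>sphere_area\<close>,
  the image of Lebesgue measure on the ball under \<open>norm\<close>.\<close>

definition rmeas :: "nat => real measure" where
 "rmeas N = density (lebesgue_on {0<..<1}) (%r. ennreal (r ^ N))"

lemma space_rmeas [simp]: "space (rmeas N) = {0<..<1}"
 and sets_rmeas: "sets (rmeas N) = sets (lebesgue_on {0<..<1})"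
 and borel_measurable_rmeas: "borel_measurable (rmeas N) = borel_measurable (lebesgue_on {0<..<1})"
 by (auto simp: rmeas_def)

lemma power_measurable_rmeas: "(%r. r ^ N) \<in> borel_measurable (lebesgue_on {0<..<1::real})"
 by (intro measurable_restrict_space1 measurable_completion) simp

lemma rmeas_integrable:
 fixes f :: "real => real"
 assumes "f \<in> borel_measurable (rmeas N)"
 shows "integrable (rmeas N) f \<longleftrightarrow> integrable (lebesgue_on {0<..<1}) (%r. r ^ N * f r)"
 unfolding rmeas_def
 by (subst integrable_real_density) (use assms power_measurable_rmeas in \<open>auto simp: borel_measurable_rmeas\<close>)

lemma rmeas_integral:
 fixes f :: "real => real"
 assumes "f \<in> borel_measurable (rmeas N)"
 shows "(LINT r|rmeas N. f r) = (LINT r|lebesgue_on {0<..<1}. r ^ N * f r)"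
 unfolding rmeas_def
 by (subst integral_real_density) (use assms power_measurable_rmeas in \<open>auto simp: borel_measurable_rmeas\<close>)

lemma AE_rmeas: "(AE r in rmeas N. P r) \<longleftrightarrow> (AE r in lebesgue_on {0<..<1}. P r)"
proof -
 have "(AE r in rmeas N. P r) \<longleftrightarrow> (AE r in lebesgue_on {0<..<1}. 0 < ennreal (r ^ N) --> P r)"
  unfolding rmeas_def using power_measurable_rmeas by (intro AE_density) simp
 also have "\<dots> \<longleftrightarrow> (AE r in lebesgue_on {0<..<1}. P r)"
  by (rule AE_cong) (auto simp: ennreal_less_zero_iff)
 finally show ?thesis .
qed

lemma finite_measure_rmeas: "finite_measure (rmeas N)"
proof (rule finite_measureI)
 have "emeasure (rmeas N) (space (rmeas N)) = (\<integral>\<^sup>+r. ennreal (r ^ N) * indicator {0<..<1} r \<partial>lebesgue_on {0<..<1})"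
  unfolding rmeas_def using power_measurable_rmeas by (subst emeasure_density) auto
 also have "\<dots> <= (\<integral>\<^sup>+r. 1 \<partial>lebesgue_on {0<..<1::real})"
  by (rule nn_integral_mono) (auto simp: power_le_one)
 also have "\<dots> = emeasure lebesgue {0<..<1::real}"
  by (subst nn_integral_const) (simp add: emeasure_restrict_space)
 also have "\<dots> < \<infinity>" by simp
 finally show "emeasure (rmeas N) (space (rmeas N)) ~= \<infinity>" by simp
qed

lemma sqint_rmeas_locally_integrable:
 assumes "sqint (rmeas N) h"
 shows "locally_integrable {0<..<1} h" "locally_integrable {0<..<1} (%r. r ^ N * h r)"
proof -
 have hm: "h \<in> borel_measurable (lebesgue_on {0<..<1})"
  using assms by (simp add: sqint_def borel_measurable_rmeas)
 have i: "integrable (lebesgue_on {0<..<1}) (%r. r ^ N * (h r)^2)"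
  using assms hm by (subst rmeas_integrable[symmetric]) (auto simp: sqint_def borel_measurable_rmeas)
 have b: "2 * \<bar>a\<bar> <= 1 + a^2" for a :: real
  using sum_squares_bound[of "\<bar>a\<bar>" 1] by simp
 have "integrable (lebesgue_on {0<..<1}) (%r. r ^ N * h r)"
 proof -
  have "integrable (rmeas N) h" by (rule sqint_integrable[OF finite_measure_rmeas assms])
  then show ?thesis using hm by (subst (asm) rmeas_integrable) (auto simp: borel_measurable_rmeas)
 qed
 note i1 = this
 have "integrable (lebesgue_on K) h & integrable (lebesgue_on K) (%r. r ^ N * h r)" if K: "compact K" "K \<subseteq> {0<..<1}" for K
 proof -
  obtain a b where ab: "0 < a" "a < b" "b < 1" "K \<subseteq> {a<..<b}"
   using compact_subset_unit_interval[OF K] by blast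
  have Km: "K \<in> sets lebesgue" using K(1) compact_imp_closed closed_borel_lebesgue by blast
  have iK: "integrable (lebesgue_on K) (%r. r ^ N * h r)"
   by (rule integrable_lebesgue_on_subset[OF i1 K(2) Km]) simp
  have "h \<in> borel_measurable (lebesgue_on K)"
  proof -
   have "(%x. if x \<in> {0<..<1} then h x else 0) \<in> borel_measurable lebesgue"
    by (rule borel_measurable_if_I[OF hm]) simp
   then have "(%x. if x \<in> {0<..<1} then h x else 0) \<in> borel_measurable (lebesgue_on K)"
    by (rule measurable_restrict_space1)
   then show ?thesis by (subst measurable_cong[where g="%x. if x \<in> {0<..<1} then h x else 0"]) (use K in auto)
  qed
  moreover have "\<bar>h r\<bar> <= \<bar>inverse (a ^ N) * (r ^ N * h r)\<bar>" if "r \<in> K" for r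
  proof -
   have r: "a < r" using that ab(4) by auto
   then have "a ^ N <= r ^ N" using ab(1) by (intro power_mono) auto
   moreover have "0 < a ^ N" using ab(1) by simp
   ultimately have "1 <= inverse (a ^ N) * r ^ N" by (simp add: field_simps)
   then have "1 * \<bar>h r\<bar> <= (inverse (a ^ N) * r ^ N) * \<bar>h r\<bar>" by (intro mult_right_mono) auto
   then show ?thesis using r ab(1) by (simp add: abs_mult mult.assoc)
  qed
  ultimately have "integrable (lebesgue_on K) h"
   by (intro Bochner_Integration.integrable_bound[OF integrable_mult_right[OF iK, of "inverse (a ^ N)"]]) (auto intro!: AE_I2)
  then show ?thesis using iK by simp
 qed
 then show "locally_integrable {0<..<1} h" "locally_integrable {0<..<1} (%r. r ^ N * h r)"
  unfolding locally_integrable_def by blast+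
qed

subsection \<open>Averages over spheres\<close>

text \<open>\<open>D\<close> is the spherical mean of \<open>P\<close>: the image under
  \<open>norm\<close> of the measure with density \<open>P\<close> is absolutely continuous with
  respect to the image of Lebesgue measure, and \<open>D\<close> is its Radon-Nikodym
  derivative.\<close>

lemma radial_average_nonneg:
 fixes P :: "'a::euclidean_space => real"
 assumes P: "integrable (lebesgue_on unit_ball) P" "!!x. 0 <= P x"
 shows "\<exists>D \<in> borel_measurable borel. \<forall>h \<in> borel_measurable borel. (\<exists>B. \<forall>r. \<bar>h r\<bar> <= B) -->
   integrable (lebesgue_on unit_ball) (%x::'a. D (norm x) * h (norm x)) \<and>
   (LINT x|lebesgue_on unit_ball. P x * h (norm x)) = (LINT x|lebesgue_on unit_ball. D (norm (x::'a)) * h (norm x))"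
proof -
 let ?L = "lebesgue_on (unit_ball :: 'a set)"
 let ?M = "distr ?L borel norm" and ?N = "distr (density ?L (%x. ennreal (P x))) borel norm"
 have Pm: "P \<in> borel_measurable ?L" using P(1) by auto
 have nm: "norm \<in> borel_measurable ?L" by (intro measurable_restrict_space1 measurable_completion) simp
 have fL: "finite_measure ?L" by (rule finite_measure_lebesgue_on) simp
 interpret M: finite_measure ?M using finite_measure.finite_measure_distr[OF fL nm] .
 have fd: "finite_measure (density ?L (%x. ennreal (P x)))"
 proof (rule finite_measureI)
  have "emeasure (density ?L (%x. ennreal (P x))) (space (density ?L (%x. ennreal (P x)))) = (\<integral>\<^sup>+x. ennreal (P x) * indicator unit_ball x \<partial>?L)"
   using Pm by (subst emeasure_density) auto
  also have "\<dots> = (\<integral>\<^sup>+x. ennreal (P x) \<partial>?L)" by (intro nn_integral_cong) auto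
  also have "\<dots> = ennreal (integral\<^sup>L ?L P)" by (rule nn_integral_eq_integral) (use P in auto)
  finally show "emeasure (density ?L (%x. ennreal (P x))) (space (density ?L (%x. ennreal (P x)))) ~= \<infinity>" by simp
 qed
 interpret N: finite_measure ?N using finite_measure.finite_measure_distr[OF fd, of norm borel] nm by simp
 have ac: "absolutely_continuous ?M ?N"
  unfolding absolutely_continuous_def
 proof
  fix A assume A: "A \<in> null_sets ?M"
  then have Ab: "A \<in> sets borel" by auto
  have "emeasure ?L (norm -` A \<inter> space ?L) = 0"
   using A Ab nm by (auto simp: null_sets_def emeasure_distr)
  then have "norm -` A \<inter> space ?L \<in> null_sets ?L"
   using measurable_sets[OF nm Ab] by (auto simp: null_sets_def)
  then have "norm -` A \<inter> space ?L \<in> null_sets (density ?L (%x. ennreal (P x)))"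
   using absolutely_continuousI_density[of "%x. ennreal (P x)" ?L] Pm unfolding absolutely_continuous_def by auto
  then show "A \<in> null_sets ?N"
   using Ab nm by (auto simp: null_sets_def emeasure_distr)
 qed
 define D where "D r = enn2real (RN_deriv ?M ?N r)" for r
 have Dm: "D \<in> borel_measurable borel" unfolding D_def by (intro borel_measurable_enn2real) (use borel_measurable_RN_deriv[of ?M ?N] in simp)
 show ?thesis
 proof (intro bexI[of _ D] ballI impI Dm)
  fix h :: "real => real" assume h: "h \<in> borel_measurable borel" and "\<exists>B. \<forall>r. \<bar>h r\<bar> <= B"
  then obtain B where B: "!!r. \<bar>h r\<bar> <= B" by blast
  have hN: "integrable ?N h" by (rule N.integrable_const_bound[of _ B]) (use B h in auto)
  have RN: "integrable ?N h \<longleftrightarrow> integrable ?M (%x. D x * h x)" "integral\<^sup>L ?N h = (LINT x|?M. D x * h x)"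
   unfolding D_def using h by (intro M.RN_deriv_integrable M.RN_deriv_integral N.sigma_finite_measure_axioms ac; simp)+
  have Dh: "(%r. D r * h r) \<in> borel_measurable borel" using Dm h by simp
  have i1: "integrable ?L (%x. D (norm x) * h (norm x))"
   using hN RN(1) integrable_distr_eq[OF nm Dh] by simp
  have "integral\<^sup>L ?N h = (LINT x|density ?L (%x. ennreal (P x)). h (norm x))"
   by (rule integral_distr) (use nm h in auto)
  also have "\<dots> = (LINT x|?L. P x * h (norm x))"
   by (subst integral_real_density) (use P(2) Pm measurable_compose[OF nm h] in auto)
  finally have "(LINT x|?L. P x * h (norm x)) = (LINT x|?M. D x * h x)" using RN(2) by simp
  also have "\<dots> = (LINT x|?L. D (norm x) * h (norm x))"
   by (rule integral_distr[OF nm Dh])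
  finally show "integrable ?L (%x. D (norm x) * h (norm x)) & (LINT x|?L. P x * h (norm x)) = (LINT x|?L. D (norm x) * h (norm x))"
   using i1 by simp
 qed
qed

text \<open>Averaging over spheres contracts the \<open>L2\<close> norm. Since \<open>q\<close> is
  not known in advance to be square integrable, it is tested against its own truncations
  \<open>hk\<close>, and Fatou's lemma removes the truncation.\<close>

lemma radial_average:
 fixes p :: "'a::euclidean_space => real"
 assumes p: "sqint (lebesgue_on unit_ball) p"
 shows "\<exists>q \<in> borel_measurable borel. sqint (rmeas (DIM('a) - 1)) q \<and>
  sphere_area TYPE('a) * (LINT r|rmeas (DIM('a) - 1). (q r)^2) <= (LINT x|lebesgue_on unit_ball. (p x)^2) \<and>
  (\<forall>h \<in> borel_measurable borel. (\<exists>B. \<forall>r. \<bar>h r\<bar> <= B) -->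
   (LINT x|lebesgue_on unit_ball. p x * h (norm x)) = sphere_area TYPE('a) * (LINT r|rmeas (DIM('a) - 1). q r * h r))"
proof -
 let ?L = "lebesgue_on (unit_ball :: 'a set)"
 have fL: "finite_measure ?L" by (rule finite_measure_lebesgue_on) simp
 have pi: "integrable ?L p" by (rule sqint_integrable[OF fL p])
 have nm: "norm \<in> borel_measurable ?L" by (intro measurable_restrict_space1 measurable_completion) simp
 have iD1: "integrable ?L (%x. max 0 (p x))" "!!x. 0 <= max 0 (p x)" using pi by simp_all
 obtain D1 where D1m: "D1 \<in> borel_measurable borel" and D1all: "\<forall>h \<in> borel_measurable borel. (\<exists>B. \<forall>r. \<bar>h r\<bar> <= B) -->
   integrable ?L (%x::'a. D1 (norm x) * h (norm x)) & (LINT x|?L. max 0 (p x) * h (norm x)) = (LINT x|?L. D1 (norm x) * h (norm x))"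
  by (rule bexE[OF radial_average_nonneg[OF iD1]]) (rule that)
 note D1 = D1m D1all[rule_format]
 have iD2: "integrable ?L (%x. max 0 (- p x))" "!!x. 0 <= max 0 (- p x)" using pi by simp_all
 obtain D2 where D2m: "D2 \<in> borel_measurable borel" and D2all: "\<forall>h \<in> borel_measurable borel. (\<exists>B. \<forall>r. \<bar>h r\<bar> <= B) -->
   integrable ?L (%x::'a. D2 (norm x) * h (norm x)) & (LINT x|?L. max 0 (- p x) * h (norm x)) = (LINT x|?L. D2 (norm x) * h (norm x))"
  by (rule bexE[OF radial_average_nonneg[OF iD2]]) (rule that)
 note D2 = D2m D2all[rule_format]
 define q where "q r = D1 r - D2 r" for r
 have qm: "q \<in> borel_measurable borel" unfolding q_def using D1(1) D2(1) by simp
 have ph: "integrable ?L (%x. s x * h (norm x))" if "integrable ?L s" "h \<in> borel_measurable borel" "!!r. \<bar>h r\<bar> <= B" for s :: "'a => real" and h B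
 proof (rule Bochner_Integration.integrable_bound[OF integrable_mult_right[OF that(1), of B]])
  show "(%x. s x * h (norm x)) \<in> borel_measurable ?L"
   using that(1) measurable_compose[OF nm that(2)] by simp
  show "AE x in ?L. norm (s x * h (norm x)) <= norm (B * s x)"
  proof (rule AE_I2)
   fix x :: 'a
   have "\<bar>h (norm x)\<bar> <= \<bar>B\<bar>" using that(3)[of "norm x"] by simp
   then show "norm (s x * h (norm x)) <= norm (B * s x)" using mult_right_mono[of "\<bar>h (norm x)\<bar>" "\<bar>B\<bar>" "\<bar>s x\<bar>"] by (simp add: abs_mult mult.commute)
  qed
 qed
 have avg: "integrable ?L (%x. q (norm x) * h (norm x)) & (LINT x|?L. p x * h (norm x)) = (LINT x|?L. q (norm x) * h (norm x))"
  if h: "h \<in> borel_measurable borel" and B: "!!r. \<bar>h r\<bar> <= B" for h B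
 proof -
  have eB: "\<exists>B. \<forall>r. \<bar>h r\<bar> <= B" using B by blast
  note d1 = D1(2)[OF h eB] and d2 = D2(2)[OF h eB]
  have "(LINT x|?L. p x * h (norm x)) = (LINT x|?L. max 0 (p x) * h (norm x) - max 0 (- p x) * h (norm x))"
   by (rule Bochner_Integration.integral_cong) (auto simp: max_def)
  also have "\<dots> = (LINT x|?L. max 0 (p x) * h (norm x)) - (LINT x|?L. max 0 (- p x) * h (norm x))"
   using pi by (intro Bochner_Integration.integral_diff ph[OF _ h B]) auto
  also have "\<dots> = (LINT x|?L. D1 (norm x) * h (norm x)) - (LINT x|?L. D2 (norm x) * h (norm x))"
   using d1 d2 by simp
  also have "\<dots> = (LINT x|?L. q (norm x) * h (norm x))"
   using d1 d2 by (simp add: q_def left_diff_distrib)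
  finally show ?thesis using d1 d2 by (simp add: q_def left_diff_distrib)
 qed
 let ?S = "LINT x|?L. (p x)^2"
 define hk where "hk k r = (if \<bar>q r\<bar> <= real k then q r else 0)" for k r
 have hkm: "hk k \<in> borel_measurable borel" for k unfolding hk_def using qm by measurable
 have hkB: "\<bar>hk k r\<bar> <= real k" for k r by (simp add: hk_def)
 have sq: "integrable ?L (%x. (hk k (norm x))^2)" "(LINT x|?L. (hk k (norm x))^2) <= ?S" for k
 proof -
  have e: "q r * hk k r = (hk k r)^2" for r by (simp add: hk_def power2_eq_square)
  have a: "integrable ?L (%x. (hk k (norm x))^2)" "(LINT x|?L. p x * hk k (norm x)) = (LINT x|?L. (hk k (norm x))^2)"
   using avg[OF hkm hkB, of k] unfolding e by auto
  show "integrable ?L (%x. (hk k (norm x))^2)" by (rule a)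
  \<comment> \<open>The left side equals the integral of \<open>(hk k (norm x))^2\<close>, so the
    second half on the right is absorbed and the bound by \<open>?S\<close> remains.\<close>
  have "(LINT x|?L. p x * hk k (norm x)) <= (LINT x|?L. (p x)^2 / 2 + (hk k (norm x))^2 / 2)"
  proof (rule integral_mono)
   show "integrable ?L (%x. p x * hk k (norm x))" by (rule ph[OF pi hkm hkB])
   show "integrable ?L (%x. (p x)^2 / 2 + (hk k (norm x))^2 / 2)" using a(1) sqintD(2)[OF p] by simp
   show "p x * hk k (norm x) <= (p x)^2 / 2 + (hk k (norm x))^2 / 2" for x
    using sum_squares_bound[of "p x" "hk k (norm x)"] by simp
  qed
  also have "\<dots> = ?S / 2 + (LINT x|?L. (hk k (norm x))^2) / 2" using a(1) sqintD(2)[OF p] by simp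
  finally show "(LINT x|?L. (hk k (norm x))^2) <= ?S" unfolding a(2) by simp
 qed
 have qn: "(%x. q (norm x)) \<in> borel_measurable ?L" by (rule measurable_compose[OF nm qm])
 have lim: "(%k. ennreal ((hk k r)^2)) \<longlonglongrightarrow> ennreal ((q r)^2)" for r
 proof -
  have "eventually (%k. ennreal ((q r)^2) = ennreal ((hk k r)^2)) sequentially"
   using eventually_ge_at_top[of "nat \<lceil>\<bar>q r\<bar>\<rceil>"]
  proof eventually_elim
   case (elim k) then have "\<bar>q r\<bar> <= real k" by linarith
   then show ?case by (simp add: hk_def)
  qed
  with tendsto_const show ?thesis by (rule Lim_transform_eventually)
 qed
 have fat: "(\<integral>\<^sup>+x. ennreal ((q (norm x))^2) \<partial>?L) <= ennreal ?S"
 proof -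
  have "(\<integral>\<^sup>+x. ennreal ((q (norm x))^2) \<partial>?L) = (\<integral>\<^sup>+x. liminf (%k. ennreal ((hk k (norm x))^2)) \<partial>?L)"
   by (intro nn_integral_cong lim_imp_Liminf[symmetric] lim) simp
  also have "\<dots> <= liminf (%k. \<integral>\<^sup>+x. ennreal ((hk k (norm x))^2) \<partial>?L)"
  proof (rule nn_integral_liminf)
   show "(%x. ennreal ((hk k (norm x))^2)) \<in> borel_measurable ?L" for k
    using measurable_compose[OF nm hkm] by simp
  qed
  also have "\<dots> <= liminf (%k::nat. ennreal ?S)"
  proof (rule Liminf_mono, rule always_eventually, rule allI)
   fix k
   have "(\<integral>\<^sup>+x. ennreal ((hk k (norm x))^2) \<partial>?L) = ennreal (LINT x|?L. (hk k (norm x))^2)"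
    by (rule nn_integral_eq_integral[OF sq(1)]) simp
   also have "\<dots> <= ennreal ?S" using sq(2) by (rule ennreal_leI)
   finally show "(\<integral>\<^sup>+x. ennreal ((hk k (norm x))^2) \<partial>?L) <= ennreal ?S" .
  qed
  also have "\<dots> = ennreal ?S" by (simp add: Liminf_const)
  finally show ?thesis .
 qed
 have q2: "integrable ?L (%x. (q (norm x))^2)"
 proof (rule integrableI_bounded)
  show "(%x. (q (norm x))^2) \<in> borel_measurable ?L" using qn by simp
  have "(\<integral>\<^sup>+x. ennreal (norm ((q (norm x))^2)) \<partial>?L) <= ennreal ?S" using fat by simp
  also have "\<dots> < \<infinity>" by simp
  finally show "(\<integral>\<^sup>+x. ennreal (norm ((q (norm x))^2)) \<partial>?L) < \<infinity>" .
 qed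
 have q2S: "(LINT x|?L. (q (norm x))^2) <= ?S"
 proof -
  have "ennreal (LINT x|?L. (q (norm x))^2) <= ennreal ?S"
   using fat by (subst (asm) nn_integral_eq_integral[OF q2]) simp_all
  then show ?thesis by (simp add: ennreal_le_iff)
 qed
 have bm: "f \<in> borel_measurable (rmeas m)" if "f \<in> borel_measurable borel" for f :: "real => real" and m
  unfolding borel_measurable_rmeas using that by (intro measurable_restrict_space1 measurable_completion) simp
 have q2m: "(%r. (q r)^2) \<in> borel_measurable borel" using qm by simp
 show ?thesis
 proof (intro bexI[of _ q] qm conjI ballI impI)
  show "sqint (rmeas (DIM('a) - 1)) q"
   unfolding sqint_def rmeas_integrable[OF bm[OF q2m]]
   using q2 radial_integral_borel(1)[OF q2m, where 'a='a] bm[OF qm] by blast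
  show "sphere_area TYPE('a) * (LINT r|rmeas (DIM('a) - 1). (q r)^2) <= ?S"
   using q2S radial_integral_borel(2)[OF q2m, where 'a='a] rmeas_integral[OF bm[OF q2m]] by simp
  fix h :: "real => real" assume h: "h \<in> borel_measurable borel" "\<exists>B. \<forall>r. \<bar>h r\<bar> <= B"
  then obtain B where B: "!!r. \<bar>h r\<bar> <= B" by blast
  have qh: "(%r. q r * h r) \<in> borel_measurable borel" using qm h by simp
  show "(LINT x|?L. p x * h (norm x)) = sphere_area TYPE('a) * (LINT r|rmeas (DIM('a) - 1). q r * h r)"
   using avg[OF h(1) B] radial_integral_borel(2)[OF qh, where 'a='a] rmeas_integral[OF bm[OF qh]] by simp
 qed
qed

subsection \<open>Radial Sobolev functions\<close>

text \<open>Vanishing up to some positive radius is what makes \<open>kap (norm x)\<close> and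
  \<open>kap r / r ^ m\<close> smooth in spite of the singularity of \<open>norm\<close> and of the
  quotient at the origin.\<close>

definition flat_at_0 :: "(real => real) => bool" where
 "flat_at_0 kap \<longleftrightarrow> smooth kap & (\<exists>a>0. \<forall>r\<le>a. kap r = 0)"

lemma flat_at_0_deriv:
 assumes "flat_at_0 kap" shows "flat_at_0 (partial 1 kap)"
proof -
 obtain a where a: "a > 0" "!!r. r <= a ==> kap r = 0" using assms unfolding flat_at_0_def by blast
 have "partial 1 kap r = 0" if "r <= a/2" for r
 proof (rule partial_real_eq)
  have "((%r. 0) has_real_derivative 0) (at r)" by simp
  then show "(kap has_real_derivative 0) (at r)"
   by (rule has_field_derivative_transform_within_open[of _ _ _ "{..<a}"]) (use a that in auto)
 qed
 moreover have "smooth (partial 1 kap)" using assms unfolding flat_at_0_def by (intro smooth_partial) auto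
 ultimately show ?thesis using a(1) unfolding flat_at_0_def by (metis half_gt_zero)
qed

lemma flat_at_0_cmult: "flat_at_0 kap ==> flat_at_0 (%r. c * kap r)"
 unfolding flat_at_0_def using smooth_cmult[of kap c] by auto

lemma flat_at_0_div_power:
 assumes "flat_at_0 kap"
 shows "flat_at_0 (%r. kap r / r ^ m)"
  "partial 1 (%r. kap r / r ^ m) r = partial 1 kap r / r ^ m - real m * kap r / r ^ (m + 1)"
proof -
 define S where "S = {(%r. kap r / r ^ m) |kap m. flat_at_0 kap}"
 have d: "((%r. kap r / r ^ m) has_real_derivative (partial 1 kap r / r ^ m + (- real m * kap r) / r ^ (m + 1))) (at r)"
  if K: "flat_at_0 kap" for kap m r
 proof (cases "r = 0")
  case False
  have "(kap has_real_derivative partial 1 kap r) (at r)"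
   using K unfolding flat_at_0_def by (intro smooth_real_deriv) auto
  then have "((%r. kap r / r ^ m) has_real_derivative ((partial 1 kap r * r ^ m - kap r * (real m * r ^ (m - 1))) / (r ^ m * r ^ m))) (at r)"
   using False by (auto intro!: derivative_eq_intros)
  moreover have "(partial 1 kap r * r ^ m - kap r * (real m * r ^ (m - 1))) / (r ^ m * r ^ m) = partial 1 kap r / r ^ m + (- real m * kap r) / r ^ (m + 1)"
   using False by (cases m) (simp_all add: field_simps)
  ultimately show ?thesis by simp
 next
  case True
  obtain a where a: "a > 0" "!!r. r <= a ==> kap r = 0" using K unfolding flat_at_0_def by blast
  obtain a' where a': "a' > 0" "!!r. r <= a' ==> partial 1 kap r = 0" using flat_at_0_deriv[OF K] unfolding flat_at_0_def by blast
  have "((%r. 0) has_real_derivative 0) (at r)" by simp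
  then have "((%r. kap r / r ^ m) has_real_derivative 0) (at r)"
   by (rule has_field_derivative_transform_within_open[of _ _ _ "{..<a}"]) (use a True in auto)
  then show ?thesis using True a a' by simp
 qed
 have S: "smooth f" if "f \<in> S" for f
 proof (rule smooth_function_algebra[of S])
  show "f \<in> function_algebra S" using that by (rule function_algebra.base)
  fix f assume "f \<in> S"
  then obtain kap m where f: "f = (%r. kap r / r ^ m)" and K: "flat_at_0 kap" unfolding S_def by blast
  have "partial 1 f = (%r. partial 1 kap r / r ^ m + (- real m * kap r) / r ^ (m + 1))"
   unfolding f by (rule ext) (rule partial_real_eq[OF d[OF K]])
  moreover have "(%r. kap' r / r ^ m') \<in> S" if "flat_at_0 kap'" for kap' m' unfolding S_def using that by blast
  note this[OF flat_at_0_deriv[OF K], of m] this[OF flat_at_0_cmult[OF K, of "- real m"], of "m + 1"]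
  ultimately have "partial 1 f \<in> function_algebra S"
   by (simp only:) (intro function_algebra.add function_algebra.base)
  moreover have "f differentiable (at x)" for x
   unfolding f using d[OF K] by (meson differentiable_def has_field_derivative_imp_has_derivative)
  ultimately show "(\<forall>x. f differentiable (at x)) & (\<forall>b\<in>Basis. partial b f \<in> function_algebra S)" by simp
 qed
 obtain a where a: "a > 0" "!!r. r <= a ==> kap r = 0" using assms unfolding flat_at_0_def by blast
 have "smooth (%r. kap r / r ^ m)" by (rule S) (use assms in \<open>auto simp: S_def\<close>)
 then show "flat_at_0 (%r. kap r / r ^ m)" unfolding flat_at_0_def using a by auto
 show "partial 1 (%r. kap r / r ^ m) r = partial 1 kap r / r ^ m - real m * kap r / r ^ (m + 1)"
  using partial_real_eq[OF d[OF assms]] by simp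
qed

lemma radial_flat_derivative:
 fixes x :: "'a::euclidean_space"
 assumes K: "flat_at_0 kap"
 shows "((%x. kap (norm x)) has_derivative (%h. partial 1 kap (norm x) / norm x * (x \<bullet> h))) (at x)"
proof (cases "x = 0")
 case False
 have "(kap has_real_derivative partial 1 kap (norm x)) (at (norm x))"
  using K unfolding flat_at_0_def by (intro smooth_real_deriv) auto
 moreover have "(norm has_derivative (%h. inner (sgn x) h)) (at x)"
  using has_derivative_norm[OF False] unfolding inner_commute[of "sgn x"] .
 ultimately have "((%x. kap (norm x)) has_derivative (%h. inner (sgn x) h * partial 1 kap (norm x))) (at x)"
  by (rule DERIV_compose_FDERIV)
 moreover have "(%h. inner (sgn x) h * partial 1 kap (norm x)) = (%h. partial 1 kap (norm x) / norm x * (x \<bullet> h))"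
  by (rule ext) (simp add: sgn_div_norm divide_inverse)
 ultimately show ?thesis by simp
next
 case True
 obtain a where a: "a > 0" "!!r. r <= a ==> kap r = 0" using K unfolding flat_at_0_def by blast
 have "((%x. 0) has_derivative (%h. 0)) (at x)" by simp
 then have "((%x. kap (norm x)) has_derivative (%h. 0)) (at x)"
  by (rule has_derivative_transform_within_open[of _ _ _ _ "ball 0 a"]) (use a True in auto)
 then show ?thesis using True by simp
qed

text \<open>A partial derivative is the product of \<open>partial 1 kap r / r\<close>, which is
  again flat and radial, with the linear function \<open>x \<bullet> b\<close>. Hence the algebra
  generated by flat radial and by smooth functions is invariant.\<close>

lemma smooth_radial_flat:
 assumes "flat_at_0 kap"
 shows "smooth (%x::'a::euclidean_space. kap (norm x))"
proof -
 define B where "B = {(%x::'a. kap (norm x)) |kap. flat_at_0 kap} \<union> {f. smooth f}"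
 have B1: "(%x. kap' (norm x)) \<in> B" if "flat_at_0 kap'" for kap' unfolding B_def using that by blast
 have B2: "f \<in> B" if "smooth f" for f unfolding B_def using that by simp
 show ?thesis
 proof (rule smooth_function_algebra[of B])
  show "(%x::'a. kap (norm x)) \<in> function_algebra B"
   by (rule function_algebra.base[OF B1[OF assms]])
  fix f assume "f \<in> B"
  then consider kap where "f = (%x. kap (norm x))" "flat_at_0 kap" | "smooth f" unfolding B_def by blast
  then show "(\<forall>x. f differentiable (at x)) & (\<forall>b\<in>Basis. partial b f \<in> function_algebra B)"
  proof cases
   case 1
   note d = radial_flat_derivative[OF 1(2)]
   have "partial b f \<in> function_algebra B" for b
   proof -
    have "partial b f = (%x. (partial 1 kap (norm x) / norm x ^ 1) * (x \<bullet> b))"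
     unfolding 1(1) by (rule ext) (simp add: partial_eq[OF d])
    moreover have "(%x. partial 1 kap (norm x) / norm x ^ 1) \<in> B"
     by (rule B1[OF flat_at_0_div_power(1)[OF flat_at_0_deriv[OF 1(2)], of 1]])
    moreover have "(%x. x \<bullet> b) \<in> B" by (rule B2[OF smooth_inner])
    ultimately show ?thesis by (simp only:) (intro function_algebra.mult function_algebra.base)
   qed
   then show ?thesis unfolding 1(1) using d differentiable_def by blast
  next
   case 2
   have "partial b f \<in> function_algebra B" if "b \<in> Basis" for b
    by (rule function_algebra.base[OF B2[OF smooth_partial[OF 2 that]]])
   then show ?thesis using smooth_differentiable[OF 2] by blast
  qed
 qed
qed

lemma test_function_flat:
 assumes "test_function {0<..<1} \<eta>" shows "flat_at_0 \<eta>"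
proof -
 obtain a b where "0 < a" "!!x. x <= a \<or> b <= x ==> \<eta> x = 0 & partial 1 \<eta> x = 0"
  using test_function_unit_interval_support[OF assms] by blast
 then show ?thesis unfolding flat_at_0_def using test_function_smooth[OF assms] by blast
qed

lemma test_function_radial:
 fixes \<sigma> :: "'a::euclidean_space => real"
 assumes \<eta>: "test_function {0<..<1} \<eta>" and \<sigma>: "smooth \<sigma>"
 shows "test_function unit_ball (%x::'a. \<sigma> x * (\<eta> (norm x) / norm x ^ m))"
proof -
 obtain a b where ab: "0 < a" "a < b" "b < 1" "!!x. x <= a \<or> b <= x ==> \<eta> x = 0 & partial 1 \<eta> x = 0"
  using test_function_unit_interval_support[OF \<eta>] by blast
 show ?thesis
 proof (rule test_functionI[of _ "cball 0 b"])
  show "smooth (%x::'a. \<sigma> x * (\<eta> (norm x) / norm x ^ m))"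
   by (intro smooth_mult \<sigma> smooth_radial_flat[of "%r. \<eta> r / r ^ m"] flat_at_0_div_power test_function_flat \<eta>)
  show "\<sigma> x * (\<eta> (norm x) / norm x ^ m) = 0" if "x \<notin> cball 0 b" for x
  proof -
   have "b <= norm x" using that by simp
   then show ?thesis using ab(4)[of "norm x"] by simp
  qed
 qed (use ab in auto)
qed

lemma sum_inner_Basis_sq: "(\<Sum>b\<in>Basis. (x \<bullet> b)^2) = (norm (x::'a::euclidean_space))^2"
 unfolding power2_norm_eq_inner using euclidean_inner[of x x] unfolding power2_eq_square by (rule sym)

lemma in_L2_sqint: "in_L2 \<Omega> f \<longleftrightarrow> sqint (lebesgue_on \<Omega>) f"
 by (simp add: in_L2_def sqint_def)

lemma test_div_power_bounded:
 assumes "test_function {0<..<1} \<eta>"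
 shows "(%r. \<eta> r / r ^ m) \<in> borel_measurable borel" "\<exists>B. \<forall>r. \<bar>\<eta> r / r ^ m\<bar> <= B"
proof -
 show "(%r. \<eta> r / r ^ m) \<in> borel_measurable borel"
  using smooth_borel[OF test_function_smooth[OF assms]] by simp
 obtain a b where ab: "0 < a" "!!x. x <= a \<or> b <= x ==> \<eta> x = 0 & partial 1 \<eta> x = 0"
  using test_function_unit_interval_support[OF assms] by blast
 obtain B where B: "!!x. \<bar>\<eta> x\<bar> <= B" "B >= 0" using test_function_bounded[OF assms] by metis
 have "\<bar>\<eta> r / r ^ m\<bar> <= B / a ^ m" for r
 proof (cases "r <= a")
  case True then show ?thesis using ab B by simp
 next
  case False
  then have "a ^ m <= r ^ m" "0 < a ^ m" using ab(1) by (auto intro: power_mono)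
  then have "\<bar>\<eta> r\<bar> / r ^ m <= B / a ^ m" using B by (intro frac_le) auto
  moreover have "0 < r" using False ab(1) by simp
  ultimately show ?thesis by simp
 qed
 then show "\<exists>B. \<forall>r. \<bar>\<eta> r / r ^ m\<bar> <= B" by blast
qed

lemma borel_imp_rmeas:
 fixes f :: "real => real"
 shows "f \<in> borel_measurable borel ==> f \<in> borel_measurable (rmeas N)"
 unfolding borel_measurable_rmeas by (intro measurable_restrict_space1 measurable_completion) simp

text \<open>The weak gradient of a radial function is not known in advance to point in the radial
  direction. \<open>q\<close> is the spherical mean of its radial component and \<open>l\<close>
  that of the sum of the \<open>k b\<close>. Testing with a radial vector field gives
  \<open>\<phi>' = q\<close>; testing with \<open>\<eta> (norm x)\<close> gives the Laplacian in the
  divergence form \<open>(r ^ N * q)' = r ^ N * l\<close>, which avoids the singular quotient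
  \<open>q / r\<close>.\<close>

lemma radial_weak_derivatives:
 fixes g :: "'a::euclidean_space => 'a => real"
 assumes f: "sqint (lebesgue_on unit_ball) (radial \<phi> :: 'a => real)"
  and g: "!!b. b \<in> Basis ==> has_weak_partial unit_ball b (radial \<phi>) (g b)"
   "!!b. b \<in> Basis ==> sqint (lebesgue_on unit_ball) (g b)"
 shows "\<exists>q. sqint (rmeas (DIM('a) - 1)) q & has_weak_partial {0<..<1} 1 \<phi> q \<and>
   sphere_area TYPE('a) * (LINT r|rmeas (DIM('a) - 1). (q r)^2) <= (\<Sum>b\<in>Basis. LINT x|lebesgue_on unit_ball. (g b x)^2) \<and>
   (\<forall>k. (\<forall>b\<in>Basis. has_weak_partial unit_ball b (g b) (k b) & sqint (lebesgue_on unit_ball) (k b)) -->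
    (\<exists>l. sqint (rmeas (DIM('a) - 1)) l \<and>
     has_weak_partial {0<..<1} 1 (%r. r ^ (DIM('a) - 1) * q r) (%r. r ^ (DIM('a) - 1) * l r) \<and>
     sphere_area TYPE('a) * (LINT r|rmeas (DIM('a) - 1). (l r)^2) \<le>
      (LINT x|lebesgue_on unit_ball. (\<Sum>b\<in>Basis. k b x)^2)))"
proof -
 let ?N = "DIM('a) - 1" and ?L = "lebesgue_on (unit_ball :: 'a set)" and ?c = "sphere_area TYPE('a)"
 have c0: "?c ~= 0" using sphere_area_pos[where 'a='a] by simp
 have N1: "Suc ?N = DIM('a)" by (simp add: Suc_leI)
 have pw: "s ^ DIM('a) = s * s ^ ?N" for s :: real
  using power_Suc[of s ?N] unfolding N1 .
 define p where "p x = (\<Sum>b\<in>Basis. (x \<bullet> b / norm x) * g b x)" for x :: 'a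
 have nm: "norm \<in> borel_measurable ?L" by (intro measurable_restrict_space1 measurable_completion) simp
 have p: "sqint ?L p"
  unfolding p_def
 proof (rule sqint_sum, rule sqint_bounded_mult[where B=1])
  fix b :: 'a assume b: "b \<in> Basis"
  show "sqint ?L (g b)" by (rule g(2)[OF b])
  show "(%x. x \<bullet> b / norm x) \<in> borel_measurable ?L"
   by (intro measurable_restrict_space1 measurable_completion) simp
  show "\<bar>x \<bullet> b / norm x\<bar> <= 1" for x
   using Basis_le_norm[OF b, of x] by (simp add: divide_le_eq)
 qed
 have p_le: "(LINT x|?L. (p x)^2) <= (\<Sum>b\<in>Basis. LINT x|?L. (g b x)^2)"
 proof -
  have "(LINT x|?L. (p x)^2) <= (LINT x|?L. (\<Sum>b\<in>Basis. (g b x)^2))"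
  proof (rule integral_mono)
   show "integrable ?L (%x. (p x)^2)" using p by (rule sqintD)
   show "integrable ?L (%x. \<Sum>b\<in>Basis. (g b x)^2)" using g(2) sqintD(2) by (intro Bochner_Integration.integrable_sum) blast
   fix x :: 'a
   have "(p x)^2 <= (\<Sum>b\<in>Basis. (x \<bullet> b / norm x)^2) * (\<Sum>b\<in>Basis. (g b x)^2)"
    unfolding p_def by (rule Cauchy_Schwarz_ineq_sum)
   also have "(\<Sum>b\<in>Basis. (x \<bullet> b / norm x)^2) <= 1"
    by (cases "x = 0") (simp_all add: power_divide sum_divide_distrib[symmetric] sum_inner_Basis_sq)
   then have "(\<Sum>b\<in>Basis. (x \<bullet> b / norm x)^2) * (\<Sum>b\<in>Basis. (g b x)^2) <= 1 * (\<Sum>b\<in>Basis. (g b x)^2)"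
    by (intro mult_right_mono sum_nonneg) auto
   finally show "(p x)^2 <= (\<Sum>b\<in>Basis. (g b x)^2)" by simp
  qed
  also have "\<dots> = (\<Sum>b\<in>Basis. LINT x|?L. (g b x)^2)"
   using g(2) sqintD(2) by (intro Bochner_Integration.integral_sum) blast
  finally show ?thesis .
 qed
 obtain q where q: "q \<in> borel_measurable borel" "sqint (rmeas ?N) q"
   "?c * (LINT r|rmeas ?N. (q r)^2) <= (LINT x|?L. (p x)^2)"
  and qavg: "\<forall>h \<in> borel_measurable borel. (\<exists>B. \<forall>r. \<bar>h r\<bar> <= B) --> (LINT x|?L. p x * h (norm x)) = ?c * (LINT r|rmeas ?N. q r * h r)"
  using radial_average[OF p] by blast
 have \<phi>m: "\<phi> \<in> borel_measurable (lebesgue_on {0<..<1})"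
  using sqintD(1)[OF f] unfolding radial_def by (rule borel_measurable_radialD)
 have \<phi>2: "sqint (rmeas ?N) \<phi>"
  unfolding sqint_def borel_measurable_rmeas
 proof (intro conjI \<phi>m)
  have m2: "(%r. (\<phi> r)^2) \<in> borel_measurable (lebesgue_on {0<..<1})" using \<phi>m by simp
  then show "integrable (rmeas ?N) (%r. (\<phi> r)^2)"
   using radial_integral(2)[OF m2, where 'a='a] sqintD(2)[OF f] unfolding radial_def
   by (subst rmeas_integrable) (auto simp: borel_measurable_rmeas)
 qed
 have pL: "?c * (LINT r|lebesgue_on {0<..<1}. u r) = ?c * (LINT r|lebesgue_on {0<..<1}. v r)"
  if "!!r. 0 < r ==> r < 1 ==> u r = v r" for u v :: "real => real"
  by (rule arg_cong[where f="%z. ?c * z"], rule Bochner_Integration.integral_cong) (use that in auto)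
 have weak1: "has_weak_partial {0<..<1} 1 \<phi> q"
  unfolding has_weak_partial_def
 proof (intro conjI allI impI)
  show "locally_integrable {0<..<1} \<phi>" "locally_integrable {0<..<1} q"
   using sqint_rmeas_locally_integrable(1) \<phi>2 q(2) by blast+
  fix \<eta> :: "real => real" assume \<eta>: "test_function {0<..<1} \<eta>"
  have fl: "flat_at_0 \<eta>" by (rule test_function_flat[OF \<eta>])
  define kap where "kap r = \<eta> r / r ^ DIM('a)" for r
  have k: "flat_at_0 kap" unfolding kap_def by (rule flat_at_0_div_power(1)[OF fl])
  have k': "partial 1 kap r = partial 1 \<eta> r / r ^ DIM('a) - real DIM('a) * \<eta> r / r ^ (DIM('a) + 1)" for r
   unfolding kap_def by (rule flat_at_0_div_power(2)[OF fl])
  \<comment> \<open>Components of a field along \<open>x / norm x ^ DIM('a)\<close>. That field is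
    divergence free away from the origin, so the divergence only sees the derivative of
    \<open>\<eta>\<close>.\<close>
  define \<Phi> where "\<Phi> b x = (x \<bullet> b) * (\<eta> (norm x) / norm x ^ DIM('a))" for b x :: 'a
  have \<Phi>: "test_function unit_ball (\<Phi> b)" for b
   unfolding \<Phi>_def by (rule test_function_radial[OF \<eta> smooth_inner])
  have d\<Phi>: "partial b (\<Phi> b) x = (x \<bullet> b)^2 * (partial 1 kap (norm x) / norm x) + kap (norm x)" if b: "b \<in> Basis" for b x
  proof -
   have "((%x. (x \<bullet> b) * kap (norm x)) has_derivative
     (%h. (x \<bullet> b) * (partial 1 kap (norm x) / norm x * (x \<bullet> h)) + (h \<bullet> b) * kap (norm x))) (at x)"
    by (rule has_derivative_mult[OF _ radial_flat_derivative[OF k]]) (auto intro!: derivative_eq_intros)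
   then have "(\<Phi> b has_derivative
     (%h. (x \<bullet> b) * (partial 1 kap (norm x) / norm x * (x \<bullet> h)) + (h \<bullet> b) * kap (norm x))) (at x)"
    unfolding \<Phi>_def kap_def .
   from partial_eq[OF this] b show ?thesis by (simp add: power2_eq_square algebra_simps)
  qed
  have sumd: "(\<Sum>b\<in>Basis. partial b (\<Phi> b) x) = partial 1 \<eta> (norm x) / norm x ^ ?N" for x :: 'a
  proof (cases "x = 0")
   case True
   obtain a b where "0 < a" "!!x. x <= a \<or> b <= x ==> \<eta> x = 0 & partial 1 \<eta> x = 0"
    using test_function_unit_interval_support[OF \<eta>] by blast
   then show ?thesis using True d\<Phi> by (simp add: kap_def)
  next
   case False
   then have r: "norm x > 0" by simp
   have "(\<Sum>b\<in>Basis. partial b (\<Phi> b) x) = (norm x)^2 * (partial 1 kap (norm x) / norm x) + real DIM('a) * kap (norm x)"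
   proof -
    have "(\<Sum>b\<in>Basis. partial b (\<Phi> b) x) = (\<Sum>b\<in>(Basis::'a set). (x \<bullet> b)^2 * (partial 1 kap (norm x) / norm x) + kap (norm x))"
     by (rule sum.cong) (simp_all add: d\<Phi>)
    then show ?thesis
     unfolding sum.distrib sum_distrib_right[symmetric] sum_inner_Basis_sq by simp
   qed
   also have "\<dots> = norm x * partial 1 kap (norm x) + real DIM('a) * kap (norm x)"
    using r by (simp add: power2_eq_square)
   also have "\<dots> = norm x * (partial 1 \<eta> (norm x) / norm x ^ DIM('a))"
    using r unfolding k' kap_def by (simp add: field_simps)
   also have "\<dots> = partial 1 \<eta> (norm x) / norm x ^ ?N"
    using r unfolding pw by simp
   finally show ?thesis .
  qed
  have hi: "(%r. partial 1 \<eta> r / r ^ ?N) \<in> borel_measurable borel"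
   by (rule test_div_power_bounded(1)[OF test_function_partial[OF \<eta>]]) simp
  have lp: "locally_integrable unit_ball (radial \<phi> :: 'a => real)" "!!b. b \<in> Basis ==> locally_integrable unit_ball (g b)"
   using g(1)[OF SOME_Basis] g(1) unfolding has_weak_partial_def by simp_all
  have L1: "(\<Sum>b\<in>Basis. LINT x|?L. radial \<phi> x * partial b (\<Phi> b) x) = ?c * (LINT r|lebesgue_on {0<..<1}. \<phi> r * partial 1 \<eta> r)"
  proof -
   have "(\<Sum>b\<in>Basis. LINT x|?L. radial \<phi> x * partial b (\<Phi> b) x) = (LINT x|?L. (\<Sum>b\<in>Basis. radial \<phi> x * partial b (\<Phi> b) x))"
    by (rule Bochner_Integration.integral_sum[symmetric], rule locally_integrable_times_test[OF lp(1) test_function_partial[OF \<Phi>]]) auto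
   also have "\<dots> = (LINT x|?L. (%r. \<phi> r * (partial 1 \<eta> r / r ^ ?N)) (norm x))"
    by (simp add: sum_distrib_left[symmetric] sumd radial_def)
   also have "\<dots> = ?c * (LINT r|lebesgue_on {0<..<1}. r ^ ?N * (\<phi> r * (partial 1 \<eta> r / r ^ ?N)))"
   proof (rule radial_integral(3))
    have "(%r. partial 1 \<eta> r / r ^ ?N) \<in> borel_measurable (lebesgue_on {0<..<1})"
     using hi by (intro measurable_restrict_space1 measurable_completion) simp
    with \<phi>m show "(%r. \<phi> r * (partial 1 \<eta> r / r ^ ?N)) \<in> borel_measurable (lebesgue_on {0<..<1})"
     by (rule borel_measurable_times)
   qed
   also have "\<dots> = ?c * (LINT r|lebesgue_on {0<..<1}. \<phi> r * partial 1 \<eta> r)"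
    by (rule pL) simp
   finally show ?thesis .
  qed
  have L2: "(\<Sum>b\<in>Basis. LINT x|?L. g b x * \<Phi> b x) = ?c * (LINT r|lebesgue_on {0<..<1}. q r * \<eta> r)"
  proof -
   have "(\<Sum>b\<in>Basis. LINT x|?L. g b x * \<Phi> b x) = (LINT x|?L. (\<Sum>b\<in>Basis. g b x * \<Phi> b x))"
    by (rule Bochner_Integration.integral_sum[symmetric], rule locally_integrable_times_test[OF lp(2) \<Phi>]) auto
   also have "\<dots> = (LINT x|?L. p x * (%r. \<eta> r / r ^ ?N) (norm x))"
   proof (rule Bochner_Integration.integral_cong)
    fix x :: 'a
    have "g b x * \<Phi> b x = (x \<bullet> b / norm x) * g b x * (\<eta> (norm x) / norm x ^ ?N)" for b
     unfolding \<Phi>_def pw by (simp add: divide_inverse ac_simps)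
    then show "(\<Sum>b\<in>Basis. g b x * \<Phi> b x) = p x * (%r. \<eta> r / r ^ ?N) (norm x)"
     by (simp only: p_def sum_distrib_right)
   qed simp
   also have "\<dots> = ?c * (LINT r|rmeas ?N. q r * (\<eta> r / r ^ ?N))"
    by (rule mp[OF bspec[OF qavg test_div_power_bounded(1)[OF \<eta>, of ?N]] test_div_power_bounded(2)[OF \<eta>, of ?N]])
   also have "\<dots> = ?c * (LINT r|lebesgue_on {0<..<1}. r ^ ?N * (q r * (\<eta> r / r ^ ?N)))"
    by (simp only: rmeas_integral[OF borel_imp_rmeas[OF borel_measurable_times[OF q(1) test_div_power_bounded(1)[OF \<eta>, of ?N]]]])
   also have "\<dots> = ?c * (LINT r|lebesgue_on {0<..<1}. q r * \<eta> r)"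
    by (rule pL) simp
   finally show ?thesis .
  qed
  have "(\<Sum>b\<in>Basis. LINT x|?L. radial \<phi> x * partial b (\<Phi> b) x) = (\<Sum>b\<in>Basis. - (LINT x|?L. g b x * \<Phi> b x))"
   by (rule sum.cong) (use g(1) \<Phi> in \<open>auto simp: has_weak_partial_def\<close>)
  then have "?c * (LINT r|lebesgue_on {0<..<1}. \<phi> r * partial 1 \<eta> r) = ?c * - (LINT r|lebesgue_on {0<..<1}. q r * \<eta> r)"
   using L1 L2 by (simp add: sum_negf)
  then show "(LINT r|lebesgue_on {0<..<1}. \<phi> r * partial 1 \<eta> r) = - (LINT r|lebesgue_on {0<..<1}. q r * \<eta> r)"
   unfolding mult_left_cancel[OF c0] .
 qed
 have weak2: "\<exists>l. sqint (rmeas ?N) l \<and>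
     has_weak_partial {0<..<1} 1 (%r. r ^ ?N * q r) (%r. r ^ ?N * l r) \<and>
     ?c * (LINT r|rmeas ?N. (l r)^2) <= (LINT x|?L. (\<Sum>b\<in>Basis. k b x)^2)"
  if k: "\<forall>b\<in>Basis. has_weak_partial unit_ball b (g b) (k b) & sqint ?L (k b)" for k
 proof -
  have ks: "sqint ?L (%x. \<Sum>b\<in>Basis. k b x)" by (rule sqint_sum) (use k in blast)
  obtain l where l: "l \<in> borel_measurable borel" "sqint (rmeas ?N) l"
    "?c * (LINT r|rmeas ?N. (l r)^2) <= (LINT x|?L. (\<Sum>b\<in>Basis. k b x)^2)"
   and lavg: "\<forall>h \<in> borel_measurable borel. (\<exists>B. \<forall>r. \<bar>h r\<bar> <= B) -->
     (LINT x|?L. (\<Sum>b\<in>Basis. k b x) * h (norm x)) = ?c * (LINT r|rmeas ?N. l r * h r)"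
   using radial_average[OF ks] by blast
  have "has_weak_partial {0<..<1} 1 (%r. r ^ ?N * q r) (%r. r ^ ?N * l r)"
   unfolding has_weak_partial_def
  proof (intro conjI allI impI)
   show "locally_integrable {0<..<1} (%r. r ^ ?N * q r)" "locally_integrable {0<..<1} (%r. r ^ ?N * l r)"
    using sqint_rmeas_locally_integrable(2) q(2) l(2) by blast+
   fix \<eta> :: "real => real" assume \<eta>: "test_function {0<..<1} \<eta>"
   have fl: "flat_at_0 \<eta>" by (rule test_function_flat[OF \<eta>])
   have \<eta>': "test_function {0<..<1} (partial 1 \<eta>)" by (rule test_function_partial[OF \<eta>]) simp
   have \<Phi>: "test_function unit_ball (%x::'a. \<eta> (norm x))"
    using test_function_radial[OF \<eta> smooth_const[of 1], of 0] by simp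
   have d\<Phi>: "partial b (%x::'a. \<eta> (norm x)) x = partial 1 \<eta> (norm x) / norm x * (x \<bullet> b)" for b x
    by (rule partial_eq[OF radial_flat_derivative[OF fl]])
   have lp: "!!b. b \<in> Basis ==> locally_integrable unit_ball (g b)" "!!b. b \<in> Basis ==> locally_integrable unit_ball (k b)"
    using k unfolding has_weak_partial_def by blast+
   have rm: "(LINT r|rmeas ?N. s r * h r) = (LINT r|lebesgue_on {0<..<1}. r ^ ?N * s r * h r)"
    if "s \<in> borel_measurable borel" "test_function {0<..<1} h" for s h :: "real => real"
    unfolding rmeas_integral[OF borel_imp_rmeas[OF borel_measurable_times[OF that(1) smooth_borel[OF test_function_smooth[OF that(2)]]]]]
    by (simp only: mult.assoc)
   have hb: "h \<in> borel_measurable borel & (\<exists>B. \<forall>r. \<bar>h r\<bar> <= B)" if "test_function {0<..<1} h" for h :: "real => real"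
    using test_div_power_bounded[OF that, of 0] by simp
   have "(\<Sum>b\<in>Basis. LINT x|?L. g b x * partial b (%x. \<eta> (norm x)) x) = (LINT x|?L. (\<Sum>b\<in>Basis. g b x * partial b (%x. \<eta> (norm x)) x))"
    by (rule Bochner_Integration.integral_sum[symmetric], rule locally_integrable_times_test[OF lp(1) test_function_partial[OF \<Phi>]]) auto
   also have "\<dots> = (LINT x|?L. p x * partial 1 \<eta> (norm x))"
   proof (rule Bochner_Integration.integral_cong)
    fix x :: 'a
    have "g b x * partial b (%x. \<eta> (norm x)) x = (x \<bullet> b / norm x) * g b x * partial 1 \<eta> (norm x)" for b
     by (simp add: d\<Phi>)
    then show "(\<Sum>b\<in>Basis. g b x * partial b (%x. \<eta> (norm x)) x) = p x * partial 1 \<eta> (norm x)"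
     by (simp only: p_def sum_distrib_right)
   qed simp
   also have "\<dots> = ?c * (LINT r|lebesgue_on {0<..<1}. r ^ ?N * q r * partial 1 \<eta> r)"
    using mp[OF bspec[OF qavg conjunct1[OF hb[OF \<eta>']]] conjunct2[OF hb[OF \<eta>']]] rm[OF q(1) \<eta>'] by simp
   finally have L1: "(\<Sum>b\<in>Basis. LINT x|?L. g b x * partial b (%x. \<eta> (norm x)) x) = \<dots>" .
   have "(\<Sum>b\<in>Basis. LINT x|?L. k b x * \<eta> (norm x)) = (LINT x|?L. (\<Sum>b\<in>Basis. k b x * \<eta> (norm x)))"
    by (rule Bochner_Integration.integral_sum[symmetric], rule locally_integrable_times_test[OF lp(2) \<Phi>]) auto
   also have "\<dots> = (LINT x|?L. (\<Sum>b\<in>Basis. k b x) * \<eta> (norm x))"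
    by (simp add: sum_distrib_right)
   also have "\<dots> = ?c * (LINT r|lebesgue_on {0<..<1}. r ^ ?N * l r * \<eta> r)"
    using mp[OF bspec[OF lavg conjunct1[OF hb[OF \<eta>]]] conjunct2[OF hb[OF \<eta>]]] rm[OF l(1) \<eta>] by simp
   finally have L2: "(\<Sum>b\<in>Basis. LINT x|?L. k b x * \<eta> (norm x)) = \<dots>" .
   have "(\<Sum>b\<in>Basis. LINT x|?L. g b x * partial b (%x. \<eta> (norm x)) x) = (\<Sum>b\<in>Basis. - (LINT x|?L. k b x * \<eta> (norm x)))"
    by (rule sum.cong) (use k \<Phi> in \<open>auto simp: has_weak_partial_def\<close>)
   then have "?c * (LINT r|lebesgue_on {0<..<1}. r ^ ?N * q r * partial 1 \<eta> r) = ?c * - (LINT r|lebesgue_on {0<..<1}. r ^ ?N * l r * \<eta> r)"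
    using L1 L2 by (simp add: sum_negf)
   then show "(LINT r|lebesgue_on {0<..<1}. r ^ ?N * q r * partial 1 \<eta> r) = - (LINT r|lebesgue_on {0<..<1}. r ^ ?N * l r * \<eta> r)"
    unfolding mult_left_cancel[OF c0] .
  qed
  then show ?thesis using l by blast
 qed
 show ?thesis using q(2,3) p_le weak1 weak2 by (intro exI[of _ q]) (auto intro: order_trans)
qed

subsection \<open>From the Sobolev formulation to one radial variable\<close>

text \<open>The solution in one space variable: \<open>p\<close> is \<open>u_r\<close>,
  \<open>l\<close> the radial Laplacian, \<open>v\<close> the version of \<open>u_t\<close> that is
  continuous in \<open>r\<close>, \<open>v'\<close> is \<open>v_r\<close>, and \<open>w\<close> is
  \<open>u_tt\<close>. Of these, \<open>p\<close>, \<open>l\<close> and \<open>v\<close> are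
  continuous in time in \<open>L2\<close>, but no time derivative of \<open>p\<close> is provided;
  this dictates how the gradient energy is differentiated later.\<close>

definition strong_solution ::
 "nat => (real => real) => real => real => (real => real) => (real => real) => (real => real => real) =>
  (real => real => real) => (real => real => real) => (real => real => real) => (real => real => real) => (real => real => real) => bool" where
 "strong_solution N F' eps \<tau> u0 u1 u p l v v' w \<longleftrightarrow>
  (\<forall>t\<ge>0. continuous_on {0..1} (%r. u r t) & u 1 t = 1 \<and>
    ac (%r. u r t) (%r. p r t) & sqint (rmeas N) (%r. p r t) & sqint (rmeas N) (%r. l r t) \<and>
    ac (%r. p r t) (%r. l r t - real N / r * p r t) \<and>
    ac (%r. r ^ N * p r t) (%r. r ^ N * l r t) \<and>
    ac (%r. v r t) (%r. v' r t) & sqint (rmeas N) (%r. v r t) & sqint (rmeas N) (%r. v' r t) \<and>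
    L2lim (rmeas N) (%s r. p r s) (%r. p r t) (at t within {0..}) \<and>
    L2lim (rmeas N) (%s r. l r s) (%r. l r t) (at t within {0..}) \<and>
    L2lim (rmeas N) (%s r. v r s) (%r. v r t) (at t within {0..}) \<and>
    L2lim (rmeas N) (%s r. (u r s - u r t) / (s - t)) (%r. v r t) (at t within {0..})) \<and>
  (\<forall>t>0. sqint (rmeas N) (%r. w r t) \<and>
    L2lim (rmeas N) (%s r. (v r s - v r t) / (s - t)) (%r. w r t) (at t within {0..}) \<and>
    (AE r in rmeas N. eps\<^sup>2 * \<tau> * w r t + v r t = l r t - F' (u r t) / eps^2)) \<and>
  (\<forall>r\<in>{0<..<1}. u r 0 = u0 r) \<and>
  (AE r in rmeas N. v r 0 = u1 r) \<and>
  (AE r in rmeas N. p r 0 = weak_deriv_r u0 r)"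

lemma in_H1_weak_partial:
 assumes "in_H1 \<Omega> f" "open \<Omega>" "b \<in> Basis"
 shows "has_weak_partial \<Omega> b f (weak_partial \<Omega> b f)" "sqint (lebesgue_on \<Omega>) (weak_partial \<Omega> b f)"
proof -
 obtain g where g: "has_weak_partial \<Omega> b f g" "sqint (lebesgue_on \<Omega>) g"
  using assms unfolding in_H1_def in_L2_sqint by blast
 show h: "has_weak_partial \<Omega> b f (weak_partial \<Omega> b f)" by (rule weak_partial_works[OF g(1)])
 show "sqint (lebesgue_on \<Omega>) (weak_partial \<Omega> b f)"
  by (rule sqint_AE[OF g(2) has_weak_partial_unique[OF g(1) h assms(2)] open_borel_lebesgue[OF assms(2)]])
qed

lemma in_H1_diff:
 assumes f: "in_H1 \<Omega> f" and g: "in_H1 \<Omega> g" and \<Omega>: "open \<Omega>"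
 shows "in_H1 \<Omega> (%x. f x - g x)"
 unfolding in_H1_def in_L2_sqint
proof (intro conjI ballI exI)
 show "sqint (lebesgue_on \<Omega>) (%x. f x - g x)"
  using f g unfolding in_H1_def in_L2_sqint by (blast intro: sqint_diff)
 fix b :: 'a assume b: "b \<in> Basis"
 note wf = in_H1_weak_partial[OF f \<Omega> b] and wg = in_H1_weak_partial[OF g \<Omega> b]
 show "has_weak_partial \<Omega> b (%x. f x - g x) (%x. weak_partial \<Omega> b f x - weak_partial \<Omega> b g x)"
  by (rule has_weak_partial_diff[OF wf(1) wg(1) \<Omega> b])
 show "sqint (lebesgue_on \<Omega>) (%x. weak_partial \<Omega> b f x - weak_partial \<Omega> b g x)"
  by (rule sqint_diff[OF wf(2) wg(2)])
qed

lemma in_H1_AE: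
 assumes f: "in_H1 \<Omega> f" and ae: "AE x in lebesgue_on \<Omega>. f x = g x" and \<Omega>: "open \<Omega>"
 shows "in_H1 \<Omega> g"
 unfolding in_H1_def in_L2_sqint
proof (intro conjI ballI exI)
 show "sqint (lebesgue_on \<Omega>) g"
  using f unfolding in_H1_def in_L2_sqint by (intro sqint_AE[OF _ ae open_borel_lebesgue[OF \<Omega>]]) blast
 fix b :: 'a assume b: "b \<in> Basis"
 show "has_weak_partial \<Omega> b g (weak_partial \<Omega> b f)"
  by (rule has_weak_partial_AE[OF in_H1_weak_partial(1)[OF f \<Omega> b] \<Omega> ae _ b]) simp
 show "sqint (lebesgue_on \<Omega>) (weak_partial \<Omega> b f)" by (rule in_H1_weak_partial(2)[OF f \<Omega> b])
qed

lemma in_H2_diff: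
 assumes f: "in_H2 \<Omega> f" and g: "in_H2 \<Omega> g" and \<Omega>: "open \<Omega>"
 shows "in_H2 \<Omega> (%x. f x - g x)"
 unfolding in_H2_def
proof (intro conjI ballI)
 have f1: "in_H1 \<Omega> f" and g1: "in_H1 \<Omega> g" using f g unfolding in_H2_def by auto
 show d: "in_H1 \<Omega> (%x. f x - g x)" by (rule in_H1_diff[OF f1 g1 \<Omega>])
 fix b :: 'a assume b: "b \<in> Basis"
 note wf = in_H1_weak_partial[OF f1 \<Omega> b] and wg = in_H1_weak_partial[OF g1 \<Omega> b]
 have "in_H1 \<Omega> (%x. weak_partial \<Omega> b f x - weak_partial \<Omega> b g x)"
  using f g b unfolding in_H2_def by (intro in_H1_diff \<Omega>) auto
 then show "in_H1 \<Omega> (weak_partial \<Omega> b (%x. f x - g x))"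
  by (rule in_H1_AE[OF _ has_weak_partial_unique[OF has_weak_partial_diff[OF wf(1) wg(1) \<Omega> b] in_H1_weak_partial(1)[OF d \<Omega> b] \<Omega>] \<Omega>])
qed

lemma L2_norm_sq: "(L2_norm \<Omega> f)^2 = (LINT x|lebesgue_on \<Omega>. (f x)^2)"
 by (simp add: L2_norm_def)

lemma H1_norm_sq: "(H1_norm \<Omega> f)^2 = (L2_norm \<Omega> f)^2 + (\<Sum>b\<in>Basis. (L2_norm \<Omega> (weak_partial \<Omega> b f))^2)"
 unfolding H1_norm_def by (intro real_sqrt_pow2 add_nonneg_nonneg sum_nonneg) auto

lemma H2_norm_sq: "(H2_norm \<Omega> f)^2 = (L2_norm \<Omega> f)^2 + (\<Sum>b\<in>Basis. (H1_norm \<Omega> (weak_partial \<Omega> b f))^2)"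
 unfolding H2_norm_def by (intro real_sqrt_pow2 add_nonneg_nonneg sum_nonneg) auto

lemma H2_norm_first: "(\<Sum>b\<in>Basis. (L2_norm \<Omega> (weak_partial \<Omega> b f))^2) <= (H2_norm \<Omega> f)^2"
proof -
 have "(\<Sum>b\<in>Basis. (L2_norm \<Omega> (weak_partial \<Omega> b f))^2) <= (\<Sum>b\<in>Basis. (H1_norm \<Omega> (weak_partial \<Omega> b f))^2)"
  by (rule sum_mono) (simp add: H1_norm_sq sum_nonneg)
 then show ?thesis unfolding H2_norm_sq by (simp add: add_increasing)
qed

lemma H2_norm_second: "(\<Sum>b\<in>Basis. (L2_norm \<Omega> (weak_partial \<Omega> b (weak_partial \<Omega> b f)))^2) <= (H2_norm \<Omega> f)^2"
proof -
 have "(L2_norm \<Omega> (weak_partial \<Omega> b (weak_partial \<Omega> b f)))^2 <= (H1_norm \<Omega> (weak_partial \<Omega> b f))^2" if "b \<in> Basis" for b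
 proof -
  have "(L2_norm \<Omega> (weak_partial \<Omega> b (weak_partial \<Omega> b f)))^2 <= (\<Sum>c\<in>Basis. (L2_norm \<Omega> (weak_partial \<Omega> c (weak_partial \<Omega> b f)))^2)"
   by (rule member_le_sum) (use that in auto)
  then show ?thesis unfolding H1_norm_sq by (simp add: add_increasing)
 qed
 then have "(\<Sum>b\<in>Basis. (L2_norm \<Omega> (weak_partial \<Omega> b (weak_partial \<Omega> b f)))^2) <= (\<Sum>b\<in>Basis. (H1_norm \<Omega> (weak_partial \<Omega> b f))^2)"
  by (rule sum_mono)
 then show ?thesis unfolding H2_norm_sq by (simp add: add_increasing)
qed

lemma sqint_radialD:
 assumes "sqint (lebesgue_on unit_ball) (radial \<phi> :: 'a::euclidean_space => real)"
 shows "sqint (rmeas (DIM('a) - 1)) \<phi>"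
  "l2norm (rmeas (DIM('a) - 1)) \<phi> = L2_norm unit_ball (radial \<phi> :: 'a => real) / sqrt (sphere_area TYPE('a))"
proof -
 have m: "\<phi> \<in> borel_measurable (lebesgue_on {0<..<1})"
  using sqintD(1)[OF assms] unfolding radial_def by (rule borel_measurable_radialD)
 have m2: "(%r. (\<phi> r)^2) \<in> borel_measurable (lebesgue_on {0<..<1})" using m by simp
 show "sqint (rmeas (DIM('a) - 1)) \<phi>"
  unfolding sqint_def borel_measurable_rmeas
  using m radial_integral(2)[OF m2, where 'a='a] sqintD(2)[OF assms] m2 unfolding radial_def
  by (subst rmeas_integrable) (auto simp: borel_measurable_rmeas)
 have "(LINT x|lebesgue_on unit_ball. (radial \<phi> (x::'a))^2) = sphere_area TYPE('a) * (LINT r|rmeas (DIM('a) - 1). (\<phi> r)^2)"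
  unfolding radial_def radial_integral(3)[OF m2, where 'a='a]
  by (subst rmeas_integral) (use m2 in \<open>auto simp: borel_measurable_rmeas\<close>)
 then show "l2norm (rmeas (DIM('a) - 1)) \<phi> = L2_norm unit_ball (radial \<phi> :: 'a => real) / sqrt (sphere_area TYPE('a))"
  using sphere_area_pos[where 'a='a] by (simp add: L2_norm_def l2norm_def real_sqrt_mult)
qed

lemma l2norm_le_if_scaled:
 assumes "c > 0" "c * (LINT x|M. (f x)^2) <= K * B^2" "0 <= B" "0 <= K"
 shows "l2norm M f <= sqrt (K / c) * B"
proof -
 have "(LINT x|M. (f x)^2) <= K / c * B^2" using assms(1,2) by (simp add: field_simps)
 also have "\<dots> = (sqrt (K / c) * B)^2" using assms by (simp add: power_mult_distrib)
 finally show ?thesis unfolding l2norm_def using assms by (intro real_le_lsqrt) auto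
qed

lemma AE_radial_power_cancel:
 assumes "AE r in lebesgue_on {0<..<1}. r ^ N * f r = r ^ N * (g r :: real)"
 shows "AE r in lebesgue_on {0<..<1}. f r = g r"
proof -
 have "AE r in lebesgue_on {0<..<1::real}. r \<in> {0<..<1}" by (rule AE_I2) simp
 with assms show ?thesis by eventually_elim auto
qed

lemma sqint_rmeas_AE:
 assumes "sqint (rmeas N) f" "AE r in lebesgue_on {0<..<1}. f r = g r"
 shows "sqint (rmeas N) g" "l2norm (rmeas N) g = l2norm (rmeas N) f"
proof -
 have fm: "f \<in> borel_measurable (rmeas N)" by (rule sqintD(1)[OF assms(1)])
 have gm: "g \<in> borel_measurable (rmeas N)"
  unfolding borel_measurable_rmeas
  by (rule borel_measurable_AE_lebesgue_on[OF _ assms(2)]) (use fm in \<open>auto simp: borel_measurable_rmeas\<close>)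
 have m2: "(%r. (f r)^2) \<in> borel_measurable (rmeas N)" "(%r. (g r)^2) \<in> borel_measurable (rmeas N)"
  using fm gm by simp_all
 have ae: "AE r in rmeas N. (f r)^2 = (g r)^2"
  unfolding AE_rmeas using assms(2) by eventually_elim simp
 show "sqint (rmeas N) g"
  using integrable_cong_AE[OF m2 ae] sqintD(2)[OF assms(1)] gm by (simp add: sqint_def)
 show "l2norm (rmeas N) g = l2norm (rmeas N) f"
  using integral_cong_AE[OF m2 ae] by (simp add: l2norm_def)
qed

text \<open>The bounds by the \<open>H2\<close> norm carry continuity in time: applied to
  differences of \<open>u\<close> at two times, they turn norm continuity into \<open>L2\<close>
  continuity of \<open>p\<close> and \<open>l\<close>. The factor \<open>real DIM('a)\<close> is
  Cauchy-Schwarz for the sum of the pure second derivatives. \<open>p\<close> is chosen as the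
  version for which \<open>r ^ N * p r\<close> is absolutely continuous.\<close>

lemma radial_H2_derivatives:
 fixes \<phi> :: "real => real"
 assumes H: "in_H2 unit_ball (radial \<phi> :: 'a::euclidean_space => real)"
 defines "N \<equiv> DIM('a) - 1"
 shows "\<exists>p l. sqint (rmeas N) p & sqint (rmeas N) l & has_weak_partial {0<..<1} 1 \<phi> p \<and>
  ac (%r. r ^ N * p r) (%r. r ^ N * l r) \<and>
  l2norm (rmeas N) p <= sqrt (1 / sphere_area TYPE('a)) * H2_norm unit_ball (radial \<phi> :: 'a => real) \<and>
  l2norm (rmeas N) l <= sqrt (real DIM('a) / sphere_area TYPE('a)) * H2_norm unit_ball (radial \<phi> :: 'a => real)"
proof -
 let ?B = "unit_ball :: 'a set" and ?c = "sphere_area TYPE('a)" and ?f = "radial \<phi> :: 'a => real"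
 have ob: "open ?B" by simp
 have H1: "in_H1 ?B ?f" "!!b. b \<in> Basis ==> in_H1 ?B (weak_partial ?B b ?f)" using H unfolding in_H2_def by auto
 have fs: "sqint (lebesgue_on ?B) ?f" using H1(1) unfolding in_H1_def in_L2_sqint by blast
 note g = in_H1_weak_partial[OF H1(1) ob]
 note k = in_H1_weak_partial[OF H1(2) ob]
 obtain q where q: "sqint (rmeas N) q" "has_weak_partial {0<..<1} 1 \<phi> q"
   "?c * (LINT r|rmeas N. (q r)^2) <= (\<Sum>b\<in>Basis. LINT x|lebesgue_on ?B. (weak_partial ?B b ?f x)^2)"
  and qk: "\<forall>k. (\<forall>b\<in>Basis. has_weak_partial ?B b (weak_partial ?B b ?f) (k b) & sqint (lebesgue_on ?B) (k b)) -->
    (\<exists>l. sqint (rmeas N) l & has_weak_partial {0<..<1} 1 (%r. r ^ N * q r) (%r. r ^ N * l r) \<and>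
     ?c * (LINT r|rmeas N. (l r)^2) <= (LINT x|lebesgue_on ?B. (\<Sum>b\<in>Basis. k b x)^2))"
  using radial_weak_derivatives[OF fs g] unfolding N_def by blast
 let ?k = "%b. weak_partial ?B b (weak_partial ?B b ?f)"
 have kk: "has_weak_partial ?B b (weak_partial ?B b ?f) (?k b) & sqint (lebesgue_on ?B) (?k b)" if "b \<in> Basis" for b
  using k[OF that that] by blast
 then obtain l where l: "sqint (rmeas N) l" "has_weak_partial {0<..<1} 1 (%r. r ^ N * q r) (%r. r ^ N * l r)"
   "?c * (LINT r|rmeas N. (l r)^2) <= (LINT x|lebesgue_on ?B. (\<Sum>b\<in>Basis. ?k b x)^2)"
  using spec[OF qk, of ?k] by blast
 obtain G where G: "ac G (%r. r ^ N * l r)" "AE r in lebesgue_on {0<..<1}. r ^ N * q r = G r"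
  using has_weak_partial_imp_ac[OF l(2)] by blast
 define p where "p r = G r / r ^ N" for r
 have pG: "r ^ N * p r = G r" if "0 < r" for r using that by (simp add: p_def)
 have "AE r in lebesgue_on {0<..<1::real}. r \<in> {0<..<1}" by (rule AE_I2) simp
 with G(2) have "AE r in lebesgue_on {0<..<1}. r ^ N * q r = r ^ N * p r"
  by eventually_elim (auto simp: pG)
 then have qp: "AE r in lebesgue_on {0<..<1}. q r = p r" by (rule AE_radial_power_cancel)
 have ps: "sqint (rmeas N) p" "l2norm (rmeas N) p = l2norm (rmeas N) q" by (rule sqint_rmeas_AE[OF q(1) qp])+
 have "has_weak_partial {0<..<1} 1 \<phi> p"
  by (rule has_weak_partial_AE[OF q(2) _ _ qp]) auto
 moreover have "ac (%r. r ^ N * p r) (%r. r ^ N * l r)"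
  by (rule ac_cong_AE[OF G(1)]) (auto simp: pG)
 moreover have n0: "0 <= H2_norm ?B ?f" unfolding H2_norm_def by (intro real_sqrt_ge_zero add_nonneg_nonneg sum_nonneg) auto
 moreover have "l2norm (rmeas N) p <= sqrt (1 / ?c) * H2_norm ?B ?f"
  unfolding ps(2)
 proof (rule l2norm_le_if_scaled[OF sphere_area_pos])
  show "?c * (LINT r|rmeas N. (q r)^2) <= 1 * (H2_norm ?B ?f)^2"
   using q(3) H2_norm_first[of ?B ?f] unfolding L2_norm_sq by simp
 qed (use n0 in auto)
 moreover have "l2norm (rmeas N) l <= sqrt (real DIM('a) / ?c) * H2_norm ?B ?f"
 proof (rule l2norm_le_if_scaled[OF sphere_area_pos])
  have "(LINT x|lebesgue_on ?B. (\<Sum>b\<in>Basis. ?k b x)^2) <= (LINT x|lebesgue_on ?B. real DIM('a) * (\<Sum>b\<in>Basis. (?k b x)^2))"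
  proof (rule integral_mono)
   show "integrable (lebesgue_on ?B) (%x. (\<Sum>b\<in>Basis. ?k b x)^2)"
    by (rule sqintD(2)[OF sqint_sum]) (use kk in blast)
   show "integrable (lebesgue_on ?B) (%x. real DIM('a) * (\<Sum>b\<in>Basis. (?k b x)^2))"
    by (intro integrable_mult_right Bochner_Integration.integrable_sum sqintD(2)) (use kk in blast)
   fix x
   have "(\<Sum>b\<in>Basis. 1 * ?k b x)^2 <= (\<Sum>b\<in>(Basis::'a set). 1\<^sup>2) * (\<Sum>b\<in>Basis. (?k b x)^2)"
    by (rule Cauchy_Schwarz_ineq_sum)
   then show "(\<Sum>b\<in>Basis. ?k b x)^2 <= real DIM('a) * (\<Sum>b\<in>Basis. (?k b x)^2)" by simp
  qed
  also have "\<dots> = real DIM('a) * (\<Sum>b\<in>Basis. LINT x|lebesgue_on ?B. (?k b x)^2)"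
   by (subst integral_mult_right_zero, subst Bochner_Integration.integral_sum) (use kk sqintD(2) in blast)+
  also have "\<dots> <= real DIM('a) * (H2_norm ?B ?f)^2"
   using H2_norm_second[of ?B ?f] unfolding L2_norm_sq by (intro mult_left_mono) auto
  finally show "?c * (LINT r|rmeas N. (l r)^2) <= real DIM('a) * (H2_norm ?B ?f)^2" using l(3) by linarith
 qed (use n0 in auto)
 ultimately show ?thesis using ps(1) l(1) by blast
qed

lemma radial_H1_derivative:
 fixes \<phi> :: "real => real"
 assumes H: "in_H1 unit_ball (radial \<phi> :: 'a::euclidean_space => real)"
 shows "\<exists>f f'. ac f f' & (AE r in lebesgue_on {0<..<1}. \<phi> r = f r) & sqint (rmeas (DIM('a) - 1)) f'"
proof -
 let ?B = "unit_ball :: 'a set" and ?f = "radial \<phi> :: 'a => real"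
 have ob: "open ?B" by simp
 have fs: "sqint (lebesgue_on ?B) ?f" using H unfolding in_H1_def in_L2_sqint by blast
 obtain q where q: "sqint (rmeas (DIM('a) - 1)) q" "has_weak_partial {0<..<1} 1 \<phi> q"
  using radial_weak_derivatives[OF fs in_H1_weak_partial[OF H ob]] by blast
 then show ?thesis using has_weak_partial_imp_ac[OF q(2)] by blast
qed

lemma ac_inverse_power: "ac (%r. inverse (r ^ N)) (%r. - real N / r * inverse (r ^ N))"
proof (rule ac_C1)
 fix x :: real assume x: "0 < x"
 have "((%r. inverse (r ^ N)) has_real_derivative - (inverse (x ^ N) * (real N * x ^ (N - 1)) * inverse (x ^ N))) (at x)"
  using x by (auto intro!: derivative_eq_intros)
 moreover have "- (inverse (x ^ N) * (real N * x ^ (N - 1)) * inverse (x ^ N)) = - real N / x * inverse (x ^ N)"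
  using x by (cases N) (auto simp: field_simps)
 ultimately show "((%r. inverse (r ^ N)) has_real_derivative - real N / x * inverse (x ^ N)) (at x)" by simp
qed (auto intro!: continuous_intros)

lemma ac_divide_power:
 assumes "ac (%r. r ^ N * p r) (%r. r ^ N * l r)"
 shows "ac p (%r. l r - real N / r * p r)"
proof (rule ac_cong_AE[OF ac_mult[OF assms ac_inverse_power[of N]]])
 show "r ^ N * p r * inverse (r ^ N) = p r" if "0 < r" "r < 1" for r :: real
  using that by (simp add: field_simps)
 show "AE r in lebesgue_on {0<..<1}. r ^ N * l r * inverse (r ^ N) + r ^ N * p r * (- real N / r * inverse (r ^ N)) = l r - real N / r * p r"
  by (rule AE_I2) (auto simp: field_simps)
qed

text \<open>Moves \<open>L2\<close> convergence from the ball to the radial measure and exchanges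
  each function for an almost everywhere equal version, as needed when \<open>u_t\<close> is
  replaced by its continuous representative.\<close>

lemma L2lim_radial:
 fixes f g :: "real => real => real"
 assumes fs: "!!s. 0 <= s ==> sqint (lebesgue_on unit_ball) (radial (f s) :: 'a::euclidean_space => real)"
  and f0: "sqint (lebesgue_on unit_ball) (radial f0 :: 'a => real)"
  and lim: "((%s. L2_norm unit_ball (%x::'a. radial (f s) x - radial f0 x)) \<longlongrightarrow> 0) (at t within {0..})"
  and ae: "!!s. 0 <= s ==> AE r in lebesgue_on {0<..<1}. f s r = g s r" "AE r in lebesgue_on {0<..<1}. f0 r = g0 r"
 shows "L2lim (rmeas (DIM('a) - 1)) g g0 (at t within {0..})"
proof (rule L2lim_le[where B="%s. L2_norm unit_ball (%x::'a. radial (f s) x - radial f0 x) / sqrt (sphere_area TYPE('a))"])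
 have ev: "eventually (%s. s \<in> {0::real..}) (at t within {0..})" by (simp add: eventually_at_filter)
 show "sqint (rmeas (DIM('a) - 1)) g0" by (rule sqint_rmeas_AE(1)[OF sqint_radialD(1)[OF f0] ae(2)])
 show "eventually (%s. sqint (rmeas (DIM('a) - 1)) (g s)) (at t within {0..})"
  using ev by eventually_elim (use sqint_rmeas_AE(1)[OF sqint_radialD(1)[OF fs] ae(1)] in auto)
 show "eventually (%s. l2norm (rmeas (DIM('a) - 1)) (%x. g s x - g0 x) \<le>
   L2_norm unit_ball (%x::'a. radial (f s) x - radial f0 x) / sqrt (sphere_area TYPE('a))) (at t within {0..})"
  using ev
 proof eventually_elim
  case (elim s)
  then have s: "0 <= s" by simp
  have rd: "radial (%r. f s r - f0 r) = (%x::'a. radial (f s) x - radial f0 x)" by (simp add: radial_def fun_eq_iff)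
  have sd: "sqint (lebesgue_on unit_ball) (radial (%r. f s r - f0 r) :: 'a => real)"
   unfolding rd by (rule sqint_diff[OF fs[OF s] f0])
  have "AE r in lebesgue_on {0<..<1}. f s r - f0 r = g s r - g0 r"
   using ae(1)[OF s] ae(2) by eventually_elim simp
  from sqint_rmeas_AE(2)[OF sqint_radialD(1)[OF sd] this] sqint_radialD(2)[OF sd]
  show ?case unfolding rd by simp
 qed
 show "((%s. L2_norm unit_ball (%x::'a. radial (f s) x - radial f0 x) / sqrt (sphere_area TYPE('a))) \<longlongrightarrow> 0) (at t within {0..})"
  using tendsto_divide[OF lim tendsto_const, of "sqrt (sphere_area TYPE('a))"] sphere_area_pos[where 'a='a] by simp
qed

lemma L2_norm_le_H1_norm: "L2_norm \<Omega> f <= H1_norm \<Omega> f"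
proof (rule power2_le_imp_le)
 show "(L2_norm \<Omega> f)^2 <= (H1_norm \<Omega> f)^2" unfolding H1_norm_sq by (simp add: sum_nonneg)
 show "0 <= H1_norm \<Omega> f" unfolding H1_norm_def by (intro real_sqrt_ge_zero add_nonneg_nonneg sum_nonneg) auto
qed

lemma damped_radial_solution_imp_strong:
 fixes u :: "real => real => real"
 assumes sol: "damped_radial_solution TYPE('n::finite) F' eps \<tau> u0 u1 u"
  and N: "N = CARD('n) - 1"
 shows "\<exists>p l v v' w. strong_solution N F' eps \<tau> u0 u1 u p l v v' w"
proof -
 let ?B = "unit_ball :: (real^'n) set"
 let ?U = "%t. radial (%r. u r t) :: real^'n => real"
 have D: "DIM(real^'n) - 1 = N" using N by simp
 have ob: "open ?B" by simp
 obtain V W where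
  U2: "\<forall>t\<ge>0. in_H2 ?B (?U t)" "norm_continuous (H2_norm ?B) ?U"
  and V1: "\<forall>t\<ge>0. in_H10 ?B (radial (%r. V r t))" "norm_continuous (H1_norm ?B) (%t. radial (%r. V r t))"
  and dU: "\<forall>t\<ge>0. has_L2_time_derivative ?B ?U (radial (%r. V r t)) t"
  and dV: "\<forall>t>0. has_L2_time_derivative ?B (%t. radial (%r. V r t)) (radial (%r. W r t)) t"
  and eq: "\<forall>t>0. AE r in lebesgue_on {0<..<1}.
      eps\<^sup>2 * \<tau> * W r t + V r t = weak_deriv_r (weak_deriv_r (%s. u s t)) r
       + (real CARD('n) - 1) / r * weak_deriv_r (%s. u s t) r - F' (u r t) / eps^2"
  and bc: "\<forall>t\<ge>0. continuous_on {0..1} (%r. u r t) & u 1 t = 1 \<and>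
      ((%r. u r t) has_real_derivative 0) (at 0 within {0..1})"
  and ic: "\<forall>r\<in>{0<..<1}. u r 0 = u0 r" "AE r in lebesgue_on {0<..<1}. V r 0 = u1 r"
  using sol unfolding damped_radial_solution_def Let_def by blast
 let ?H = "%d. H2_norm ?B (radial d :: real^'n => real)"
 let ?k1 = "sqrt (1 / sphere_area TYPE(real^'n))" and ?k2 = "sqrt (real DIM(real^'n) / sphere_area TYPE(real^'n))"
 define Q where "Q \<phi> p l \<longleftrightarrow> sqint (rmeas N) p & sqint (rmeas N) l & has_weak_partial {0<..<1} 1 \<phi> p \<and>
  ac (%r. r ^ N * p r) (%r. r ^ N * l r) & l2norm (rmeas N) p <= ?k1 * ?H \<phi> & l2norm (rmeas N) l <= ?k2 * ?H \<phi>" for \<phi> p l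
 have Q: "\<exists>p l. Q \<phi> p l" if "in_H2 ?B (radial \<phi> :: real^'n => real)" for \<phi>
  using radial_H2_derivatives[OF that] unfolding D Q_def .
 have "\<forall>t. \<exists>x. 0 <= t --> Q (%r. u r t) (fst x) (snd x)"
  using Q U2(1) by (metis fst_conv snd_conv)
 then obtain X where X: "!!t. 0 <= t ==> Q (%r. u r t) (fst (X t)) (snd (X t))"
  by (metis choice_iff)
 define p where "p r t = fst (X t) r" for r t
 define l where "l r t = snd (X t) r" for r t
 have Qt: "Q (%r. u r t) (%r. p r t) (%r. l r t)" if "0 <= t" for t
  using X[OF that] unfolding p_def l_def by simp
 have VH1: "in_H1 ?B (radial (%r. V r t) :: real^'n => real)" if "0 <= t" for t
  using V1(1) that unfolding in_H10_def by blast
 define Z where "Z \<phi> f f' \<longleftrightarrow> ac f f' & (AE r in lebesgue_on {0<..<1}. \<phi> r = f r) & sqint (rmeas N) f'" for \<phi> f f'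
 have Z: "\<exists>f f'. Z \<phi> f f'" if "in_H1 ?B (radial \<phi> :: real^'n => real)" for \<phi>
  using radial_H1_derivative[OF that] unfolding D Z_def .
 have "\<forall>t. \<exists>x. 0 <= t --> Z (%r. V r t) (fst x) (snd x)"
  using Z VH1 by (metis fst_conv snd_conv)
 then obtain Y where Y: "!!t. 0 <= t ==> Z (%r. V r t) (fst (Y t)) (snd (Y t))"
  by (metis choice_iff)
 define v where "v r t = fst (Y t) r" for r t
 define v' where "v' r t = snd (Y t) r" for r t
 have Zt: "ac (%r. v r t) (%r. v' r t)" "AE r in lebesgue_on {0<..<1}. V r t = v r t" "sqint (rmeas N) (%r. v' r t)" if "0 <= t" for t
  using Y[OF that] unfolding v_def v'_def Z_def by simp_all
 have pf: "ac (%r. u r t) (%r. p r t)" "sqint (rmeas N) (%r. p r t)" "sqint (rmeas N) (%r. l r t)"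
   "ac (%r. r ^ N * p r t) (%r. r ^ N * l r t)" "has_weak_partial {0<..<1} 1 (%r. u r t) (%r. p r t)" if t: "0 <= t" for t
 proof -
  show w: "has_weak_partial {0<..<1} 1 (%r. u r t) (%r. p r t)" using Qt[OF t] unfolding Q_def by blast
  have "continuous_on {0..1} (%r. u r t)" using bc t by blast
  then have "continuous_on {0<..<1} (%r. u r t)" by (rule continuous_on_subset) auto
  then show "ac (%r. u r t) (%r. p r t)" by (rule has_weak_partial_continuous_imp_ac[OF w])
  show "sqint (rmeas N) (%r. p r t)" "sqint (rmeas N) (%r. l r t)" "ac (%r. r ^ N * p r t) (%r. r ^ N * l r t)"
   using Qt[OF t] unfolding Q_def by blast+
 qed
 have Us: "sqint (lebesgue_on ?B) (?U t)" if "0 <= t" for t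
  using U2(1) that unfolding in_H2_def in_H1_def in_L2_sqint by blast
 have Vs: "sqint (lebesgue_on ?B) (radial (%r. V r t) :: real^'n => real)" if "0 <= t" for t
  using VH1[OF that] unfolding in_H1_def in_L2_sqint by blast
 have vs: "sqint (rmeas N) (%r. v r t)" if "0 <= t" for t
  using sqint_rmeas_AE(1)[OF sqint_radialD(1)[OF Vs[OF that]] Zt(2)[OF that]] unfolding D .
 have ev: "eventually (%s. s \<in> {0::real..}) (at t within {0..})" for t by (simp add: eventually_at_filter)
 \<comment> \<open>The derivatives were chosen separately at each time. Those of
   \<open>u s - u t\<close> are identified with the differences of the chosen ones by uniqueness of
   weak derivatives, first for \<open>p\<close>, then for \<open>r ^ N * l\<close>.\<close>
 have diff: "l2norm (rmeas N) (%r. p r s - p r t) <= ?k1 * H2_norm ?B (%x. ?U s x - ?U t x) \<and>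
   l2norm (rmeas N) (%r. l r s - l r t) <= ?k2 * H2_norm ?B (%x. ?U s x - ?U t x)" if s: "0 <= s" and t: "0 <= t" for s t
 proof -
  have rd: "radial (%r. u r s - u r t) = (%x. ?U s x - ?U t x)" by (simp add: radial_def fun_eq_iff)
  have "in_H2 ?B (radial (%r. u r s - u r t) :: real^'n => real)"
   unfolding rd using U2(1) s t by (intro in_H2_diff ob) auto
  then obtain q k where qk: "Q (%r. u r s - u r t) q k" using Q by blast
  have qk': "sqint (rmeas N) q" "sqint (rmeas N) k" "has_weak_partial {0<..<1} 1 (%r. u r s - u r t) q"
   "ac (%r. r ^ N * q r) (%r. r ^ N * k r)" using qk unfolding Q_def by blast+
  have ae: "AE r in lebesgue_on {0<..<1}. q r = p r s - p r t"
   by (rule has_weak_partial_unique[OF qk'(3) has_weak_partial_diff[OF pf(5)[OF s] pf(5)[OF t]]]) auto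
  have "has_weak_partial {0<..<1} 1 (%r. r ^ N * p r s - r ^ N * p r t) (%r. r ^ N * l r s - r ^ N * l r t)"
   by (rule has_weak_partial_diff[OF ac_has_weak_partial[OF pf(4)[OF s]] ac_has_weak_partial[OF pf(4)[OF t]]]) auto
  moreover have "has_weak_partial {0<..<1} 1 (%r. r ^ N * p r s - r ^ N * p r t) (%r. r ^ N * k r)"
  proof (rule has_weak_partial_AE[OF ac_has_weak_partial[OF qk'(4)]])
   show "AE r in lebesgue_on {0<..<1}. r ^ N * q r = r ^ N * p r s - r ^ N * p r t"
    using ae by eventually_elim (simp add: right_diff_distrib)
  qed auto
  ultimately have "AE r in lebesgue_on {0<..<1}. r ^ N * k r = r ^ N * l r s - r ^ N * l r t"
   by (intro has_weak_partial_unique) auto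
  then have "AE r in lebesgue_on {0<..<1}. r ^ N * k r = r ^ N * (l r s - l r t)"
   by eventually_elim (simp add: right_diff_distrib)
  then have ae2: "AE r in lebesgue_on {0<..<1}. k r = l r s - l r t" by (rule AE_radial_power_cancel)
  show ?thesis
   using qk sqint_rmeas_AE(2)[OF qk'(1) ae] sqint_rmeas_AE(2)[OF qk'(2) ae2] unfolding Q_def rd by simp
 qed
 have limH: "((%s. K * H2_norm ?B (%x. ?U s x - ?U t x)) \<longlongrightarrow> 0) (at t within {0..})" if "0 <= t" for t K
  using tendsto_mult_right_zero[of "%s. H2_norm ?B (%x. ?U s x - ?U t x)" _ K] U2(2) that unfolding norm_continuous_def by blast
 have Lp: "L2lim (rmeas N) (%s r. p r s) (%r. p r t) (at t within {0..})" if t: "0 <= t" for t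
 proof (rule L2lim_le[OF pf(2)[OF t] _ _ limH[OF t, of ?k1]])
  show "eventually (%s. sqint (rmeas N) (%r. p r s)) (at t within {0..})"
   using ev by eventually_elim (use pf(2) in auto)
  show "eventually (%s. l2norm (rmeas N) (%r. p r s - p r t) <= ?k1 * H2_norm ?B (%x. ?U s x - ?U t x)) (at t within {0..})"
   using ev by eventually_elim (use diff[OF _ t] in auto)
 qed
 have Ll: "L2lim (rmeas N) (%s r. l r s) (%r. l r t) (at t within {0..})" if t: "0 <= t" for t
 proof (rule L2lim_le[OF pf(3)[OF t] _ _ limH[OF t, of ?k2]])
  show "eventually (%s. sqint (rmeas N) (%r. l r s)) (at t within {0..})"
   using ev by eventually_elim (use pf(3) in auto)
  show "eventually (%s. l2norm (rmeas N) (%r. l r s - l r t) <= ?k2 * H2_norm ?B (%x. ?U s x - ?U t x)) (at t within {0..})"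
   using ev by eventually_elim (use diff[OF _ t] in auto)
 qed
 have Lv: "L2lim (rmeas N) (%s r. v r s) (%r. v r t) (at t within {0..})" if t: "0 <= t" for t
  unfolding D[symmetric]
 proof (rule L2lim_radial[where f="%s r. V r s" and ?f0.0="%r. V r t"])
  have h: "((%s. H1_norm ?B (%x. radial (%r. V r s) x - radial (%r. V r t) x)) \<longlongrightarrow> 0) (at t within {0..})"
   using V1(2) t unfolding norm_continuous_def by blast
  have e1: "eventually (%s. 0 <= L2_norm ?B (%x. radial (%r. V r s) x - radial (%r. V r t) x)) (at t within {0..})"
   by (rule always_eventually) (simp add: L2_norm_def)
  have e2: "eventually (%s. L2_norm ?B (%x. radial (%r. V r s) x - radial (%r. V r t) x) \<le>
    H1_norm ?B (%x. radial (%r. V r s) x - radial (%r. V r t) x)) (at t within {0..})"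
   by (intro always_eventually allI L2_norm_le_H1_norm)
  show "((%s. L2_norm ?B (%x. radial (%r. V r s) x - radial (%r. V r t) x)) \<longlongrightarrow> 0) (at t within {0..})"
   by (rule tendsto_sandwich[OF e1 e2 tendsto_const h])
 qed (use Vs Zt(2) t in auto)
 have Lu: "L2lim (rmeas N) (%s r. (u r s - u r t) / (s - t)) (%r. v r t) (at t within {0..})" if t: "0 <= t" for t
  unfolding D[symmetric]
 proof (rule L2lim_radial[where f="%s r. (u r s - u r t) / (s - t)" and ?f0.0="%r. V r t"])
  show "sqint (lebesgue_on ?B) (radial (%r. (u r s - u r t) / (s - t)) :: real^'n => real)" if "0 <= s" for s
   using sqint_cmult[OF sqint_diff[OF Us[OF that] Us[OF t]], of "inverse (s - t)"]
   unfolding radial_def by (simp add: divide_inverse mult.commute)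
  show "((%s. L2_norm ?B (%x. radial (%r. (u r s - u r t) / (s - t)) x - radial (%r. V r t) x)) \<longlongrightarrow> 0) (at t within {0..})"
   using dU t unfolding has_L2_time_derivative_def radial_def by blast
 qed (use Vs Zt(2) t in auto)
 have Ws: "sqint (lebesgue_on ?B) (radial (%r. W r t) :: real^'n => real)" if "0 < t" for t
  using dV that unfolding has_L2_time_derivative_def in_L2_sqint by blast
 have ws: "sqint (rmeas N) (%r. W r t)" if "0 < t" for t
  using sqint_radialD(1)[OF Ws[OF that]] unfolding D .
 have Lw: "L2lim (rmeas N) (%s r. (v r s - v r t) / (s - t)) (%r. W r t) (at t within {0..})" if t: "0 < t" for t
  unfolding D[symmetric]
 proof (rule L2lim_radial[where f="%s r. (V r s - V r t) / (s - t)" and ?f0.0="%r. W r t"])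
  have t0: "0 <= t" using t by simp
  show "sqint (lebesgue_on ?B) (radial (%r. (V r s - V r t) / (s - t)) :: real^'n => real)" if "0 <= s" for s
   using sqint_cmult[OF sqint_diff[OF Vs[OF that] Vs[OF t0]], of "inverse (s - t)"]
   unfolding radial_def by (simp add: divide_inverse mult.commute)
  show "((%s. L2_norm ?B (%x. radial (%r. (V r s - V r t) / (s - t)) x - radial (%r. W r t) x)) \<longlongrightarrow> 0) (at t within {0..})"
   using dV t unfolding has_L2_time_derivative_def radial_def by blast
  show "AE r in lebesgue_on {0<..<1}. (V r s - V r t) / (s - t) = (v r s - v r t) / (s - t)" if "0 <= s" for s
   using Zt(2)[OF that] Zt(2)[OF t0] by eventually_elim simp
 qed (use Ws t in auto)
 have acp: "ac (%r. p r t) (%r. l r t - real N / r * p r t)" if t: "0 <= t" for t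
  by (rule ac_divide_power[OF pf(4)[OF t]])
 have wd: "AE r in lebesgue_on {0<..<1}. p r t = weak_deriv_r (%s. u s t) r" if t: "0 <= t" for t
  by (rule has_weak_partial_unique[OF pf(5)[OF t] weak_partial_works[OF pf(5)[OF t]]]) simp
 have wd2: "AE r in lebesgue_on {0<..<1}. l r t - real N / r * p r t = weak_deriv_r (weak_deriv_r (%s. u s t)) r" if t: "0 <= t" for t
 proof -
  have h: "has_weak_partial {0<..<1} 1 (weak_deriv_r (%s. u s t)) (%r. l r t - real N / r * p r t)"
   by (rule has_weak_partial_AE[OF ac_has_weak_partial[OF acp[OF t]] _ wd[OF t]]) auto
  show ?thesis by (rule has_weak_partial_unique[OF h weak_partial_works[OF h]]) simp
 qed
 have N': "real N = real CARD('n) - 1" using N by (simp add: of_nat_diff Suc_leI)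
 have eq': "AE r in rmeas N. eps\<^sup>2 * \<tau> * W r t + v r t = l r t - F' (u r t) / eps^2" if t: "0 < t" for t
 proof -
  have t0: "0 <= t" using t by simp
  have e: "AE r in lebesgue_on {0<..<1}. eps\<^sup>2 * \<tau> * W r t + V r t = weak_deriv_r (weak_deriv_r (%s. u s t)) r
       + (real CARD('n) - 1) / r * weak_deriv_r (%s. u s t) r - F' (u r t) / eps^2" using eq t by blast
  show ?thesis unfolding AE_rmeas
   using e wd[OF t0] wd2[OF t0] Zt(2)[OF t0]
  proof eventually_elim
   case (elim r)
   show ?case using elim(1) unfolding elim(2)[symmetric] elim(3)[symmetric] elim(4) N' by simp
  qed
 qed
 have "AE r in rmeas N. v r 0 = u1 r"
  unfolding AE_rmeas using ic(2) Zt(2)[OF order_refl] by eventually_elim simp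
 moreover have "AE r in rmeas N. p r 0 = weak_deriv_r u0 r"
 proof -
  have h: "has_weak_partial {0<..<1} 1 u0 (%r. p r 0)"
   by (rule has_weak_partial_AE[OF pf(5)[of 0]]) (use ic(1) in \<open>auto intro!: AE_I2\<close>)
  show ?thesis unfolding AE_rmeas
   by (rule has_weak_partial_unique[OF h weak_partial_works[OF h]]) simp
 qed
 ultimately have "strong_solution N F' eps \<tau> u0 u1 u p l v v' W"
  unfolding strong_solution_def using bc pf acp Zt vs Lp Ll Lv Lu ws Lw eq' ic(1) by auto
 then show ?thesis by blast
qed

subsection \<open>Integration by parts with the radial weight\<close>

lemma ac_integral_limits:
 assumes A: "ac A \<alpha>" and i: "integrable (lebesgue_on {0<..<1}) \<alpha>"
  and l0: "(A \<longlongrightarrow> a) (at_right 0)" and l1: "(A \<longlongrightarrow> b) (at_left 1)"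
 shows "(LINT r|lebesgue_on {0<..<1}. \<alpha> r) = b - a"
proof -
 define e where "e k = inverse (real (Suc (Suc k)))" for k
 have e: "0 < e k" "e k <= 1/2" for k by (auto simp: e_def field_simps)
 have e0: "e \<longlonglongrightarrow> 0" unfolding e_def by (rule LIMSEQ_Suc[OF LIMSEQ_inverse_real_of_nat])
 have ne: "e k ~= 0" for k using e(1)[of k] by simp
 have e1: "filterlim e (at_right 0) sequentially"
  using e0 e(1) ne by (auto simp: filterlim_at)
 have e2: "filterlim (%k. 1 - e k) (at_left 1) sequentially"
  using tendsto_diff[OF tendsto_const e0, of 1] e(1) ne by (auto simp: filterlim_at)
 have sub: "{e k..1 - e k} \<subseteq> {0<..<1}" for k using e[of k] by auto
 have I: "(LINT r|lebesgue_on {0<..<1}. (if r \<in> {e k..1 - e k} then \<alpha> r else 0)) = A (1 - e k) - A (e k)" for k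
 proof -
  have ab: "0 < e k" "e k <= 1 - e k" "1 - e k < 1" using e[of k] by auto
  have "(LINT r|lebesgue_on {0<..<1}. (if r \<in> {e k..1 - e k} then \<alpha> r else 0)) = integral\<^sup>L (lebesgue_on {e k..1 - e k}) \<alpha>"
   by (rule integral_restrict[OF sub]) auto
  also have "\<dots> = integral {e k..1 - e k} \<alpha>"
   by (rule lebesgue_integral_eq_integral[OF integrable_lebesgue_on_subset[OF i sub]]) auto
  also have "\<dots> = A (1 - e k) - A (e k)" by (rule acD(2)[OF A ab])
  finally show ?thesis .
 qed
 have "(%k. LINT r|lebesgue_on {0<..<1}. (if r \<in> {e k..1 - e k} then \<alpha> r else 0)) \<longlonglongrightarrow> (LINT r|lebesgue_on {0<..<1}. \<alpha> r)"
 proof (rule integral_dominated_convergence[where w="%r. \<bar>\<alpha> r\<bar>"])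
  have am: "\<alpha> \<in> borel_measurable (lebesgue_on {0<..<1})" using i by auto
  then show "\<alpha> \<in> borel_measurable (lebesgue_on {0<..<1})" .
  have "{e k..1 - e k} \<in> sets (lebesgue_on {0<..<1})" for k
   using sub[of k] by (subst sets_restrict_space_iff) auto
  then show "(%r. if r \<in> {e k..1 - e k} then \<alpha> r else 0) \<in> borel_measurable (lebesgue_on {0<..<1})" for k
   using am by (intro measurable_If_set) auto
  show "integrable (lebesgue_on {0<..<1}) (%r. \<bar>\<alpha> r\<bar>)" using i by simp
  show "AE r in lebesgue_on {0<..<1}. (%k. if r \<in> {e k..1 - e k} then \<alpha> r else 0) \<longlonglongrightarrow> \<alpha> r"
  proof (rule AE_I2)
   fix r assume "r \<in> space (lebesgue_on {0<..<1::real})"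
   then have r: "0 < r" "r < 1" by auto
   have "eventually (%k. e k < min r (1 - r)) sequentially"
    using e0 r by (intro order_tendstoD(2)) auto
   then have "eventually (%k. \<alpha> r = (if r \<in> {e k..1 - e k} then \<alpha> r else 0)) sequentially"
    by eventually_elim auto
   with tendsto_const show "(%k. if r \<in> {e k..1 - e k} then \<alpha> r else 0) \<longlonglongrightarrow> \<alpha> r"
    by (rule Lim_transform_eventually)
  qed
 qed (auto intro!: AE_I2)
 then have "(%k. A (1 - e k) - A (e k)) \<longlonglongrightarrow> (LINT r|lebesgue_on {0<..<1}. \<alpha> r)" unfolding I .
 moreover have "(%k. A (1 - e k) - A (e k)) \<longlonglongrightarrow> b - a"
  by (intro tendsto_diff filterlim_compose[OF l1 e2] filterlim_compose[OF l0 e1])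
 ultimately show ?thesis by (rule LIMSEQ_unique)
qed

lemma rmeas_integral_by_parts:
 assumes A: "ac A (%r. r ^ N * \<alpha> r)" and i: "integrable (rmeas N) \<alpha>"
  and l0: "(A \<longlongrightarrow> 0) (at_right 0)" and l1: "(A \<longlongrightarrow> b) (at_left 1)"
 shows "(LINT r|rmeas N. \<alpha> r) = b"
proof -
 have m: "\<alpha> \<in> borel_measurable (rmeas N)" using i by auto
 show ?thesis
  unfolding rmeas_integral[OF m] using ac_integral_limits[OF A _ l0 l1] i rmeas_integrable[OF m] by simp
qed

lemma continuous_rmeas: "continuous_on {0<..<1} (h :: real => real) ==> h \<in> borel_measurable (rmeas N)"
 unfolding borel_measurable_rmeas by (rule continuous_imp_measurable_on_sets_lebesgue) auto

text \<open>Cauchy-Schwarz on a segment in the weighted measure. With \<open>c = 1\<close> it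
  controls increments of the flux \<open>r ^ N * p r\<close>; with
  \<open>c = inverse (s ^ N)\<close> it controls increments of a function whose derivative is
  weighted square integrable.\<close>

lemma rmeas_integral_segment_bound:
 assumes h: "sqint (rmeas N) h" and ab: "0 < a" "a <= b" "b < 1" and c: "continuous_on {0<..<1} c"
  and D: "!!s. a <= s ==> s <= b ==> s ^ N * (c s)^2 <= D" "0 <= D"
 shows "\<bar>integral {a..b} (%s. s ^ N * (c s * h s))\<bar> <= sqrt (D * (b - a)) * l2norm (rmeas N) h"
proof -
 let ?k = "%s. if s \<in> {a..b} then c s else 0"
 have sub: "{a..b} \<subseteq> {0<..<1}" using ab by auto
 have S: "{a..b} \<in> sets (rmeas N)" unfolding sets_rmeas using sub by (subst sets_restrict_space_iff) auto
 have km: "?k \<in> borel_measurable (rmeas N)"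
  using S continuous_rmeas[OF c] Int_absorb2[OF sub] by (intro measurable_If_set) simp_all
 obtain B where B: "!!s. s \<in> {a..b} ==> \<bar>c s\<bar> <= B"
 proof -
  have "compact (c ` {a..b})" using continuous_on_subset[OF c sub] by (intro compact_continuous_image) auto
  then have "bounded (c ` {a..b})" by (rule compact_imp_bounded)
  then obtain B0 where "\<forall>x\<in>c ` {a..b}. norm x <= B0" unfolding bounded_iff by blast
  then show ?thesis by (intro that[of B0]) auto
 qed
 have ks: "sqint (rmeas N) ?k"
 proof (rule sqint_bounded[OF finite_measure_rmeas km, of "\<bar>B\<bar>"])
  show "\<bar>?k x\<bar> <= \<bar>B\<bar>" for x using B[of x] by (cases "x \<in> {a..b}") (simp_all, linarith)
 qed
 have hm: "h \<in> borel_measurable (rmeas N)" by (rule sqintD(1)[OF h])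
 have i: "integrable (rmeas N) (%s. ?k s * h s)" by (rule sqint_times[OF ks h])
 have kh: "(%s. ?k s * h s) \<in> borel_measurable (rmeas N)" using i by auto
 have il: "integrable (lebesgue_on {0<..<1}) (%s. s ^ N * (?k s * h s))"
  using i rmeas_integrable[OF kh] by simp
 have ih: "integrable (lebesgue_on {a..b}) (%s. s ^ N * (c s * h s))"
 proof -
  have "integrable (lebesgue_on {a..b}) (%s. s ^ N * (?k s * h s))"
   by (rule integrable_lebesgue_on_subset[OF il sub]) auto
  moreover have "integrable (lebesgue_on {a..b}) (%s. s ^ N * (?k s * h s)) \<longleftrightarrow> integrable (lebesgue_on {a..b}) (%s. s ^ N * (c s * h s))"
   by (rule Bochner_Integration.integrable_cong) auto
  ultimately show ?thesis by simp
 qed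
 have "(LINT s|rmeas N. ?k s * h s) = (LINT s|lebesgue_on {0<..<1}. s ^ N * (?k s * h s))"
  by (rule rmeas_integral[OF kh])
 also have "\<dots> = (LINT s|lebesgue_on {0<..<1}. (if s \<in> {a..b} then s ^ N * (c s * h s) else 0))"
  by (rule Bochner_Integration.integral_cong) auto
 also have "\<dots> = integral\<^sup>L (lebesgue_on {a..b}) (%s. s ^ N * (c s * h s))"
  by (rule integral_restrict[OF sub]) auto
 also have "\<dots> = integral {a..b} (%s. s ^ N * (c s * h s))"
  by (rule lebesgue_integral_eq_integral[OF ih]) simp
 finally have e: "integral {a..b} (%s. s ^ N * (c s * h s)) = (LINT s|rmeas N. ?k s * h s)" by simp
 have "(LINT s|rmeas N. (?k s)^2) <= D * (b - a)"
 proof -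
  have k2: "(%s. (?k s)^2) \<in> borel_measurable (rmeas N)" using km by simp
  have "(LINT s|rmeas N. (?k s)^2) = (LINT s|lebesgue_on {0<..<1}. s ^ N * (?k s)^2)"
   by (rule rmeas_integral[OF k2])
  also have "\<dots> <= (LINT s|lebesgue_on {0<..<1}. (if s \<in> {a..b} then D else 0))"
  proof (rule integral_mono)
   show "integrable (lebesgue_on {0<..<1}) (%s. s ^ N * (?k s)^2)"
    using sqintD(2)[OF ks] rmeas_integrable[OF k2] by simp
   have "integrable (lebesgue_on {0<..<1}) (%s. indicator {a..b} s * D)"
    using S unfolding sets_rmeas
    by (intro integrable_mult_left integrable_real_indicator) 
      (auto simp: emeasure_restrict_space sub Int_absorb1 emeasure_lborel_Icc_eq)
   moreover have "(%s. indicator {a..b} s * D) = (%s. if s \<in> {a..b} then D else 0)" by auto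
   ultimately show "integrable (lebesgue_on {0<..<1}) (%s. if s \<in> {a..b} then D else 0)" by simp
   show "s ^ N * (?k s)^2 <= (if s \<in> {a..b} then D else 0)" for s using D(1)[of s] by auto
  qed
  also have "\<dots> = integral\<^sup>L (lebesgue_on {a..b}) (%s. D)"
   by (rule integral_restrict[OF sub]) auto
  also have "\<dots> = D * (b - a)" using ab by (simp add: measure_restrict_space)
  finally show ?thesis .
 qed
 then have "l2norm (rmeas N) ?k <= sqrt (D * (b - a))" unfolding l2norm_def by (rule real_sqrt_le_mono)
 then have "l2norm (rmeas N) ?k * l2norm (rmeas N) h <= sqrt (D * (b - a)) * l2norm (rmeas N) h"
  by (rule mult_right_mono) simp
 then show ?thesis unfolding e using Cauchy_Schwarz_integral[OF ks h] by linarith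
qed

text \<open>The fluxes at \<open>a\<close> and at \<open>r\<close> differ by at most the right-hand
  side. If the bound failed by a margin \<open>\<delta>\<close>, the flux would stay above
  \<open>\<delta>\<close> all the way to the origin, and
  \<open>s ^ N * (p s)^2 >= \<delta>^2 / s\<close>, which uses \<open>s ^ N <= s\<close>, would have
  a divergent integral. In particular the flux tends to zero at the origin.\<close>

lemma flux_bound:
 assumes N: "1 <= N" and p: "sqint (rmeas N) p" and l: "sqint (rmeas N) l"
  and P: "ac (%r. r ^ N * p r) (%r. r ^ N * l r)" and r: "0 < r" "r < 1"
 shows "\<bar>r ^ N * p r\<bar> <= sqrt (r ^ Suc N) * l2norm (rmeas N) l"
proof (rule ccontr)
 let ?K = "l2norm (rmeas N) l"
 assume "\<not> \<bar>r ^ N * p r\<bar> <= sqrt (r ^ Suc N) * ?K"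
 then have d: "0 < \<bar>r ^ N * p r\<bar> - sqrt (r ^ Suc N) * ?K" (is "0 < ?\<delta>") by simp
 have P\<delta>: "?\<delta> <= \<bar>a ^ N * p a\<bar>" if a: "0 < a" "a <= r" for a
 proof -
  have "\<bar>integral {a..r} (%s. s ^ N * (1 * l s))\<bar> <= sqrt (r ^ N * (r - a)) * ?K"
   by (rule rmeas_integral_segment_bound[OF l]) (use a r in \<open>auto intro: power_mono\<close>)
  also have "sqrt (r ^ N * (r - a)) * ?K <= sqrt (r ^ Suc N) * ?K"
   using a r by (intro mult_right_mono real_sqrt_le_mono) (auto simp: mult.commute intro!: mult_right_mono)
  finally have "\<bar>r ^ N * p r - a ^ N * p a\<bar> <= sqrt (r ^ Suc N) * ?K"
   using acD(2)[OF P a(1,2) r(2)] by simp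
  then show ?thesis by linarith
 qed
 have "?\<delta>\<^sup>2 * (ln r - ln a) <= (LINT s|rmeas N. (p s)^2)" if a: "0 < a" "a <= r" for a
 proof -
  have sub: "{a..r} \<subseteq> {0<..<1}" using a r by auto
  have p2: "(%s. (p s)^2) \<in> borel_measurable (rmeas N)" using sqintD(1)[OF p] by simp
  have i: "integrable (lebesgue_on {0<..<1}) (%s. s ^ N * (p s)^2)"
   using sqintD(2)[OF p] rmeas_integrable[OF p2] by simp
  have ia: "integrable (lebesgue_on {a..r}) (%s. s ^ N * (p s)^2)"
   by (rule integrable_lebesgue_on_subset[OF i sub]) auto
  have ln: "((%s. ?\<delta>\<^sup>2 * (1 / s)) has_integral (?\<delta>\<^sup>2 * ln r - ?\<delta>\<^sup>2 * ln a)) {a..r}"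
  proof (rule fundamental_theorem_of_calculus[OF a(2)])
   fix x assume "x \<in> {a..r}"
   then have "0 < x" using a by simp
   then show "((%s. ?\<delta>\<^sup>2 * ln s) has_vector_derivative ?\<delta>\<^sup>2 * (1 / x)) (at x within {a..r})"
    unfolding has_real_derivative_iff_has_vector_derivative[symmetric]
    by (auto intro!: derivative_eq_intros)
  qed
  have "?\<delta>\<^sup>2 * (ln r - ln a) = integral {a..r} (%s. ?\<delta>\<^sup>2 * (1 / s))"
   using integral_unique[OF ln] by (simp add: right_diff_distrib)
  also have "\<dots> <= integral {a..r} (%s. s ^ N * (p s)^2)"
  proof (rule integral_le)
   show "(%s. ?\<delta>\<^sup>2 * (1 / s)) integrable_on {a..r}" using ln by blast
   show "(%s. s ^ N * (p s)^2) integrable_on {a..r}" by (rule integrable_on_lebesgue_on[OF ia]) simp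
   fix s assume "s \<in> {a..r}"
   then have s: "0 < s" "s <= r" "s < 1" using a r by auto
   have sN: "0 < s ^ N" "s ^ N <= s" using s N power_decreasing[of 1 N s] by auto
   have "\<bar>?\<delta>\<bar> <= \<bar>s ^ N * p s\<bar>" using P\<delta>[OF s(1,2)] d by linarith
   then have "?\<delta>\<^sup>2 <= (s ^ N * p s)^2" by (simp only: abs_le_square_iff)
   then have "?\<delta>\<^sup>2 * (1 / s) <= (s ^ N * p s)^2 * (1 / s ^ N)"
    using s sN by (intro mult_mono) (auto simp: frac_le)
   also have "\<dots> = s ^ N * (p s)^2" using sN by (simp add: power2_eq_square field_simps)
   finally show "?\<delta>\<^sup>2 * (1 / s) <= s ^ N * (p s)^2" .
  qed
  also have "\<dots> = integral\<^sup>L (lebesgue_on {a..r}) (%s. s ^ N * (p s)^2)"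
   by (rule lebesgue_integral_eq_integral[OF ia, symmetric]) simp
  also have "\<dots> = (LINT s|lebesgue_on {0<..<1}. (if s \<in> {a..r} then s ^ N * (p s)^2 else 0))"
   by (rule integral_restrict[symmetric, OF sub]) auto
  also have "\<dots> <= (LINT s|lebesgue_on {0<..<1}. s ^ N * (p s)^2)"
  proof (rule integral_mono'[OF i])
   show "(if s \<in> {a..r} then s ^ N * (p s)^2 else 0) <= s ^ N * (p s)^2" "0 <= s ^ N * (p s)^2"
    if "s \<in> space (lebesgue_on {0<..<1})" for s using that by auto
  qed
  also have "\<dots> = (LINT s|rmeas N. (p s)^2)" by (rule rmeas_integral[OF p2, symmetric])
  finally show ?thesis .
 qed
 note bound = this
 define K where "K = (LINT s|rmeas N. (p s)^2)"
 \<comment> \<open>Chosen so that \<open>ln r - ln a\<close> is \<open>(K + 1)\<close> divided by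
   the squared margin, which makes the lower bound exceed the integral \<open>K\<close>.\<close>
 define a where "a = r * exp (- ((K + 1) / ?\<delta>\<^sup>2))"
 have K0: "0 <= K" by (simp add: K_def)
 have "0 <= (K + 1) / ?\<delta>\<^sup>2" using K0 by (intro divide_nonneg_nonneg) auto
 then have "exp (- ((K + 1) / ?\<delta>\<^sup>2)) <= 1" by simp
 then have a: "0 < a" "a <= r" using r unfolding a_def by (simp, intro mult_right_le_one_le) auto
 have "ln r - ln a = (K + 1) / ?\<delta>\<^sup>2" using r by (simp add: a_def ln_mult)
 then have "?\<delta>\<^sup>2 * (ln r - ln a) = K + 1" using d by simp
 then show False using bound[OF a] by (simp add: K_def)
qed

text \<open>\<open>v\<close> is compared with its value at the reference point \<open>1/2\<close>.
  The oscillation between two points is controlled by the weight at the smaller one, and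
  \<open>r / min r (1/2) <= 2\<close>. The bound lets boundary terms quadratic in \<open>v\<close>
  vanish wherever the weight does.\<close>

lemma trace_bound:
 assumes v: "ac v v'" and v': "sqint (rmeas N) v'" and r: "0 < r" "r < 1"
 shows "r ^ N * (v r)^2 <= 2 * (v (1/2))^2 + 2 * 2 ^ N * (l2norm (rmeas N) v')^2"
proof -
 let ?K = "l2norm (rmeas N) v'" and ?m = "min r (1/2)"
 have seg: "\<bar>v b - v a\<bar> <= sqrt (inverse (a ^ N)) * ?K" if ab: "0 < a" "a <= b" "b < 1" for a b
 proof -
  have "\<bar>integral {a..b} (%s. s ^ N * (inverse (s ^ N) * v' s))\<bar> <= sqrt (inverse (a ^ N) * (b - a)) * ?K"
  proof (rule rmeas_integral_segment_bound[OF v' ab])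
   show "continuous_on {0<..<1} (%s::real. inverse (s ^ N))" by (auto intro!: continuous_intros)
   fix s assume s: "a <= s" "s <= b"
   have "s ^ N * (inverse (s ^ N))^2 = inverse (s ^ N)" using s ab by (simp add: power2_eq_square)
   also have "\<dots> <= inverse (a ^ N)" using s ab by (intro le_imp_inverse_le power_mono) auto
   finally show "s ^ N * (inverse (s ^ N))^2 <= inverse (a ^ N)" .
  qed (use ab in auto)
  also have "\<dots> <= sqrt (inverse (a ^ N)) * ?K"
   using ab by (intro mult_right_mono real_sqrt_le_mono mult_right_le_one_le) auto
  also have "integral {a..b} (%s. s ^ N * (inverse (s ^ N) * v' s)) = integral {a..b} v'"
   by (rule Henstock_Kurzweil_Integration.integral_cong) (use ab in auto)
  finally show ?thesis using acD(2)[OF v ab] by simp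
 qed
 have m: "0 < ?m" using r by simp
 have "\<bar>v r - v (1/2)\<bar> <= sqrt (inverse (?m ^ N)) * ?K"
 proof (cases "r <= 1/2")
  case True then show ?thesis using seg[of r "1/2"] r by (simp add: min_def abs_minus_commute)
 next
  case False then show ?thesis using seg[of "1/2" r] r by (simp add: min_def)
 qed
 then have "\<bar>v r - v (1/2)\<bar> <= \<bar>sqrt (inverse (?m ^ N)) * ?K\<bar>" by (rule order_trans[OF _ abs_ge_self])
 then have "(v r - v (1/2))^2 <= (sqrt (inverse (?m ^ N)) * ?K)^2" by (simp only: abs_le_square_iff)
 also have "\<dots> = inverse (?m ^ N) * ?K\<^sup>2" using m by (simp add: power_mult_distrib)
 finally have d: "(v r - v (1/2))^2 <= inverse (?m ^ N) * ?K\<^sup>2" .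
 have "(v r)^2 <= 2 * (v (1/2))^2 + 2 * (v r - v (1/2))^2"
  using zero_le_power2[of "v r - 2 * v (1/2)"] by (simp add: power2_eq_square algebra_simps)
 then have "r ^ N * (v r)^2 <= r ^ N * (2 * (v (1/2))^2 + 2 * (inverse (?m ^ N) * ?K\<^sup>2))"
  using d r by (intro mult_left_mono) auto
 also have "\<dots> = r ^ N * (2 * (v (1/2))^2) + 2 * (r ^ N * inverse (?m ^ N)) * ?K\<^sup>2" by (simp add: algebra_simps)
 also have "\<dots> <= 1 * (2 * (v (1/2))^2) + 2 * 2 ^ N * ?K\<^sup>2"
 proof (intro add_mono mult_right_mono mult_left_mono)
  show "r ^ N <= 1" using r by (intro power_le_one) auto
  have "r ^ N * inverse (?m ^ N) = (r / ?m) ^ N" by (rule trans[OF divide_inverse[symmetric] power_divide[symmetric]])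
  also have "\<dots> <= 2 ^ N"
  proof (intro power_mono)
   show "r / ?m <= 2" using r by (cases "r <= 1/2") (simp_all add: min_def)
   show "0 <= r / ?m" using r m by simp
  qed
  finally show "r ^ N * inverse (?m ^ N) <= 2 ^ N" .
 qed auto
 finally show ?thesis by simp
qed

section \<open>Integration by parts against continuously differentiable radial weights\<close>

lemma bounded_unit_interval:
 fixes c :: "real => real"
 assumes "continuous_on {0..1} c"
 shows "\<exists>B\<ge>0. \<forall>x. 0 <= x --> x <= 1 --> \<bar>c x\<bar> <= B"
proof -
 have "bounded (c ` {0..1})" by (intro compact_imp_bounded compact_continuous_image assms) auto
 then obtain B where "\<forall>x\<in>c ` {0..1}. norm x <= B" unfolding bounded_iff by blast
 then show ?thesis by (intro exI[of _ "max B 0"]) (auto simp: le_max_iff_disj)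
qed

lemma continuous_rmeas_Icc: "continuous_on {0..1} (h :: real => real) ==> h \<in> borel_measurable (rmeas N)"
 by (rule continuous_rmeas[OF continuous_on_subset]) auto

lemma sqint_continuous_mult:
 assumes c: "continuous_on {0..1} c" and f: "sqint (rmeas N) f"
 shows "sqint (rmeas N) (%x. c x * f x)"
proof -
 obtain B where "\<forall>x. 0 <= x --> x <= 1 --> \<bar>c x\<bar> <= B" using bounded_unit_interval[OF c] by blast
 then show ?thesis by (intro sqint_bounded_mult[OF f continuous_rmeas_Icc[OF c], of B]) simp
qed

lemma sqint_continuous: "continuous_on {0..1} c ==> sqint (rmeas N) c"
proof -
 assume c: "continuous_on {0..1} c"
 obtain B where "\<forall>x. 0 <= x --> x <= 1 --> \<bar>c x\<bar> <= B" using bounded_unit_interval[OF c] by blast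
 then show ?thesis by (intro sqint_bounded[OF finite_measure_rmeas continuous_rmeas_Icc[OF c], of _ B]) simp
qed

lemma Icc_tendsto_at_right_0:
 fixes c :: "real => real"
 assumes "continuous_on {0..1} c" shows "(c \<longlongrightarrow> c 0) (at_right 0)"
proof -
 have "(c \<longlongrightarrow> c 0) (at 0 within {0..1})" using assms by (simp add: continuous_on_def)
 then show ?thesis by (simp add: at_within_Icc_at_right)
qed

lemma Icc_tendsto_at_left_1:
 fixes c :: "real => real"
 assumes "continuous_on {0..1} c" shows "(c \<longlongrightarrow> c 1) (at_left 1)"
proof -
 have "(c \<longlongrightarrow> c 1) (at 1 within {0..1})" using assms by (simp add: continuous_on_def)
 then show ?thesis by (simp add: at_within_Icc_at_left)
qed

lemma tendsto_0_at_ends: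
 fixes A :: "real => real"
 assumes "!!r. 0 < r ==> r < 1 ==> \<bar>A r\<bar> <= B * \<bar>c r\<bar>"
 shows "(c \<longlongrightarrow> 0) (at_right 0) ==> (A \<longlongrightarrow> 0) (at_right 0)"
  "(c \<longlongrightarrow> 0) (at_left 1) ==> (A \<longlongrightarrow> 0) (at_left 1)"
proof -
 have ev: "eventually (%r. r \<in> {0<..<1}) (at_right (0::real))" "eventually (%r. r \<in> {0<..<1}) (at_left (1::real))"
  using eventually_at_right_less[of "0::real"] eventually_at_rightI[of 0 1 "%r::real. r \<in> {0<..<1}"]
   eventually_at_leftI[of 0 1 "%r::real. r \<in> {0<..<1}"] by auto
 show "(A \<longlongrightarrow> 0) (at_right 0)" if "(c \<longlongrightarrow> 0) (at_right 0)"
 proof (rule Lim_null_comparison)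
  show "eventually (%r. norm (A r) <= B * \<bar>c r\<bar>) (at_right 0)"
   using ev(1) by eventually_elim (use assms in auto)
  show "((%r. B * \<bar>c r\<bar>) \<longlongrightarrow> 0) (at_right 0)"
   using tendsto_mult[OF tendsto_const[of B] tendsto_rabs[OF that]] by simp
 qed
 show "(A \<longlongrightarrow> 0) (at_left 1)" if "(c \<longlongrightarrow> 0) (at_left 1)"
 proof (rule Lim_null_comparison)
  show "eventually (%r. norm (A r) <= B * \<bar>c r\<bar>) (at_left 1)"
   using ev(2) by eventually_elim (use assms in auto)
  show "((%r. B * \<bar>c r\<bar>) \<longlongrightarrow> 0) (at_left 1)"
   using tendsto_mult[OF tendsto_const[of B] tendsto_rabs[OF that]] by simp
 qed
qed

definition C1_weight :: "(real => real) => (real => real) => bool" where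
 "C1_weight c c' \<longleftrightarrow> (\<forall>x. 0 < x --> x < 1 --> (c has_real_derivative c' x) (at x)) \<and>
   continuous_on {0..1} c & continuous_on {0..1} c'"

lemma C1_weight_ac: "C1_weight c c' ==> ac c c'"
 unfolding C1_weight_def by (intro ac_C1) (auto intro: continuous_on_subset)

text \<open>The factorisation \<open>c r = r * d r\<close> absorbs the quotient \<open>N / r\<close>
  that arises from differentiating \<open>r ^ N\<close>, so the derivative has a cofactor continuous
  up to the origin.\<close>

lemma ac_power_weight:
 assumes N: "1 <= N" and c: "C1_weight c c'" and d: "!!r. c r = r * d r"
 shows "ac (%r. r ^ N * c r) (%r. r ^ N * (c' r + real N * d r))"
proof -
 have "ac (%r. r ^ N) (%r. real N * r ^ (N - 1))"
  by (rule ac_C1) (auto intro!: derivative_eq_intros continuous_intros)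
 from ac_mult[OF this C1_weight_ac[OF c]] show ?thesis
 proof (rule ac_cong_AE)
  show "AE r in lebesgue_on {0<..<1}. real N * r ^ (N - 1) * c r + r ^ N * c' r = r ^ N * (c' r + real N * d r)"
  proof (rule AE_I2)
   fix r :: real
   have "r ^ N = r ^ (N - 1) * r" using N by (cases N) auto
   then show "real N * r ^ (N - 1) * c r + r ^ N * c' r = r ^ N * (c' r + real N * d r)"
    by (simp add: d algebra_simps)
  qed
 qed simp
qed

text \<open>The boundary terms vanish for different reasons: at \<open>0\<close> by
  \<open>flux_bound\<close>, at \<open>1\<close> because \<open>\<delta> 1 = 0\<close>. It is
  applied to difference quotients of \<open>u\<close>, which vanish at \<open>1\<close> by the
  Dirichlet condition.\<close>

lemma integral_by_parts_flux:
 assumes N: "1 <= N" and p: "sqint (rmeas N) p" and l: "sqint (rmeas N) l"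
  and P: "ac (%r. r ^ N * p r) (%r. r ^ N * l r)" and c: "C1_weight c c'"
  and \<delta>: "ac \<delta> \<delta>'" "sqint (rmeas N) \<delta>'" "continuous_on {0..1} \<delta>" "\<delta> 1 = 0"
 shows "(LINT r|rmeas N. c r * p r * \<delta>' r) = - (LINT r|rmeas N. (c r * l r + c' r * p r) * \<delta> r)"
proof -
 have cc: "continuous_on {0..1} c" "continuous_on {0..1} c'" using c unfolding C1_weight_def by auto
 let ?\<alpha> = "%r. (c r * l r + c' r * p r) * \<delta> r + c r * p r * \<delta>' r"
 have s: "sqint (rmeas N) (%r. c r * l r + c' r * p r)" "sqint (rmeas N) (%r. c r * p r)"
  by (intro sqint_add sqint_continuous_mult cc p l)+
 have i1: "integrable (rmeas N) (%r. (c r * l r + c' r * p r) * \<delta> r)"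
  by (rule sqint_times[OF s(1) sqint_continuous[OF \<delta>(3)]])
 have i2: "integrable (rmeas N) (%r. c r * p r * \<delta>' r)" by (rule sqint_times[OF s(2) \<delta>(2)])
 have A: "ac (%r. c r * ((r ^ N * p r) * \<delta> r)) (%r. r ^ N * ?\<alpha> r)"
  by (rule ac_cong_AE[OF ac_mult[OF C1_weight_ac[OF c] ac_mult[OF P \<delta>(1)]]]) (auto intro!: AE_I2 simp: algebra_simps)
 obtain Bc where Bc: "Bc >= 0" "!!x. 0 <= x ==> x <= 1 ==> \<bar>c x\<bar> <= Bc" using bounded_unit_interval[OF cc(1)] by blast
 obtain Bd where Bd: "Bd >= 0" "!!x. 0 <= x ==> x <= 1 ==> \<bar>\<delta> x\<bar> <= Bd" using bounded_unit_interval[OF \<delta>(3)] by blast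
 let ?K = "l2norm (rmeas N) l"
 note fb = flux_bound[OF N p l P]
 have "((%r. c r * ((r ^ N * p r) * \<delta> r)) \<longlongrightarrow> 0) (at_right 0)"
 proof (rule tendsto_0_at_ends(1)[of _ "Bc * ?K * Bd" "%r. sqrt (r ^ Suc N)"])
  fix r :: real assume r: "0 < r" "r < 1"
  have "\<bar>c r\<bar> * (\<bar>r ^ N * p r\<bar> * \<bar>\<delta> r\<bar>) <= Bc * ((sqrt (r ^ Suc N) * ?K) * Bd)"
   using fb[OF r] Bc(2)[of r] Bd(2)[of r] Bc(1) r by (intro mult_mono mult_nonneg_nonneg) auto
  then show "\<bar>c r * ((r ^ N * p r) * \<delta> r)\<bar> <= Bc * ?K * Bd * \<bar>sqrt (r ^ Suc N)\<bar>"
   using r by (simp add: abs_mult algebra_simps)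
 next
  have "((%r. sqrt (r ^ Suc N)) \<longlongrightarrow> sqrt (0 ^ Suc N)) (at_right 0)" by (intro tendsto_intros)
  then show "((%r. sqrt (r ^ Suc N)) \<longlongrightarrow> 0) (at_right 0)" by simp
 qed
 moreover have "((%r. c r * ((r ^ N * p r) * \<delta> r)) \<longlongrightarrow> 0) (at_left 1)"
 proof (rule tendsto_0_at_ends(2)[of _ "Bc * ?K" \<delta>])
  fix r :: real assume r: "0 < r" "r < 1"
  have "sqrt (r ^ Suc N) * ?K <= 1 * ?K"
   using r by (intro mult_right_mono) (auto intro!: power_le_one simp del: power_Suc)
  then have "\<bar>c r\<bar> * (\<bar>r ^ N * p r\<bar> * \<bar>\<delta> r\<bar>) <= Bc * (?K * \<bar>\<delta> r\<bar>)"
   using fb[OF r] Bc(2)[of r] Bc(1) r by (intro mult_mono mult_nonneg_nonneg) auto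
  then show "\<bar>c r * ((r ^ N * p r) * \<delta> r)\<bar> <= Bc * ?K * \<bar>\<delta> r\<bar>" by (simp add: abs_mult algebra_simps)
 next
  show "(\<delta> \<longlongrightarrow> 0) (at_left 1)" using Icc_tendsto_at_left_1[OF \<delta>(3)] \<delta>(4) by simp
 qed
 ultimately have "(LINT r|rmeas N. ?\<alpha> r) = 0"
  using rmeas_integral_by_parts[OF A] i1 i2 by simp
 then show ?thesis using i1 i2 by simp
qed

text \<open>\<open>c * h * h'\<close> is \<open>c\<close> times half the derivative of
  \<open>h^2\<close>. Near the end points only \<open>r ^ N * (h r)^2\<close> is bounded, so the
  weight itself has to vanish there: at \<open>0\<close> through the factor \<open>r\<close>, at
  \<open>1\<close> through \<open>d 1 = 0\<close>.\<close>

lemma integral_by_parts_quadratic: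
 assumes N: "1 <= N" and h: "ac h h'" "sqint (rmeas N) h" "!!r. 0 < r ==> r < 1 ==> r ^ N * (h r)^2 <= C"
  and c: "C1_weight c c'" "!!r. c r = r * d r" "continuous_on {0..1} d" "d 1 = 0"
  and i: "integrable (rmeas N) (%r. c r * h r * h' r)"
 shows "(LINT r|rmeas N. c r * h r * h' r) = - (LINT r|rmeas N. (c' r + real N * d r) * (h r)^2) / 2"
proof -
 have cc: "continuous_on {0..1} c" "continuous_on {0..1} c'" using c unfolding C1_weight_def by auto
 let ?\<alpha> = "%r. (c' r + real N * d r) * (h r)^2 + 2 * (c r * h r * h' r)"
 have k: "continuous_on {0..1} (%r. c' r + real N * d r)" by (intro continuous_intros cc c(3))
 have i1: "integrable (rmeas N) (%r. (c' r + real N * d r) * (h r)^2)"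
  using sqint_times[OF sqint_continuous_mult[OF k h(2)] h(2)] by (simp add: power2_eq_square mult.assoc)
 have A: "ac (%r. (r ^ N * c r) * (h r * h r)) (%r. r ^ N * ?\<alpha> r)"
  by (rule ac_cong_AE[OF ac_mult[OF ac_power_weight[OF N c(1,2)] ac_mult[OF h(1) h(1)]]])
    (auto intro!: AE_I2 simp: algebra_simps power2_eq_square)
 have b: "\<bar>(r ^ N * c r) * (h r * h r)\<bar> <= C * \<bar>c r\<bar>" if r: "0 < r" "r < 1" for r
 proof -
  have "\<bar>(r ^ N * c r) * (h r * h r)\<bar> = (r ^ N * (h r)^2) * \<bar>c r\<bar>"
   using r by (simp add: abs_mult power2_eq_square)
  also have "\<dots> <= C * \<bar>c r\<bar>" using h(3)[OF r] by (intro mult_right_mono) auto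
  finally show ?thesis .
 qed
 have "((%r. (r ^ N * c r) * (h r * h r)) \<longlongrightarrow> 0) (at_right 0)"
  by (rule tendsto_0_at_ends(1)[OF b]) (use Icc_tendsto_at_right_0[OF cc(1)] c(2)[of 0] in auto)
 moreover have "((%r. (r ^ N * c r) * (h r * h r)) \<longlongrightarrow> 0) (at_left 1)"
  by (rule tendsto_0_at_ends(2)[OF b]) (use Icc_tendsto_at_left_1[OF cc(1)] c(2)[of 1] c(4) in auto)
 ultimately have "(LINT r|rmeas N. ?\<alpha> r) = 0"
  using rmeas_integral_by_parts[OF A] i1 i by simp
 then have "(LINT r|rmeas N. (c' r + real N * d r) * (h r)^2) + 2 * (LINT r|rmeas N. c r * h r * h' r) = 0"
  using i1 i by simp
 then show ?thesis by simp
qed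

text \<open>Here \<open>h\<close> is continuous up to the boundary and the term at \<open>1\<close>
  survives. In the applications \<open>u 1 t = 1\<close> turns it into \<open>0\<close> for
  \<open>F\<close> and into \<open>min_energy F\<close> times the weight for
  \<open>well_potential\<close>.\<close>

lemma integral_by_parts_linear:
 assumes N: "1 <= N" and h: "ac h h'" "sqint (rmeas N) h'" "continuous_on {0..1} h"
  and c: "C1_weight c c'" "!!r. c r = r * d r" "continuous_on {0..1} d"
 shows "(LINT r|rmeas N. c r * h' r) = c 1 * h 1 - (LINT r|rmeas N. (c' r + real N * d r) * h r)"
proof -
 have cc: "continuous_on {0..1} c" "continuous_on {0..1} c'" using c unfolding C1_weight_def by auto
 have k: "continuous_on {0..1} (%r. (c' r + real N * d r) * h r)" by (intro continuous_intros cc c(3) h(3))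
 have i1: "integrable (rmeas N) (%r. (c' r + real N * d r) * h r)"
  by (rule sqint_integrable[OF finite_measure_rmeas sqint_continuous[OF k]])
 have i2: "integrable (rmeas N) (%r. c r * h' r)"
  by (rule sqint_integrable[OF finite_measure_rmeas sqint_continuous_mult[OF cc(1) h(2)]])
 have A: "ac (%r. (r ^ N * c r) * h r) (%r. r ^ N * ((c' r + real N * d r) * h r + c r * h' r))"
  by (rule ac_cong_AE[OF ac_mult[OF ac_power_weight[OF N c(1,2)] h(1)]])
    (auto intro!: AE_I2 simp: algebra_simps)
 have cA: "continuous_on {0..1} (%r. (r ^ N * c r) * h r)" by (intro continuous_intros cc h(3))
 have "(LINT r|rmeas N. (c' r + real N * d r) * h r + c r * h' r) = c 1 * h 1"
  using rmeas_integral_by_parts[OF A, of "c 1 * h 1"] Icc_tendsto_at_right_0[OF cA] Icc_tendsto_at_left_1[OF cA] i1 i2 c(2)[of 0] by simp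
 then show ?thesis using i1 i2 by simp
qed

lemma integral_by_parts_mixed:
 assumes N: "1 <= N" and v: "ac v v'" "sqint (rmeas N) v" "sqint (rmeas N) v'" "!!r. 0 < r ==> r < 1 ==> r ^ N * (v r)^2 <= C"
  and \<delta>: "ac \<delta> \<delta>'" "sqint (rmeas N) \<delta>'" "continuous_on {0..1} \<delta>"
  and c: "C1_weight c c'" "!!r. c r = r * d r" "continuous_on {0..1} d" "d 1 = 0"
 shows "(LINT r|rmeas N. c r * v r * \<delta>' r) = - (LINT r|rmeas N. ((c' r + real N * d r) * v r + c r * v' r) * \<delta> r)"
proof -
 have cc: "continuous_on {0..1} c" "continuous_on {0..1} c'" using c unfolding C1_weight_def by auto
 have k: "continuous_on {0..1} (%r. c' r + real N * d r)" by (intro continuous_intros cc c(3))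
 let ?\<alpha> = "%r. ((c' r + real N * d r) * v r + c r * v' r) * \<delta> r + c r * v r * \<delta>' r"
 have i1: "integrable (rmeas N) (%r. ((c' r + real N * d r) * v r + c r * v' r) * \<delta> r)"
  by (intro sqint_times sqint_add sqint_continuous_mult k cc v sqint_continuous \<delta>(3))
 have i2: "integrable (rmeas N) (%r. c r * v r * \<delta>' r)"
  by (intro sqint_times sqint_continuous_mult cc v \<delta>(2))
 have A: "ac (%r. (r ^ N * c r) * (v r * \<delta> r)) (%r. r ^ N * ?\<alpha> r)"
  by (rule ac_cong_AE[OF ac_mult[OF ac_power_weight[OF N c(1,2)] ac_mult[OF v(1) \<delta>(1)]]])
    (auto intro!: AE_I2 simp: algebra_simps)
 obtain Bd where Bd: "Bd >= 0" "!!x. 0 <= x ==> x <= 1 ==> \<bar>\<delta> x\<bar> <= Bd" using bounded_unit_interval[OF \<delta>(3)] by blast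
 have C0: "0 <= C" using order_trans[OF _ v(4)[of "1/2"]] by simp
 have b: "\<bar>(r ^ N * c r) * (v r * \<delta> r)\<bar> <= (sqrt C * Bd) * \<bar>c r\<bar>" if r: "0 < r" "r < 1" for r
 proof -
  have "(r ^ N * v r)^2 = r ^ N * (r ^ N * (v r)^2)" by (simp add: power2_eq_square)
  also have "\<dots> <= 1 * C" using v(4)[OF r] r by (intro mult_mono) (auto intro: power_le_one)
  finally have "\<bar>r ^ N * v r\<bar> <= sqrt C" by (simp add: real_le_rsqrt abs_le_iff power2_abs)
  then have "\<bar>c r\<bar> * (\<bar>r ^ N * v r\<bar> * \<bar>\<delta> r\<bar>) <= \<bar>c r\<bar> * (sqrt C * Bd)"
   using Bd(1) Bd(2)[of r] r C0 by (intro mult_left_mono mult_mono) auto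
  then show ?thesis using r by (simp add: abs_mult algebra_simps)
 qed
 have "((%r. (r ^ N * c r) * (v r * \<delta> r)) \<longlongrightarrow> 0) (at_right 0)"
  by (rule tendsto_0_at_ends(1)[OF b]) (use Icc_tendsto_at_right_0[OF cc(1)] c(2)[of 0] in auto)
 moreover have "((%r. (r ^ N * c r) * (v r * \<delta> r)) \<longlongrightarrow> 0) (at_left 1)"
  by (rule tendsto_0_at_ends(2)[OF b]) (use Icc_tendsto_at_left_1[OF cc(1)] c(2)[of 1] c(4) in auto)
 ultimately have "(LINT r|rmeas N. ?\<alpha> r) = 0"
  using rmeas_integral_by_parts[OF A] i1 i2 by simp
 then show ?thesis using i1 i2 by simp
qed

subsection \<open>Differentiation in time\<close>

text \<open>Uniformity in \<open>r\<close> of the difference quotients allows the weight to vary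
  inside integrals against factors that are merely square integrable.\<close>

definition uniformly_differentiable_weight ::
 "(real => real => real) => (real => real) => real => bool" where
 "uniformly_differentiable_weight c c' t \<longleftrightarrow>
   (\<forall>s. continuous_on {0..1} (%r. c r s)) & continuous_on {0..1} c' \<and>
   (\<forall>e>0. eventually (%s. \<forall>r. 0 < r --> r < 1 --> \<bar>(c r s - c r t) / (s - t) - c' r\<bar> <= e) (at t within {0..}))"

text \<open>The increment splits into the change of the weight, whose quotient converges uniformly,
  and the change of the integrand with the weight frozen at time \<open>t\<close>. The second limit
  is left as hypothesis \<open>D\<close> because each functional needs its own argument for
  it.\<close>

lemma weighted_integral_has_derivative:
 fixes f h :: "real => real => real"
 assumes f: "L2lim (rmeas N) (%s r. f r s) (%r. f r t) (at t within {0..})"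
  and h: "L2lim (rmeas N) (%s r. h r s) (%r. h r t) (at t within {0..})"
  and c: "uniformly_differentiable_weight c c' t"
  and D: "((%s. ((LINT r|rmeas N. c r t * (f r s * h r s)) - (LINT r|rmeas N. c r t * (f r t * h r t))) / (s - t)) \<longlongrightarrow> D) (at t within {0..})"
 shows "((%s. \<integral>r. c r s * (f r s * h r s) \<partial>rmeas N) has_real_derivative (LINT r|rmeas N. c' r * (f r t * h r t)) + D) (at t within {0..})"
proof -
 let ?F = "at t within {0::real..}"
 have cc: "continuous_on {0..1} (%r. c r s)" "continuous_on {0..1} c'" for s
  using c unfolding uniformly_differentiable_weight_def by auto
 obtain B where B: "!!x. 0 <= x ==> x <= 1 ==> \<bar>c' x\<bar> <= B" using bounded_unit_interval[OF cc(2)] by blast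
 have c'q: "L2lim (rmeas N) (%s r. (c r s - c r t) / (s - t) * f r s) (%r. c' r * f r t) ?F"
 proof -
  define e where "e s = (SUP r\<in>{0<..<1::real}. \<bar>(c r s - c r t) / (s - t) - c' r\<bar>)" for s
  have bdd: "bdd_above ((%r. \<bar>(c r s - c r t) / (s - t) - c' r\<bar>) ` {0<..<1})" for s
  proof -
   have "continuous_on {0..1} (%r. (c r s - c r t) * inverse (s - t) - c' r)" by (intro continuous_intros cc)
   then obtain B' where "\<forall>x. 0 <= x --> x <= 1 --> \<bar>(c x s - c x t) * inverse (s - t) - c' x\<bar> <= B'"
    using bounded_unit_interval by blast
   then show ?thesis by (intro bdd_aboveI[of _ B']) (auto simp: divide_inverse)
  qed
  have le: "\<bar>(c r s - c r t) / (s - t) - c' r\<bar> <= e s" if "r \<in> {0<..<1}" for r s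
   unfolding e_def by (rule cSUP_upper[OF that bdd])
  have e0: "0 <= e s" for s using order_trans[OF abs_ge_zero le[of "1/2" s]] by simp
  have "(e \<longlongrightarrow> 0) ?F"
  proof (rule tendstoI)
   fix \<eta> :: real assume \<eta>: "0 < \<eta>"
   have "eventually (%s. \<forall>r. 0 < r --> r < 1 --> \<bar>(c r s - c r t) / (s - t) - c' r\<bar> <= \<eta> / 2) ?F"
    using c half_gt_zero[OF \<eta>] unfolding uniformly_differentiable_weight_def by blast
   then show "eventually (%s. dist (e s) 0 < \<eta>) ?F"
   proof eventually_elim
    case (elim s)
    have "e s <= \<eta> / 2" unfolding e_def by (rule cSUP_least) (use elim in auto)
    then show ?case using \<eta> e0[of s] by simp
   qed
  qed
  then show ?thesis
  proof (rule L2lim_weight[OF f, where e=e and B=B, rotated -1])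
   show "(%r. (c r s - c r t) / (s - t)) \<in> borel_measurable (rmeas N)" for s
    using continuous_rmeas_Icc[OF cc(1)[of s]] continuous_rmeas_Icc[OF cc(1)[of t]] by simp
   show "c' \<in> borel_measurable (rmeas N)" by (rule continuous_rmeas_Icc[OF cc(2)])
   show "eventually (%s. \<forall>x\<in>space (rmeas N). \<bar>(c x s - c x t) / (s - t) - c' x\<bar> <= e s) ?F"
    by (intro always_eventually allI ballI le) simp
  qed (use B in auto)
 qed
 have lim1: "((%s. \<integral>r. ((c r s - c r t) / (s - t) * f r s) * h r s \<partial>rmeas N) \<longlongrightarrow> (LINT r|rmeas N. (c' r * f r t) * h r t)) ?F"
  by (rule L2lim_times[OF c'q h])
 have "((%s. ((LINT r|rmeas N. c r s * (f r s * h r s)) - (LINT r|rmeas N. c r t * (f r t * h r t))) / (s - t)) \<longlongrightarrow> (LINT r|rmeas N. (c' r * f r t) * h r t) + D) ?F"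
 proof (rule Lim_transform_eventually[OF tendsto_add[OF lim1 D]])
  have ne: "eventually (%s. s ~= t) ?F" by (simp add: eventually_at_filter)
  show "eventually (%s. (LINT r|rmeas N. ((c r s - c r t) / (s - t) * f r s) * h r s) +
    ((LINT r|rmeas N. c r t * (f r s * h r s)) - (LINT r|rmeas N. c r t * (f r t * h r t))) / (s - t) =
    ((LINT r|rmeas N. c r s * (f r s * h r s)) - (LINT r|rmeas N. c r t * (f r t * h r t))) / (s - t)) ?F"
   using ne L2limD(2)[OF f] L2limD(2)[OF h]
  proof eventually_elim
   case (elim s)
   have i: "integrable (rmeas N) (%r. c r q * (f r s * h r s))" for q
    using sqint_times[OF sqint_continuous_mult[OF cc(1)[of q] elim(2)] elim(3)] by (simp add: mult.assoc)
   have "(LINT r|rmeas N. ((c r s - c r t) / (s - t) * f r s) * h r s) = (LINT r|rmeas N. (c r s * (f r s * h r s) - c r t * (f r s * h r s)) / (s - t))"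
    by (rule Bochner_Integration.integral_cong) (auto simp: field_simps)
   also have "\<dots> = ((LINT r|rmeas N. c r s * (f r s * h r s)) - (LINT r|rmeas N. c r t * (f r s * h r s))) / (s - t)"
    using i by simp
   finally show ?case by (simp add: diff_divide_distrib)
  qed
 qed
 moreover have "(LINT r|rmeas N. (c' r * f r t) * h r t) = (LINT r|rmeas N. c' r * (f r t * h r t))"
  by (simp add: mult.assoc)
 ultimately show ?thesis by (simp add: has_field_derivative_iff)
qed

section \<open>Time derivatives of the weighted functionals along a strong solution\<close>

lemma strong_solutionD:
 assumes "strong_solution N F' eps \<tau> u0 u1 u p l v v' w" "0 <= t"
 shows "continuous_on {0..1} (%r. u r t)" "u 1 t = 1"
  "ac (%r. u r t) (%r. p r t)" "sqint (rmeas N) (%r. p r t)" "sqint (rmeas N) (%r. l r t)"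
  "ac (%r. p r t) (%r. l r t - real N / r * p r t)"
  "ac (%r. r ^ N * p r t) (%r. r ^ N * l r t)"
  "ac (%r. v r t) (%r. v' r t)" "sqint (rmeas N) (%r. v r t)" "sqint (rmeas N) (%r. v' r t)"
  "L2lim (rmeas N) (%s r. p r s) (%r. p r t) (at t within {0..})"
  "L2lim (rmeas N) (%s r. l r s) (%r. l r t) (at t within {0..})"
  "L2lim (rmeas N) (%s r. v r s) (%r. v r t) (at t within {0..})"
  "L2lim (rmeas N) (%s r. (u r s - u r t) / (s - t)) (%r. v r t) (at t within {0..})"
 using assms unfolding strong_solution_def by simp_all

lemma strong_solutionD':
 assumes "strong_solution N F' eps \<tau> u0 u1 u p l v v' w" "0 < t"
 shows "sqint (rmeas N) (%r. w r t)"
  "L2lim (rmeas N) (%s r. (v r s - v r t) / (s - t)) (%r. w r t) (at t within {0..})"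
  "AE r in rmeas N. eps\<^sup>2 * \<tau> * w r t + v r t = l r t - F' (u r t) / eps^2"
 using assms unfolding strong_solution_def by simp_all

lemma strong_solution_eventually:
 "eventually (%s. s \<in> {0::real..} & s ~= t) (at t within {0..})"
 by (auto simp: eventually_at_filter)

lemma strong_solution_profile_limit:
 assumes sol: "strong_solution N F' eps \<tau> u0 u1 u p l v v' w" and t: "0 <= t"
 shows "L2lim (rmeas N) (%s r. u r s) (%r. u r t) (at t within {0..})"
proof -
 note S = strong_solutionD[OF sol]
 let ?F = "at t within {0::real..}"
 let ?q = "%s. l2norm (rmeas N) (%r. (u r s - u r t) / (s - t) - v r t)"
 show ?thesis
 proof (rule L2lim_le[where B="%s. \<bar>s - t\<bar> * (?q s + l2norm (rmeas N) (%r. v r t))"])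
  show "sqint (rmeas N) (%r. u r t)" by (rule sqint_continuous[OF S(1)[OF t]])
  show "eventually (%s. sqint (rmeas N) (%r. u r s)) ?F"
   using strong_solution_eventually by eventually_elim (auto intro: sqint_continuous[OF S(1)])
  show "eventually (%s. l2norm (rmeas N) (%r. u r s - u r t) <= \<bar>s - t\<bar> * (?q s + l2norm (rmeas N) (%r. v r t))) ?F"
   using strong_solution_eventually L2limD(2)[OF S(14)[OF t]]
  proof eventually_elim
   case (elim s)
   then have st: "s - t ~= 0" by simp
   have "l2norm (rmeas N) (%r. u r s - u r t) = l2norm (rmeas N) (%r. (s - t) * ((u r s - u r t) / (s - t)))"
    by (rule l2norm_cong) (use st in simp)
   also have "\<dots> <= \<bar>\<bar>s - t\<bar>\<bar> * l2norm (rmeas N) (%r. (u r s - u r t) / (s - t))"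
    by (rule l2norm_bounded_mult[OF elim(2)]) auto
   also have "l2norm (rmeas N) (%r. (u r s - u r t) / (s - t)) <= ?q s + l2norm (rmeas N) (%r. v r t)"
    using l2norm_triangle[OF sqint_diff[OF elim(2) S(9)[OF t]] S(9)[OF t]] by simp
   finally show ?case by (simp add: mult_left_mono)
  qed
  have "((%s. \<bar>s - t\<bar> * (?q s + l2norm (rmeas N) (%r. v r t))) \<longlongrightarrow> \<bar>t - t\<bar> * (0 + l2norm (rmeas N) (%r. v r t))) ?F"
   by (intro tendsto_intros L2limD(3)[OF S(14)[OF t]])
  then show "((%s. \<bar>s - t\<bar> * (?q s + l2norm (rmeas N) (%r. v r t))) \<longlongrightarrow> 0) ?F" by simp
 qed
qed

text \<open>A quadratic Taylor remainder and a Lipschitz bound, both on the range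
  \<open>[-C, C]\<close> of the solution. This covers \<open>well_potential\<close>, whose
  derivative is shown to be Lipschitz although it contains a square root of
  \<open>F\<close>.\<close>

definition C1_on_range :: "(real => real) => (real => real) => real => real => bool" where
 "C1_on_range \<Phi> \<Phi>' C K \<longleftrightarrow> (\<forall>x. (\<Phi> has_real_derivative \<Phi>' x) (at x)) & continuous_on UNIV \<Phi>' \<and>
   (\<forall>a b. \<bar>a\<bar> <= C --> \<bar>b\<bar> <= C --> \<bar>\<Phi> a - \<Phi> b - \<Phi>' b * (a - b)\<bar> <= K * (a - b)^2) \<and>
   (\<forall>a b. \<bar>a\<bar> <= C --> \<bar>b\<bar> <= C --> \<bar>\<Phi> a - \<Phi> b\<bar> <= K * \<bar>a - b\<bar>)"

lemma C1_on_rangeD: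
 assumes "C1_on_range \<Phi> \<Phi>' C K"
 shows "(\<Phi> has_real_derivative \<Phi>' x) (at x)"
  "\<bar>a\<bar> <= C ==> \<bar>b\<bar> <= C ==> \<bar>\<Phi> a - \<Phi> b - \<Phi>' b * (a - b)\<bar> <= K * (a - b)^2"
  "\<bar>a\<bar> <= C ==> \<bar>b\<bar> <= C ==> \<bar>\<Phi> a - \<Phi> b\<bar> <= K * \<bar>a - b\<bar>"
 using assms unfolding C1_on_range_def by simp_all

lemma C1_on_range_continuous:
 assumes "C1_on_range \<Phi> \<Phi>' C K"
 shows "continuous_on A \<Phi>" "continuous_on A \<Phi>'"
 using assms unfolding C1_on_range_def
 by (meson DERIV_isCont continuous_at_imp_continuous_on, meson continuous_on_subset subset_UNIV)

lemma strong_solution_compose: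
 assumes sol: "strong_solution N F' eps \<tau> u0 u1 u p l v v' w" and t: "0 <= t"
  and \<Phi>: "C1_on_range \<Phi> \<Phi>' C K"
 shows "continuous_on {0..1} (%r. \<Phi> (u r t))" "continuous_on {0..1} (%r. \<Phi>' (u r t))"
  "ac (%r. \<Phi> (u r t)) (%r. \<Phi>' (u r t) * p r t)"
proof -
 note S = strong_solutionD[OF sol t]
 note c = C1_on_range_continuous[OF \<Phi>]
 show c1: "continuous_on {0..1} (%r. \<Phi> (u r t))" "continuous_on {0..1} (%r. \<Phi>' (u r t))"
  using continuous_on_compose2[OF c(1)[of UNIV] S(1)] continuous_on_compose2[OF c(2)[of UNIV] S(1)] by auto
 show "ac (%r. \<Phi> (u r t)) (%r. \<Phi>' (u r t) * p r t)"
 proof (rule ac_C1)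
  show "continuous_on {0<..<1} (%r. \<Phi>' (u r t) * p r t)"
   by (intro continuous_on_mult ac_continuous[OF S(6)] continuous_on_subset[OF c1(2)]) auto
  fix x :: real assume x: "0 < x" "x < 1"
  have "((%r. u r t) has_real_derivative p x t) (at x)"
   by (rule ac_real_derivative[OF S(3) ac_continuous[OF S(6)] x])
  then show "((%r. \<Phi> (u r t)) has_real_derivative \<Phi>' (u x t) * p x t) (at x)"
   by (rule DERIV_chain2[OF C1_on_rangeD(1)[OF \<Phi>]])
 qed
qed

lemma strong_solution_compose_limit:
 assumes sol: "strong_solution N F' eps \<tau> u0 u1 u p l v v' w" and t: "0 <= t"
  and bd: "!!r t. 0 < r ==> r < 1 ==> 0 <= t ==> \<bar>u r t\<bar> <= C" and \<Phi>: "C1_on_range \<Phi> \<Phi>' C K"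
 shows "L2lim (rmeas N) (%s r. \<Phi> (u r s)) (%r. \<Phi> (u r t)) (at t within {0..})"
proof (rule L2lim_le[where B="%s. \<bar>K\<bar> * l2norm (rmeas N) (%r. u r s - u r t)"])
 note c = strong_solution_compose(1)[OF sol _ \<Phi>]
 note S = strong_solutionD[OF sol]
 show "sqint (rmeas N) (%r. \<Phi> (u r t))" by (rule sqint_continuous[OF c[OF t]])
 show "eventually (%s. sqint (rmeas N) (%r. \<Phi> (u r s))) (at t within {0..})"
  using strong_solution_eventually by eventually_elim (auto intro: sqint_continuous[OF c])
 show "eventually (%s. l2norm (rmeas N) (%r. \<Phi> (u r s) - \<Phi> (u r t)) <= \<bar>K\<bar> * l2norm (rmeas N) (%r. u r s - u r t)) (at t within {0..})"
  using strong_solution_eventually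
 proof eventually_elim
  case (elim s)
  then have s: "0 <= s" by simp
  have q: "sqint (rmeas N) (%r. u r s - u r t)" by (rule sqint_diff[OF sqint_continuous[OF S(1)[OF s]] sqint_continuous[OF S(1)[OF t]]])
  have q2: "sqint (rmeas N) (%r. \<Phi> (u r s) - \<Phi> (u r t))" by (rule sqint_diff[OF sqint_continuous[OF c[OF s]] sqint_continuous[OF c[OF t]]])
  have "(LINT r|rmeas N. (\<Phi> (u r s) - \<Phi> (u r t))^2) <= (LINT r|rmeas N. K\<^sup>2 * (u r s - u r t)^2)"
  proof (rule integral_mono)
   show "integrable (rmeas N) (%r. (\<Phi> (u r s) - \<Phi> (u r t))^2)" by (rule sqintD(2)[OF q2])
   show "integrable (rmeas N) (%r. K\<^sup>2 * (u r s - u r t)^2)" using sqintD(2)[OF q] by simp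
   fix r assume "r \<in> space (rmeas N)"
   then have r: "0 < r" "r < 1" by auto
   have "\<bar>\<Phi> (u r s) - \<Phi> (u r t)\<bar> <= K * \<bar>u r s - u r t\<bar>"
    by (rule C1_on_rangeD(3)[OF \<Phi> bd[OF r s] bd[OF r t]])
   also have "\<dots> <= \<bar>K * (u r s - u r t)\<bar>" unfolding abs_mult by (intro mult_right_mono) auto
   finally have "(\<Phi> (u r s) - \<Phi> (u r t))^2 <= (K * (u r s - u r t))^2" by (simp only: abs_le_square_iff)
   then show "(\<Phi> (u r s) - \<Phi> (u r t))^2 <= K^2 * (u r s - u r t)^2" by (simp add: power_mult_distrib)
  qed
  also have "\<dots> = (\<bar>K\<bar> * l2norm (rmeas N) (%r. u r s - u r t))^2" by (simp add: power_mult_distrib l2norm_sq)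
  finally show ?case unfolding l2norm_def[of _ "%r. \<Phi> (u r s) - \<Phi> (u r t)"] by (intro real_le_lsqrt) simp_all
 qed
 show "((%s. \<bar>K\<bar> * l2norm (rmeas N) (%r. u r s - u r t)) \<longlongrightarrow> 0) (at t within {0..})"
  using tendsto_mult_right_zero[OF L2limD(3)[OF strong_solution_profile_limit[OF sol t]]] .
qed

lemma time_derivative_velocity:
 assumes sol: "strong_solution N F' eps \<tau> u0 u1 u p l v v' w" and t: "0 < t"
  and c: "uniformly_differentiable_weight c c' t"
 shows "((%s. \<integral>r. c r s * (v r s * v r s) \<partial>rmeas N) has_real_derivative
   (LINT r|rmeas N. c' r * (v r t * v r t)) + (LINT r|rmeas N. c r t * (v r t + v r t) * w r t)) (at t within {0..})"
proof -
 note S = strong_solutionD[OF sol less_imp_le[OF t]] and S' = strong_solutionD'[OF sol t]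
 let ?F = "at t within {0::real..}"
 have cc: "continuous_on {0..1} (%r. c r t)" using c unfolding uniformly_differentiable_weight_def by auto
 obtain B where B: "!!x. 0 <= x ==> x <= 1 ==> \<bar>c x t\<bar> <= B" using bounded_unit_interval[OF cc] by blast
 have L: "L2lim (rmeas N) (%s r. c r t * (v r s + v r t)) (%r. c r t * (v r t + v r t)) ?F"
  by (rule L2lim_bounded_mult[OF L2lim_add[OF S(13) L2lim_const[OF S(9)]] continuous_rmeas_Icc[OF cc], of B]) (use B in auto)
 show ?thesis
 proof (rule weighted_integral_has_derivative[OF S(13) S(13) c])
  show "((%s. ((LINT r|rmeas N. c r t * (v r s * v r s)) - (LINT r|rmeas N. c r t * (v r t * v r t))) / (s - t)) \<longlongrightarrow>
    (LINT r|rmeas N. c r t * (v r t + v r t) * w r t)) ?F"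
  proof (rule Lim_transform_eventually[OF L2lim_times[OF L S'(2)]])
   show "eventually (%s. (LINT r|rmeas N. c r t * (v r s + v r t) * ((v r s - v r t) / (s - t))) =
     ((LINT r|rmeas N. c r t * (v r s * v r s)) - (LINT r|rmeas N. c r t * (v r t * v r t))) / (s - t)) ?F"
    using L2limD(2)[OF S(13)]
   proof eventually_elim
    case (elim s)
    have i: "integrable (rmeas N) (%r. c r t * (v r q * v r q))" if "sqint (rmeas N) (%r. v r q)" for q
     using sqint_times[OF sqint_continuous_mult[OF cc that] that] by (simp add: mult.assoc)
    have "(LINT r|rmeas N. c r t * (v r s + v r t) * ((v r s - v r t) / (s - t))) =
      (LINT r|rmeas N. (c r t * (v r s * v r s) - c r t * (v r t * v r t)) / (s - t))"
     by (rule Bochner_Integration.integral_cong) (simp_all add: algebra_simps diff_divide_distrib add_divide_distrib)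
    then show ?case using i[OF elim] i[OF S(9)] by simp
   qed
  qed
 qed
qed

lemma time_derivative_gradient:
 assumes sol: "strong_solution N F' eps \<tau> u0 u1 u p l v v' w" and t: "0 <= t" and N: "1 <= N"
  and c: "uniformly_differentiable_weight c c' t" and cr: "C1_weight (%r. c r t) cr"
 shows "((%s. \<integral>r. c r s * (p r s * p r s) \<partial>rmeas N) has_real_derivative
   (LINT r|rmeas N. c' r * (p r t * p r t)) + - (LINT r|rmeas N. (c r t * (l r t + l r t) + cr r * (p r t + p r t)) * v r t)) (at t within {0..})"
proof -
 note S = strong_solutionD[OF sol] and St = strong_solutionD[OF sol t]
 let ?F = "at t within {0::real..}"
 have cc: "continuous_on {0..1} (%r. c r t)" "continuous_on {0..1} cr" using cr unfolding C1_weight_def by auto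
 obtain B where B: "!!x. 0 <= x ==> x <= 1 ==> \<bar>c x t\<bar> <= B" using bounded_unit_interval[OF cc(1)] by blast
 obtain B' where B': "!!x. 0 <= x ==> x <= 1 ==> \<bar>cr x\<bar> <= B'" using bounded_unit_interval[OF cc(2)] by blast
 have L: "L2lim (rmeas N) (%s r. c r t * (l r s + l r t) + cr r * (p r s + p r t)) (%r. c r t * (l r t + l r t) + cr r * (p r t + p r t)) ?F"
  by (intro L2lim_add L2lim_bounded_mult[OF L2lim_add[OF St(12) L2lim_const[OF St(5)]] continuous_rmeas_Icc[OF cc(1)], of B]
   L2lim_bounded_mult[OF L2lim_add[OF St(11) L2lim_const[OF St(4)]] continuous_rmeas_Icc[OF cc(2)], of B']) (use B B' in auto)
 show ?thesis
 proof (rule weighted_integral_has_derivative[OF St(11) St(11) c])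
  show "((%s. ((LINT r|rmeas N. c r t * (p r s * p r s)) - (LINT r|rmeas N. c r t * (p r t * p r t))) / (s - t)) \<longlongrightarrow>
    - (LINT r|rmeas N. (c r t * (l r t + l r t) + cr r * (p r t + p r t)) * v r t)) ?F"
  proof (rule Lim_transform_eventually[OF tendsto_minus[OF L2lim_times[OF L St(14)]]])
   show "eventually (%s. - (LINT r|rmeas N. (c r t * (l r s + l r t) + cr r * (p r s + p r t)) * ((u r s - u r t) / (s - t))) =
     ((LINT r|rmeas N. c r t * (p r s * p r s)) - (LINT r|rmeas N. c r t * (p r t * p r t))) / (s - t)) ?F"
    using strong_solution_eventually
   proof eventually_elim
    case (elim s)
    then have s: "0 <= s" by simp
    let ?d = "%r. (u r s - u r t) / (s - t)" and ?d' = "%r. (p r s - p r t) / (s - t)"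
    have i: "integrable (rmeas N) (%r. c r t * (p r q * p r q))" if "0 <= q" for q
     using sqint_times[OF sqint_continuous_mult[OF cc(1) S(4)[OF that]] S(4)[OF that]] by (simp add: mult.assoc)
    have ad: "ac ?d ?d'"
     using ac_mult[OF C1_weight_ac ac_add[OF S(3)[OF s] ac_mult[OF C1_weight_ac S(3)[OF t]]], of "%r. inverse (s - t)" "%r. 0" "%r. -1" "%r. 0"]
     by (simp add: C1_weight_def divide_inverse algebra_simps)
    have flux: "(LINT r|rmeas N. c r t * (p r s + p r t) * ?d' r) = - (LINT r|rmeas N. (c r t * (l r s + l r t) + cr r * (p r s + p r t)) * ?d r)"
    proof (rule integral_by_parts_flux[OF N _ _ _ cr ad])
     show "sqint (rmeas N) (%r. p r s + p r t)" "sqint (rmeas N) (%r. l r s + l r t)"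
      by (intro sqint_add S s t)+
     show "ac (%r. r ^ N * (p r s + p r t)) (%r. r ^ N * (l r s + l r t))"
      using ac_add[OF S(7)[OF s] S(7)[OF t]] by (simp add: distrib_left)
     show "sqint (rmeas N) ?d'"
      using sqint_cmult[OF sqint_diff[OF S(4)[OF s] S(4)[OF t]], of "inverse (s - t)"] by (simp add: divide_inverse mult.commute)
     show "continuous_on {0..1} ?d"
      using elim by (intro continuous_intros S s t) auto
     show "?d 1 = 0" using S(2)[OF s] S(2)[OF t] by simp
    qed
    have "(LINT r|rmeas N. c r t * (p r s + p r t) * ?d' r) = (LINT r|rmeas N. (c r t * (p r s * p r s) - c r t * (p r t * p r t)) / (s - t))"
     by (rule Bochner_Integration.integral_cong) (simp_all add: algebra_simps diff_divide_distrib add_divide_distrib)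
    also have "\<dots> = ((LINT r|rmeas N. c r t * (p r s * p r s)) - (LINT r|rmeas N. c r t * (p r t * p r t))) / (s - t)"
     using i[OF s] i[OF t] by simp
    finally show ?case unfolding flux .
   qed
  qed
 qed
qed

text \<open>Quotients of \<open>v\<close> converge to \<open>w\<close>; quotients of
  \<open>p\<close> are moved onto \<open>u\<close> by \<open>integral_by_parts_mixed\<close>. The
  limit of the moved term is the integral of \<open>?m * v\<close>, whose part
  \<open>c * v * v'\<close> is integrated by parts again and cancels half of the remaining part,
  hence the factor \<open>1/2\<close>.\<close>

lemma time_derivative_momentum:
 assumes sol: "strong_solution N F' eps \<tau> u0 u1 u p l v v' w" and t: "0 < t" and N: "1 <= N"
  and c: "uniformly_differentiable_weight c c' t" and cr: "C1_weight (%r. c r t) cr"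
  and d: "!!r. c r t = r * d r" "continuous_on {0..1} d" "d 1 = 0"
 shows "((%s. \<integral>r. c r s * (p r s * v r s) \<partial>rmeas N) has_real_derivative
   (LINT r|rmeas N. c' r * (p r t * v r t)) +
   ((LINT r|rmeas N. c r t * p r t * w r t) - (LINT r|rmeas N. (cr r + real N * d r) * (v r t)^2) / 2)) (at t within {0..})"
proof -
 have t0: "0 <= t" using t by simp
 note S = strong_solutionD[OF sol] and St = strong_solutionD[OF sol t0] and S' = strong_solutionD'[OF sol t]
 let ?F = "at t within {0::real..}"
 have cc: "continuous_on {0..1} (%r. c r t)" "continuous_on {0..1} cr" using cr unfolding C1_weight_def by auto
 obtain B where B: "!!x. 0 <= x ==> x <= 1 ==> \<bar>c x t\<bar> <= B" using bounded_unit_interval[OF cc(1)] by blast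
 have k: "continuous_on {0..1} (%r. cr r + real N * d r)" by (intro continuous_intros cc d(2))
 let ?m = "%r. (cr r + real N * d r) * v r t + c r t * v' r t"
 have ms: "sqint (rmeas N) ?m" by (intro sqint_add sqint_continuous_mult k cc St)
 note tb = trace_bound[OF St(8) St(10)]
 have L1: "((%s. \<integral>r. c r t * p r s * ((v r s - v r t) / (s - t)) \<partial>rmeas N) \<longlongrightarrow> (LINT r|rmeas N. c r t * p r t * w r t)) ?F"
  by (rule L2lim_times[OF L2lim_bounded_mult[OF St(11) continuous_rmeas_Icc[OF cc(1)], of B] S'(2)]) (use B in auto)
 have L2: "((%s. \<integral>r. ?m r * ((u r s - u r t) / (s - t)) \<partial>rmeas N) \<longlongrightarrow> (LINT r|rmeas N. ?m r * v r t)) ?F"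
  by (rule L2lim_times[OF L2lim_const[OF ms] St(14)])
 have i1: "integrable (rmeas N) (%r. c r t * v r t * v' r t)" by (rule sqint_times[OF sqint_continuous_mult[OF cc(1) St(9)] St(10)])
 have i2: "integrable (rmeas N) (%r. (cr r + real N * d r) * (v r t)^2)"
  using sqint_times[OF sqint_continuous_mult[OF k St(9)] St(9)] by (simp add: power2_eq_square mult.assoc)
 have "(LINT r|rmeas N. ?m r * v r t) = (LINT r|rmeas N. (cr r + real N * d r) * (v r t)^2 + c r t * v r t * v' r t)"
  by (rule Bochner_Integration.integral_cong) (auto simp: power2_eq_square algebra_simps)
 also have "\<dots> = (LINT r|rmeas N. (cr r + real N * d r) * (v r t)^2) / 2"
  using i1 i2 integral_by_parts_quadratic[OF N St(8,9) tb cr d i1] by simp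
 finally have mv: "(LINT r|rmeas N. ?m r * v r t) = (LINT r|rmeas N. (cr r + real N * d r) * (v r t)^2) / 2" .
 show ?thesis
 proof (rule weighted_integral_has_derivative[OF St(11) St(13) c])
  show "((%s. ((LINT r|rmeas N. c r t * (p r s * v r s)) - (LINT r|rmeas N. c r t * (p r t * v r t))) / (s - t)) \<longlongrightarrow>
    (LINT r|rmeas N. c r t * p r t * w r t) - (LINT r|rmeas N. (cr r + real N * d r) * (v r t)^2) / 2) ?F"
   unfolding mv[symmetric]
  proof (rule Lim_transform_eventually[OF tendsto_diff[OF L1 L2]])
   show "eventually (%s. (LINT r|rmeas N. c r t * p r s * ((v r s - v r t) / (s - t))) - (LINT r|rmeas N. ?m r * ((u r s - u r t) / (s - t))) =
     ((LINT r|rmeas N. c r t * (p r s * v r s)) - (LINT r|rmeas N. c r t * (p r t * v r t))) / (s - t)) ?F"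
    using strong_solution_eventually
   proof eventually_elim
    case (elim s)
    then have s: "0 <= s" by simp
    let ?d = "%r. (u r s - u r t) / (s - t)" and ?d' = "%r. (p r s - p r t) / (s - t)"
    have i: "integrable (rmeas N) (%r. c r t * (p r q * v r q'))" if "0 <= q" "0 <= q'" for q q'
     using sqint_times[OF sqint_continuous_mult[OF cc(1) S(4)[OF that(1)]] S(9)[OF that(2)]] by (simp add: mult.assoc)
    have ad: "ac ?d ?d'"
     using ac_mult[OF C1_weight_ac ac_add[OF S(3)[OF s] ac_mult[OF C1_weight_ac S(3)[OF t0]]], of "%r. inverse (s - t)" "%r. 0" "%r. -1" "%r. 0"]
     by (simp add: C1_weight_def divide_inverse algebra_simps)
    have mixed: "(LINT r|rmeas N. c r t * v r t * ?d' r) = - (LINT r|rmeas N. ?m r * ?d r)"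
    proof (rule integral_by_parts_mixed[OF N St(8,9,10) tb ad _ _ cr d])
     show "sqint (rmeas N) ?d'"
      using sqint_cmult[OF sqint_diff[OF S(4)[OF s] S(4)[OF t0]], of "inverse (s - t)"] by (simp add: divide_inverse mult.commute)
     show "continuous_on {0..1} ?d"
      using elim by (intro continuous_intros S s t0) auto
    qed
    have "(LINT r|rmeas N. c r t * p r s * ((v r s - v r t) / (s - t))) = (LINT r|rmeas N. (c r t * (p r s * v r s) - c r t * (p r s * v r t)) / (s - t))"
     by (rule Bochner_Integration.integral_cong) (simp_all add: algebra_simps diff_divide_distrib add_divide_distrib)
    then have e1: "(LINT r|rmeas N. c r t * p r s * ((v r s - v r t) / (s - t))) = ((LINT r|rmeas N. c r t * (p r s * v r s)) - (LINT r|rmeas N. c r t * (p r s * v r t))) / (s - t)"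
     using i[OF s s] i[OF s t0] by simp
    have "(LINT r|rmeas N. c r t * v r t * ?d' r) = (LINT r|rmeas N. (c r t * (p r s * v r t) - c r t * (p r t * v r t)) / (s - t))"
     by (rule Bochner_Integration.integral_cong) (simp_all add: algebra_simps diff_divide_distrib add_divide_distrib)
    then have e2: "(LINT r|rmeas N. c r t * v r t * ?d' r) = ((LINT r|rmeas N. c r t * (p r s * v r t)) - (LINT r|rmeas N. c r t * (p r t * v r t))) / (s - t)"
     using i[OF s t0] i[OF t0 t0] by simp
    show ?case unfolding e1 using mixed unfolding e2 by (simp add: diff_divide_distrib)
   qed
  qed
 qed
qed

lemma divide_abs_square:
 assumes "(d::real) ~= 0" shows "x\<^sup>2 / \<bar>d\<bar> = \<bar>d\<bar> * (x / d * (x / d))"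
 using assms by (cases "0 < d") (auto simp: power2_eq_square)

lemma integral_difference_quotient:
 fixes f g h :: "'b => real"
 assumes "integrable M f" "integrable M g" "integrable M h"
 shows "integrable M (%x. (f x - g x) / c - h x)"
  "(integral\<^sup>L M f - integral\<^sup>L M g) / c - integral\<^sup>L M h = (LINT x|M. (f x - g x) / c - h x)"
 using assms by simp_all

text \<open>Up to the bound of the weight, the Taylor remainder divided by \<open>s - t\<close> is
  at most \<open>\<bar>K\<bar> * \<bar>s - t\<bar>\<close> times the squared difference quotient of
  \<open>u\<close>. The integral of that square converges, so the remainder disappears.\<close>

lemma time_derivative_compose:
 assumes sol: "strong_solution N F' eps \<tau> u0 u1 u p l v v' w" and t: "0 <= t"
  and bd: "!!r t. 0 < r ==> r < 1 ==> 0 <= t ==> \<bar>u r t\<bar> <= C" and \<Phi>: "C1_on_range \<Phi> \<Phi>' C K"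
  and c: "uniformly_differentiable_weight c c' t"
 shows "((%s. \<integral>r. c r s * (\<Phi> (u r s) * 1) \<partial>rmeas N) has_real_derivative
   (LINT r|rmeas N. c' r * (\<Phi> (u r t) * 1)) + (LINT r|rmeas N. c r t * \<Phi>' (u r t) * v r t)) (at t within {0..})"
proof -
 note S = strong_solutionD[OF sol] and St = strong_solutionD[OF sol t]
 note C = strong_solution_compose[OF sol _ \<Phi>]
 let ?F = "at t within {0::real..}"
 have cc: "continuous_on {0..1} (%r. c r t)" using c unfolding uniformly_differentiable_weight_def by auto
 obtain B where B: "B >= 0" "!!x. 0 <= x ==> x <= 1 ==> \<bar>c x t\<bar> <= B" using bounded_unit_interval[OF cc] by blast
 let ?q = "%s r. (u r s - u r t) / (s - t)"
 have s1: "sqint (rmeas N) (%r. c r t * \<Phi>' (u r t))" by (rule sqint_continuous_mult[OF cc sqint_continuous[OF C(2)[OF t]]])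
 have L: "((%s. \<integral>r. c r t * \<Phi>' (u r t) * ?q s r \<partial>rmeas N) \<longlongrightarrow> (LINT r|rmeas N. c r t * \<Phi>' (u r t) * v r t)) ?F"
  by (rule L2lim_times[OF L2lim_const[OF s1] St(14)])
 have q2: "((%s. \<integral>r. ?q s r * ?q s r \<partial>rmeas N) \<longlongrightarrow> (LINT r|rmeas N. v r t * v r t)) ?F"
  by (rule L2lim_times[OF St(14) St(14)])
 have R: "((%s. ((LINT r|rmeas N. c r t * (\<Phi> (u r s) * 1)) - (LINT r|rmeas N. c r t * (\<Phi> (u r t) * 1))) / (s - t)
   - (LINT r|rmeas N. c r t * \<Phi>' (u r t) * ?q s r)) \<longlongrightarrow> 0) ?F"
 proof (rule Lim_null_comparison)
  show "((%s. B * \<bar>K\<bar> * \<bar>s - t\<bar> * (LINT r|rmeas N. ?q s r * ?q s r)) \<longlongrightarrow> 0) ?F"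
  proof -
   have "((%s. B * \<bar>K\<bar> * \<bar>s - t\<bar> * (LINT r|rmeas N. ?q s r * ?q s r)) \<longlongrightarrow> B * \<bar>K\<bar> * \<bar>t - t\<bar> * (LINT r|rmeas N. v r t * v r t)) ?F"
    by (intro tendsto_intros q2)
   then show ?thesis by simp
  qed
  show "eventually (%s. norm (((LINT r|rmeas N. c r t * (\<Phi> (u r s) * 1)) - (LINT r|rmeas N. c r t * (\<Phi> (u r t) * 1))) / (s - t)
   - (LINT r|rmeas N. c r t * \<Phi>' (u r t) * ?q s r)) <= B * \<bar>K\<bar> * \<bar>s - t\<bar> * (LINT r|rmeas N. ?q s r * ?q s r)) ?F"
   using strong_solution_eventually L2limD(2)[OF St(14)]
  proof eventually_elim
   case (elim s)
   then have s: "0 <= s" and st: "s - t ~= 0" by auto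
   have i: "integrable (rmeas N) (%r. c r t * (\<Phi> (u r q) * 1))" if "0 <= q" for q
    using sqint_integrable[OF finite_measure_rmeas sqint_continuous_mult[OF cc sqint_continuous[OF C(1)[OF that]]]] by simp
   have i1: "integrable (rmeas N) (%r. c r t * \<Phi>' (u r t) * ?q s r)" by (rule sqint_times[OF s1 elim(2)])
   have i2: "integrable (rmeas N) (%r. ?q s r * ?q s r)" by (rule sqint_times[OF elim(2) elim(2)])
   let ?e = "%r. (c r t * (\<Phi> (u r s) * 1) - c r t * (\<Phi> (u r t) * 1)) / (s - t) - c r t * \<Phi>' (u r t) * ?q s r"
   note ie = integral_difference_quotient[OF i[OF s] i[OF t] i1, of "s - t"]
   have "(LINT r|rmeas N. norm (?e r)) <= (LINT r|rmeas N. B * \<bar>K\<bar> * \<bar>s - t\<bar> * (?q s r * ?q s r))"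
   proof (rule integral_mono)
    show "integrable (rmeas N) (%r. norm (?e r))" by (rule Bochner_Integration.integrable_norm[OF ie(1)])
    show "integrable (rmeas N) (%r. B * \<bar>K\<bar> * \<bar>s - t\<bar> * (?q s r * ?q s r))" by (rule integrable_mult_right[OF i2])
    fix r assume "r \<in> space (rmeas N)"
    then have r: "0 < r" "r < 1" by auto
    have "\<bar>\<Phi> (u r s) - \<Phi> (u r t) - \<Phi>' (u r t) * (u r s - u r t)\<bar> <= K * (u r s - u r t)^2"
     by (rule C1_on_rangeD(2)[OF \<Phi> bd[OF r s] bd[OF r t]])
    also have "\<dots> <= \<bar>K\<bar> * (u r s - u r t)^2" by (intro mult_right_mono) auto
    finally have k: "\<bar>\<Phi> (u r s) - \<Phi> (u r t) - \<Phi>' (u r t) * (u r s - u r t)\<bar> <= \<bar>K\<bar> * (u r s - u r t)^2" .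
    have "?e r = c r t * (\<Phi> (u r s) - \<Phi> (u r t) - \<Phi>' (u r t) * (u r s - u r t)) / (s - t)"
     by (simp add: algebra_simps diff_divide_distrib add_divide_distrib)
    then have "norm (?e r) = \<bar>c r t\<bar> * \<bar>\<Phi> (u r s) - \<Phi> (u r t) - \<Phi>' (u r t) * (u r s - u r t)\<bar> / \<bar>s - t\<bar>"
     by (simp add: abs_mult)
    also have "\<dots> <= B * (\<bar>K\<bar> * (u r s - u r t)^2) / \<bar>s - t\<bar>"
     using B(2)[of r] B(1) r k by (intro divide_right_mono mult_mono) auto
    also have "\<dots> = B * \<bar>K\<bar> * \<bar>s - t\<bar> * (?q s r * ?q s r)"
    proof -
     have "B * (\<bar>K\<bar> * (u r s - u r t)^2) / \<bar>s - t\<bar> = B * \<bar>K\<bar> * ((u r s - u r t)^2 / \<bar>s - t\<bar>)" by simp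
     then show ?thesis unfolding divide_abs_square[OF st] by (simp only: mult.assoc)
    qed
    finally show "norm (?e r) <= B * \<bar>K\<bar> * \<bar>s - t\<bar> * (?q s r * ?q s r)" .
   qed
   then have "norm (LINT r|rmeas N. ?e r) <= (LINT r|rmeas N. B * \<bar>K\<bar> * \<bar>s - t\<bar> * (?q s r * ?q s r))"
    by (rule order_trans[OF integral_norm_bound])
   then show ?case unfolding ie(2)[symmetric] by simp
  qed
 qed
 show ?thesis
 proof (rule weighted_integral_has_derivative[where h="%r s. 1", OF strong_solution_compose_limit[OF sol t bd \<Phi>] _ c])
  show "L2lim (rmeas N) (%s r. 1) (%r. 1) ?F" by (rule L2lim_const[OF sqint_continuous]) auto
  show "((%s. ((LINT r|rmeas N. c r t * (\<Phi> (u r s) * 1)) - (LINT r|rmeas N. c r t * (\<Phi> (u r t) * 1))) / (s - t)) \<longlongrightarrow>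
    (LINT r|rmeas N. c r t * \<Phi>' (u r t) * v r t)) ?F"
   using tendsto_add[OF R L] by simp
 qed
qed

text \<open>The weights depend on time only through \<open>i\<close> and \<open>j\<close>. Writing
  the time derivative as one continuous function \<open>G\<close> of \<open>(r, i, j)\<close> gives
  joint continuity on a compact set; the mean value theorem and uniform continuity then yield
  uniform difference quotients.\<close>

lemma uniformly_differentiable_weightI:
 fixes G :: "real \<times> real \<times> real => real"
 assumes ab: "a < t" "t < b" and ij: "continuous_on {a..b} i" "continuous_on {a..b} j"
  and c: "!!s. continuous_on {0..1} (%r. c r s)"
  and d: "!!r s. a <= s ==> s <= b ==> ((%s. c r s) has_real_derivative G (r, i s, j s)) (at s)"
  and G: "continuous_on UNIV G"
 shows "uniformly_differentiable_weight c (%r. G (r, i t, j t)) t"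
 unfolding uniformly_differentiable_weight_def
proof (intro conjI allI impI c)
 show "continuous_on {0..1} (%r. G (r, i t, j t))"
  by (rule continuous_on_compose2[OF G]) (auto intro!: continuous_intros)
 fix e :: real assume e: "0 < e"
 let ?K = "{0..1::real} \<times> {a..b}" and ?H = "%x. G (fst x, i (snd x), j (snd x))"
 have "continuous_on ?K (%x. i (snd x))" "continuous_on ?K (%x. j (snd x))"
  by (rule continuous_on_compose2[OF ij(1)], auto intro!: continuous_intros)
    (rule continuous_on_compose2[OF ij(2)], auto intro!: continuous_intros)
 then have "continuous_on ?K ?H"
  by (intro continuous_on_compose2[OF G]) (auto intro!: continuous_intros)
 then have "uniformly_continuous_on ?K ?H"
  by (intro compact_uniformly_continuous compact_Times) auto
 then obtain \<delta> where \<delta>: "\<delta> > 0" "!!x y. x \<in> ?K ==> y \<in> ?K ==> dist x y < \<delta> ==> dist (?H x) (?H y) < e"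
  unfolding uniformly_continuous_on_def using e by (metis dist_commute)
 have close: "\<bar>G (r, i \<xi>, j \<xi>) - G (r, i t, j t)\<bar> <= e"
  if "0 < r" "r < 1" "\<bar>\<xi> - t\<bar> < \<delta>" "a <= \<xi>" "\<xi> <= b" for r \<xi>
  using \<delta>(2)[of "(r, \<xi>)" "(r, t)"] that ab by (auto simp: dist_Pair_Pair dist_real_def)
 have "eventually (%s. s ~= t & a < s & s < b & \<bar>s - t\<bar> < \<delta>) (at t within {0..})"
 proof -
  have "eventually (%s. s \<in> {a<..<b} \<inter> {t - \<delta><..<t + \<delta>}) (at t within {0..})"
   using ab \<delta>(1) by (intro eventually_at_in_open' eventually_at_topological[THEN iffD2] exI[of _ "{a<..<b} \<inter> {t - \<delta><..<t + \<delta>}"]) auto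
  moreover have "eventually (%s. s ~= t) (at t within {0..})" by (auto simp: eventually_at_filter)
  ultimately show ?thesis by eventually_elim auto
 qed
 then show "eventually (%s. \<forall>r. 0 < r --> r < 1 --> \<bar>(c r s - c r t) / (s - t) - G (r, i t, j t)\<bar> <= e) (at t within {0..})"
 proof eventually_elim
  case (elim s)
  show ?case
  proof (intro allI impI)
   fix r :: real assume r: "0 < r" "r < 1"
   have "\<exists>\<xi>. min s t <= \<xi> & \<xi> <= max s t & c r s - c r t = (s - t) * G (r, i \<xi>, j \<xi>)"
   proof (cases "s < t")
    case True
    obtain \<xi> where "s < \<xi>" "\<xi> < t" "c r t - c r s = (t - s) * G (r, i \<xi>, j \<xi>)"
     using MVT2[OF True, of "c r" "%s. G (r, i s, j s)"] d[of _ r] elim ab by auto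
    then show ?thesis by (intro exI[of _ \<xi>]) (auto simp: algebra_simps)
   next
    case False
    then have "t < s" using elim by simp
    then obtain \<xi> where "t < \<xi>" "\<xi> < s" "c r s - c r t = (s - t) * G (r, i \<xi>, j \<xi>)"
     using MVT2[of t s "c r" "%s. G (r, i s, j s)"] d[of _ r] elim ab by auto
    then show ?thesis by (intro exI[of _ \<xi>]) auto
   qed
   then obtain \<xi> where \<xi>: "min s t <= \<xi>" "\<xi> <= max s t" "c r s - c r t = (s - t) * G (r, i \<xi>, j \<xi>)" by blast
   then have "(c r s - c r t) / (s - t) = G (r, i \<xi>, j \<xi>)" using elim by simp
   then show "\<bar>(c r s - c r t) / (s - t) - G (r, i t, j t)\<bar> <= e"
    using close[OF r, of \<xi>] \<xi>(1,2) elim ab by (auto simp: min_def max_def split: if_splits)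
  qed
 qed
qed

lemma weighted_integral_continuous:
 fixes f h :: "real => real => real"
 assumes f: "L2lim (rmeas N) (%s r. f r s) (%r. f r t) (at t within {0..})"
  and h: "L2lim (rmeas N) (%s r. h r s) (%r. h r t) (at t within {0..})"
  and c: "uniformly_differentiable_weight c c' t"
 shows "((%s. \<integral>r. c r s * (f r s * h r s) \<partial>rmeas N) \<longlongrightarrow> (LINT r|rmeas N. c r t * (f r t * h r t))) (at t within {0..})"
proof -
 have cc: "!!s. continuous_on {0..1} (%r. c r s)" "continuous_on {0..1} c'"
  using c unfolding uniformly_differentiable_weight_def by auto
 obtain B where B: "!!x. 0 <= x ==> x <= 1 ==> \<bar>c x t\<bar> <= B" using bounded_unit_interval[OF cc(1)] by blast
 obtain B' where B': "!!x. 0 <= x ==> x <= 1 ==> \<bar>c' x\<bar> <= B'" using bounded_unit_interval[OF cc(2)] by blast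
 have ev1: "eventually (%s. \<forall>r. 0 < r --> r < 1 --> \<bar>(c r s - c r t) / (s - t) - c' r\<bar> <= 1) (at t within {0..})"
  using c[unfolded uniformly_differentiable_weight_def, THEN conjunct2, THEN conjunct2, rule_format, of 1] by simp
 have L: "L2lim (rmeas N) (%s r. c r s * f r s) (%r. c r t * f r t) (at t within {0..})"
 proof (rule L2lim_weight[OF f, of "%s r. c r s", where e="%s. \<bar>s - t\<bar> * (B' + 1)"])
  show "eventually (%s. \<forall>r\<in>space (rmeas N). \<bar>c r s - c r t\<bar> <= \<bar>s - t\<bar> * (B' + 1)) (at t within {0..})"
   using ev1 strong_solution_eventually
  proof eventually_elim
   case (elim s)
   show ?case
   proof
    fix r assume "r \<in> space (rmeas N)"
    then have r: "0 < r" "r < 1" by auto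
    have "\<bar>(c r s - c r t) / (s - t) - c' r\<bar> <= 1" using elim r by blast
    moreover have "\<bar>c' r\<bar> <= B'" using B'[of r] r by simp
    ultimately have "\<bar>(c r s - c r t) / (s - t)\<bar> <= B' + 1" by linarith
    then have "\<bar>s - t\<bar> * \<bar>(c r s - c r t) / (s - t)\<bar> <= \<bar>s - t\<bar> * (B' + 1)" by (intro mult_left_mono) auto
    then show "\<bar>c r s - c r t\<bar> <= \<bar>s - t\<bar> * (B' + 1)" using elim by simp
   qed
  qed
  have "((%s. \<bar>s - t\<bar> * (B' + 1)) \<longlongrightarrow> \<bar>t - t\<bar> * (B' + 1)) (at t within {0..})" by (intro tendsto_intros)
  then show "((%s. \<bar>s - t\<bar> * (B' + 1)) \<longlongrightarrow> 0) (at t within {0..})" by simp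
  show "\<bar>c x t\<bar> <= B" if "x \<in> space (rmeas N)" for x using B[of x] that by simp
 qed (rule continuous_rmeas_Icc[OF cc(1)])+
 show ?thesis using L2lim_times[OF L h] by (simp only: mult.assoc)
qed

section \<open>Elementary bounds for functions of the unknown\<close>

lemma C1_on_range_Lipschitz:
 assumes d: "!!x. (\<Phi> has_real_derivative \<Phi>' x) (at x)" and c: "continuous_on UNIV \<Phi>'"
  and L: "!!x y. \<bar>x\<bar> <= C ==> \<bar>y\<bar> <= C ==> \<bar>\<Phi>' x - \<Phi>' y\<bar> <= L * \<bar>x - y\<bar>"
  and B: "!!x. \<bar>x\<bar> <= C ==> \<bar>\<Phi>' x\<bar> <= L"
 shows "C1_on_range \<Phi> \<Phi>' C L"
proof -
 have mv: "\<exists>\<xi>. \<bar>\<xi>\<bar> <= C & \<bar>\<xi> - b\<bar> <= \<bar>a - b\<bar> & \<Phi> a - \<Phi> b = \<Phi>' \<xi> * (a - b)" if ab: "\<bar>a\<bar> <= C" "\<bar>b\<bar> <= C" for a b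
 proof -
  consider "a < b" | "a = b" | "b < a" by linarith
  then show ?thesis
  proof cases
   case 1
   obtain \<xi> where "a < \<xi>" "\<xi> < b" "\<Phi> b - \<Phi> a = (b - a) * \<Phi>' \<xi>" using MVT2[OF 1, of \<Phi> \<Phi>'] d by blast
   then show ?thesis using ab by (intro exI[of _ \<xi>]) (auto simp: algebra_simps)
  next
   case 2 then show ?thesis using ab by auto
  next
   case 3
   obtain \<xi> where "b < \<xi>" "\<xi> < a" "\<Phi> a - \<Phi> b = (a - b) * \<Phi>' \<xi>" using MVT2[OF 3, of \<Phi> \<Phi>'] d by blast
   then show ?thesis using ab by (intro exI[of _ \<xi>]) (auto simp: algebra_simps)
  qed
 qed
 show ?thesis
  unfolding C1_on_range_def
 proof (intro conjI allI impI d c)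
  fix a b assume ab: "\<bar>a\<bar> <= C" "\<bar>b\<bar> <= C"
  obtain \<xi> where x: "\<bar>\<xi>\<bar> <= C" "\<bar>\<xi> - b\<bar> <= \<bar>a - b\<bar>" "\<Phi> a - \<Phi> b = \<Phi>' \<xi> * (a - b)" using mv[OF ab] by blast
  have L0: "0 <= L" using B[OF ab(1)] by simp
  have "\<bar>\<Phi> a - \<Phi> b - \<Phi>' b * (a - b)\<bar> = \<bar>\<Phi>' \<xi> - \<Phi>' b\<bar> * \<bar>a - b\<bar>" unfolding x(3) by (simp flip: left_diff_distrib abs_mult)
  also have "\<dots> <= (L * \<bar>a - b\<bar>) * \<bar>a - b\<bar>"
   using order_trans[OF L[OF x(1) ab(2)] mult_left_mono[OF x(2) L0]] by (rule mult_right_mono) simp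
  finally show "\<bar>\<Phi> a - \<Phi> b - \<Phi>' b * (a - b)\<bar> <= L * (a - b)^2" by (simp add: power2_eq_square mult.assoc)
  show "\<bar>\<Phi> a - \<Phi> b\<bar> <= L * \<bar>a - b\<bar>" unfolding x(3) abs_mult by (intro mult_right_mono B x(1)) simp
 qed
qed

text \<open>Compactness: on the points of \<open>[-C, C]\<close> at distance at least
  \<open>\<eta>\<close> from \<open>\<sigma>\<close> the function \<open>h\<close> has a positive
  minimum, and \<open>K\<close> is a bound for the distance divided by this minimum.\<close>

lemma distance_from_zero:
 fixes h :: "real => real"
 assumes h: "continuous_on UNIV h" "!!x. 0 <= h x" "!!x. x ~= \<sigma> ==> 0 < h x" and \<eta>: "0 < \<eta>"
 shows "\<exists>K\<ge>0. \<forall>x. \<bar>x\<bar> <= C --> \<bar>x - \<sigma>\<bar> <= \<eta> + K * h x"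
proof -
 let ?S = "{-C..C} \<inter> {x. \<eta> <= \<bar>x - \<sigma>\<bar>}"
 show ?thesis
 proof (cases "?S = {}")
  case True
  show ?thesis
  proof (intro exI[of _ 0] conjI allI impI)
   fix x :: real assume "\<bar>x\<bar> <= C"
   then have "x \<in> {-C..C}" by auto
   then have "x \<notin> {x. \<eta> <= \<bar>x - \<sigma>\<bar>}" using True by blast
   then show "\<bar>x - \<sigma>\<bar> <= \<eta> + 0 * h x" by simp
  qed simp
 next
  case False
  have "closed {x. \<eta> <= \<bar>x - \<sigma>\<bar>}" by (intro closed_Collect_le continuous_intros)
  then have "compact ?S" by (intro compact_Int_closed) auto
  then obtain m where m: "m \<in> ?S" "!!x. x \<in> ?S ==> h m <= h x"
   using continuous_attains_inf[OF _ False continuous_on_subset[OF h(1)]] by blast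
  have hm: "0 < h m" using m(1) \<eta> by (intro h(3)) auto
  have C: "0 <= C" using m(1) by simp
  show ?thesis
  proof (intro exI[of _ "(C + \<bar>\<sigma>\<bar>) / h m"] conjI allI impI)
   fix x :: real assume x: "\<bar>x\<bar> <= C"
   have K: "0 <= (C + \<bar>\<sigma>\<bar>) / h m" using hm C by (intro divide_nonneg_pos) auto
   show "\<bar>x - \<sigma>\<bar> <= \<eta> + (C + \<bar>\<sigma>\<bar>) / h m * h x"
   proof (cases "\<eta> <= \<bar>x - \<sigma>\<bar>")
    case True
    then have "h m <= h x" using x by (intro m(2)) auto
    then have "(C + \<bar>\<sigma>\<bar>) / h m * h m <= (C + \<bar>\<sigma>\<bar>) / h m * h x" by (intro mult_left_mono K)
    moreover have "\<bar>x - \<sigma>\<bar> <= (C + \<bar>\<sigma>\<bar>) / h m * h m" using x hm by simp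
    ultimately show ?thesis using \<eta> by linarith
   next
    case False
    then show ?thesis using mult_nonneg_nonneg[OF K h(2)[of x]] by linarith
   qed
  qed (use hm C in simp)
 qed
qed

subsection \<open>Double-well potentials\<close>

locale double_well =
 fixes F F' F'' :: "real => real"
 assumes DF: "!!s. (F has_real_derivative F' s) (at s)"
  and DF': "!!s. (F' has_real_derivative F'' s) (at s)"
  and F''_cont: "continuous_on UNIV F''"
  and F_zero: "F (-1) = 0" "F 1 = 0"
  and F_pos: "!!s. s ~= -1 ==> s ~= 1 ==> 0 < F s"
begin

lemma F_nonneg: "0 <= F s"
 using F_pos[of s] F_zero by (cases "s = -1"; cases "s = 1") auto

lemma F_cont: "continuous_on S F" "continuous_on S F'"
 using DF DF' by (meson DERIV_isCont continuous_at_imp_continuous_on)+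

text \<open>Clamping the argument makes the primitive constant beyond the wells, so
  \<open>well_potential\<close> takes values in \<open>[0, min_energy F]\<close> even where the
  solution leaves \<open>[-1, 1]\<close>. The price is that \<open>well_speed_sq\<close> is an
  inequality.\<close>

definition well_speed :: "real => real" where
 "well_speed s = sqrt (2 * F (max (-1) (min 1 s)))"

lemma well_speed_nonneg: "0 <= well_speed s"
 by (simp add: well_speed_def F_nonneg)

lemma well_speed_sq: "(well_speed s)^2 <= 2 * F s"
proof (cases "-1 <= s & s <= 1")
 case True
 then have "max (-1) (min 1 s) = s" by simp
 then show ?thesis by (simp add: well_speed_def F_nonneg)
next
 case False
 then have "max (-1) (min 1 s) = -1 \<or> max (-1) (min 1 s) = 1" by auto
 then have "well_speed s = 0" unfolding well_speed_def using F_zero by auto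
 then show ?thesis by (simp add: F_nonneg)
qed

lemma well_speed_cont: "continuous_on S well_speed"
 unfolding well_speed_def by (intro continuous_intros continuous_on_compose2[OF F_cont(1)[of UNIV]]) auto

text \<open>A nonnegative function with second derivative bounded by \<open>M\<close> satisfies \<open>F'\<^sup>2 <= 2 M F\<close>;
 hence \<open>sqrt F\<close> is Lipschitz although \<open>F\<close> vanishes at the wells.\<close>

lemma gradient_inequality: "\<exists>M\<ge>1. \<forall>s. \<bar>s\<bar> <= 1 --> (F' s)\<^sup>2 <= 2 * M * F s"
proof -
 have "compact (F'' ` {-2..2})" "compact (F' ` {-2..2})"
  by (intro compact_continuous_image continuous_on_subset[OF F''_cont] F_cont; simp)+
 then have "bounded (F'' ` {-2..2})" "bounded (F' ` {-2..2})" by (auto dest: compact_imp_bounded)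
 then obtain M1 M2 where M12: "!!s. s \<in> {-2..2} ==> \<bar>F'' s\<bar> <= M1" "!!s. s \<in> {-2..2} ==> \<bar>F' s\<bar> <= M2"
  unfolding bounded_iff by (metis imageI real_norm_def)
 define M where "M = max 1 (max M1 M2)"
 have M: "1 <= M" "!!s. s \<in> {-2..2} ==> F'' s <= M" "!!s. s \<in> {-2..2} ==> \<bar>F' s\<bar> <= M"
  using M12 unfolding M_def by (auto simp: le_max_iff_disj dest: abs_le_D1)
 show ?thesis
 proof (intro exI[of _ M] conjI allI impI M(1))
  fix s :: real assume s: "\<bar>s\<bar> <= 1"
  \<comment> \<open>The minimiser of the quadratic upper bound
    \<open>F s + F' s * h + M * h^2 / 2\<close>. As \<open>M\<close> also bounds \<open>F'\<close>,
    the step has length at most \<open>1\<close> and \<open>s + h\<close> stays in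
    \<open>[-2, 2]\<close>, where \<open>M\<close> bounds \<open>F''\<close>.\<close>
  define h where "h = - F' s / M"
  have h: "\<bar>h\<bar> <= 1" using M(1) M(3)[of s] s by (auto simp: h_def abs_le_iff)
  have "F (s + h) <= F s + F' s * h + M * h^2 / 2"
  proof (cases "h = 0")
   case False
   define D where "D m = (if m = 0 then F else if m = 1 then F' else F'')" for m :: nat
   have bs: "-2 <= s" "s <= 2" "-2 <= s + h" "s + h <= 2" "h ~= 0" using h s False by linarith+
   have DD: "\<forall>m t. m < 2 & -2 <= t & t <= 2 --> (D m has_real_derivative D (Suc m) t) (at t)"
    using DF DF' by (auto simp: D_def less_2_cases_iff)
   obtain \<xi> where x: "(if s + h < s then s + h < \<xi> & \<xi> < s else s < \<xi> & \<xi> < s + h)"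
     "F (s + h) = (\<Sum>m<2. (D m s / fact m) * (s + h - s) ^ m) + (D 2 \<xi> / fact 2) * (s + h - s) ^ 2"
    using Taylor[OF _ _ DD, of F s "s + h"] bs by (auto simp: D_def)
   have "F'' \<xi> <= M" using x(1) s h by (intro M(2)) (auto split: if_splits)
   then have "F'' \<xi> * h^2 <= M * h^2" by (rule mult_right_mono) simp
   moreover have "F (s + h) = F s + F' s * h + F'' \<xi> * h^2 / 2"
    using x(2) by (simp add: D_def numeral_2_eq_2)
   ultimately show ?thesis by linarith
  qed simp
  moreover have "F' s * h + M * h^2 / 2 = - ((F' s)^2 / (2 * M))"
   using M(1) by (simp add: h_def field_simps power2_eq_square)
  ultimately have "(F' s)^2 / (2 * M) <= F s" using F_nonneg[of "s + h"] by linarith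
  then show "(F' s)^2 <= 2 * M * F s" using M(1) by (simp add: field_simps)
 qed
qed

text \<open>Strictly between the wells the derivative \<open>F' / sqrt (2 * F)\<close> is at most
  \<open>sqrt M\<close> in absolute value by \<open>gradient_inequality\<close>. The mean value
  theorem differentiates only inside the segment, so the wells may be its end points; clamping does
  not increase distances.\<close>

lemma well_speed_Lipschitz: "\<exists>L\<ge>0. \<forall>x y. \<bar>well_speed x - well_speed y\<bar> <= L * \<bar>x - y\<bar>"
proof -
 obtain M where M: "1 <= M" "!!s. \<bar>s\<bar> <= 1 ==> (F' s)\<^sup>2 <= 2 * M * F s" using gradient_inequality by blast
 have seg: "\<bar>sqrt (2 * F y) - sqrt (2 * F x)\<bar> <= sqrt M * (y - x)" if xy: "-1 <= x" "x < y" "y <= 1" for x y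
 proof -
  let ?f = "%s. sqrt (2 * F s)" and ?f' = "%s. F' s / sqrt (2 * F s)"
  have D: "(?f has_real_derivative ?f' s) (at s)" if "x < s" "s < y" for s
  proof -
   have p: "0 < F s" using that xy by (intro F_pos) auto
   have g: "((%s. 2 * F s) has_real_derivative 2 * F' s) (at s)" by (intro DERIV_cmult DF)
   have pp: "0 < 2 * F s" using p by simp
   have "(?f has_real_derivative inverse (sqrt (2 * F s)) / 2 * (2 * F' s)) (at s)"
    by (rule DERIV_chain2[where f=sqrt and g="%s. 2 * F s", OF DERIV_real_sqrt[OF pp] g])
   moreover have "inverse a / 2 * (2 * b) = b / a" for a b :: real by (simp add: inverse_eq_divide)
   ultimately show ?thesis by (simp only:)
  qed
  have cf: "continuous_on {x..y} ?f" by (intro continuous_intros F_cont)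
  have df: "?f differentiable (at s)" if "x < s" "s < y" for s
   using D[OF that] unfolding real_differentiable_def by (rule exI)
  from MVT[OF xy(2) cf df] obtain l z where z: "x < z" "z < y" "(?f has_real_derivative l) (at z)" "?f y - ?f x = (y - x) * l" by blast
  have l: "l = ?f' z" using DERIV_unique[OF z(3) D[OF z(1,2)]] .
  have p: "0 < F z" using z xy by (intro F_pos) auto
  have "\<bar>F' z\<bar> <= sqrt (M * (2 * F z))" using M(2)[of z] z xy by (intro real_le_rsqrt) (auto simp: mult_ac)
  then have "\<bar>l\<bar> <= sqrt M" unfolding l using p by (simp add: real_sqrt_mult field_simps)
  then have "(y - x) * \<bar>l\<bar> <= (y - x) * sqrt M" using xy by (intro mult_left_mono) auto
  then show ?thesis unfolding z(4) abs_mult using xy by (simp add: mult.commute)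
 qed
 have seg': "\<bar>sqrt (2 * F x) - sqrt (2 * F y)\<bar> <= sqrt M * \<bar>x - y\<bar>" if xy: "-1 <= x" "x <= 1" "-1 <= y" "y <= 1" for x y
 proof (cases x y rule: linorder_cases)
  case less
  then have "\<bar>x - y\<bar> = y - x" by simp
  then show ?thesis using seg[OF xy(1) less xy(4)] by (simp only: abs_minus_commute)
 next
  case greater
  then have "\<bar>x - y\<bar> = x - y" by simp
  then show ?thesis using seg[OF xy(3) greater xy(2)] by simp
 qed simp
 have "\<bar>well_speed x - well_speed y\<bar> <= sqrt M * \<bar>x - y\<bar>" for x y
 proof -
  let ?x = "max (-1) (min 1 x)" and ?y = "max (-1) (min 1 y)"
  have "\<bar>sqrt (2 * F ?x) - sqrt (2 * F ?y)\<bar> <= sqrt M * \<bar>?x - ?y\<bar>"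
   by (rule seg') auto
  also have "\<dots> <= sqrt M * \<bar>x - y\<bar>" using M(1) by (intro mult_left_mono) auto
  finally show ?thesis unfolding well_speed_def .
 qed
 then show ?thesis using M(1) by (intro exI[of _ "sqrt M"]) auto
qed

lemma well_potential_exists:
 "\<exists>W. (\<forall>x. (W has_real_derivative well_speed x) (at x)) & W (-1) = 0"
proof -
 have "\<exists>G. \<forall>x. -\<infinity> < ereal x --> ereal x < \<infinity> --> (G has_vector_derivative well_speed x) (at x)"
  by (rule einterval_antiderivative) (use well_speed_cont[of UNIV] in \<open>auto simp: continuous_on_eq_continuous_at\<close>)
 then obtain G where "!!x. (G has_real_derivative well_speed x) (at x)"
  by (auto simp: has_real_derivative_iff_has_vector_derivative)
 then show ?thesis by (intro exI[of _ "%x. G x - G (-1)"]) (auto intro!: derivative_eq_intros)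
qed

definition well_potential :: "real => real" where
 "well_potential = (SOME W. (\<forall>x. (W has_real_derivative well_speed x) (at x)) & W (-1) = 0)"

lemma well_potential: "(well_potential has_real_derivative well_speed x) (at x)" "well_potential (-1) = 0"
 using someI_ex[OF well_potential_exists] unfolding well_potential_def by auto

lemma well_potential_mono: "x <= y ==> well_potential x <= well_potential y"
 by (rule DERIV_nonneg_imp_nondecreasing) (use well_potential(1) well_speed_nonneg in blast)+

lemma well_potential_const:
 assumes "!!s. x <= s ==> s <= y ==> well_speed s = 0" "x <= y" shows "well_potential x = well_potential y"
proof -
 have "well_potential y <= well_potential x"
 proof (rule DERIV_nonpos_imp_nonincreasing[OF assms(2)])
  fix s assume "x <= s" "s <= y"
  then show "\<exists>l. (well_potential has_real_derivative l) (at s) & l <= 0"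
   using well_potential(1)[of s] assms(1)[of s] by (intro exI[of _ "well_speed s"]) auto
 qed
 then show ?thesis using well_potential_mono[OF assms(2)] by simp
qed

lemma well_potential_left: "x <= -1 ==> well_potential x = 0"
 using well_potential_const[of x "-1"] well_potential(2) F_zero by (simp add: well_speed_def)

lemma well_potential_1: "well_potential 1 = min_energy F"
proof -
 have c: "continuous_on {-1..1} (%s. sqrt (2 * F s))" by (intro continuous_intros F_cont)
 have "(well_speed has_integral (well_potential 1 - well_potential (-1))) {-1..1}"
  by (rule fundamental_theorem_of_calculus)
    (auto intro: has_field_derivative_at_within well_potential(1) simp flip: has_real_derivative_iff_has_vector_derivative)
 then have "((%s. sqrt (2 * F s)) has_integral well_potential 1) {-1..1}"
  unfolding well_potential(2) diff_zero
  by (rule has_integral_eq[rotated]) (simp add: well_speed_def)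
 then show ?thesis unfolding min_energy_def
  using lebesgue_integral_eq_integral[OF continuous_imp_integrable_real[OF c]] by (simp add: integral_unique)
qed

lemma well_potential_right: "1 <= x ==> well_potential x = min_energy F"
 using well_potential_const[of 1 x] well_potential_1 F_zero by (simp add: well_speed_def)

lemma well_potential_range: "0 <= well_potential x" "well_potential x <= min_energy F"
 using well_potential_mono[of "min x (-1)" x] well_potential_left[of "min x (-1)"]
  well_potential_mono[of x "max x 1"] well_potential_right[of "max x 1"] by auto

lemma min_energy_pos: "0 < min_energy F"
proof -
 have "well_potential (-1) < well_potential 1"
 proof (rule DERIV_pos_imp_increasing_open[of "-1" 1 well_potential])
  show "continuous_on {-1..1} well_potential"
   using well_potential(1) by (meson DERIV_isCont continuous_at_imp_continuous_on)
  fix x :: real assume "-1 < x" "x < 1"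
  then show "\<exists>y. (well_potential has_real_derivative y) (at x) & 0 < y"
   using well_potential(1)[of x] F_pos[of x] by (intro exI[of _ "well_speed x"]) (auto simp: well_speed_def)
 qed simp
 then show ?thesis using well_potential(2) well_potential_1 by simp
qed

lemma C1_on_range_F: "\<exists>K. C1_on_range F F' C K"
proof -
 have "compact (F'' ` {-C..C})" "compact (F' ` {-C..C})"
  by (intro compact_continuous_image continuous_on_subset[OF F''_cont] F_cont; simp)+
 then have "bounded (F'' ` {-C..C})" "bounded (F' ` {-C..C})" by (auto dest: compact_imp_bounded)
 then obtain M1 M2 where M: "!!s. s \<in> {-C..C} ==> \<bar>F'' s\<bar> <= M1" "!!s. s \<in> {-C..C} ==> \<bar>F' s\<bar> <= M2"
  unfolding bounded_iff by (metis imageI real_norm_def)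
 have "C1_on_range F F' C (max M1 M2)"
 proof (rule C1_on_range_Lipschitz[OF DF F_cont(2)])
  fix x y assume xy: "\<bar>x\<bar> <= C" "\<bar>y\<bar> <= C"
  have "norm (F' x - F' y) <= M1 * norm (x - y)"
   by (rule field_differentiable_bound[of "{-C..C}" F' F''])
     (use xy M(1) has_field_derivative_at_within[OF DF'] in auto)
  also have "\<dots> <= max M1 M2 * norm (x - y)" by (intro mult_right_mono) auto
  finally show "\<bar>F' x - F' y\<bar> <= max M1 M2 * \<bar>x - y\<bar>" by simp
 next
  fix x assume "\<bar>x\<bar> <= C"
  then have "x \<in> {-C..C}" by auto
  then show "\<bar>F' x\<bar> <= max M1 M2" using M(2)[of x] by simp
 qed
 then show ?thesis by blast
qed

lemma C1_on_range_well_potential: "\<exists>K. C1_on_range well_potential well_speed C K"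
proof -
 obtain L where L: "0 <= L" "!!x y. \<bar>well_speed x - well_speed y\<bar> <= L * \<bar>x - y\<bar>" using well_speed_Lipschitz by blast
 have "C1_on_range well_potential well_speed C (max L (L * (\<bar>C\<bar> + 1)))"
 proof (rule C1_on_range_Lipschitz[OF well_potential(1) well_speed_cont])
  show "\<bar>well_speed x - well_speed y\<bar> <= max L (L * (\<bar>C\<bar> + 1)) * \<bar>x - y\<bar>" for x y
   by (rule order_trans[OF L(2)]) (intro mult_right_mono, auto)
  fix x assume "\<bar>x\<bar> <= C"
  then have "L * \<bar>x - 1\<bar> <= L * (\<bar>C\<bar> + 1)" using L(1) by (intro mult_left_mono) auto
  moreover have "well_speed 1 = 0" by (simp add: well_speed_def F_zero)
  ultimately show "\<bar>well_speed x\<bar> <= max L (L * (\<bar>C\<bar> + 1))" using L(2)[of x 1] by auto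
 qed
 then show ?thesis by blast
qed

text \<open>\<open>F\<close> alone cannot tell the two wells apart, and
  \<open>well_potential\<close> alone does not see how far a value lies outside
  \<open>[-1, 1]\<close>. Each sum vanishes at exactly one well.\<close>

lemma distance_from_wells:
 assumes "0 < \<eta>"
 shows "\<exists>K\<ge>0. \<forall>x. \<bar>x\<bar> <= C --> \<bar>x + 1\<bar> <= \<eta> + K * (\<bar>well_potential x\<bar> + F x)"
  "\<exists>K\<ge>0. \<forall>x. \<bar>x\<bar> <= C --> \<bar>x - 1\<bar> <= \<eta> + K * (\<bar>well_potential x - min_energy F\<bar> + F x)"
proof -
 have c: "continuous_on UNIV well_potential"
  using well_potential(1) by (meson DERIV_isCont continuous_at_imp_continuous_on)
 have "\<exists>K\<ge>0. \<forall>x. \<bar>x\<bar> <= C --> \<bar>x - - 1\<bar> <= \<eta> + K * (\<bar>well_potential x\<bar> + F x)"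
 proof (rule distance_from_zero)
  fix x :: real assume "x ~= -1"
  then show "0 < \<bar>well_potential x\<bar> + F x"
   using F_pos[of x] F_zero well_potential_1 min_energy_pos by (cases "x = 1") (auto intro: add_nonneg_pos)
 qed (use F_nonneg assms c in \<open>auto intro!: continuous_intros F_cont\<close>)
 then show "\<exists>K\<ge>0. \<forall>x. \<bar>x\<bar> <= C --> \<bar>x + 1\<bar> <= \<eta> + K * (\<bar>well_potential x\<bar> + F x)" by simp
 show "\<exists>K\<ge>0. \<forall>x. \<bar>x\<bar> <= C --> \<bar>x - 1\<bar> <= \<eta> + K * (\<bar>well_potential x - min_energy F\<bar> + F x)"
 proof (rule distance_from_zero)
  fix x :: real assume "x ~= 1"
  then show "0 < \<bar>well_potential x - min_energy F\<bar> + F x"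
   using F_pos[of x] F_zero well_potential(2) min_energy_pos by (cases "x = -1") (auto intro: add_nonneg_pos)
 qed (use F_nonneg assms c in \<open>auto intro!: continuous_intros F_cont\<close>)
qed

end

subsection \<open>Weights adapted to the moving interface\<close>

text \<open>The weights below are written in terms of \<open>i = 1/\<rho>\<close> and \<open>j = 1/(1 - \<rho>)\<close>, so that they are
 polynomial up to exponentials. Here \<open>r ^ N * wt_g\<close> is the paper's weight centred at \<open>\<rho>\<close>, and
 \<open>r * wt_d\<close> is a velocity field that agrees with the interface velocity \<open>- N/\<rho>\<close> up to
 third order at \<open>r = \<rho>\<close> and vanishes at \<open>r = 0\<close> and \<open>r = 1\<close>. The suffix \<open>r\<close> or \<open>t\<close> marks
 derivatives, and \<open>wt_a\<close> is the logarithmic time derivative of \<open>wt_g\<close>.\<close>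

definition wt_g :: "nat => real => real => real" where
 "wt_g N i r = i ^ N * exp (real N * (1 - r * i))"

definition wt_q :: "real => real => real => real" where
 "wt_q i j r = r * (1 - r) * (i * j)"

definition wt_d :: "nat => real => real => real => real" where
 "wt_d N i j r = - real N * i * ((1 - r) * (i * j)) * (3 - 3 * wt_q i j r + (wt_q i j r)^2)"

definition wt_br :: "nat => real => real => real => real" where
 "wt_br N i j r = - real N * i * (3 * (1 - wt_q i j r)^2 * ((1 - 2 * r) * (i * j)))"

definition wt_bt :: "nat => real => real => real => real" where
 "wt_bt N i j r = - real N * (real N * i ^ 3 * (1 - (1 - wt_q i j r) ^ 3)
   + i * (3 * (1 - wt_q i j r)^2 * (r * (1 - r) * (real N * i ^ 3 * j - real N * i^2 * j^2))))"

definition wt_a :: "nat => real => real => real" where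
 "wt_a N i r = (real N)^2 * i^2 * (1 - r * i)"

text \<open>The divergence of the calibration relative to the weight:
  \<open>r ^ N * wt_g * wt_w\<close> is the \<open>r\<close>-derivative of
  \<open>r ^ N * wt_g * (r * wt_m)\<close>, which is the power \<open>N + 1\<close> of
  \<open>r * i * exp (1 - r * i)\<close>. It changes sign at the interface, where that power has its
  maximum \<open>1\<close>.\<close>

definition wt_w :: "nat => real => real => real" where
 "wt_w N i r = (real N + 1) * (1 - r * i) * exp (1 - r * i) * i"

definition wt_wt :: "nat => real => real => real" where
 "wt_wt N i r = (real N + 1) * real N * i ^ 3 * exp (1 - r * i) * ((real N + 1) * (1 - r * i)^2 - r * i)"

definition wt_m :: "real => real => real" where
 "wt_m i r = i * exp (1 - r * i)"

definition wt_mt :: "nat => real => real => real" where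
 "wt_mt N i r = real N * (real N + 1) * (1 - r * i) * exp (1 - r * i) * i ^ 3"

lemma wt_velocity: "r * wt_d N i j r = - real N * i * (1 - (1 - wt_q i j r) ^ 3)"
 unfolding wt_d_def wt_q_def by algebra

lemma wt_continuous:
 fixes f :: "'a::topological_space => real"
 assumes "continuous_on S f" "continuous_on S I"
 shows "continuous_on S (%x. wt_g N (I x) (f x))" "continuous_on S (%x. wt_a N (I x) (f x))"
  "continuous_on S (%x. wt_w N (I x) (f x))" "continuous_on S (%x. wt_wt N (I x) (f x))"
  "continuous_on S (%x. wt_m (I x) (f x))" "continuous_on S (%x. wt_mt N (I x) (f x))"
 unfolding wt_g_def wt_a_def wt_w_def wt_wt_def wt_m_def wt_mt_def
 by (intro continuous_intros assms)+

lemma wt_continuous2: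
 fixes f :: "'a::topological_space => real"
 assumes "continuous_on S f" "continuous_on S I" "continuous_on S J"
 shows "continuous_on S (%x. wt_d N (I x) (J x) (f x))" "continuous_on S (%x. wt_br N (I x) (J x) (f x))"
  "continuous_on S (%x. wt_bt N (I x) (J x) (f x))"
 unfolding wt_q_def wt_d_def wt_br_def wt_bt_def
 by (intro continuous_intros assms)+

lemma wt_g_deriv_r: "((%r. wt_g N i r) has_real_derivative - real N * i * wt_g N i r) (at r)"
 unfolding wt_g_def by (auto intro!: derivative_eq_intros)

lemma wt_exp_deriv_r: "((%r. exp (1 - r * i)) has_real_derivative - i * exp (1 - r * i)) (at (r::real))"
 by (auto intro!: derivative_eq_intros)

lemma wt_line_deriv_r: "((%r. 1 - r * i) has_real_derivative - i) (at (r::real))"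
 by (auto intro!: derivative_eq_intros)

lemma wt_velocity_deriv_r: "((%r. r * wt_d N i j r) has_real_derivative wt_br N i j r) (at r)"
proof -
 have q: "((%r. wt_q i j r) has_real_derivative (1 - 2 * r) * (i * j)) (at r)"
  unfolding wt_q_def by (auto intro!: derivative_eq_intros)
 have q3: "((%r. 1 - (1 - wt_q i j r) ^ 3) has_real_derivative 3 * (1 - wt_q i j r)^2 * ((1 - 2 * r) * (i * j))) (at r)"
  by (rule DERIV_cong[OF DERIV_diff[OF DERIV_const DERIV_power[OF DERIV_diff[OF DERIV_const q]]]]) (simp add: numeral_3_eq_3 power2_eq_square)
 show ?thesis unfolding wt_velocity wt_br_def by (rule DERIV_cmult[OF q3])
qed

lemma C1_weight_g: "C1_weight (%r. wt_g N i r) (%r. - real N * i * wt_g N i r)"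
 unfolding C1_weight_def by (intro conjI allI impI wt_g_deriv_r continuous_intros wt_continuous)

lemma C1_weight_momentum:
 "C1_weight (%r. r * (wt_g N i r * wt_d N i j r)) (%r. wt_g N i r * (- real N * i * (r * wt_d N i j r) + wt_br N i j r))"
 unfolding C1_weight_def
proof (intro conjI allI impI)
 fix x :: real
 show "((%r. r * (wt_g N i r * wt_d N i j r)) has_real_derivative wt_g N i x * (- real N * i * (x * wt_d N i j x) + wt_br N i j x)) (at x)"
  unfolding mult.left_commute[of _ "wt_g N i _"]
  by (rule DERIV_cong[OF DERIV_mult[OF wt_g_deriv_r wt_velocity_deriv_r]]) (simp add: algebra_simps)
qed (intro continuous_intros wt_continuous wt_continuous2)+

lemma wt_m_deriv_r: "((%r. wt_m i r) has_real_derivative - i * wt_m i r) (at r)"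
 unfolding wt_m_def by (auto intro!: derivative_eq_intros)

lemma C1_weight_m:
 "C1_weight (%r. r * (wt_g N i r * wt_m i r)) (%r. wt_g N i r * wt_w N i r - real N * (wt_g N i r * wt_m i r))"
 unfolding C1_weight_def
proof (intro conjI allI impI)
 fix x :: real
 show "((%r. r * (wt_g N i r * wt_m i r)) has_real_derivative wt_g N i x * wt_w N i x - real N * (wt_g N i x * wt_m i x)) (at x)"
  by (rule DERIV_cong[OF DERIV_mult[OF DERIV_ident DERIV_mult[OF wt_g_deriv_r wt_m_deriv_r]]])
    (simp add: wt_w_def wt_m_def algebra_simps)
qed (intro continuous_intros wt_continuous wt_continuous2)+

text \<open>The relation between \<open>wt_m\<close> and \<open>wt_w\<close> persists for
  \<open>wt_mt\<close> and \<open>wt_wt\<close>, since differentiation in time and in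
  \<open>r\<close> commute. It later rewrites part of the time derivative of the excess as an
  integral against \<open>well_speed u * p\<close>.\<close>

lemma C1_weight_mt:
 "C1_weight (%r. r * (wt_g N i r * wt_mt N i r)) (%r. wt_g N i r * wt_wt N i r - real N * (wt_g N i r * wt_mt N i r))"
 unfolding C1_weight_def
proof (intro conjI allI impI)
 fix x :: real
 have m: "((%r. wt_mt N i r) has_real_derivative
   real N * (real N + 1) * i ^ 3 * (- i * exp (1 - x * i) + - i * exp (1 - x * i) * (1 - x * i))) (at x)"
  unfolding wt_mt_def
  by (rule DERIV_cong[OF DERIV_cmult_right[OF DERIV_mult[OF DERIV_cmult[OF wt_line_deriv_r] wt_exp_deriv_r]]]) (simp add: algebra_simps)
 show "((%r. r * (wt_g N i r * wt_mt N i r)) has_real_derivative wt_g N i x * wt_wt N i x - real N * (wt_g N i x * wt_mt N i x)) (at x)"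
  by (rule DERIV_cong[OF DERIV_mult[OF DERIV_ident DERIV_mult[OF wt_g_deriv_r m]]])
    (simp add: wt_wt_def wt_mt_def algebra_simps power2_eq_square)
qed (intro continuous_intros wt_continuous wt_continuous2)+

section \<open>Time derivatives of the weights along the interface motion\<close>

context
 fixes N :: nat and i j :: "real => real" and s :: real
 assumes N: "1 <= N" and i': "(i has_real_derivative real N * i s ^ 3) (at s)"
  and j': "(j has_real_derivative - real N * i s * (j s)^2) (at s)"
begin

lemma wt_g_deriv_t: "((%s. wt_g N (i s) r) has_real_derivative wt_g N (i s) r * wt_a N (i s) r) (at s)"
proof -
 obtain M where M: "N = Suc M" using N by (cases N) auto
 have e: "((%s. exp (real N * (1 - r * i s))) has_real_derivative exp (real N * (1 - r * i s)) * (real N * (0 - r * (real N * i s ^ 3)))) (at s)"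
  by (rule DERIV_chain2[OF DERIV_exp]) (intro DERIV_cmult DERIV_diff DERIV_const i')
 show ?thesis
  unfolding wt_g_def
  by (rule DERIV_cong[OF DERIV_mult[OF DERIV_power[OF i'] e]])
    (simp add: wt_a_def M algebra_simps power2_eq_square power3_eq_cube del: of_nat_Suc)
qed

lemma wt_exp_deriv_t: "((%s. exp (1 - r * i s)) has_real_derivative exp (1 - r * i s) * (0 - r * (real N * i s ^ 3))) (at s)"
 by (rule DERIV_chain2[OF DERIV_exp]) (intro DERIV_cmult DERIV_diff DERIV_const i')

lemma wt_velocity_deriv_t: "((%s. r * wt_d N (i s) (j s) r) has_real_derivative wt_bt N (i s) (j s) r) (at s)"
proof -
 have q: "((%s. wt_q (i s) (j s) r) has_real_derivative r * (1 - r) * (real N * i s ^ 3 * j s - real N * (i s)^2 * (j s)^2)) (at s)"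
  unfolding wt_q_def by (rule DERIV_cong[OF DERIV_cmult[OF DERIV_mult[OF i' j']]]) (simp add: algebra_simps power2_eq_square)
 have q3: "((%s. 1 - (1 - wt_q (i s) (j s) r) ^ 3) has_real_derivative
   3 * (1 - wt_q (i s) (j s) r)^2 * (r * (1 - r) * (real N * i s ^ 3 * j s - real N * (i s)^2 * (j s)^2))) (at s)"
  by (rule DERIV_cong[OF DERIV_diff[OF DERIV_const DERIV_power[OF DERIV_diff[OF DERIV_const q]]]]) (simp add: numeral_3_eq_3 power2_eq_square)
 show ?thesis
  unfolding wt_velocity wt_bt_def
  by (rule DERIV_cong[OF DERIV_mult[OF DERIV_cmult[OF i'] q3]]) (simp add: algebra_simps)
qed

lemma wt_momentum_deriv_t: "((%s. r * (wt_g N (i s) r * wt_d N (i s) (j s) r)) has_real_derivative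
  wt_g N (i s) r * (wt_bt N (i s) (j s) r + wt_a N (i s) r * (r * wt_d N (i s) (j s) r))) (at s)"
proof -
 have e: "(%s. r * (wt_g N (i s) r * wt_d N (i s) (j s) r)) = (%s. wt_g N (i s) r * (r * wt_d N (i s) (j s) r))"
  by (simp add: mult.left_commute)
 show ?thesis unfolding e
  by (rule DERIV_cong[OF DERIV_mult[OF wt_g_deriv_t wt_velocity_deriv_t]]) (simp add: algebra_simps)
qed

lemma wt_w_deriv_t: "((%s. wt_g N (i s) r * wt_w N (i s) r) has_real_derivative wt_g N (i s) r * wt_wt N (i s) r) (at s)"
proof -
 have w: "((%s. wt_w N (i s) r) has_real_derivative
   ((real N + 1) * (0 - r * (real N * i s ^ 3)) * exp (1 - r * i s) + exp (1 - r * i s) * (0 - r * (real N * i s ^ 3)) * ((real N + 1) * (1 - r * i s))) * i s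
    + real N * i s ^ 3 * ((real N + 1) * (1 - r * i s) * exp (1 - r * i s))) (at s)"
  unfolding wt_w_def
  by (intro DERIV_mult DERIV_cmult DERIV_diff DERIV_const i' wt_exp_deriv_t)
 show ?thesis
  by (rule DERIV_cong[OF DERIV_mult[OF wt_g_deriv_t w]])
    (simp add: wt_w_def wt_wt_def wt_a_def algebra_simps power2_eq_square power3_eq_cube)
qed

lemma wt_m_deriv_t: "((%s. r * (wt_g N (i s) r * wt_m (i s) r)) has_real_derivative r * (wt_g N (i s) r * wt_mt N (i s) r)) (at s)"
proof -
 have m: "((%s. wt_m (i s) r) has_real_derivative
   real N * i s ^ 3 * exp (1 - r * i s) + exp (1 - r * i s) * (0 - r * (real N * i s ^ 3)) * i s) (at s)"
  unfolding wt_m_def by (intro DERIV_mult i' wt_exp_deriv_t)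
 show ?thesis
  by (rule DERIV_cong[OF DERIV_cmult[OF DERIV_mult[OF wt_g_deriv_t m]]])
    (simp add: wt_m_def wt_mt_def wt_a_def algebra_simps power2_eq_square power3_eq_cube)
qed

end

text \<open>One constant for finitely many continuous coefficients on a compact box. Uniformity in
  time comes from bounding \<open>i\<close> and \<open>j\<close> on \<open>[0, T]\<close>.\<close>

lemma box_bound:
 fixes fs :: "(real \<times> real \<times> real \<times> real => real) list"
 assumes "\<forall>\<Phi>\<in>set fs. continuous_on UNIV \<Phi>"
 shows "\<exists>A\<ge>1. \<forall>\<Phi>\<in>set fs. \<forall>i j \<rho> r. 0 <= i --> i <= I --> 0 <= j --> j <= J --> 0 <= \<rho> --> \<rho> <= 1 --> 0 <= r --> r <= 1 -->
   \<bar>\<Phi> (i, j, \<rho>, r)\<bar> <= A"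
 using assms
proof (induction fs)
 case Nil
 show ?case by (intro exI[of _ 1]) auto
next
 case (Cons \<Phi> fs)
 have "\<forall>\<Phi>\<in>set fs. continuous_on UNIV \<Phi>" using Cons.prems by simp
 from Cons.IH[OF this] obtain A where A: "1 <= A" "\<forall>\<Phi>\<in>set fs. \<forall>i j \<rho> r. 0 <= i --> i <= I --> 0 <= j --> j <= J --> 0 <= \<rho> --> \<rho> <= 1 --> 0 <= r --> r <= 1 -->
   \<bar>\<Phi> (i, j, \<rho>, r)\<bar> <= A"
  by (elim exE conjE) (rule that)
 have "compact (\<Phi> ` ({0..I} \<times> {0..J} \<times> {0..1} \<times> {0..1}))"
  using Cons.prems by (intro compact_continuous_image compact_Times) (auto intro: continuous_on_subset)
 from compact_imp_bounded[OF this] obtain B where B: "\<forall>x\<in>\<Phi> ` ({0..I} \<times> {0..J} \<times> {0..1} \<times> {0..1}). norm x <= B"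
  unfolding bounded_iff by (elim exE) (rule that)
 show ?case
 proof (intro exI[of _ "max A B"] conjI ballI allI impI)
  fix \<Psi> and i j \<rho> r :: real assume "\<Psi> \<in> set (\<Phi> # fs)" and x: "0 <= i" "i <= I" "0 <= j" "j <= J" "0 <= \<rho>" "\<rho> <= 1" "0 <= r" "r <= 1"
  then consider "\<Psi> = \<Phi>" | "\<Psi> \<in> set fs" by auto
  then show "\<bar>\<Psi> (i, j, \<rho>, r)\<bar> <= max A B"
  proof cases
   case 1
   have "norm (\<Phi> (i, j, \<rho>, r)) <= B" using x by (intro B[rule_format] imageI) auto
   then show ?thesis using 1 by simp
  next
   case 2
   have "\<bar>\<Psi> (i, j, \<rho>, r)\<bar> <= A" by (rule A(2)[rule_format, OF 2 x])
   then show ?thesis by simp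
  qed
 qed (use A in simp)
qed

text \<open>With \<open>h = r * i - 1\<close> the last factor is \<open>1 - r * wt_m i r\<close>, so
  the calibration field drops below length \<open>1\<close> at a quadratic rate. The inequality is a
  rearrangement of \<open>(1 + h/2)^2 <= exp h\<close>.\<close>

lemma exp_excess: "(-1::real) <= h ==> h\<^sup>2 <= 4 * exp h * (1 - (1 + h) * exp (- h))"
proof -
 assume h: "-1 <= h"
 have "(1 + h/2)^2 <= (exp (h/2))^2" using h exp_ge_add_one_self[of "h/2"] by (intro power_mono) auto
 also have "\<dots> = exp h" by (simp add: power2_eq_square flip: exp_add)
 finally have "h\<^sup>2 <= 4 * (exp h - (1 + h))" by (simp add: power2_eq_square algebra_simps)
 also have "\<dots> = 4 * exp h * (1 - (1 + h) * exp (- h))"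
 proof -
  have "4 * exp h * (1 - (1 + h) * exp (- h)) = 4 * (exp h - (1 + h) * (exp h * exp (- h)))" by (simp add: algebra_simps)
  then show ?thesis by (simp flip: exp_add)
 qed
 finally show ?thesis .
qed

lemma wt_m_le_1: "0 <= r * i ==> r * wt_m i r <= 1" "0 <= i ==> 0 <= r ==> 0 <= r * wt_m i r"
proof -
 assume "0 <= r * i"
 have "r * i <= exp (r * i - 1)" using exp_ge_add_one_self[of "r * i - 1"] by simp
 then have "r * i * exp (1 - r * i) <= exp (r * i - 1) * exp (1 - r * i)" by (rule mult_right_mono) simp
 then show "r * wt_m i r <= 1" by (simp add: wt_m_def mult.assoc flip: exp_add)
qed (simp add: wt_m_def)

text \<open>In order: the coefficients of potential and gradient energy left after completing the
  square; three first-order factors, which occur only squared or in products of two; three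
  coefficients that come with a factor \<open>kap\<close> and need only be bounded; and the
  comparison of \<open>(r * i - 1)^2\<close> with the calibration defect, which makes the
  second-order terms controllable by the coercive part of the functional.\<close>

definition weight_bounds :: "nat => real => real => real => real => bool" where
 "weight_bounds N A i j r \<longleftrightarrow>
  \<bar>wt_a N i r + real N * wt_d N i j r - real N * i * (r * wt_d N i j r) + wt_br N i j r\<bar> <= A * (r * i - 1)^2 \<and>
  \<bar>wt_a N i r + real N * wt_d N i j r - real N * i * (r * wt_d N i j r) - wt_br N i j r\<bar> <= A * (r * i - 1)^2 \<and>
  \<bar>wt_w N i r\<bar> <= A * \<bar>r * i - 1\<bar> \<and>
  \<bar>- real N * i - r * wt_d N i j r\<bar> <= A * \<bar>r * i - 1\<bar> \<and>
  \<bar>r * i * (- real N * i) - r * wt_d N i j r\<bar> <= A * \<bar>r * i - 1\<bar> \<and>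
  \<bar>wt_a N i r - (real N * wt_d N i j r - real N * i * (r * wt_d N i j r) + wt_br N i j r)\<bar> <= A \<and>
  \<bar>wt_bt N i j r + wt_a N i r * (r * wt_d N i j r)\<bar> <= A \<and>
  \<bar>r * wt_d N i j r\<bar> <= A \<and>
  (r * i - 1)\<^sup>2 <= A * (1 - r * wt_m i r)"

text \<open>Each small expression is factored as a power of \<open>r * i - 1\<close> times a
  continuous cofactor, and the cofactors are bounded by compactness. \<open>\<rho>\<close> is kept
  as a variable beside \<open>i\<close> and \<open>j\<close> so that the factorisations are
  polynomial identities modulo \<open>i * \<rho> = 1\<close> and
  \<open>j * (1 - \<rho>) = 1\<close>, apart from exponentials that stay in the cofactors.\<close>

lemma weight_coefficient_bounds:
 fixes I J :: real and N :: nat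
 shows "\<exists>A\<ge>1. \<forall>i j \<rho> r. 0 < \<rho> --> \<rho> < 1 --> i * \<rho> = 1 --> j * (1 - \<rho>) = 1 --> i <= I --> j <= J --> 0 <= r --> r <= 1 -->
  weight_bounds N A i j r"
proof -
 \<comment> \<open>The cofactor in \<open>1 - wt_q = (r * i - 1) * \<sigma>\<close>, which comes
   from \<open>\<rho> * (1 - \<rho>) - r * (1 - r) = (r - \<rho>) * (r + \<rho> -
   1)\<close>.\<close>
 define \<sigma> where "\<sigma> j \<rho> r = (r + \<rho> - 1) * j" for j \<rho> r :: real
 define P where "P = (%(i, j, \<rho>, r). (real N)^2 * i^2 * (\<sigma> j \<rho> r + (r * i - 1) * (\<sigma> j \<rho> r)^2
   - \<rho> * j * (1 + (r * i - 1) * \<sigma> j \<rho> r + (r * i - 1)^2 * (\<sigma> j \<rho> r)^2)))"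
 define Q where "Q = (%(i, j, \<rho>, r). - real N * i * (3 * (\<sigma> j \<rho> r)^2 * ((1 - 2 * r) * (i * j))))"
 define R where "R = (%(i, j, \<rho>, r). real N * i * (r * i - 1)^2 * (\<sigma> j \<rho> r) ^ 3)"
 define fs where "fs = [%x. P x + Q x, %x. P x - Q x, %(i, j, \<rho>, r). (real N + 1) * exp (1 - r * i) * i, R, %(i, j, \<rho>, r). real N * i + R (i, j, \<rho>, r),
  %(i, j, \<rho>, r). wt_a N i r - (real N * wt_d N i j r - real N * i * (r * wt_d N i j r) + wt_br N i j r),
  %(i, j, \<rho>, r). wt_bt N i j r + wt_a N i r * (r * wt_d N i j r), %(i, j, \<rho>, r). r * wt_d N i j r, %(i, j, \<rho>, r). 4 * exp (r * i - 1)]"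
 have "\<forall>\<Phi>\<in>set fs. continuous_on UNIV \<Phi>"
  unfolding fs_def P_def Q_def R_def \<sigma>_def case_prod_beta
  by (simp, intro conjI continuous_intros wt_continuous wt_continuous2)
 from box_bound[OF this, of I J] obtain A where A: "1 <= A" "\<forall>\<Phi>\<in>set fs. \<forall>i j \<rho> r. 0 <= i --> i <= I --> 0 <= j --> j <= J --> 0 <= \<rho> --> \<rho> <= 1 --> 0 <= r --> r <= 1 -->
   \<bar>\<Phi> (i, j, \<rho>, r)\<bar> <= A"
  by (elim exE conjE) (rule that)
 show ?thesis
 proof (rule exI[of _ A], rule conjI[OF A(1)], intro allI impI)
  fix i j \<rho> r :: real
  assume \<rho>: "0 < \<rho>" "\<rho> < 1" and i: "i * \<rho> = 1" and j: "j * (1 - \<rho>) = 1" and x: "i <= I" "j <= J" "0 <= r" "r <= 1"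
  have "0 < i * \<rho>" "0 < j * (1 - \<rho>)" using i j by simp_all
  then have ij: "0 <= i" "0 <= j" using \<rho> by (simp_all add: zero_less_mult_iff)
  note A = A(2)[rule_format, OF _ ij(1) x(1) ij(2) x(2) less_imp_le[OF \<rho>(1)] less_imp_le[OF \<rho>(2)] x(3,4)]
  let ?h = "r * i - 1" and ?\<sigma> = "\<sigma> j \<rho> r"
  have q: "1 - wt_q i j r = ?h * ?\<sigma>" using i j unfolding wt_q_def \<sigma>_def by algebra
  have jr: "(1 - r) * j = 1 - \<rho> * ?h * j" using i j by algebra
  have d: "wt_d N i j r = - real N * i^2 * (1 - \<rho> * ?h * j) * (1 + ?h * ?\<sigma> + (?h * ?\<sigma>)^2)"
  proof -
   have "3 - 3 * wt_q i j r + (wt_q i j r)^2 = 1 + (1 - wt_q i j r) + (1 - wt_q i j r)^2" by algebra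
   then have "3 - 3 * wt_q i j r + (wt_q i j r)^2 = 1 + ?h * ?\<sigma> + (?h * ?\<sigma>)^2" unfolding q .
   then show ?thesis unfolding wt_d_def using jr by algebra
  qed
  \<comment> \<open>Two cancellations at the interface. At order zero \<open>N * wt_d\<close>
    cancels the product of \<open>- N * i\<close> with the velocity. At order one the term
    \<open>- N^2 * i^2 * h\<close> of \<open>wt_a\<close> cancels the one that
    \<open>N * wt_d\<close> acquires from dividing the velocity by \<open>r\<close>; this fixes the
    rate of the exponential weight.\<close>
  have P: "wt_a N i r + real N * wt_d N i j r - real N * i * (r * wt_d N i j r) = P (i, j, \<rho>, r) * ?h\<^sup>2"
   unfolding wt_a_def d P_def prod.case by algebra
  have Q: "wt_br N i j r = Q (i, j, \<rho>, r) * ?h\<^sup>2"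
   unfolding wt_br_def q Q_def prod.case by algebra
  have R: "- real N * i - r * wt_d N i j r = - (R (i, j, \<rho>, r) * ?h)"
   unfolding wt_velocity q R_def prod.case by algebra
  have R2: "r * i * (- real N * i) - r * wt_d N i j r = - ((real N * i + R (i, j, \<rho>, r)) * ?h)"
   using R by algebra
  have w: "wt_w N i r = - (((real N + 1) * exp (1 - r * i) * i) * ?h)"
   unfolding wt_w_def by algebra
  have m1: "\<bar>c * ?h\<bar> <= A * \<bar>?h\<bar>" "\<bar>c * ?h\<^sup>2\<bar> <= A * ?h\<^sup>2" if "\<bar>c\<bar> <= A" for c
   using mult_right_mono[OF that, of "\<bar>?h\<bar>"] mult_right_mono[OF that, of "?h\<^sup>2"] by (simp_all add: abs_mult)
  have h: "-1 <= ?h" using x ij by simp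
  have "0 <= 1 - r * wt_m i r" using wt_m_le_1(1)[of r i] x ij by simp
  then have "4 * exp ?h * (1 - r * wt_m i r) <= A * (1 - r * wt_m i r)"
   using A[of "%(i, j, \<rho>, r). 4 * exp (r * i - 1)"] by (intro mult_right_mono) (simp_all add: fs_def)
  then have 9: "?h\<^sup>2 <= A * (1 - r * wt_m i r)"
   using exp_excess[OF h] by (simp add: wt_m_def mult.assoc)
  show "weight_bounds N A i j r"
   unfolding weight_bounds_def
  proof (intro conjI 9)
   show "\<bar>wt_a N i r + real N * wt_d N i j r - real N * i * (r * wt_d N i j r) + wt_br N i j r\<bar> <= A * ?h\<^sup>2"
    unfolding P Q distrib_right[symmetric] by (intro m1) (use A[of "%x. P x + Q x"] in \<open>simp add: fs_def\<close>)
   show "\<bar>wt_a N i r + real N * wt_d N i j r - real N * i * (r * wt_d N i j r) - wt_br N i j r\<bar> <= A * ?h\<^sup>2"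
    unfolding P Q left_diff_distrib[symmetric] by (intro m1) (use A[of "%x. P x - Q x"] in \<open>simp add: fs_def\<close>)
   show "\<bar>wt_w N i r\<bar> <= A * \<bar>?h\<bar>"
    unfolding w abs_minus_cancel by (intro m1) (use A[of "%(i, j, \<rho>, r). (real N + 1) * exp (1 - r * i) * i"] in \<open>simp add: fs_def\<close>)
   show "\<bar>- real N * i - r * wt_d N i j r\<bar> <= A * \<bar>?h\<bar>"
    unfolding R abs_minus_cancel by (intro m1) (use A[of R] in \<open>simp add: fs_def\<close>)
   show "\<bar>r * i * (- real N * i) - r * wt_d N i j r\<bar> <= A * \<bar>?h\<bar>"
    unfolding R2 abs_minus_cancel by (intro m1) (use A[of "%(i, j, \<rho>, r). real N * i + R (i, j, \<rho>, r)"] in \<open>simp add: fs_def\<close>)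
   show "\<bar>wt_a N i r - (real N * wt_d N i j r - real N * i * (r * wt_d N i j r) + wt_br N i j r)\<bar> <= A"
    using A[of "%(i, j, \<rho>, r). wt_a N i r - (real N * wt_d N i j r - real N * i * (r * wt_d N i j r) + wt_br N i j r)"] by (simp add: fs_def)
   show "\<bar>wt_bt N i j r + wt_a N i r * (r * wt_d N i j r)\<bar> <= A"
    using A[of "%(i, j, \<rho>, r). wt_bt N i j r + wt_a N i r * (r * wt_d N i j r)"] by (simp add: fs_def)
   show "\<bar>r * wt_d N i j r\<bar> <= A"
    using A[of "%(i, j, \<rho>, r). r * wt_d N i j r"] by (simp add: fs_def)
  qed
 qed
qed

lemma dissipation_constants:
 fixes a1 a2 b1 b2 c1 c2 d1 d2 :: real
 assumes "a1 <= a2" "0 <= a2" "b1 <= b2" "0 <= b2" "c1 <= c2" "0 <= c2" "d1 <= d2" "0 <= d2"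
 shows "a2 + 4 * b2 + 2 * (a2 + b2) + a1 + b1 + 2 * c1 + d1 <= 7 * a2 + 7 * b2 + 7 * c2 + 7 * d2"
 using assms by argo

text \<open>The substitution \<open>z = v + b p\<close> completes the square. What is left of the quadratic form in
 \<open>p\<close> has coefficients of second order at the interface; here \<open>\<Phi>\<close> stands for \<open>F(u)/eps\<close>.\<close>

lemma dissipation_bound:
 fixes a b d b' eps kap A h p v f \<Phi> \<omega> y B c :: real
 assumes e: "0 < eps" "0 <= kap" and A: "1 <= A" and f: "f\<^sup>2 <= 2 * eps * \<Phi>"
  and c1: "\<bar>a + d + c * b + b'\<bar> <= A * h^2" and c2: "\<bar>a + d + c * b - b'\<bar> <= A * h^2"
  and w: "\<bar>\<omega>\<bar> <= A * \<bar>h\<bar>" and s1: "\<bar>c - b\<bar> <= A * \<bar>h\<bar>" and s2: "\<bar>y * c - b\<bar> <= A * \<bar>h\<bar>"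
  and R: "\<bar>a - (d + c * b + b')\<bar> <= A" and B: "\<bar>B\<bar> <= A"
 shows "eps * kap / 2 * a * v^2 - eps * v^2 + eps / 2 * a * p^2 - eps * c * p * v + a * \<Phi> + eps * kap * B * p * v - eps * b * p * v
   - eps * kap / 2 * (d + c * b + b') * v^2 + eps / 2 * (d - c * b - b') * p^2 + (d + c * b + b') * \<Phi> + 2 * \<omega> * f * v + 2 * \<omega> * y * c * f * p
  <= 7 * A^2 * (h^2 * (eps / 2 * p^2 + \<Phi>) + eps * kap / 2 * v^2 + kap * (eps / 2 * p^2))" (is "?X <= _")
proof -
 define z where "z = v + b * p"
 have \<Phi>: "0 <= \<Phi>" using order_trans[OF zero_le_power2 f] e by (simp add: zero_le_mult_iff)
 have sq: "x\<^sup>2 <= A^2 * h^2" if "\<bar>x\<bar> <= A * \<bar>h\<bar>" for x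
  using power_mono[OF that, of 2] by (simp add: power_mult_distrib)
 \<comment> \<open>\<open>- eps * z^2\<close> pays for the cross terms: one half is spent in
   \<open>t1\<close>, the other in \<open>t2\<close>.\<close>
 have X: "?X = - eps * z^2 - eps * (c - b) * p * z + eps / 2 * (a + d + c * b - b') * p^2 + (a + d + c * b + b') * \<Phi>
   + 2 * \<omega> * f * z + 2 * \<omega> * (y * c - b) * (f * p) + eps * kap * ((a - (d + c * b + b')) / 2 * v^2 + B * p * v)"
  unfolding z_def by (simp add: power2_eq_square algebra_simps add_divide_distrib diff_divide_distrib)
 have t1: "- (eps * (c - b) * p * z) <= eps / 2 * z^2 + A^2 * h^2 * (eps / 2 * p^2)"
 proof -
  have "0 <= eps / 2 * ((c - b) * p + z)^2" using e by simp
  also have "\<dots> = eps / 2 * z^2 + (c - b)^2 * (eps / 2 * p^2) + eps * (c - b) * p * z" by (simp add: power2_eq_square algebra_simps add_divide_distrib diff_divide_distrib)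
  moreover have "(c - b)^2 * (eps / 2 * p^2) <= A^2 * h^2 * (eps / 2 * p^2)" using e by (intro mult_right_mono sq s1) simp
  ultimately show ?thesis by linarith
 qed
 have t2: "2 * \<omega> * f * z <= eps / 2 * z^2 + 4 * (A^2 * h^2 * \<Phi>)"
 proof -
  have "0 <= (2 * \<omega> * f - eps * z)^2" by simp
  also have "\<dots> = 4 * (\<omega>^2 * f^2) + eps^2 * z^2 - 2 * eps * (2 * \<omega> * f * z)" by (simp add: power2_eq_square algebra_simps)
  also have "\<omega>\<^sup>2 * f^2 <= (A^2 * h^2) * (2 * eps * \<Phi>)" by (intro mult_mono sq w f) auto
  finally have "(2 * eps) * (2 * \<omega> * f * z) <= (2 * eps) * (eps / 2 * z^2 + 4 * (A^2 * h^2 * \<Phi>))" by (simp add: power2_eq_square algebra_simps)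
  then show ?thesis using e by (simp only: mult_le_cancel_left_pos zero_less_numeral mult_pos_pos)
 qed
 have fp: "\<bar>f * p\<bar> <= eps / 2 * p^2 + \<Phi>"
 proof -
  have "0 <= (\<bar>f\<bar> - eps * \<bar>p\<bar>)^2" by simp
  also have "\<dots> = f^2 + eps^2 * p^2 - 2 * eps * \<bar>f * p\<bar>" by (simp add: power2_diff power_mult_distrib abs_mult)
  finally have "(2 * eps) * \<bar>f * p\<bar> <= (2 * eps) * (eps / 2 * p^2 + \<Phi>)" using f by (simp add: power2_eq_square algebra_simps)
  then show ?thesis using e by (simp only: mult_le_cancel_left_pos zero_less_numeral mult_pos_pos)
 qed
 have t3: "2 * \<omega> * (y * c - b) * (f * p) <= 2 * (A^2 * h^2 * (eps / 2 * p^2 + \<Phi>))"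
 proof -
  have "\<bar>\<omega>\<bar> * \<bar>y * c - b\<bar> * \<bar>f * p\<bar> <= (A * \<bar>h\<bar>) * (A * \<bar>h\<bar>) * (eps / 2 * p^2 + \<Phi>)"
   using A by (intro mult_mono w s2 fp mult_nonneg_nonneg) auto
  moreover have "\<omega> * (y * c - b) * (f * p) <= \<bar>\<omega>\<bar> * \<bar>y * c - b\<bar> * \<bar>f * p\<bar>" by (simp flip: abs_mult)
  moreover have "(A * \<bar>h\<bar>) * (A * \<bar>h\<bar>) = A^2 * h^2" by (simp add: power2_eq_square)
  ultimately show ?thesis by simp
 qed
 have t4: "eps / 2 * (a + d + c * b - b') * p^2 <= A * h^2 * (eps / 2 * p^2)"
  using mult_right_mono[OF order_trans[OF abs_ge_self c2], of "eps / 2 * p^2"] e by (simp add: mult_ac)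
 have t5: "(a + d + c * b + b') * \<Phi> <= A * h^2 * \<Phi>"
  using mult_right_mono[OF order_trans[OF abs_ge_self c1] \<Phi>] .
 have t6: "eps * kap * ((a - (d + c * b + b')) / 2 * v^2 + B * p * v) <= eps * kap * (A * v^2 + A / 2 * p^2)"
 proof (rule mult_left_mono)
  have "(a - (d + c * b + b')) * v^2 <= A * v^2" using order_trans[OF abs_ge_self R] by (rule mult_right_mono) simp
  moreover have "B * (p * v) <= A * ((p^2 + v^2) / 2)"
  proof -
   have "B * (p * v) <= \<bar>B\<bar> * \<bar>p * v\<bar>" by (simp flip: abs_mult)
   also have "\<dots> <= A * ((p^2 + v^2) / 2)"
   proof (rule mult_mono[OF B])
    show "\<bar>p * v\<bar> <= (p^2 + v^2) / 2"
     using sum_squares_bound[of "\<bar>p\<bar>" "\<bar>v\<bar>"] by (simp add: abs_mult)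
   qed (use A in auto)
   finally show ?thesis .
  qed
  ultimately show "(a - (d + c * b + b')) / 2 * v^2 + B * p * v <= A * v^2 + A / 2 * p^2"
  proof -
   have "(a - (d + c * b + b')) / 2 * v^2 + B * p * v = (a - (d + c * b + b')) * v^2 / 2 + B * (p * v)" by simp
   moreover have "A * ((p^2 + v^2) / 2) = A * v^2 / 2 + A / 2 * p^2" by (simp add: algebra_simps add_divide_distrib)
   ultimately show ?thesis using \<open>(a - (d + c * b + b')) * v^2 <= A * v^2\<close> \<open>B * (p * v) <= A * ((p^2 + v^2) / 2)\<close> by linarith
  qed
 qed (use e in simp)
 let ?e = "eps / 2 * p^2 + \<Phi>"
 have e0: "0 <= h^2 * (eps / 2 * p^2)" "0 <= h^2 * \<Phi>" "0 <= eps * kap / 2 * v^2" "0 <= kap * (eps / 2 * p^2)" using e \<Phi> by simp_all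
 have AA: "A <= A^2" using A by (simp add: power2_eq_square)
 have m: "A * x <= A^2 * x" "0 <= A^2 * x" if "0 <= x" for x using AA that by (auto intro: mult_right_mono)
 have "?X <= A^2 * (h^2 * (eps / 2 * p^2)) + 4 * (A^2 * (h^2 * \<Phi>)) + 2 * (A^2 * (h^2 * (eps / 2 * p^2)) + A^2 * (h^2 * \<Phi>))
   + A * (h^2 * (eps / 2 * p^2)) + A * (h^2 * \<Phi>) + 2 * (A * (eps * kap / 2 * v^2)) + A * (kap * (eps / 2 * p^2))"
  unfolding X using t1 t2 t3 t4 t5 t6 by (simp add: algebra_simps add_divide_distrib)
 \<comment> \<open>The largest coefficient is that of \<open>h^2 * \<Phi>\<close>, namely
   \<open>4 + 2 + 1\<close>; it is used for all four terms.\<close>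
 also have "\<dots> <= 7 * (A^2 * (h^2 * (eps / 2 * p^2))) + 7 * (A^2 * (h^2 * \<Phi>)) + 7 * (A^2 * (eps * kap / 2 * v^2)) + 7 * (A^2 * (kap * (eps / 2 * p^2)))"
  by (rule dissipation_constants[OF m[OF e0(1)] m[OF e0(2)] m[OF e0(3)] m[OF e0(4)]])
 finally show ?thesis by (simp add: algebra_simps)
qed

subsection \<open>The Lyapunov functional\<close>

text \<open>\<open>H\<close>, \<open>G\<close> and \<open>f\<close> stand for \<open>F\<close>,
  \<open>F'\<close> and \<open>well_speed\<close> at \<open>u\<close>. The left side collects the
  integrands of the time derivative, with \<open>kap * w\<close> eliminated through the equation,
  and adds two groups that integrate to zero by parts. These groups remove \<open>l\<close> and
  \<open>G\<close>, so the right side is a form in \<open>v\<close>, \<open>p\<close>,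
  \<open>f\<close> and \<open>H\<close> alone. Hypothesis \<open>m\<close> ties the time derivative
  of the calibration to its divergence.\<close>

lemma energy_identity_pointwise:
 fixes r eps :: real
 assumes r: "r ~= 0" "eps ~= 0" and m: "r * m = - (w * y * c)"
 shows "eps * kap / 2 * (g * a * (v * v)) + eps / 2 * (g * (v + v) * (l - G / eps^2 - v)) + eps / 2 * (g * a * (p * p))
   - eps / 2 * ((g * (l + l) + c * g * (p + p)) * v) + 1 / eps * (g * a * (H * 1)) + 1 / eps * (g * G * v)
   + eps * kap * (g * B * (p * v)) + eps * (r * (g * d) * p * (l - G / eps^2 - v))
   - eps * kap / 2 * ((g * (c * (r * d) + b') + n * (g * d)) * v^2) + 2 * (g * w * f * v) - 2 * (r * (g * m) * (f * p))
   - eps * (r * (g * d) * p * (l - n / r * p) + 1 / 2 * ((g * (c * (r * d) + b') + n * (g * d)) * p^2))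
   + 1 / eps * (r * (g * d) * (G * p) + (g * (c * (r * d) + b') + n * (g * d)) * H)
  = g * (eps * kap / 2 * a * v^2 - eps * v^2 + eps / 2 * a * p^2 - eps * c * p * v + a * (H / eps) + eps * kap * B * p * v - eps * (r * d) * p * v
   - eps * kap / 2 * (n * d + c * (r * d) + b') * v^2 + eps / 2 * (n * d - c * (r * d) - b') * p^2
   + (n * d + c * (r * d) + b') * (H / eps) + 2 * w * f * v + 2 * w * y * c * f * p)"
proof -
 obtain Q where Q: "G = eps^2 * Q" using r(2) by (metis nonzero_mult_div_cancel_left power_not_zero times_divide_eq_right)
 obtain \<Phi> where \<Phi>: "H = eps * \<Phi>" using r(2) by (metis nonzero_mult_div_cancel_left times_divide_eq_right)
 obtain q where q: "p = r * q" using r(1) by (metis nonzero_mult_div_cancel_left times_divide_eq_right)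
 have 1: "G / eps^2 = Q" "H / eps = \<Phi>" "n / r * p = n * q" using r by (simp_all add: Q \<Phi> q)
 have 2: "1 / eps * (g * a * (H * 1)) = g * a * \<Phi>" "1 / eps * (g * G * v) = eps * g * Q * v"
  "1 / eps * (r * (g * d) * (G * p) + (g * (c * (r * d) + b') + n * (g * d)) * H)
   = eps * r * (g * d) * (Q * p) + (g * (c * (r * d) + b') + n * (g * d)) * \<Phi>"
  using r(2) by (simp_all add: Q \<Phi> power2_eq_square distrib_left)
 have 3: "r * (g * m) * (f * p) = g * f * p * - (w * y * c)" unfolding m[symmetric] by simp
 show ?thesis unfolding 1 2 3 unfolding q by (simp add: power2_eq_square algebra_simps add_divide_distrib)
qed

text \<open>Of \<open>kap = sqrt kap * sqrt kap\<close> one root is paired with the velocity in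
  Young's inequality, and the other remains as the small factor.\<close>

lemma kinetic_gradient_bound:
 fixes eps kap A b p v :: real
 assumes "0 <= eps" "0 <= kap" "\<bar>b\<bar> <= A"
 shows "\<bar>eps * kap * (b * (p * v))\<bar> <= A * sqrt kap * (eps * kap / 2 * v^2 + eps / 2 * p^2)"
proof -
 have "2 * \<bar>p\<bar> * (sqrt kap * \<bar>v\<bar>) <= \<bar>p\<bar>\<^sup>2 + (sqrt kap * \<bar>v\<bar>)^2" by (rule sum_squares_bound)
 then have s: "\<bar>p\<bar> * (sqrt kap * \<bar>v\<bar>) <= (kap * v^2 + p^2) / 2" using assms by (simp add: power_mult_distrib)
 have k: "kap = sqrt kap * sqrt kap" using assms by simp
 have "\<bar>eps * kap * (b * (p * v))\<bar> = eps * kap * (\<bar>b\<bar> * (\<bar>p\<bar> * \<bar>v\<bar>))" using assms by (simp add: abs_mult)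
 also have "\<dots> = eps * (sqrt kap * sqrt kap) * (\<bar>b\<bar> * (\<bar>p\<bar> * \<bar>v\<bar>))" by (simp only: k[symmetric])
 also have "\<dots> = \<bar>b\<bar> * (sqrt kap * eps * (\<bar>p\<bar> * (sqrt kap * \<bar>v\<bar>)))" by (simp only: mult_ac)
 also have "\<dots> <= A * (sqrt kap * eps * ((kap * v^2 + p^2) / 2))"
  using assms by (intro mult_mono mult_left_mono s mult_nonneg_nonneg) auto
 finally show ?thesis by (simp add: algebra_simps add_divide_distrib)
qed

lemma gronwall:
 fixes Y Y' :: "real => real"
 assumes c: "continuous_on {0..T} Y" and d: "!!t. 0 < t ==> t < T ==> (Y has_real_derivative Y' t) (at t)"
  and b: "!!t. 0 < t ==> t < T ==> Y' t <= K * (Y t + \<delta>)" and t: "0 <= t" "t <= T"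
 shows "Y t + \<delta> <= (Y 0 + \<delta>) * exp (K * t)"
proof -
 let ?h = "%t. (Y t + \<delta>) * exp (- (K * t))"
 have "?h t <= ?h 0"
 proof (rule DERIV_nonpos_imp_decreasing_open[OF t(1)])
  show "continuous_on {0..t} ?h" using t by (intro continuous_intros continuous_on_subset[OF c]) auto
  fix s assume s: "0 < s" "s < t"
  then have s': "0 < s" "s < T" using t by auto
  have "(?h has_real_derivative Y' s * exp (- (K * s)) + - K * exp (- (K * s)) * (Y s + \<delta>)) (at s)"
   by (auto intro!: derivative_eq_intros d[OF s'])
  moreover have "(Y' s - K * (Y s + \<delta>)) * exp (- (K * s)) <= 0"
   using b[OF s'] by (intro mult_nonpos_nonneg) auto
  ultimately show "\<exists>y. (?h has_real_derivative y) (at s) & y <= 0" by (auto simp: algebra_simps)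
 qed
 then have "?h t * exp (K * t) <= ?h 0 * exp (K * t)" by (rule mult_right_mono) simp
 then show ?thesis by (simp add: mult.assoc flip: exp_add)
qed

text \<open>The primitive \<open>\<phi>\<close> of \<open>r ^ N * wt_g * wt_w\<close> equals
  \<open>1\<close> at the interface, so the flux through \<open>R < r < 1\<close> is
  \<open>\<phi> 1 - 1\<close>. Stopping the primitive at \<open>max r R\<close> gives an absolutely
  continuous function with a kink at \<open>R\<close>.\<close>

lemma weight_flux:
 assumes N: "1 <= N" and R: "0 < R" "R < 1" "i * R = 1"
 shows "integrable (rmeas N) (%r. if r * i < 1 then 0 else wt_g N i r * wt_w N i r)"
  "(LINT r|rmeas N. (if r * i < 1 then 0 else wt_g N i r * wt_w N i r)) = 1 * (wt_g N i 1 * wt_m i 1) - 1"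
proof -
 have i: "0 < i" using R by (metis zero_less_mult_pos2 zero_less_one)
 have ri: "r * i < 1 \<longleftrightarrow> r < R" for r
  using R i by (metis mult.commute mult_less_cancel_right_pos)
 define \<phi> where "\<phi> r = r ^ N * (r * (wt_g N i r * wt_m i r))" for r
 define \<psi> where "\<psi> r = wt_g N i r * wt_w N i r" for r
 have Ri: "R * i = 1" using R(3) by (simp add: mult.commute)
 have "\<phi> R = (R ^ N * i ^ N) * ((R * i) * (exp (real N * (1 - R * i)) * exp (1 - R * i)))"
  unfolding \<phi>_def wt_g_def wt_m_def by (simp only: mult_ac)
 then have \<phi>R: "\<phi> R = 1" unfolding power_mult_distrib[symmetric] Ri by simp
 have D\<phi>: "(\<phi> has_real_derivative r ^ N * \<psi> r) (at r)" if "0 < r" "r < 1" for r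
 proof -
  have "((%r. r * (wt_g N i r * wt_m i r)) has_real_derivative wt_g N i r * wt_w N i r - real N * (wt_g N i r * wt_m i r)) (at r)"
   using C1_weight_m[of N i] that unfolding C1_weight_def by blast
  moreover have "((%r. r ^ N) has_real_derivative real N * r ^ (N - 1)) (at r)" by (auto intro!: derivative_eq_intros)
  ultimately have "(\<phi> has_real_derivative real N * r ^ (N - 1) * (r * (wt_g N i r * wt_m i r)) +
    (wt_g N i r * wt_w N i r - real N * (wt_g N i r * wt_m i r)) * r ^ N) (at r)"
   unfolding \<phi>_def by (intro DERIV_mult)
  moreover have "r ^ N = r ^ (N - 1) * r" using N by (cases N) auto
  ultimately show ?thesis by (elim DERIV_cong) (simp add: \<psi>_def algebra_simps)
 qed
 have \<phi>c: "continuous_on S \<phi>" for S unfolding \<phi>_def by (intro continuous_intros wt_continuous)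
 have \<psi>c: "continuous_on S \<psi>" for S unfolding \<psi>_def by (intro continuous_intros wt_continuous)
 let ?\<alpha> = "%r. if r * i < 1 then 0 else \<psi> r" and ?A = "%r. \<phi> (max r R) - 1"
 have \<psi>neg: "\<psi> r <= 0" if "\<not> r * i < 1" for r
 proof -
  have "wt_w N i r <= 0" using that i unfolding wt_w_def by (intro mult_nonpos_nonneg mult_nonneg_nonpos) auto
  moreover have "0 <= wt_g N i r" using i by (simp add: wt_g_def)
  ultimately show ?thesis unfolding \<psi>_def by (simp add: mult_nonneg_nonpos)
 qed
 have ac: "ac ?A (%r. r ^ N * ?\<alpha> r)"
  unfolding ac_def
 proof (intro allI impI)
  fix a b :: real assume ab: "0 < a" "a <= b" "b < 1"
  have "((%r. r ^ N * ?\<alpha> r) has_integral (?A b - ?A a)) {a..b}"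
  proof (rule fundamental_theorem_of_calculus_strong[of "{R}", OF _ ab(2)])
   show "continuous_on {a..b} ?A" by (intro continuous_intros continuous_on_compose2[OF \<phi>c[of UNIV]]) auto
   fix x assume x: "x \<in> {a..b} - {R}"
   show "(?A has_vector_derivative x ^ N * ?\<alpha> x) (at x)"
    unfolding has_real_derivative_iff_has_vector_derivative[symmetric]
   proof (cases "x < R")
    case True
    have "(?A has_real_derivative 0) (at x)"
     by (rule has_field_derivative_transform_within_open[of "%r. 0" 0 x "{..<R}"]) (use True \<phi>R in \<open>auto simp: max_def\<close>)
    then show "(?A has_real_derivative x ^ N * ?\<alpha> x) (at x)" using True ri by simp
   next
    case False
    have "((%r. \<phi> r - 1) has_real_derivative x ^ N * \<psi> x - 0) (at x)"
     by (intro DERIV_diff D\<phi> DERIV_const) (use x ab in auto)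
    then have "(?A has_real_derivative x ^ N * \<psi> x - 0) (at x)"
     by (rule has_field_derivative_transform_within_open[of _ _ x "{R<..}"]) (use False x in \<open>auto simp: max_def\<close>)
    then show "(?A has_real_derivative x ^ N * ?\<alpha> x) (at x)" using False ri by simp
   qed
  qed simp
  then have hi: "((%r. r ^ N * ?\<alpha> r) has_integral (?A b - ?A a)) {a..b}" .
  have "(%r. - (r ^ N * ?\<alpha> r)) absolutely_integrable_on {a..b}"
  proof (rule nonnegative_absolutely_integrable_1)
   show "(%r. - (r ^ N * ?\<alpha> r)) integrable_on {a..b}" using has_integral_neg[OF hi] by blast
   fix r assume "r \<in> {a..b}"
   then show "0 <= - (r ^ N * ?\<alpha> r)" using ab \<psi>neg[of r] by (auto simp: mult_nonneg_nonpos)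
  qed
  then have "(%r. r ^ N * ?\<alpha> r) absolutely_integrable_on {a..b}" by (simp add: absolutely_integrable_on_def integrable_neg_iff set_integrable_def)
  then show "(%r. r ^ N * ?\<alpha> r) absolutely_integrable_on {a..b} & integral {a..b} (%r. r ^ N * ?\<alpha> r) = ?A b - ?A a"
   by (rule conjI[OF _ integral_unique[OF hi]])
 qed
 have iv: "{r \<in> space (rmeas N). r * i < 1} \<in> sets (rmeas N)"
 proof -
  have "{r \<in> space (rmeas N). r * i < 1} = {0<..<R}" unfolding ri space_rmeas using R(1,2) by auto
  moreover have "{0<..<R} \<in> sets (rmeas N)" unfolding sets_rmeas using R(1,2) by (subst sets_restrict_space_iff) auto
  ultimately show ?thesis by simp
 qed
 have "?\<alpha> \<in> borel_measurable (rmeas N)"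
  by (rule measurable_If[OF _ continuous_rmeas_Icc[OF \<psi>c] iv]) simp
 moreover obtain B where "!!x. 0 <= x ==> x <= 1 ==> \<bar>\<psi> x\<bar> <= B" "0 <= B" using bounded_unit_interval[OF \<psi>c] by blast
 ultimately have int: "integrable (rmeas N) ?\<alpha>"
  by (intro sqint_integrable[OF finite_measure_rmeas sqint_bounded[OF finite_measure_rmeas, of _ _ B]]) simp_all
 then show "integrable (rmeas N) (%r. if r * i < 1 then 0 else wt_g N i r * wt_w N i r)" unfolding \<psi>_def .
 have "(LINT r|rmeas N. ?\<alpha> r) = \<phi> 1 - 1"
 proof (rule rmeas_integral_by_parts[OF ac int])
  have cA: "continuous_on {0..1} ?A" by (intro continuous_intros continuous_on_compose2[OF \<phi>c[of UNIV]]) auto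
  show "(?A \<longlongrightarrow> 0) (at_right 0)" using Icc_tendsto_at_right_0[OF cA] R \<phi>R by (simp add: max_def)
  show "(?A \<longlongrightarrow> \<phi> 1 - 1) (at_left 1)" using Icc_tendsto_at_left_1[OF cA] R by (simp add: max_def)
 qed
 then show "(LINT r|rmeas N. (if r * i < 1 then 0 else wt_g N i r * wt_w N i r)) = 1 * (wt_g N i 1 * wt_m i 1) - 1"
  unfolding \<psi>_def by (simp add: \<phi>_def)
qed

text \<open>\<open>[a, b]\<close> strictly contains \<open>[0, T]\<close>, so the weights have
  two-sided time derivatives at the end times as well. The interface motion
  \<open>R' = - N / R\<close> enters through the differential equations for \<open>i\<close> and
  \<open>j\<close>.\<close>

locale damped_interface = double_well F F' F'' for F F' F'' :: "real => real" +
 fixes N :: nat and eps \<tau> C a b T A :: real and u0 u1 :: "real => real"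
  and u p l v v' w :: "real => real => real" and i j R :: "real => real"
 assumes sol: "strong_solution N F' eps \<tau> u0 u1 u p l v v' w"
  and N: "1 <= N" and eps: "0 < eps" and \<tau>: "0 < \<tau>"
  and bd: "!!r t. 0 < r ==> r < 1 ==> 0 <= t ==> \<bar>u r t\<bar> <= C"
  and ab: "a < 0" "T < b"
  and i': "!!s. a <= s ==> s <= b ==> (i has_real_derivative real N * i s ^ 3) (at s)"
  and j': "!!s. a <= s ==> s <= b ==> (j has_real_derivative - real N * i s * (j s)^2) (at s)"
  and R: "!!s. 0 <= s ==> s <= T ==> 0 < R s & R s < 1 & i s * R s = 1"
  and A: "1 <= A"
  and coeff: "!!s r. 0 <= s ==> s <= T ==> 0 <= r ==> r <= 1 ==>
  weight_bounds N A (i s) (j s) r"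
begin

abbreviation M :: "real measure" where "M \<equiv> rmeas N"
abbreviation g :: "real => real => real" where "g t r \<equiv> wt_g N (i t) r"
abbreviation kap :: real where "kap \<equiv> eps\<^sup>2 * \<tau>"
abbreviation c0 :: real where "c0 \<equiv> min_energy F"
abbreviation m1 :: "real => real" where "m1 t \<equiv> 1 * (g t 1 * wt_m (i t) 1)"
abbreviation kin :: "real => real" where "kin t \<equiv> \<integral>r. g t r * (v r t * v r t) \<partial>M"
abbreviation grd :: "real => real" where "grd t \<equiv> \<integral>r. g t r * (p r t * p r t) \<partial>M"
abbreviation pot :: "real => real" where "pot t \<equiv> \<integral>r. g t r * (F (u r t) * 1) \<partial>M"
abbreviation mom :: "real => real" where "mom t \<equiv> \<integral>r. r * (g t r * wt_d N (i t) (j t) r) * (p r t * v r t) \<partial>M"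
abbreviation wel :: "real => real" where "wel t \<equiv> \<integral>r. g t r * wt_w N (i t) r * (well_potential (u r t) * 1) \<partial>M"

definition energy :: "real => real" where
 "energy t = eps * kap / 2 * kin t + eps / 2 * grd t + 1 / eps * pot t"

text \<open>After integration by parts this is \<open>c0\<close> minus the weighted integral of the
  calibration field times \<open>well_speed u * p\<close>. The form without \<open>p\<close> is
  taken as definition because it can be differentiated in time and compared with the sharp
  profile.\<close>

definition excess :: "real => real" where
 "excess t = c0 * (1 - m1 t) + wel t"

text \<open>The excess enters twice: one copy makes \<open>energy - c0 + excess\<close> nonnegative
  by calibration, the other measures the distance to the sharp profile. The momentum is a
  perturbation of relative size \<open>A * sqrt kap\<close>.\<close>

definition lyapunov :: "real => real" where
 "lyapunov t = energy t + eps * kap * mom t - c0 + 2 * excess t"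

lemma kap: "0 < kap" using eps \<tau> by simp

lemma g_nonneg: "0 <= t ==> t <= T ==> 0 <= g t r"
proof -
 assume "0 <= t" "t <= T"
 from R[OF this] have "0 < i t" by (metis zero_less_mult_pos2 zero_less_one)
 then show "0 <= g t r" by (simp add: wt_g_def)
qed

lemma i_pos: "0 <= t ==> t <= T ==> 0 < i t"
 using R by (metis zero_less_mult_pos2 zero_less_one)

lemma ij_continuous: "continuous_on {a..b} i" "continuous_on {a..b} j"
 by (rule continuous_at_imp_continuous_on, use DERIV_isCont[OF i'] in auto)
   (rule continuous_at_imp_continuous_on, use DERIV_isCont[OF j'] in auto)

lemmas wt_cont = wt_continuous[OF continuous_on_id continuous_on_const] wt_continuous2[OF continuous_on_id continuous_on_const continuous_on_const]

lemma weight_time: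
 assumes t: "0 <= t" "t <= T"
 shows "uniformly_differentiable_weight (%r s. g s r) (%r. g t r * wt_a N (i t) r) t"
  "uniformly_differentiable_weight (%r s. r * (g s r * wt_d N (i s) (j s) r))
   (%r. g t r * (wt_bt N (i t) (j t) r + wt_a N (i t) r * (r * wt_d N (i t) (j t) r))) t"
  "uniformly_differentiable_weight (%r s. g s r * wt_w N (i s) r) (%r. g t r * wt_wt N (i t) r) t"
proof -
 have t': "a < t" "t < b" using t ab by auto
 note I = uniformly_differentiable_weightI[OF t' ij_continuous]
 have c: "continuous_on UNIV (fst :: real \<times> real \<times> real => real)" "continuous_on UNIV (%x :: real \<times> real \<times> real. fst (snd x))"
  "continuous_on UNIV (%x :: real \<times> real \<times> real. snd (snd x))" by (intro continuous_intros)+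
 note W = wt_continuous[OF c(1,2)] wt_continuous2[OF c]
 have "uniformly_differentiable_weight (%r s. g s r) (%r. (%x. wt_g N (fst (snd x)) (fst x) * wt_a N (fst (snd x)) (fst x)) (r, i t, j t)) t"
  by (rule I) (auto intro!: wt_cont continuous_intros W wt_g_deriv_t[OF N i' j'])
 then show "uniformly_differentiable_weight (%r s. g s r) (%r. g t r * wt_a N (i t) r) t" by simp
 have "uniformly_differentiable_weight (%r s. r * (g s r * wt_d N (i s) (j s) r))
   (%r. (%x. wt_g N (fst (snd x)) (fst x) * (wt_bt N (fst (snd x)) (snd (snd x)) (fst x) + wt_a N (fst (snd x)) (fst x) * (fst x * wt_d N (fst (snd x)) (snd (snd x)) (fst x)))) (r, i t, j t)) t"
  by (rule I) (simp_all, (intro wt_cont continuous_intros W wt_momentum_deriv_t[OF N i' j']; assumption?)+)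
 then show "uniformly_differentiable_weight (%r s. r * (g s r * wt_d N (i s) (j s) r))
   (%r. g t r * (wt_bt N (i t) (j t) r + wt_a N (i t) r * (r * wt_d N (i t) (j t) r))) t" by simp
 have "uniformly_differentiable_weight (%r s. g s r * wt_w N (i s) r) (%r. (%x. wt_g N (fst (snd x)) (fst x) * wt_wt N (fst (snd x)) (fst x)) (r, i t, j t)) t"
  by (rule I) (auto intro!: wt_cont continuous_intros W wt_w_deriv_t[OF N i' j'])
 then show "uniformly_differentiable_weight (%r s. g s r * wt_w N (i s) r) (%r. g t r * wt_wt N (i t) r) t" by simp
qed

lemma mult_integrable:
 assumes "continuous_on {0..1} c" "sqint M x"
 shows "integrable M (%r. c r * x r)" "sqint M y ==> integrable M (%r. c r * (x r * y r))" "sqint M y ==> integrable M (%r. c r * x r * y r)"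
 using sqint_integrable[OF finite_measure_rmeas sqint_continuous_mult[OF assms]] sqint_times[OF sqint_continuous_mult[OF assms]]
 by (auto simp: mult.assoc)

lemma profile:
 assumes t: "0 <= t"
 shows "sqint M (%r. F (u r t))" "sqint M (%r. well_potential (u r t))"
  "continuous_on {0..1} (%r. F (u r t))" "continuous_on {0..1} (%r. F' (u r t))"
  "continuous_on {0..1} (%r. well_potential (u r t))" "continuous_on {0..1} (%r. well_speed (u r t))"
  "ac (%r. F (u r t)) (%r. F' (u r t) * p r t)" "ac (%r. well_potential (u r t)) (%r. well_speed (u r t) * p r t)"
proof -
 obtain K K' where K: "C1_on_range F F' C K" "C1_on_range well_potential well_speed C K'"
  using C1_on_range_F C1_on_range_well_potential by blast
 note S1 = strong_solution_compose[OF sol t K(1)] and S2 = strong_solution_compose[OF sol t K(2)]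
 show "sqint M (%r. F (u r t))" "sqint M (%r. well_potential (u r t))"
  "continuous_on {0..1} (%r. F (u r t))" "continuous_on {0..1} (%r. F' (u r t))"
  "continuous_on {0..1} (%r. well_potential (u r t))" "continuous_on {0..1} (%r. well_speed (u r t))"
  "ac (%r. F (u r t)) (%r. F' (u r t) * p r t)" "ac (%r. well_potential (u r t)) (%r. well_speed (u r t) * p r t)"
  using S1 S2 sqint_continuous[OF S1(1)] sqint_continuous[OF S2(1)] by auto
qed

lemma excess_by_parts:
 assumes t: "0 <= t"
 shows "excess t = c0 - (LINT r|M. r * (g t r * wt_m (i t) r) * (well_speed (u r t) * p r t))"
proof -
 note S = strong_solutionD[OF sol t] and P = profile[OF t]
 have "(LINT r|M. r * (g t r * wt_m (i t) r) * (well_speed (u r t) * p r t)) = 1 * (g t 1 * wt_m (i t) 1) * well_potential (u 1 t)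
   - (LINT r|M. (g t r * wt_w N (i t) r - real N * (g t r * wt_m (i t) r) + real N * (g t r * wt_m (i t) r)) * well_potential (u r t))"
  by (rule integral_by_parts_linear[OF N P(8) sqint_continuous_mult[OF P(6) S(4)] P(5) C1_weight_m refl]) (intro continuous_intros wt_cont)
 then show ?thesis unfolding excess_def S(2) well_potential_1 by (simp add: algebra_simps)
qed

text \<open>\<open>wt_w\<close> is nonnegative inside the interface and nonpositive outside, while
  \<open>well_potential u\<close> lies between \<open>0\<close> and \<open>c0\<close>, so the signed
  integrand is a product of absolute values. The boundary quantity \<open>m1 t\<close> is accounted
  for by \<open>weight_flux\<close>.\<close>

lemma excess_eq:
 assumes t: "0 <= t" "t <= T"
 shows "excess t = (LINT r|M. g t r * \<bar>wt_w N (i t) r\<bar> * \<bar>well_potential (u r t) - (if r * i t < 1 then 0 else c0)\<bar>)"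
  "integrable M (%r. g t r * \<bar>wt_w N (i t) r\<bar> * \<bar>well_potential (u r t) - (if r * i t < 1 then 0 else c0)\<bar>)"
proof -
 note Rt = R[OF t] and P = profile[OF t(1)]
 have ip: "0 < i t" by (rule i_pos[OF t])
 note flux = weight_flux[OF N, of "R t" "i t"]
 let ?\<alpha> = "%r. if r * i t < 1 then 0 else g t r * wt_w N (i t) r"
 have i1: "integrable M (%r. g t r * wt_w N (i t) r * (well_potential (u r t) * 1))"
  using mult_integrable(1)[OF _ P(2), of "%r. g t r * wt_w N (i t) r"] by (simp add: continuous_intros wt_cont)
 have i2: "integrable M (%r. c0 * ?\<alpha> r)" using flux Rt by (intro integrable_mult_right) auto
 have e: "g t r * \<bar>wt_w N (i t) r\<bar> * \<bar>well_potential (u r t) - (if r * i t < 1 then 0 else c0)\<bar>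
   = g t r * wt_w N (i t) r * (well_potential (u r t) * 1) - c0 * ?\<alpha> r" for r
 proof (cases "r * i t < 1")
  case True
  then have "0 <= wt_w N (i t) r" using ip by (simp add: wt_w_def)
  then show ?thesis using True well_potential_range(1)[of "u r t"] by simp
 next
  case False
  then have w: "wt_w N (i t) r <= 0" using ip unfolding wt_w_def by (intro mult_nonpos_nonneg mult_nonneg_nonpos) auto
  have "\<bar>well_potential (u r t) - c0\<bar> = c0 - well_potential (u r t)" using well_potential_range(2)[of "u r t"] by simp
  then show ?thesis using False w by (simp add: algebra_simps)
 qed
 show "integrable M (%r. g t r * \<bar>wt_w N (i t) r\<bar> * \<bar>well_potential (u r t) - (if r * i t < 1 then 0 else c0)\<bar>)"
  unfolding e using i1 i2 by (rule Bochner_Integration.integrable_diff)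
 have "(LINT r|M. c0 * ?\<alpha> r) = c0 * (m1 t - 1)" using flux(2) Rt by (simp only: integral_mult_right_zero)
 then show "excess t = (LINT r|M. g t r * \<bar>wt_w N (i t) r\<bar> * \<bar>well_potential (u r t) - (if r * i t < 1 then 0 else c0)\<bar>)"
  unfolding e Bochner_Integration.integral_diff[OF i1 i2] excess_def by (simp add: algebra_simps)
qed

lemma excess_nonneg: "0 <= t ==> t <= T ==> 0 <= excess t"
 using excess_eq(1) g_nonneg by simp

lemma energy_integrable:
 assumes t: "0 <= t"
 shows "integrable M (%r. g t r * (v r t * v r t))" "integrable M (%r. g t r * (p r t * p r t))" "integrable M (%r. g t r * (F (u r t) * 1))"
 using mult_integrable(2)[OF wt_cont(1)] mult_integrable(1)[OF wt_cont(1)] strong_solutionD(4,9)[OF sol t] profile(1)[OF t] by auto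

end

lemma speed_gradient_bound:
 fixes eps :: real
 assumes e: "0 < eps" and f: "f\<^sup>2 <= 2 * H"
 shows "\<bar>f * p\<bar> <= eps / 2 * p^2 + H / eps"
proof -
 have "0 <= (\<bar>f\<bar> - eps * \<bar>p\<bar>)^2" by simp
 also have "\<dots> = f^2 + eps^2 * p^2 - 2 * eps * \<bar>f * p\<bar>" by (simp add: power2_diff power_mult_distrib abs_mult)
 finally have "2 * eps * \<bar>f * p\<bar> <= 2 * eps * (eps / 2 * p^2 + H / eps)" using e f by (simp add: power2_eq_square distrib_left)
 then show ?thesis using e by (simp only: mult_le_cancel_left_pos zero_less_numeral mult_pos_pos)
qed

lemma absorb_half:
 fixes L x d y z k :: real
 assumes "\<bar>L - x\<bar> <= d" "d <= y" "z <= 1 / 2 * x" "y = z + k" shows "x <= 2 * (L + k)"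
proof -
 have "x - L <= d" using assms(1) by simp
 then show ?thesis using assms(2-4) by argo
qed

lemma integral_linear_combination:
 fixes f h k :: "'b => real"
 assumes "integrable M f" "integrable M h" "integrable M k"
 shows "integrable M (%r. x * f r + y * h r + z * k r)"
  "(LINT r|M. x * f r + y * h r + z * k r) = x * integral\<^sup>L M f + y * integral\<^sup>L M h + z * integral\<^sup>L M k"
 using assms by simp_all

context damped_interface
begin

abbreviation density :: "real => real => real" where
 "density t r \<equiv> eps / 2 * (p r t)^2 + F (u r t) / eps"

lemma density_nonneg: "0 <= density t r"
 using eps F_nonneg by simp

lemma energy_alt:
 assumes t: "0 <= t"
 shows "integrable M (%r. g t r * (eps * kap / 2 * (v r t)^2 + density t r))"
  "energy t = (LINT r|M. g t r * (eps * kap / 2 * (v r t)^2 + density t r))"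
proof -
 have e: "g t r * (eps * kap / 2 * (v r t)^2 + density t r)
   = eps * kap / 2 * (g t r * (v r t * v r t)) + eps / 2 * (g t r * (p r t * p r t)) + 1 / eps * (g t r * (F (u r t) * 1))" for r
  by (simp add: power2_eq_square algebra_simps)
 note lin = integral_linear_combination[OF energy_integrable[OF t], of "eps * kap / 2" "eps / 2" "1 / eps"]
 show "integrable M (%r. g t r * (eps * kap / 2 * (v r t)^2 + density t r))" unfolding e by (rule lin(1))
 show "energy t = (LINT r|M. g t r * (eps * kap / 2 * (v r t)^2 + density t r))" unfolding e energy_def by (rule lin(2)[symmetric])
qed

text \<open>With \<open>c0 - excess\<close> written as the integral of the calibration field against
  \<open>well_speed u * p\<close>, Young's inequality bounds the latter product by the energy
  density, and only the share \<open>1 - r * wt_m\<close> of the density is left.\<close>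

lemma coercive:
 assumes t: "0 <= t" "t <= T"
 shows "integrable M (%r. g t r * (eps * kap / 2 * (v r t)^2 + (1 - r * wt_m (i t) r) * density t r))"
  "(LINT r|M. g t r * (eps * kap / 2 * (v r t)^2 + (1 - r * wt_m (i t) r) * density t r)) <= energy t - c0 + excess t"
proof -
 note S = strong_solutionD[OF sol t(1)] and P = profile[OF t(1)]
 let ?c = "%r. g t r * (1 - r * wt_m (i t) r)"
 have c: "continuous_on {0..1} ?c" by (intro continuous_intros wt_cont)
 have e: "g t r * (eps * kap / 2 * (v r t)^2 + (1 - r * wt_m (i t) r) * density t r)
   = eps * kap / 2 * (g t r * (v r t * v r t)) + eps / 2 * (?c r * (p r t * p r t)) + 1 / eps * (?c r * F (u r t))" for r
  by (simp add: power2_eq_square algebra_simps add_divide_distrib diff_divide_distrib)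
 show int: "integrable M (%r. g t r * (eps * kap / 2 * (v r t)^2 + (1 - r * wt_m (i t) r) * density t r))"
  unfolding e by (rule integral_linear_combination(1)[OF energy_integrable(1)[OF t(1)] mult_integrable(2)[OF c S(4) S(4)] mult_integrable(1)[OF c P(1)]])
 have ifp: "integrable M (%r. r * (g t r * wt_m (i t) r) * (well_speed (u r t) * p r t))"
  by (rule mult_integrable(1)[OF _ sqint_continuous_mult[OF P(6) S(4)]]) (intro continuous_intros wt_cont)
 have ip: "0 < i t" by (rule i_pos[OF t])
 have "(LINT r|M. g t r * (eps * kap / 2 * (v r t)^2 + (1 - r * wt_m (i t) r) * density t r))
  <= (LINT r|M. g t r * (eps * kap / 2 * (v r t)^2 + density t r) - r * (g t r * wt_m (i t) r) * (well_speed (u r t) * p r t))"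
 proof (rule integral_mono[OF int Bochner_Integration.integrable_diff[OF energy_alt(1)[OF t(1)] ifp]])
  fix r assume "r \<in> space M"
  then have r: "0 < r" "r < 1" by auto
  have "well_speed (u r t) * p r t <= density t r"
   using speed_gradient_bound[OF eps well_speed_sq, of "u r t" "p r t"] by linarith
  moreover have "0 <= r * (g t r * wt_m (i t) r)" using r g_nonneg[OF t, of r] ip by (simp add: wt_m_def)
  ultimately have "r * (g t r * wt_m (i t) r) * (well_speed (u r t) * p r t) <= r * (g t r * wt_m (i t) r) * density t r"
   by (rule mult_left_mono)
  then show "g t r * (eps * kap / 2 * (v r t)^2 + (1 - r * wt_m (i t) r) * density t r)
   <= g t r * (eps * kap / 2 * (v r t)^2 + density t r) - r * (g t r * wt_m (i t) r) * (well_speed (u r t) * p r t)"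
   by (simp only: distrib_left left_diff_distrib right_diff_distrib mult_1_left mult_1_right mult_ac)
 qed
 also have "\<dots> = energy t - c0 + excess t"
  using Bochner_Integration.integral_diff[OF energy_alt(1)[OF t(1)] ifp] energy_alt(2)[OF t(1)] excess_by_parts[OF t(1)] by linarith
 finally show "(LINT r|M. g t r * (eps * kap / 2 * (v r t)^2 + (1 - r * wt_m (i t) r) * density t r)) <= energy t - c0 + excess t" .
qed

lemma coercive_nonneg:
 assumes t: "0 <= t" "t <= T"
 shows "0 <= energy t - c0 + excess t"
proof -
 have "0 <= (LINT r|M. g t r * (eps * kap / 2 * (v r t)^2 + (1 - r * wt_m (i t) r) * density t r))"
 proof (rule integral_nonneg_AE, rule AE_I2)
  fix r assume "r \<in> space M"
  then have r: "0 < r" "r < 1" by auto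
  have "0 <= 1 - r * wt_m (i t) r" using wt_m_le_1(1)[of r "i t"] r i_pos[OF t] by simp
  then show "0 <= g t r * (eps * kap / 2 * (v r t)^2 + (1 - r * wt_m (i t) r) * density t r)"
   using g_nonneg[OF t, of r] eps \<tau> F_nonneg[of "u r t"] by (intro mult_nonneg_nonneg add_nonneg_nonneg) auto
 qed
 then show ?thesis using coercive(2)[OF t] by linarith
qed

lemma momentum_bound:
 assumes t: "0 <= t" "t <= T"
 shows "\<bar>eps * kap * mom t\<bar> <= A * sqrt kap * energy t"
proof -
 note S = strong_solutionD[OF sol t(1)]
 have c: "continuous_on {0..1} (%r. r * (g t r * wt_d N (i t) (j t) r))" by (intro continuous_intros wt_cont)
 have im: "integrable M (%r. eps * kap * (r * (g t r * wt_d N (i t) (j t) r) * (p r t * v r t)))"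
  by (rule integrable_mult_right[OF mult_integrable(2)[OF c S(4) S(9)]])
 have eq: "eps * kap * mom t = (LINT r|M. eps * kap * (r * (g t r * wt_d N (i t) (j t) r) * (p r t * v r t)))" by (rule integral_mult_right_zero[symmetric])
 have "(LINT r|M. \<bar>eps * kap * (r * (g t r * wt_d N (i t) (j t) r) * (p r t * v r t))\<bar>)
   <= (LINT r|M. A * sqrt kap * (g t r * (eps * kap / 2 * (v r t)^2 + density t r)))"
 proof (rule integral_mono[OF integrable_abs[OF im] integrable_mult_right[OF energy_alt(1)[OF t(1)]]])
  fix r assume "r \<in> space M"
  then have r: "0 <= r" "r <= 1" by auto
  have "\<bar>eps * kap * ((r * wt_d N (i t) (j t) r) * (p r t * v r t))\<bar> <= A * sqrt kap * (eps * kap / 2 * (v r t)^2 + eps / 2 * (p r t)^2)"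
   using coeff[OF t r, unfolded weight_bounds_def] eps kap by (intro kinetic_gradient_bound) auto
  also have "\<dots> <= A * sqrt kap * (eps * kap / 2 * (v r t)^2 + density t r)"
   using A kap eps F_nonneg[of "u r t"] by (intro mult_left_mono) auto
  finally have "g t r * \<bar>eps * kap * ((r * wt_d N (i t) (j t) r) * (p r t * v r t))\<bar> <= g t r * (A * sqrt kap * (eps * kap / 2 * (v r t)^2 + density t r))"
   by (rule mult_left_mono[OF _ g_nonneg[OF t]])
  moreover have "\<bar>eps * kap * (r * (g t r * wt_d N (i t) (j t) r) * (p r t * v r t))\<bar> = g t r * \<bar>eps * kap * ((r * wt_d N (i t) (j t) r) * (p r t * v r t))\<bar>"
  proof -
   have "eps * kap * (r * (g t r * wt_d N (i t) (j t) r) * (p r t * v r t)) = g t r * (eps * kap * ((r * wt_d N (i t) (j t) r) * (p r t * v r t)))" by (simp only: mult_ac)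
   then show ?thesis using g_nonneg[OF t, of r] by (simp only: abs_mult[of "g t r"] abs_of_nonneg)
  qed
  ultimately show "\<bar>eps * kap * (r * (g t r * wt_d N (i t) (j t) r) * (p r t * v r t))\<bar> <= A * sqrt kap * (g t r * (eps * kap / 2 * (v r t)^2 + density t r))"
   by (simp only: mult_ac)
 qed
 also have "\<dots> = A * sqrt kap * energy t" unfolding energy_alt(2)[OF t(1)] by (rule integral_mult_right_zero)
 finally show ?thesis unfolding eq by (rule order_trans[OF integral_abs_bound])
qed

text \<open>Differentiability is available only for \<open>t > 0\<close>, where \<open>w\<close> and
  the equation are given; continuity up to \<open>t = 0\<close> lets Gronwall's lemma start from the
  initial data.\<close>

lemma lyapunov_continuous: "continuous_on {0..T} lyapunov"
 unfolding continuous_on_def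
proof
 fix t assume "t \<in> {0..T}"
 then have t: "0 <= t" "t <= T" by auto
 obtain K K' where K: "C1_on_range F F' C K" "C1_on_range well_potential well_speed C K'"
  using C1_on_range_F C1_on_range_well_potential by blast
 note S = strong_solutionD[OF sol t(1)] and W = weight_time[OF t]
 have one: "L2lim M (%s r. 1) (%r. 1) (at t within {0..})" by (rule L2lim_const[OF sqint_continuous]) auto
 have m: "isCont (%s. 1 * (wt_g N (i s) 1 * wt_m (i s) 1)) t"
  by (rule DERIV_isCont[OF wt_m_deriv_t[OF N i' j', of t 1]]) (use t ab in auto)
 have "(lyapunov \<longlongrightarrow> lyapunov t) (at t within {0..})"
  unfolding lyapunov_def energy_def excess_def
  by (intro tendsto_add tendsto_diff tendsto_mult tendsto_const
   weighted_integral_continuous[OF S(13) S(13) W(1)] weighted_integral_continuous[OF S(11) S(11) W(1)]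
   weighted_integral_continuous[where h="%r s. 1", OF strong_solution_compose_limit[OF sol t(1) bd K(1)] one W(1)]
   weighted_integral_continuous[OF S(11) S(13) W(2)]
   weighted_integral_continuous[where h="%r s. 1", OF strong_solution_compose_limit[OF sol t(1) bd K(2)] one W(3)]
   isContD[OF m, THEN tendsto_within_subset[OF _ subset_UNIV]])
 then show "(lyapunov \<longlongrightarrow> lyapunov t) (at t within {0..T})" by (rule tendsto_within_subset) auto
qed

text \<open>The derivative is computed as a combination of integrals, which are then merged into the
  integral of a single function so that \<open>dissipation_bound\<close> applies pointwise. On the
  right the full energy carries the factor \<open>kap\<close>; the rest is the coercive
  quantity.\<close>

lemma lyapunov_derivative:
 assumes t: "0 < t" "t < T"
 shows "\<exists>D. (lyapunov has_real_derivative D) (at t) & D <= 7 * A^2 * (A * (energy t - c0 + excess t) + kap * energy t)"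
proof -
 have t0: "0 <= t" "t <= T" using t by auto
 obtain K K' where K: "C1_on_range F F' C K" "C1_on_range well_potential well_speed C K'"
  using C1_on_range_F C1_on_range_well_potential by blast
 note S = strong_solutionD[OF sol t0(1)] and S' = strong_solutionD'[OF sol t(1)] and W = weight_time[OF t0] and P = profile[OF t0(1)]
 let ?g = "%r. g t r" and ?a = "%r. wt_a N (i t) r" and ?d = "%r. wt_d N (i t) (j t) r" and ?br = "%r. wt_br N (i t) (j t) r"
  and ?bt = "%r. wt_bt N (i t) (j t) r" and ?w = "%r. wt_w N (i t) r" and ?c = "- real N * i t"
 let ?k = "%r. ?g r * (?c * (r * ?d r) + ?br r) + real N * (?g r * ?d r)"
 let ?q = "%r. l r t - F' (u r t) / eps^2 - v r t"
 have cg: "continuous_on {0..1} ?g" "continuous_on {0..1} (%r. ?g r * ?a r)" "continuous_on {0..1} (%r. r * (?g r * ?d r))"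
   "continuous_on {0..1} ?k" "continuous_on {0..1} (%r. ?g r * ?d r)" "continuous_on {0..1} (%r. ?c * ?g r)"
   "continuous_on {0..1} (%r. ?g r * (?bt r + ?a r * (r * ?d r)))" "continuous_on {0..1} (%r. ?g r * ?w r)"
   "continuous_on {0..1} (%r. r * (?g r * wt_mt N (i t) r))" "continuous_on {0..1} (%r. ?g r * wt_mt N (i t) r)"
  by (intro continuous_intros wt_cont)+
 have d1: "?g 1 * ?d 1 = 0" by (simp add: wt_d_def)
 define A1 where "A1 = (LINT r|M. ?g r * ?a r * (v r t * v r t))"
 define A2 where "A2 = (LINT r|M. ?g r * (v r t + v r t) * w r t)"
 define A3 where "A3 = (LINT r|M. ?g r * ?a r * (p r t * p r t))"
 define A4 where "A4 = (LINT r|M. (?g r * (l r t + l r t) + ?c * ?g r * (p r t + p r t)) * v r t)"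
 define A5 where "A5 = (LINT r|M. ?g r * ?a r * (F (u r t) * 1))"
 define A6 where "A6 = (LINT r|M. ?g r * F' (u r t) * v r t)"
 define A7 where "A7 = (LINT r|M. ?g r * (?bt r + ?a r * (r * ?d r)) * (p r t * v r t))"
 define A8 where "A8 = (LINT r|M. r * (?g r * ?d r) * p r t * w r t)"
 define A9 where "A9 = (LINT r|M. ?k r * (v r t)^2)"
 define A10 where "A10 = (LINT r|M. ?g r * wt_wt N (i t) r * (well_potential (u r t) * 1))"
 define A11 where "A11 = (LINT r|M. ?g r * ?w r * well_speed (u r t) * v r t)"
 define A12 where "A12 = (LINT r|M. ?k r * (p r t)^2)"
 define A13 where "A13 = (LINT r|M. ?k r * F (u r t))"
 define e1 where "e1 = 1 * (g t 1 * wt_mt N (i t) 1)"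
 have "(lyapunov has_real_derivative
   eps * kap / 2 * (A1 + A2) + eps / 2 * (A3 + - A4) + 1 / eps * (A5 + A6) + eps * kap * (A7 + (A8 - A9 / 2)) - 0
    + 2 * (c0 * (0 - e1) + (A10 + A11))) (at t within {0..})"
  unfolding lyapunov_def energy_def excess_def A1_def A2_def A3_def A4_def A5_def A6_def A7_def A8_def A9_def A10_def A11_def e1_def
  by (intro DERIV_add DERIV_diff DERIV_cmult DERIV_const
   time_derivative_velocity[OF sol t(1) W(1)] time_derivative_gradient[OF sol t0(1) N W(1) C1_weight_g]
   time_derivative_compose[OF sol t0(1) bd K(1) W(1)]
   time_derivative_momentum[OF sol t(1) N W(2) C1_weight_momentum refl cg(5) d1]
   time_derivative_compose[OF sol t0(1) bd K(2) W(3)]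
   has_field_derivative_at_within[OF wt_m_deriv_t[OF N i' j']]; use t ab in simp)
 then have deriv: "(lyapunov has_real_derivative
   eps * kap / 2 * (A1 + A2) + eps / 2 * (A3 + - A4) + 1 / eps * (A5 + A6) + eps * kap * (A7 + (A8 - A9 / 2)) - 0
    + 2 * (c0 * (0 - e1) + (A10 + A11))) (at t)" (is "(lyapunov has_real_derivative ?D) _")
  using t by (simp only: at_within_interior[of t "{0..}"] interior_real_atLeast greaterThan_iff)
 have qs: "sqint M ?q"
  using sqint_diff[OF sqint_diff[OF S(5) sqint_cmult[OF sqint_continuous[OF P(4)], where c="inverse (eps^2)"]] S(9)] by (simp add: divide_inverse mult.commute)
 \<comment> \<open>The equation holds almost everywhere, so under an integral \<open>kap * w\<close>
   may be exchanged for \<open>?q\<close>.\<close>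
 have wq: "(LINT r|M. c r * x r * ?q r) = kap * (LINT r|M. c r * x r * w r t)" "integrable M (%r. c r * x r * ?q r)"
  if c: "continuous_on {0..1} c" and x: "sqint M x" for c x
 proof -
  note i = mult_integrable(3)[OF c x qs] mult_integrable(3)[OF c x S'(1)]
  show "integrable M (%r. c r * x r * ?q r)" by (rule i(1))
  have "(LINT r|M. c r * x r * ?q r) = (LINT r|M. kap * (c r * x r * w r t))"
  proof (rule integral_cong_AE)
   show "AE r in M. c r * x r * ?q r = kap * (c r * x r * w r t)"
    using S'(3)
   proof eventually_elim
    case (elim r)
    then have "?q r = kap * w r t" by simp
    then show ?case by (simp only: mult_ac)
   qed
  qed (use i in auto)
  also have "\<dots> = kap * (LINT r|M. c r * x r * w r t)" by (rule integral_mult_right_zero)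
  finally show "(LINT r|M. c r * x r * ?q r) = kap * (LINT r|M. c r * x r * w r t)" .
 qed
 note hI = has_bochner_integral_integrable
 have H1: "has_bochner_integral M (%r. ?g r * ?a r * (v r t * v r t)) A1" unfolding A1_def by (rule hI[OF mult_integrable(2)[OF cg(2) S(9) S(9)]])
 have H2: "has_bochner_integral M (%r. ?g r * (v r t + v r t) * ?q r) (kap * A2)"
  unfolding A2_def wq(1)[OF cg(1) sqint_add[OF S(9) S(9)], symmetric] by (rule hI[OF wq(2)[OF cg(1) sqint_add[OF S(9) S(9)]]])
 have H3: "has_bochner_integral M (%r. ?g r * ?a r * (p r t * p r t)) A3" unfolding A3_def by (rule hI[OF mult_integrable(2)[OF cg(2) S(4) S(4)]])
 have H4: "has_bochner_integral M (%r. (?g r * (l r t + l r t) + ?c * ?g r * (p r t + p r t)) * v r t) A4"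
  unfolding A4_def by (rule hI[OF sqint_times[OF sqint_add[OF sqint_continuous_mult[OF cg(1) sqint_add[OF S(5) S(5)]] sqint_continuous_mult[OF cg(6) sqint_add[OF S(4) S(4)]]] S(9)]])
 have H5: "has_bochner_integral M (%r. ?g r * ?a r * (F (u r t) * 1)) A5"
  unfolding A5_def by (rule hI[OF mult_integrable(1)[OF cg(2)]]) (use P(1) in simp)
 have H6: "has_bochner_integral M (%r. ?g r * F' (u r t) * v r t) A6"
  unfolding A6_def by (rule hI[OF mult_integrable(3)[OF cg(1) sqint_continuous[OF P(4)] S(9)]])
 have H7: "has_bochner_integral M (%r. ?g r * (?bt r + ?a r * (r * ?d r)) * (p r t * v r t)) A7"
  unfolding A7_def by (rule hI[OF mult_integrable(2)[OF cg(7) S(4) S(9)]])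
 have H8: "has_bochner_integral M (%r. r * (?g r * ?d r) * p r t * ?q r) (kap * A8)"
  unfolding A8_def wq(1)[OF cg(3) S(4), symmetric] by (rule hI[OF wq(2)[OF cg(3) S(4)]])
 have k2: "integrable M (%r. ?k r * (x r)^2)" if "sqint M x" for x
  using mult_integrable(2)[OF cg(4) that that] by (simp add: power2_eq_square)
 have H9: "has_bochner_integral M (%r. ?k r * (v r t)^2) A9" unfolding A9_def by (rule hI[OF k2[OF S(9)]])
 have H11: "has_bochner_integral M (%r. ?g r * ?w r * well_speed (u r t) * v r t) A11"
  unfolding A11_def by (rule hI[OF mult_integrable(3)[OF cg(8) sqint_continuous[OF P(6)] S(9)]])
 have H12: "has_bochner_integral M (%r. ?k r * (p r t)^2) A12" unfolding A12_def by (rule hI[OF k2[OF S(4)]])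
 have H13: "has_bochner_integral M (%r. ?k r * F (u r t)) A13" unfolding A13_def by (rule hI[OF mult_integrable(1)[OF cg(4) P(1)]])
 have I1: "has_bochner_integral M (%r. r * (?g r * ?d r) * p r t * (l r t - real N / r * p r t)) (- A12 / 2)"
 proof -
  have "integrable M (%r. r * (?g r * ?d r) * p r t * l r t - real N * (?g r * ?d r * (p r t * p r t)))"
   by (rule Bochner_Integration.integrable_diff[OF mult_integrable(3)[OF cg(3) S(4) S(5)] integrable_mult_right[OF mult_integrable(2)[OF cg(5) S(4) S(4)]]])
  then have int: "integrable M (%r. r * (?g r * ?d r) * p r t * (l r t - real N / r * p r t))"
   by (rule Bochner_Integration.integrable_cong[THEN iffD1, OF refl, rotated]) (simp add: right_diff_distrib)
  \<comment> \<open>The bound required by \<open>integral_by_parts_quadratic\<close> with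
    \<open>h = p\<close>: dividing the squared flux estimate by \<open>r ^ N\<close> still leaves a
    factor \<open>r <= 1\<close>.\<close>
  have "r ^ N * (p r t)^2 <= (l2norm M (%r. l r t))^2" if r: "0 < r" "r < 1" for r
  proof -
   have "\<bar>r ^ N * p r t\<bar>\<^sup>2 <= (sqrt (r ^ Suc N) * l2norm M (%r. l r t))^2"
    by (rule power_mono[OF flux_bound[OF N S(4) S(5) S(7) r]]) simp
   moreover have "(sqrt (r ^ Suc N))^2 = r * r ^ N" using r by simp
   ultimately have "r ^ N * r ^ N * (p r t)^2 <= r * r ^ N * (l2norm M (%r. l r t))^2"
    by (simp only: power2_abs power_mult_distrib power2_eq_square[of "r ^ N"])
   then have "r ^ N * (r ^ N * (p r t)^2) <= r ^ N * (r * (l2norm M (%r. l r t))^2)"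
    by (simp only: mult_ac)
   then have "r ^ N * (p r t)^2 <= r * (l2norm M (%r. l r t))^2" using r by (simp only: mult_le_cancel_left_pos zero_less_power)
   also have "\<dots> <= 1 * (l2norm M (%r. l r t))^2" using r by (intro mult_right_mono) auto
   finally show ?thesis by simp
  qed
  from integral_by_parts_quadratic[OF N S(6) S(4) this C1_weight_momentum refl cg(5) d1 int] show ?thesis
   using int unfolding has_bochner_integral_iff A12_def by simp
 qed
 have I2: "has_bochner_integral M (%r. r * (?g r * ?d r) * (F' (u r t) * p r t)) (- A13)"
  using integral_by_parts_linear[OF N P(7) sqint_continuous_mult[OF P(4) S(4)] P(3) C1_weight_momentum refl cg(5)]
   mult_integrable(1)[OF cg(3) sqint_continuous_mult[OF P(4) S(4)]] S(2) F_zero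
  unfolding has_bochner_integral_iff A13_def by simp
 have I3: "has_bochner_integral M (%r. r * (?g r * wt_mt N (i t) r) * (well_speed (u r t) * p r t)) (e1 * c0 - A10)"
  using integral_by_parts_linear[OF N P(8) sqint_continuous_mult[OF P(6) S(4)] P(5) C1_weight_mt refl cg(10)]
   mult_integrable(1)[OF cg(9) sqint_continuous_mult[OF P(6) S(4)]] S(2) well_potential_1
  unfolding has_bochner_integral_iff A10_def e1_def by simp
 \<comment> \<open>The last two lines integrate to zero by \<open>I1\<close>, \<open>I2\<close> and
   the definitions of \<open>A12\<close>, \<open>A13\<close>. The term with \<open>wt_mt\<close>
   stands, by \<open>I3\<close>, for the parts of the derivative of the excess that do not contain
   \<open>v\<close>.\<close>
 let ?X = "%r. eps * kap / 2 * (?g r * ?a r * (v r t * v r t)) + eps / 2 * (?g r * (v r t + v r t) * ?q r) + eps / 2 * (?g r * ?a r * (p r t * p r t))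
   - eps / 2 * ((?g r * (l r t + l r t) + ?c * ?g r * (p r t + p r t)) * v r t) + 1 / eps * (?g r * ?a r * (F (u r t) * 1)) + 1 / eps * (?g r * F' (u r t) * v r t)
   + eps * kap * (?g r * (?bt r + ?a r * (r * ?d r)) * (p r t * v r t)) + eps * (r * (?g r * ?d r) * p r t * ?q r)
   - eps * kap / 2 * (?k r * (v r t)^2) + 2 * (?g r * ?w r * well_speed (u r t) * v r t) - 2 * (r * (?g r * wt_mt N (i t) r) * (well_speed (u r t) * p r t))
   - eps * (r * (?g r * ?d r) * p r t * (l r t - real N / r * p r t) + 1 / 2 * (?k r * (p r t)^2))
   + 1 / eps * (r * (?g r * ?d r) * (F' (u r t) * p r t) + ?k r * F (u r t))"
 have "has_bochner_integral M ?X (eps * kap / 2 * A1 + eps / 2 * (kap * A2) + eps / 2 * A3 - eps / 2 * A4 + 1 / eps * A5 + 1 / eps * A6 + eps * kap * A7 + eps * (kap * A8)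
   - eps * kap / 2 * A9 + 2 * A11 - 2 * (e1 * c0 - A10) - eps * (- A12 / 2 + 1 / 2 * A12) + 1 / eps * (- A13 + A13))"
  by (intro has_bochner_integral_add has_bochner_integral_diff has_bochner_integral_mult_right H1 H2 H3 H4 H5 H6 H7 H8 H9 H11 I3 I1 H12 I2 H13)
 moreover have "eps * kap / 2 * A1 + eps / 2 * (kap * A2) + eps / 2 * A3 - eps / 2 * A4 + 1 / eps * A5 + 1 / eps * A6 + eps * kap * A7 + eps * (kap * A8)
   - eps * kap / 2 * A9 + 2 * A11 - 2 * (e1 * c0 - A10) - eps * (- A12 / 2 + 1 / 2 * A12) + 1 / eps * (- A13 + A13) = ?D"
  by (simp add: algebra_simps add_divide_distrib diff_divide_distrib)
 ultimately have X: "integrable M ?X" "(LINT r|M. ?X r) = ?D" unfolding has_bochner_integral_iff by auto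
 let ?Y = "%r. 7 * A^2 * (A * (g t r * (eps * kap / 2 * (v r t)^2 + (1 - r * wt_m (i t) r) * density t r))
   + kap * (g t r * (eps * kap / 2 * (v r t)^2 + density t r)))"
 note Yi = integrable_mult_right[OF coercive(1)[OF t0], of A] integrable_mult_right[OF energy_alt(1)[OF t0(1)], of kap]
 have "?D <= (LINT r|M. ?Y r)"
  unfolding X(2)[symmetric]
 proof (rule integral_mono[OF X(1) integrable_mult_right[OF Bochner_Integration.integrable_add[OF Yi]]])
  fix r assume "r \<in> space M"
  then have r: "0 < r" "r < 1" "0 <= r" "r <= 1" by auto
  note co = coeff[OF t0 r(3,4), unfolded weight_bounds_def]
  have m: "r * wt_mt N (i t) r = - (?w r * (r * i t) * ?c)"
   unfolding wt_mt_def wt_w_def by (simp add: power3_eq_cube)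
  have f: "(well_speed (u r t))^2 <= 2 * eps * (F (u r t) / eps)" using well_speed_sq[of "u r t"] eps by simp
  let ?h = "r * i t - 1"
  let ?B = "eps * kap / 2 * ?a r * (v r t)^2 - eps * (v r t)^2 + eps / 2 * ?a r * (p r t)^2 - eps * ?c * p r t * v r t + ?a r * (F (u r t) / eps)
   + eps * kap * (?bt r + ?a r * (r * ?d r)) * p r t * v r t - eps * (r * ?d r) * p r t * v r t
   - eps * kap / 2 * (real N * ?d r + ?c * (r * ?d r) + ?br r) * (v r t)^2 + eps / 2 * (real N * ?d r - ?c * (r * ?d r) - ?br r) * (p r t)^2
   + (real N * ?d r + ?c * (r * ?d r) + ?br r) * (F (u r t) / eps) + 2 * ?w r * well_speed (u r t) * v r t + 2 * ?w r * (r * i t) * ?c * well_speed (u r t) * p r t"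
  have XB: "?X r = ?g r * ?B" by (rule energy_identity_pointwise[OF _ _ m]) (use r eps in auto)
  have "?B <= 7 * A^2 * (?h\<^sup>2 * density t r + eps * kap / 2 * (v r t)^2 + kap * (eps / 2 * (p r t)^2))"
   by (rule dissipation_bound[OF eps less_imp_le[OF kap] A f]) (use co in \<open>simp_all add: algebra_simps\<close>)
  also have "\<dots> <= 7 * A^2 * (A * (eps * kap / 2 * (v r t)^2 + (1 - r * wt_m (i t) r) * density t r) + kap * (eps * kap / 2 * (v r t)^2 + density t r))"
  proof (rule mult_left_mono)
   have "?h\<^sup>2 * density t r <= A * (1 - r * wt_m (i t) r) * density t r"
    using co density_nonneg by (intro mult_right_mono) auto
   moreover have "1 * (eps * kap / 2 * (v r t)^2) <= A * (eps * kap / 2 * (v r t)^2)" using A eps \<tau> by (intro mult_right_mono) auto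
   moreover have "kap * (eps / 2 * (p r t)^2) <= kap * (eps * kap / 2 * (v r t)^2 + density t r)"
    using eps \<tau> F_nonneg[of "u r t"] by (intro mult_left_mono) auto
   ultimately show "?h\<^sup>2 * density t r + eps * kap / 2 * (v r t)^2 + kap * (eps / 2 * (p r t)^2)
     <= A * (eps * kap / 2 * (v r t)^2 + (1 - r * wt_m (i t) r) * density t r) + kap * (eps * kap / 2 * (v r t)^2 + density t r)"
    unfolding distrib_left[of A] mult_1_left mult.assoc[of A] by linarith
  qed simp
  finally have "?g r * ?B <= ?g r * (7 * A^2 * (A * (eps * kap / 2 * (v r t)^2 + (1 - r * wt_m (i t) r) * density t r) + kap * (eps * kap / 2 * (v r t)^2 + density t r)))"
   by (rule mult_left_mono[OF _ g_nonneg[OF t0]])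
  also have "\<dots> = ?Y r" by (simp only: distrib_left mult_ac)
  finally show "?X r <= ?Y r" unfolding XB .
 qed
 also have "(LINT r|M. ?Y r) = 7 * A^2 * (A * (LINT r|M. g t r * (eps * kap / 2 * (v r t)^2 + (1 - r * wt_m (i t) r) * density t r)) + kap * energy t)"
  unfolding energy_alt(2)[OF t0(1)] integral_mult_right_zero Bochner_Integration.integral_add[OF Yi] ..
 also have "\<dots> <= 7 * A^2 * (A * (energy t - c0 + excess t) + kap * energy t)"
  using coercive(2)[OF t0] A by (intro mult_left_mono add_right_mono) auto
 finally show ?thesis using deriv by blast
qed

text \<open>The momentum is at most \<open>\<delta>\<close> times the energy with
  \<open>\<delta> <= 1/2\<close>, so \<open>X\<close> is at most
  \<open>2 * (lyapunov + \<delta> * c0)\<close>, and Gronwall's lemma for \<open>lyapunov\<close>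
  controls \<open>X\<close>. The rate \<open>14 * A^2 * (A + 1)\<close> is the factor
  \<open>7 * A^2 * (A + 1)\<close> from the derivative bound times the \<open>2\<close> lost in this
  comparison.\<close>

lemma main_estimate:
 assumes small: "A * sqrt kap <= 1 / 2" and t: "0 <= t" "t <= T"
 defines "B \<equiv> 2 * (energy 0 - c0 + 2 * excess 0 + A * sqrt kap * energy 0 + 2 * (A * sqrt kap * c0)) * exp (14 * A^2 * (A + 1) * T)"
 shows "excess t <= B" "energy t <= B + c0"
proof -
 define \<delta> where "\<delta> = A * sqrt kap"
 have \<delta>: "0 <= \<delta>" "\<delta> <= 1 / 2" using A kap small by (auto simp: \<delta>_def)
 have kap\<delta>: "kap <= \<delta>" "kap <= 1"
 proof -
  have s: "sqrt kap <= \<delta>" unfolding \<delta>_def using A kap by simp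
  have s1: "sqrt kap <= 1" using s \<delta> by linarith
  have "kap = sqrt kap * sqrt kap" using kap by simp
  also have "\<dots> <= \<delta> * 1" using s s1 \<delta> kap by (intro mult_mono) simp_all
  finally show "kap <= \<delta>" by simp
  then show "kap <= 1" using \<delta> by linarith
 qed
 define X where "X s = energy s - c0 + 2 * excess s" for s
 have c0: "0 < c0" by (rule min_energy_pos)
 have xf: "0 <= excess s" "excess s <= X s" "energy s <= X s + c0" "\<bar>lyapunov s - X s\<bar> <= \<delta> * energy s"
   "X s <= 2 * (lyapunov s + \<delta> * c0)"
  if s: "0 <= s" "s <= T" for s
 proof -
  show 1: "0 <= excess s" by (rule excess_nonneg[OF s])
  show "excess s <= X s" using coercive_nonneg[OF s] 1 unfolding X_def by linarith
  with 1 have x0: "0 <= X s" by (rule order_trans)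
  show 2: "energy s <= X s + c0" using 1 unfolding X_def by linarith
  show 3: "\<bar>lyapunov s - X s\<bar> <= \<delta> * energy s"
   using momentum_bound[OF s] unfolding lyapunov_def \<delta>_def X_def by simp
  have "\<delta> * energy s <= \<delta> * (X s + c0)" using 2 \<delta> by (intro mult_left_mono) auto
  moreover have "\<delta> * X s <= 1 / 2 * X s" using x0 \<delta> by (intro mult_right_mono) auto
  moreover have "\<delta> * (X s + c0) = \<delta> * X s + \<delta> * c0" by (rule distrib_left)
  ultimately show "X s <= 2 * (lyapunov s + \<delta> * c0)" using absorb_half[OF 3] by blast
 qed
 have "\<forall>s. \<exists>D. 0 < s --> s < T --> (lyapunov has_real_derivative D) (at s) & D <= 7 * A^2 * (A * (energy s - c0 + excess s) + kap * energy s)"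
  using lyapunov_derivative by blast
 then obtain Y' where Y': "!!s. 0 < s ==> s < T ==> (lyapunov has_real_derivative Y' s) (at s)"
   "!!s. 0 < s ==> s < T ==> Y' s <= 7 * A^2 * (A * (energy s - c0 + excess s) + kap * energy s)"
  by metis
 have b: "Y' s <= 14 * A^2 * (A + 1) * (lyapunov s + 2 * (\<delta> * c0))" if s: "0 < s" "s < T" for s
 proof -
  have s0: "0 <= s" "s <= T" using s by auto
  note Xs = xf[OF s0]
  have xx: "0 <= X s" using Xs by linarith
  have "A * (energy s - c0 + excess s) <= A * X s" using Xs(1) A unfolding X_def by (intro mult_left_mono) auto
  moreover have "kap * energy s <= kap * (X s + c0)" using Xs(3) kap by (intro mult_left_mono) auto
  moreover have "kap * X s <= 1 * X s" using kap\<delta> xx by (intro mult_right_mono) auto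
  moreover have "kap * c0 <= \<delta> * c0" using kap\<delta> c0 by (intro mult_right_mono) auto
  ultimately have "A * (energy s - c0 + excess s) + kap * energy s <= A * X s + X s + \<delta> * c0"
   by (simp only: distrib_left)
  also have "\<dots> <= (A + 1) * (X s + \<delta> * c0)"
   using A \<delta> c0 mult_nonneg_nonneg[of A "\<delta> * c0"] by (simp add: algebra_simps)
  also have "\<dots> <= (A + 1) * (2 * (lyapunov s + 2 * (\<delta> * c0)))"
  proof (rule mult_left_mono)
   show "X s + \<delta> * c0 <= 2 * (lyapunov s + 2 * (\<delta> * c0))"
    using Xs(5) mult_nonneg_nonneg[OF \<delta>(1) less_imp_le[OF c0]] by argo
  qed (use A in simp)
  finally have le: "7 * A^2 * (A * (energy s - c0 + excess s) + kap * energy s) <= 7 * A^2 * ((A + 1) * (2 * (lyapunov s + 2 * (\<delta> * c0))))"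
   by (rule mult_left_mono) simp
  have eq: "7 * A^2 * ((A + 1) * (2 * (lyapunov s + 2 * (\<delta> * c0)))) = 14 * A^2 * (A + 1) * (lyapunov s + 2 * (\<delta> * c0))"
   by (simp add: algebra_simps)
  show ?thesis using order_trans[OF Y'(2)[OF s] le] unfolding eq .
 qed
 have "2 * Z * e / 2 = Z * e" for Z e :: real by simp
 then have Bh: "B / 2 = (X 0 + \<delta> * energy 0 + 2 * (\<delta> * c0)) * exp (14 * A^2 * (A + 1) * T)"
  unfolding B_def \<delta>_def X_def .
 have 0: "0 <= (0::real)" "0 <= T" using t by auto
 have Y0: "lyapunov 0 <= X 0 + \<delta> * energy 0" "0 <= lyapunov 0 + 2 * (\<delta> * c0)"
  using xf[OF 0] mult_nonneg_nonneg[OF \<delta>(1) less_imp_le[OF c0]] by (linarith | argo)+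
 have "lyapunov t + 2 * (\<delta> * c0) <= (lyapunov 0 + 2 * (\<delta> * c0)) * exp (14 * A^2 * (A + 1) * t)"
  by (rule gronwall[OF lyapunov_continuous Y'(1) b t])
 also have "\<dots> <= (lyapunov 0 + 2 * (\<delta> * c0)) * exp (14 * A^2 * (A + 1) * T)"
  using A t Y0 by (intro mult_left_mono) (auto intro!: mult_left_mono)
 also have "\<dots> <= (X 0 + \<delta> * energy 0 + 2 * (\<delta> * c0)) * exp (14 * A^2 * (A + 1) * T)"
  using Y0 by (intro mult_right_mono) auto
 finally have "lyapunov t + 2 * (\<delta> * c0) <= B / 2" unfolding Bh .
 then have "X t <= B" using xf(5)[OF t] mult_nonneg_nonneg[OF \<delta>(1) less_imp_le[OF c0]] by (linarith | argo)
 then show "excess t <= B" "energy t <= B + c0" using xf(2,3)[OF t] by linarith+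
qed

end

subsection \<open>Convergence to the sharp interface\<close>

lemma lebesgue_integral_closed_unit_interval:
 fixes f :: "real => real"
 assumes "integrable (lebesgue_on {0<..<1}) f"
 shows "(LINT r|lebesgue_on {0..1}. f r) = (LINT r|lebesgue_on {0<..<1}. f r)"
proof -
 have n: "negligible {x \<in> {0<..<1} - {0..1}. f x ~= 0}" "negligible {x \<in> {0..1} - {0<..<1}. f x ~= 0}"
  by (rule negligible_subset[of "{0, 1}"]; auto)+
 have "f absolutely_integrable_on {0<..<1}" using assms by (simp add: integrable_lebesgue_on_iff)
 then have "f absolutely_integrable_on {0..1}" using absolutely_integrable_spike_set_eq[OF n] by simp
 then have "integrable (lebesgue_on {0..1}) f" by (simp add: integrable_lebesgue_on_iff)
 then show ?thesis
  using lebesgue_integral_eq_integral[of "{0..1}" f] lebesgue_integral_eq_integral[OF assms] integral_spike_set[OF n] by simp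
qed

lemma lebesgue_integral_closed_unit_interval_cong:
 fixes f g :: "real => real"
 assumes "integrable (lebesgue_on {0<..<1}) f" and e: "!!r. 0 < r ==> r < 1 ==> f r = g r"
 shows "(LINT r|lebesgue_on {0..1}. f r) = (LINT r|lebesgue_on {0..1}. g r)"
proof -
 have "(LINT r|lebesgue_on {0<..<1}. f r) = (LINT r|lebesgue_on {0<..<1}. g r)"
  by (rule Bochner_Integration.integral_cong) (use e in auto)
 moreover have "integrable (lebesgue_on {0<..<1}) g"
  using assms(1) by (rule Bochner_Integration.integrable_cong[THEN iffD1, OF refl, rotated]) (use e in auto)
 ultimately show ?thesis using assms(1) by (simp add: lebesgue_integral_closed_unit_interval)
qed

text \<open>Measurability of \<open>\<phi>\<close> is not assumed: if \<open>\<phi>\<close> is not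
  integrable, its Bochner integral is \<open>0\<close> by convention and both bounds hold.\<close>

lemma lebesgue_integral_nonneg_le:
 fixes \<phi> :: "real => real"
 assumes "0 <= T" "0 <= e" "!!t. 0 <= t ==> t <= T ==> 0 <= \<phi> t & \<phi> t <= e"
 shows "0 <= (LINT t|lebesgue_on {0..T}. \<phi> t)" "(LINT t|lebesgue_on {0..T}. \<phi> t) <= e * T"
proof -
 show "0 <= (LINT t|lebesgue_on {0..T}. \<phi> t)"
  using assms(3) by (intro integral_nonneg_AE AE_I2) simp
 show "(LINT t|lebesgue_on {0..T}. \<phi> t) <= e * T"
 proof (cases "integrable (lebesgue_on {0..T}) \<phi>")
  case True
  have "(LINT t|lebesgue_on {0..T}. \<phi> t) <= (LINT t|lebesgue_on {0..T}. e)"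
   using True assms(3) by (intro integral_mono) (auto intro: continuous_imp_integrable_real)
  also have "\<dots> = e * T" using assms(1) by (simp add: measure_restrict_space)
  finally show ?thesis .
 next
  case False
  then show ?thesis using assms by (simp add: not_integrable_integral_eq)
 qed
qed

lemma rmeas_layer:
 assumes "0 <= \<alpha>"
 shows "{R - \<alpha>..R + \<alpha>} \<inter> {0<..<1} \<in> sets (rmeas N)" "measure (rmeas N) ({R - \<alpha>..R + \<alpha>} \<inter> {0<..<1}) <= 2 * \<alpha>"
proof -
 let ?S = "{R - \<alpha>..R + \<alpha>} \<inter> {0<..<1}"
 have S: "?S \<in> sets (lebesgue_on {0<..<1})" by (subst sets_restrict_space_iff) auto
 then show "?S \<in> sets (rmeas N)" by (simp add: sets_rmeas)
 have "emeasure (rmeas N) ?S = (\<integral>\<^sup>+r. ennreal (r ^ N) * indicator ?S r \<partial>lebesgue_on {0<..<1})"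
  unfolding rmeas_def using S power_measurable_rmeas by (subst emeasure_density) auto
 also have "\<dots> <= (\<integral>\<^sup>+r. indicator ?S r \<partial>lebesgue_on {0<..<1})"
  by (rule nn_integral_mono) (auto simp: power_le_one indicator_def)
 also have "\<dots> = emeasure (lebesgue_on {0<..<1}) ?S" using S by simp
 also have "\<dots> = emeasure lebesgue ?S" by (rule emeasure_restrict_space) auto
 also have "\<dots> <= emeasure lebesgue {R - \<alpha>..R + \<alpha>}" by (rule emeasure_mono) auto
 also have "\<dots> = ennreal (2 * \<alpha>)" using assms by simp
 finally show "measure (rmeas N) ?S <= 2 * \<alpha>"
  using assms unfolding measure_def by (metis enn2real_mono enn2real_ennreal ennreal_less_top mult_nonneg_nonneg zero_le_numeral)
qed

lemma rmeas_total: "measure (rmeas N) {0<..<1} <= 1"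
 using rmeas_layer(2)[where \<alpha>="1/2" and R="1/2" and N=N] by (simp add: Int_absorb1 subset_eq)

context damped_interface
begin

abbreviation phase :: "real => real => real" where
 "phase t r \<equiv> if r * i t < 1 then -1 else 1"

lemma phase_distance_integrable:
 assumes t: "0 <= t"
 shows "integrable M (%r. \<bar>u r t - phase t r\<bar>)"
proof -
 have "(%r. r * i t) \<in> borel_measurable M" by (intro continuous_rmeas continuous_intros)
 then have "{r \<in> space M. r * i t < 1} \<in> sets M" by (intro borel_measurable_less) auto
 then have "(%r. phase t r) \<in> borel_measurable M" by (intro measurable_If) auto
 moreover have "(%r. u r t) \<in> borel_measurable M" by (rule continuous_rmeas_Icc[OF strong_solutionD(1)[OF sol t]])
 ultimately have "(%r. \<bar>u r t - phase t r\<bar>) \<in> borel_measurable M" by (intro borel_measurable_abs borel_measurable_diff)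
 then show ?thesis
 proof (intro sqint_integrable[OF finite_measure_rmeas sqint_bounded[OF finite_measure_rmeas, of _ _ "C + 1"]])
  fix r assume "r \<in> space M"
  then have "0 < r" "r < 1" by auto
  from bd[OF this t] show "\<bar>\<bar>u r t - phase t r\<bar>\<bar> <= C + 1" by auto
 qed
qed

lemma phase_distance_eq:
 assumes t: "0 <= t" "t <= T"
 shows "(LINT r|lebesgue_on {0..1}. \<bar>u r t - step_profile (R t) r\<bar> * r ^ N) = (LINT r|M. \<bar>u r t - phase t r\<bar>)"
proof -
 note int = phase_distance_integrable[OF t(1)]
 have m: "(%r. \<bar>u r t - phase t r\<bar>) \<in> borel_measurable M" using int by (rule borel_measurable_integrable)
 have Rt: "i t * R t = 1" using R[OF t] by simp
 have "r * i t < 1 \<longleftrightarrow> r < R t" for r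
  using mult_less_cancel_right_pos[OF i_pos[OF t], of r "R t"] Rt by (simp add: mult.commute)
 then have e: "\<bar>u r t - step_profile (R t) r\<bar> * r ^ N = r ^ N * \<bar>u r t - phase t r\<bar>" for r
  by (simp add: step_profile_def)
 show ?thesis
  unfolding e rmeas_integral[OF m] using int unfolding rmeas_integrable[OF m] by (rule lebesgue_integral_closed_unit_interval)
qed

text \<open>Used at time zero to turn \<open>L1\<close> closeness of the initial profile into a
  small initial excess. The sharp profile takes the values \<open>-1\<close> and \<open>1\<close>,
  where \<open>well_potential\<close> is \<open>0\<close> and \<open>c0\<close>;
  \<open>1 <= C\<close> places them in the range of the Lipschitz bound.\<close>

lemma excess_le_phase_distance:
 assumes t: "0 <= t" "t <= T" and C: "1 <= C"
  and L: "!!x y. \<bar>x\<bar> <= C ==> \<bar>y\<bar> <= C ==> \<bar>well_potential x - well_potential y\<bar> <= L * \<bar>x - y\<bar>"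
  and B: "!!r. 0 <= r ==> r <= 1 ==> g t r * \<bar>wt_w N (i t) r\<bar> <= B"
 shows "excess t <= B * L * (LINT r|M. \<bar>u r t - phase t r\<bar>)"
proof -
 have "excess t <= (LINT r|M. B * L * \<bar>u r t - phase t r\<bar>)"
  unfolding excess_eq(1)[OF t]
 proof (rule integral_mono[OF excess_eq(2)[OF t] integrable_mult_right[OF phase_distance_integrable[OF t(1)]]])
  fix r assume "r \<in> space M"
  then have r: "0 < r" "r < 1" by auto
  have p: "\<bar>phase t r\<bar> <= C" using C by simp
  have "(if r * i t < 1 then 0 else c0) = well_potential (phase t r)" using well_potential(2) well_potential_1 by simp
  then have "\<bar>well_potential (u r t) - (if r * i t < 1 then 0 else c0)\<bar> <= L * \<bar>u r t - phase t r\<bar>"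
   using L[OF bd[OF r t(1)] p] by (simp only:)
  moreover have "0 <= g t r * \<bar>wt_w N (i t) r\<bar>" using g_nonneg[OF t, of r] by simp
  moreover have Br: "g t r * \<bar>wt_w N (i t) r\<bar> <= B" using B[of r] r by simp
  ultimately have "g t r * \<bar>wt_w N (i t) r\<bar> * \<bar>well_potential (u r t) - (if r * i t < 1 then 0 else c0)\<bar> <= B * (L * \<bar>u r t - phase t r\<bar>)"
   by (intro mult_mono) auto
  then show "g t r * \<bar>wt_w N (i t) r\<bar> * \<bar>well_potential (u r t) - (if r * i t < 1 then 0 else c0)\<bar> <= B * L * \<bar>u r t - phase t r\<bar>"
   by (simp only: mult.assoc)
 qed
 then show ?thesis by (simp only: integral_mult_right_zero)
qed

text \<open>At time zero \<open>r ^ N\<close> times the factor \<open>i 0 ^ N\<close> of the weight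
  is \<open>(r / \<rho>) ^ N\<close>, so the energy density in the radial measure is exactly the
  given integrand.\<close>

lemma initial_energy:
 assumes T0: "0 <= T"
  and b: "(LINT r|lebesgue_on {0..1}. (eps ^ 3 * \<tau> / 2 * (u1 r)^2 + eps / 2 * (weak_deriv_r u0 r)^2 + F (u0 r) / eps) * interface_weight n \<rho> r) <= E"
  and n: "N = n - 1" "1 <= n" and \<rho>: "i 0 = 1 / \<rho>"
 shows "energy 0 <= E"
proof -
 let ?h = "%r. g 0 r * (eps * kap / 2 * (v r 0)^2 + density 0 r)"
 let ?k = "%r. (eps ^ 3 * \<tau> / 2 * (u1 r)^2 + eps / 2 * (weak_deriv_r u0 r)^2 + F (u0 r) / eps) * interface_weight n \<rho> r"
 note ea = energy_alt[OF order_refl]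
 have hm: "?h \<in> borel_measurable M" using ea(1) by (rule borel_measurable_integrable)
 have hi: "integrable (lebesgue_on {0<..<1}) (%r. r ^ N * ?h r)" using ea(1) unfolding rmeas_integrable[OF hm] .
 have iw: "interface_weight n \<rho> r = r ^ N * g 0 r" for r
 proof -
  have "real n - 1 = real N" using n by simp
  then show ?thesis unfolding interface_weight_def wt_g_def \<rho> n(1)[symmetric]
   by (simp add: power_divide algebra_simps)
 qed
 have ini: "\<forall>r\<in>{0<..<1}. u r 0 = u0 r" "AE r in M. v r 0 = u1 r" "AE r in M. p r 0 = weak_deriv_r u0 r"
  using sol unfolding strong_solution_def by simp_all
 have ae: "AE r in lebesgue_on {0<..<1}. r ^ N * ?h r = ?k r"
  using ini(2,3)[unfolded AE_rmeas] AE_space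
 proof eventually_elim
  case (elim r)
  then have "u r 0 = u0 r" using ini(1) by simp
  then show ?case unfolding elim(1)[symmetric] elim(2)[symmetric] iw
   by (simp add: power3_eq_cube power2_eq_square algebra_simps)
 qed
 have km: "integrable (lebesgue_on {0<..<1}) ?k" "(LINT r|lebesgue_on {0<..<1}. r ^ N * ?h r) = (LINT r|lebesgue_on {0<..<1}. ?k r)"
  using integrable_AE_lebesgue_on[OF hi ae] by simp_all
 have "energy 0 = (LINT r|lebesgue_on {0..1}. ?k r)"
  unfolding ea(2) rmeas_integral[OF hm] km(2) lebesgue_integral_closed_unit_interval[OF km(1)] ..
 then show ?thesis using b by simp
qed

text \<open>In a layer of half-width \<open>\<alpha>\<close> around the interface \<open>u\<close>
  is merely bounded, and the layer has measure at most \<open>2 * \<alpha>\<close>. Outside it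
  \<open>\<bar>1 - r * i t\<bar> >= \<alpha>\<close>, so the weight in the excess is bounded below
  and controls \<open>well_potential u\<close>, while \<open>eps\<close> times the energy controls
  \<open>F u\<close>. \<open>q\<close> is a lower bound for the exponentials in the weights, valid
  because \<open>r * i t <= I\<close>.\<close>

lemma phase_distance_le:
 assumes t: "0 <= t" "t <= T" and \<alpha>: "0 < \<alpha>" and K: "0 <= K" and \<eta>: "0 <= \<eta>" and C: "0 <= C" and I: "i t <= I"
  and K1: "!!x. \<bar>x\<bar> <= C ==> \<bar>x + 1\<bar> <= \<eta> + K * (\<bar>well_potential x\<bar> + F x)"
  and K2: "!!x. \<bar>x\<bar> <= C ==> \<bar>x - 1\<bar> <= \<eta> + K * (\<bar>well_potential x - c0\<bar> + F x)"
 defines "q \<equiv> exp ((real N + 1) * (1 - I))"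
 shows "(LINT r|M. \<bar>u r t - phase t r\<bar>) <= \<eta> + (C + 1) * (2 * \<alpha>) + K / (\<alpha> * q) * excess t + K / q * (eps * energy t)"
proof -
 have Rt: "0 < R t" "R t < 1" "i t * R t = 1" using R[OF t] by auto
 have ip: "0 < i t" by (rule i_pos[OF t])
 have i1: "1 <= i t" using Rt ip by (metis less_eq_real_def mult.right_neutral mult_left_mono)
 let ?L = "{R t - \<alpha>..R t + \<alpha>} \<inter> {0<..<1}"
 let ?J = "%r. g t r * \<bar>wt_w N (i t) r\<bar> * \<bar>well_potential (u r t) - (if r * i t < 1 then 0 else c0)\<bar>"
 let ?E = "%r. g t r * (eps * kap / 2 * (v r t)^2 + density t r)"
 interpret fm: finite_measure M by (rule finite_measure_rmeas)
 have q: "0 < q" by (simp add: q_def)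
 note lay = rmeas_layer[OF less_imp_le[OF \<alpha>], where R="R t" and N=N]
 have int: "integrable M (%r. \<eta> + (C + 1) * indicator ?L r + K / (\<alpha> * q) * ?J r + K / q * (eps * ?E r))"
  using lay(1) excess_eq(2)[OF t] energy_alt(1)[OF t(1)]
  by (intro Bochner_Integration.integrable_add integrable_mult_right fm.integrable_const integrable_real_indicator) (auto simp: fm.emeasure_eq_measure)
 have "(LINT r|M. \<bar>u r t - phase t r\<bar>) <= (LINT r|M. \<eta> + (C + 1) * indicator ?L r + K / (\<alpha> * q) * ?J r + K / q * (eps * ?E r))"
 proof (rule integral_mono[OF phase_distance_integrable[OF t(1)] int])
  fix r assume "r \<in> space M"
  then have r: "0 < r" "r < 1" by auto
  note ur = bd[OF r t(1)]
  have gr: "0 <= g t r" by (rule g_nonneg[OF t])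
  have J0: "0 <= K / (\<alpha> * q) * ?J r" using K \<alpha> q gr by simp
  have E0: "0 <= K / q * (eps * ?E r)" using K q eps \<tau> gr F_nonneg[of "u r t"] by simp
  show "\<bar>u r t - phase t r\<bar> <= \<eta> + (C + 1) * indicator ?L r + K / (\<alpha> * q) * ?J r + K / q * (eps * ?E r)"
  proof (cases "r \<in> ?L")
   case True
   have "\<bar>u r t - phase t r\<bar> <= C + 1" using ur by auto
   then show ?thesis using True J0 E0 \<eta> by simp
  next
   case False
   then have "\<alpha> <= \<bar>r - R t\<bar>" using r by auto
   also have "\<dots> <= \<bar>r - R t\<bar> * i t" using i1 mult_left_mono[of 1 "i t" "\<bar>r - R t\<bar>"] by simp
   also have "\<dots> = \<bar>1 - r * i t\<bar>"
   proof -
    have "(r - R t) * i t = - (1 - r * i t)" using Rt(3) by (simp add: algebra_simps)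
    then show ?thesis using ip by (metis abs_minus_cancel abs_mult abs_of_pos)
   qed
   finally have far: "\<alpha> <= \<bar>1 - r * i t\<bar>" .
   have "r * i t <= 1 * i t" using r ip by (intro mult_right_mono) auto
   then have ri: "r * i t <= I" using I by simp
   let ?e = "exp (1 - r * i t)"
   have x: "1 - I <= 1 - r * i t" using ri by simp
   have iN: "1 <= i t ^ N" using i1 by (rule one_le_power)
   have gq: "q <= g t r" "\<alpha> * q <= g t r * \<bar>wt_w N (i t) r\<bar>"
   proof -
    have I1: "1 - I <= 0" using i1 I by simp
    have "q <= exp (real N * (1 - I))" unfolding q_def using I1 by (simp add: distrib_right)
    also have "\<dots> <= exp (real N * (1 - r * i t))" using x by (simp add: mult_left_mono)
    also have "\<dots> <= i t ^ N * exp (real N * (1 - r * i t))" using iN by simp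
    finally show "q <= g t r" unfolding wt_g_def .
    have "\<alpha> * q <= \<bar>1 - r * i t\<bar> * exp ((real N + 1) * (1 - r * i t))"
     unfolding q_def using far \<alpha> x by (intro mult_mono) (auto intro: mult_left_mono)
    also have "\<dots> <= i t ^ N * ((real N + 1) * i t) * (\<bar>1 - r * i t\<bar> * exp ((real N + 1) * (1 - r * i t)))"
    proof -
     have "1 * (1 * 1) <= i t ^ N * ((real N + 1) * i t)" using iN i1 by (intro mult_mono) auto
     then show ?thesis using mult_right_mono[of 1 _ "\<bar>1 - r * i t\<bar> * exp ((real N + 1) * (1 - r * i t))"] by simp
    qed
    also have "\<dots> = g t r * \<bar>wt_w N (i t) r\<bar>"
    proof -
     have "exp ((real N + 1) * (1 - r * i t)) = exp (real N * (1 - r * i t)) * ?e" by (simp add: distrib_right flip: exp_add)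
     then show ?thesis unfolding wt_g_def wt_w_def using ip by (simp add: abs_mult mult_ac)
    qed
    finally show "\<alpha> * q <= g t r * \<bar>wt_w N (i t) r\<bar>" .
   qed
   let ?W = "\<bar>well_potential (u r t) - (if r * i t < 1 then 0 else c0)\<bar>"
   have "\<bar>u r t - phase t r\<bar> <= \<eta> + K * (?W + F (u r t))" using K1[OF ur] K2[OF ur] by simp
   moreover have "K * ?W <= K / (\<alpha> * q) * ?J r"
   proof -
    have "K / (\<alpha> * q) * (\<alpha> * q * ?W) <= K / (\<alpha> * q) * ?J r"
     using gq(2) K \<alpha> q by (intro mult_left_mono mult_right_mono) auto
    then show ?thesis using \<alpha> q by simp
   qed
   moreover have "K * F (u r t) <= K / q * (eps * ?E r)"
   proof -
    have "F (u r t) / eps <= eps * kap / 2 * (v r t)^2 + density t r" using eps \<tau> by simp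
    then have "q * (F (u r t) / eps) <= ?E r" using gq(1) gr q eps F_nonneg[of "u r t"] by (intro mult_mono) auto
    then have "K / q * (eps * (q * (F (u r t) / eps))) <= K / q * (eps * ?E r)" using K q eps by (intro mult_left_mono) auto
    then show ?thesis using q eps by simp
   qed
   moreover have "indicator ?L r = (0::real)" using False by simp
   ultimately show ?thesis by (simp only: distrib_left mult_zero_right)
  qed
 qed
 also have "\<dots> = \<eta> * measure M {0<..<1} + (C + 1) * measure M ?L + K / (\<alpha> * q) * excess t + K / q * (eps * energy t)"
 proof -
  have a: "integrable M (%r. \<eta>)" "integrable M (%r. (C + 1) * indicator ?L r)" "integrable M (%r. K / (\<alpha> * q) * ?J r)" "integrable M (%r. K / q * (eps * ?E r))"
   using lay(1) excess_eq(2)[OF t] energy_alt(1)[OF t(1)]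
   by (auto intro!: integrable_mult_right fm.integrable_const integrable_real_indicator simp: fm.emeasure_eq_measure)
  have "(LINT r|M. K / q * (eps * ?E r)) = K / q * (eps * energy t)"
   unfolding energy_alt(2)[OF t(1)] integral_mult_right_zero ..
  moreover have "(LINT r|M. K / (\<alpha> * q) * ?J r) = K / (\<alpha> * q) * excess t"
   unfolding excess_eq(1)[OF t] integral_mult_right_zero ..
  moreover have "(LINT r|M. (C + 1) * indicator ?L r) = (C + 1) * measure M ?L"
   unfolding integral_mult_right_zero using lay(1) by (simp add: Int_absorb2)
  moreover have "(LINT r|M. \<eta>) = \<eta> * measure M {0<..<1}" by (simp add: mult.commute)
  ultimately show ?thesis
   unfolding Bochner_Integration.integral_add[OF Bochner_Integration.integrable_add[OF Bochner_Integration.integrable_add[OF a(1,2)] a(3)] a(4)]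
    Bochner_Integration.integral_add[OF Bochner_Integration.integrable_add[OF a(1,2)] a(3)] Bochner_Integration.integral_add[OF a(1,2)] by (simp only:)
 qed
 also have "\<dots> <= \<eta> * 1 + (C + 1) * (2 * \<alpha>) + K / (\<alpha> * q) * excess t + K / q * (eps * energy t)"
  using lay(2) C \<eta> rmeas_total by (intro add_mono mult_left_mono order_refl) auto
 finally show ?thesis by simp
qed

end

lemma interface_radius_bounds:
 fixes N :: nat and \<rho>0 T :: real
 assumes \<rho>0: "0 < \<rho>0" "\<rho>0 < 1" and N: "1 <= N" and T: "0 < T" "T < \<rho>0\<^sup>2 / (2 * real N)"
 defines "R \<equiv> %s. sqrt (\<rho>0\<^sup>2 - 2 * real N * s)"
 shows "\<exists>a b. a < 0 & T < b & (\<forall>s. a <= s --> s <= b --> 0 < R s & R s < 1 \<and>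
   ((%s. inverse (R s)) has_real_derivative real N * inverse (R s) ^ 3) (at s) \<and>
   ((%s. inverse (1 - R s)) has_real_derivative - real N * inverse (R s) * (inverse (1 - R s))^2) (at s))"
  "!!s. 0 <= s ==> s <= T ==> inverse (R s) <= inverse (R T) & inverse (1 - R s) <= inverse (1 - \<rho>0)"
proof -
 have Np: "0 < real N" using N by simp
 have sq: "\<rho>0\<^sup>2 < 1" using \<rho>0 by (simp add: power_less_one_iff)
 \<comment> \<open>At time \<open>a\<close> the squared radius is the midpoint of
   \<open>\<rho>0^2\<close> and \<open>1\<close>, so the radius stays below \<open>1\<close>;
   \<open>b\<close> lies halfway between \<open>T\<close> and the extinction time.\<close>
 define a where "a = - ((1 - \<rho>0\<^sup>2) / (4 * real N))"
 define b where "b = (T + \<rho>0\<^sup>2 / (2 * real N)) / 2"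
 have lin2: "x < (x + y) / 2 & (x + y) / 2 < y" if "x < y" for x y :: real using that by simp
 have b: "T < b" "b < \<rho>0\<^sup>2 / (2 * real N)" using lin2[OF T(2)] unfolding b_def by auto
 have a: "a < 0" unfolding a_def using sq Np by simp
 have half: "x - y < 1" if "x < 1" "- ((1 - x) / 2) <= y" for x y :: real using that by (simp add: field_simps)
 have q: "0 < \<rho>0\<^sup>2 - 2 * real N * s" "\<rho>0\<^sup>2 - 2 * real N * s < 1" if s: "a <= s" "s <= b" for s
 proof -
  have "s < \<rho>0\<^sup>2 / (2 * real N)" using s b by linarith
  then show "0 < \<rho>0\<^sup>2 - 2 * real N * s" using Np by (simp add: field_simps)
  have "2 * real N * a = - (1 - \<rho>0\<^sup>2) / 2" unfolding a_def using Np by (simp add: field_simps)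
  moreover have "2 * real N * a <= 2 * real N * s" using s Np by (intro mult_left_mono) auto
  ultimately have "- ((1 - \<rho>0\<^sup>2) / 2) <= 2 * real N * s" by (simp only: minus_divide_left)
  then show "\<rho>0\<^sup>2 - 2 * real N * s < 1" using half[OF sq] by blast
 qed
 have "0 < R s & R s < 1 & ((%s. inverse (R s)) has_real_derivative real N * inverse (R s) ^ 3) (at s) \<and>
   ((%s. inverse (1 - R s)) has_real_derivative - real N * inverse (R s) * (inverse (1 - R s))^2) (at s)"
  if s: "a <= s" "s <= b" for s
 proof -
  note qs = q[OF s]
  have R: "0 < R s" "R s < 1" using qs by (simp_all add: R_def)
  have lin: "((%s. \<rho>0\<^sup>2 - 2 * real N * s) has_real_derivative - 2 * real N) (at s)"
   by (auto intro!: derivative_eq_intros)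
  have "(R has_real_derivative inverse (sqrt (\<rho>0\<^sup>2 - 2 * real N * s)) / 2 * (- 2 * real N)) (at s)"
   unfolding R_def by (rule DERIV_chain2[where f=sqrt and g="%s. \<rho>0\<^sup>2 - 2 * real N * s", OF DERIV_real_sqrt[OF qs(1)] lin])
  then have DR: "(R has_real_derivative - real N * inverse (R s)) (at s)"
   by (rule DERIV_cong) (simp add: R_def)
  have "((%s. inverse (R s)) has_real_derivative - (inverse (R s) * (- real N * inverse (R s)) * inverse (R s))) (at s)"
   using DERIV_inverse'[OF DR] R by simp
  then have 1: "((%s. inverse (R s)) has_real_derivative real N * inverse (R s) ^ 3) (at s)"
   by (rule DERIV_cong) (simp add: power3_eq_cube)
  have "((%s. 1 - R s) has_real_derivative 0 - (- real N * inverse (R s))) (at s)" by (intro DERIV_diff DERIV_const DR)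
  from DERIV_inverse'[OF this] R
  have "((%s. inverse (1 - R s)) has_real_derivative - (inverse (1 - R s) * (0 - (- real N * inverse (R s))) * inverse (1 - R s))) (at s)"
   by simp
  then have 2: "((%s. inverse (1 - R s)) has_real_derivative - real N * inverse (R s) * (inverse (1 - R s))^2) (at s)"
   by (rule DERIV_cong) (simp add: power2_eq_square)
  show ?thesis using R 1 2 by blast
 qed
 then show "\<exists>a b. a < 0 & T < b & (\<forall>s. a <= s --> s <= b --> 0 < R s & R s < 1 \<and>
   ((%s. inverse (R s)) has_real_derivative real N * inverse (R s) ^ 3) (at s) \<and>
   ((%s. inverse (1 - R s)) has_real_derivative - real N * inverse (R s) * (inverse (1 - R s))^2) (at s))"
  using a b(1) by blast
 fix s assume s: "0 <= s" "s <= T"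
 have "0 < \<rho>0\<^sup>2 - 2 * real N * T" using q[of T] a b T by simp
 moreover have "\<rho>0\<^sup>2 - 2 * real N * T <= \<rho>0\<^sup>2 - 2 * real N * s" using s Np by simp
 ultimately have "0 < R T" "R T <= R s" unfolding R_def by simp_all
 then have i: "inverse (R s) <= inverse (R T)" by (rule le_imp_inverse_le[rotated])
 have "R s <= sqrt (\<rho>0\<^sup>2)" unfolding R_def using s Np by (intro real_sqrt_le_mono) simp
 then have "R s <= \<rho>0" using \<rho>0 by simp
 then have "inverse (1 - R s) <= inverse (1 - \<rho>0)" using \<rho>0 by (intro le_imp_inverse_le) auto
 with i show "inverse (R s) <= inverse (R T) & inverse (1 - R s) <= inverse (1 - \<rho>0)" by blast
qed

theorem theorem3:
  fixes n :: nat
    and \<rho>0 T \<mu> \<epsilon>0 C3 C4 :: real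
    and \<tau> z :: "real \<Rightarrow> real"
    and F F' F'' :: "real \<Rightarrow> real"
    and u0 u1 :: "real \<Rightarrow> real \<Rightarrow> real"
    and u :: "real \<Rightarrow> real \<Rightarrow> real \<Rightarrow> real"
  assumes n: "n = CARD('n::finite)" "n \<in> {2, 3}"
    and \<rho>0: "0 < \<rho>0" "\<rho>0 < 1"
    and \<tau>_pos: "\<And>\<epsilon>. 0 < \<epsilon> \<Longrightarrow> \<epsilon> < \<epsilon>0 \<Longrightarrow> 0 < \<tau> \<epsilon>"
    and \<tau>_small: "0 < \<mu>" "\<tau> \<in> o[at_right 0](\<lambda>\<epsilon>. \<epsilon> powr \<mu>)"
    and F_C2: "\<And>s. (F has_real_derivative F' s) (at s)"
      "\<And>s. (F' has_real_derivative F'' s) (at s)"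
      "continuous_on UNIV F''"
    and F_wells: "F (-1) = 0" "F 1 = 0" "F' (-1) = 0" "F' 1 = 0" "F'' (-1) > 0" "F'' 1 > 0"
      "\<And>s. s \<noteq> -1 \<Longrightarrow> s \<noteq> 1 \<Longrightarrow> F s > 0"
    and \<epsilon>0: "0 < \<epsilon>0"
    and solution: "\<And>\<epsilon>. 0 < \<epsilon> \<Longrightarrow> \<epsilon> < \<epsilon>0 \<Longrightarrow>
      damped_radial_solution TYPE('n) F' \<epsilon> (\<tau> \<epsilon>) (u0 \<epsilon>) (u1 \<epsilon>) (u \<epsilon>)"
    and i: "((\<lambda>\<epsilon>. LINT r|lebesgue_on {0..1}. \<bar>u0 \<epsilon> r - step_profile \<rho>0 r\<bar> * r ^ (n - 1))
      \<longlongrightarrow> 0) (at_right 0)"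
    and ii: "\<And>\<epsilon>. 0 < \<epsilon> \<Longrightarrow> 0 \<le> z \<epsilon>" "(z \<longlongrightarrow> 0) (at_right 0)"
      "\<And>\<epsilon>. 0 < \<epsilon> \<Longrightarrow> \<epsilon> < \<epsilon>0 \<Longrightarrow>
        (LINT r|lebesgue_on {0..1}.
          (\<epsilon> ^ 3 * \<tau> \<epsilon> / 2 * (u1 \<epsilon> r)\<^sup>2 + \<epsilon> / 2 * (weak_deriv_r (u0 \<epsilon>) r)\<^sup>2 + F (u0 \<epsilon> r) / \<epsilon>)
          * interface_weight n \<rho>0 r)
        \<le> min_energy F + z \<epsilon>"
    and iii: "0 < C3"
      "\<And>\<epsilon>. 0 < \<epsilon> \<Longrightarrow> \<epsilon> < \<epsilon>0 \<Longrightarrow>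
        1 / (\<epsilon>\<^sup>2 * \<tau> \<epsilon>) * (LINT x|lebesgue_on (ball (0::real^'n) 1).
          (weak_laplacian (ball 0 1) (radial (u0 \<epsilon>)) x
            - F' (u0 \<epsilon> (norm x)) / \<epsilon>\<^sup>2 - u1 \<epsilon> (norm x))\<^sup>2)
        + (LINT x|lebesgue_on (ball (0::real^'n) 1).
            (\<Sum>b\<in>Basis. (weak_partial (ball 0 1) b (radial (u1 \<epsilon>)) x)\<^sup>2))
        \<le> C3 / (\<epsilon> ^ 5 * \<tau> \<epsilon>)"
    and iv: "0 < C4"
      "\<And>\<epsilon> r t. 0 < \<epsilon> \<Longrightarrow> \<epsilon> < \<epsilon>0 \<Longrightarrow> 0 < r \<Longrightarrow> r < 1 \<Longrightarrow> 0 \<le> t \<Longrightarrow> \<bar>u \<epsilon> r t\<bar> \<le> C4"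
    and T: "0 < T" "T < \<rho>0\<^sup>2 / (2 * (real n - 1))"
  shows "((\<lambda>\<epsilon>. LINT t|lebesgue_on {0..T}. LINT r|lebesgue_on {0..1}.
      \<bar>u \<epsilon> r t - step_profile (interface_radius n \<rho>0 t) r\<bar> * r ^ (n - 1)) \<longlongrightarrow> 0) (at_right 0)"
proof -
 interpret W: double_well F F' F''
  using F_C2 F_wells by unfold_locales auto
 define N where "N = n - 1"
 have N: "1 <= N" "real n - 1 = real N" "N = CARD('n) - 1" using n by (auto simp: N_def)
 define R where "R s = sqrt (\<rho>0\<^sup>2 - 2 * real N * s)" for s
 define I J where "I s = inverse (R s)" and "J s = inverse (1 - R s)" for s
 have R_eq: "interface_radius n \<rho>0 t = R t" for t by (simp add: interface_radius_def R_def N(2))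
 have R0: "R 0 = \<rho>0" using \<rho>0 by (simp add: R_def)
 note geo = interface_radius_bounds[OF \<rho>0 N(1) T(1) T(2)[unfolded N(2)], folded R_def, folded I_def J_def]
 obtain a b where ab: "a < 0" "T < b" and geo': "!!s. a <= s ==> s <= b ==> 0 < R s & R s < 1 \<and>
   (I has_real_derivative real N * I s ^ 3) (at s) & (J has_real_derivative - real N * I s * (J s)^2) (at s)"
  using geo(1) by (elim exE conjE) (rule that, auto)
 have Rs: "0 < R s" "R s < 1" "I s * R s = 1" "J s * (1 - R s) = 1" if "0 <= s" "s <= T" for s
  using geo'[of s] that ab by (auto simp: I_def J_def)
 obtain A where A: "1 <= A" and coeff: "\<forall>i j \<rho> r. 0 < \<rho> --> \<rho> < 1 --> i * \<rho> = 1 --> j * (1 - \<rho>) = 1 --> i <= I T --> j <= inverse (1 - \<rho>0) --> 0 <= r --> r <= 1 -->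
  weight_bounds N A i j r"
  using weight_coefficient_bounds[of "I T" "inverse (1 - \<rho>0)" N] by (elim exE conjE) (rule that)
 \<comment> \<open>The maximum with \<open>1\<close> puts both wells into the range
   \<open>[-C, C]\<close>.\<close>
 define C where "C = max C4 1"
 obtain L where "C1_on_range W.well_potential W.well_speed C L" using W.C1_on_range_well_potential by blast
 note L = C1_on_rangeD(3)[OF this]
 have "continuous_on {0..1} (%r. wt_g N (I 0) r * \<bar>wt_w N (I 0) r\<bar>)"
  by (intro continuous_intros wt_continuous)
 from bounded_unit_interval[OF this] obtain B where B: "!!r. 0 <= r ==> r <= 1 ==> \<bar>wt_g N (I 0) r * \<bar>wt_w N (I 0) r\<bar>\<bar> <= B" by blast
 define c0 where "c0 = min_energy F"
 define d where "d \<epsilon> = (LINT r|lebesgue_on {0..1}. \<bar>u0 \<epsilon> r - step_profile \<rho>0 r\<bar> * r ^ (n - 1))" for \<epsilon>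
 define \<delta> where "\<delta> \<epsilon> = A * sqrt (\<epsilon>^2 * \<tau> \<epsilon>)" for \<epsilon>
 \<comment> \<open>The constant of \<open>main_estimate\<close> with the initial energy replaced by
   \<open>c0 + z \<epsilon>\<close> and the initial excess by \<open>B * L * d \<epsilon>\<close>.
   The term \<open>c0 + z \<epsilon> - c0\<close> is left uncancelled so that the comparison is term
   by term.\<close>
 define S where "S \<epsilon> = 2 * (c0 + z \<epsilon> - c0 + 2 * (B * L * d \<epsilon>) + \<delta> \<epsilon> * (c0 + z \<epsilon>) + 2 * (\<delta> \<epsilon> * c0)) * exp (14 * A^2 * (A + 1) * T)" for \<epsilon>
 have \<delta>_lim: "(\<delta> \<longlongrightarrow> 0) (at_right 0)"
 proof -
  have ev: "eventually (%\<epsilon>::real. 0 < \<epsilon> & \<epsilon> < min \<epsilon>0 1) (at_right 0)"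
   using eventually_at_right[of 0 1] \<epsilon>0 eventually_at_right_real[of 0 "min \<epsilon>0 1"] by auto
  have "eventually (%\<epsilon>. norm (\<tau> \<epsilon>) <= 1 * norm (\<epsilon> powr \<mu>)) (at_right 0)"
   using landau_o.smallD[OF \<tau>_small(2), of 1] by simp
  then have bd: "eventually (%\<epsilon>. norm (\<epsilon>^2 * \<tau> \<epsilon>) <= \<epsilon>^2) (at_right 0)"
   using ev
  proof eventually_elim
   case (elim \<epsilon>)
   have "\<epsilon> powr \<mu> <= 1 powr \<mu>" using elim \<tau>_small(1) by (intro powr_mono2) auto
   then have "\<bar>\<tau> \<epsilon>\<bar> <= 1" using elim by simp
   then have "\<epsilon>\<^sup>2 * \<bar>\<tau> \<epsilon>\<bar> <= \<epsilon>^2 * 1" by (intro mult_left_mono) auto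
   then show ?case by (simp add: abs_mult)
  qed
  have "((%\<epsilon>::real. \<epsilon>\<^sup>2) \<longlongrightarrow> 0\<^sup>2) (at_right 0)" by (intro tendsto_intros)
  then have "((%\<epsilon>. \<epsilon>\<^sup>2 * \<tau> \<epsilon>) \<longlongrightarrow> 0) (at_right 0)" by (intro Lim_null_comparison[OF bd]) simp
  from tendsto_mult[OF tendsto_const[of A] tendsto_real_sqrt[OF this]] show ?thesis unfolding \<delta>_def by simp
 qed
 have d_lim: "(d \<longlongrightarrow> 0) (at_right 0)" using i unfolding d_def .
 have S_lim: "(S \<longlongrightarrow> 0) (at_right 0)"
 proof -
  have "(S \<longlongrightarrow> 2 * (c0 + 0 - c0 + 2 * (B * L * 0) + 0 * (c0 + 0) + 2 * (0 * c0)) * exp (14 * A^2 * (A + 1) * T)) (at_right 0)"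
   unfolding S_def by (intro tendsto_intros ii(2) d_lim \<delta>_lim)
  then show ?thesis by simp
 qed
 \<comment> \<open>The right side does not depend on \<open>t\<close>, and \<open>\<alpha>\<close>,
   \<open>\<eta>\<close> and \<open>K\<close> are still free; they are fixed before
   \<open>\<epsilon>\<close> tends to zero.\<close>
 have step: "(LINT r|lebesgue_on {0..1}. \<bar>u \<epsilon> r t - step_profile (R t) r\<bar> * r ^ (n - 1))
   <= \<eta> + (C + 1) * (2 * \<alpha>) + K / (\<alpha> * exp ((real N + 1) * (1 - I T))) * S \<epsilon> + K / exp ((real N + 1) * (1 - I T)) * (\<epsilon> * (S \<epsilon> + c0))"
  if \<epsilon>: "0 < \<epsilon>" "\<epsilon> < \<epsilon>0" and small: "\<delta> \<epsilon> <= 1 / 2" and t: "0 <= t" "t <= T" and \<alpha>: "0 < \<alpha>" and K: "0 <= K" and \<eta>: "0 <= \<eta>"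
   and K1: "!!x. \<bar>x\<bar> <= C ==> \<bar>x + 1\<bar> <= \<eta> + K * (\<bar>W.well_potential x\<bar> + F x)"
   and K2: "!!x. \<bar>x\<bar> <= C ==> \<bar>x - 1\<bar> <= \<eta> + K * (\<bar>W.well_potential x - min_energy F\<bar> + F x)"
  for \<epsilon> t \<alpha> K \<eta>
 proof -
  obtain p l v v' w where sol: "strong_solution N F' \<epsilon> (\<tau> \<epsilon>) (u0 \<epsilon>) (u1 \<epsilon>) (u \<epsilon>) p l v v' w"
   using damped_radial_solution_imp_strong[OF solution[OF \<epsilon>] N(3)] by blast
  interpret D: damped_interface F F' F'' N \<epsilon> "\<tau> \<epsilon>" C a b T A "u0 \<epsilon>" "u1 \<epsilon>" "u \<epsilon>" p l v v' w I J R
  proof unfold_locales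
   show "\<bar>u \<epsilon> r t\<bar> <= C" if "0 < r" "r < 1" "0 <= t" for r t
    using iv(2)[OF \<epsilon> that] unfolding C_def by linarith
   show "0 < R s & R s < 1 & I s * R s = 1" if "0 <= s" "s <= T" for s using Rs[OF that] by blast
   fix s r :: real assume s: "0 <= s" "s <= T" and r: "0 <= r" "r <= 1"
   have g: "I s <= I T" "J s <= inverse (1 - \<rho>0)" using geo(2)[OF s] by auto
   show "weight_bounds N A (I s) (J s) r"
    by (rule coeff[rule_format, OF Rs(1)[OF s] Rs(2)[OF s] Rs(3)[OF s] Rs(4)[OF s] g r])
  qed (use sol N \<epsilon> \<tau>_pos[OF \<epsilon>] ab geo' A in simp_all)
  have T0: "0 <= T" using T by simp
  have E0: "D.energy 0 <= c0 + z \<epsilon>"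
   by (rule D.initial_energy[OF T0 ii(3)[OF \<epsilon>, folded c0_def] N_def]) (use n R0 in \<open>auto simp: I_def divide_inverse\<close>)
  have "D.excess 0 <= B * L * (LINT r|rmeas N. \<bar>u \<epsilon> r 0 - D.phase 0 r\<bar>)"
  proof (rule D.excess_le_phase_distance[OF order_refl T0 _ L])
   show "wt_g N (I 0) r * \<bar>wt_w N (I 0) r\<bar> <= B" if "0 <= r" "r <= 1" for r using B[OF that] by linarith
  qed (simp_all add: C_def)
  also have "(LINT r|rmeas N. \<bar>u \<epsilon> r 0 - D.phase 0 r\<bar>) = d \<epsilon>"
  proof -
   have u0: "\<forall>r\<in>{0<..<1}. u \<epsilon> r 0 = u0 \<epsilon> r" using sol unfolding strong_solution_def by simp
   have "(LINT r|lebesgue_on {0..1}. \<bar>u \<epsilon> r 0 - step_profile (R 0) r\<bar> * r ^ N) = d \<epsilon>"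
    unfolding d_def R0 N_def[symmetric]
   proof (rule lebesgue_integral_closed_unit_interval_cong)
    fix r :: real assume "0 < r" "r < 1"
    then show "\<bar>u \<epsilon> r 0 - step_profile \<rho>0 r\<bar> * r ^ N = \<bar>u0 \<epsilon> r - step_profile \<rho>0 r\<bar> * r ^ N" using u0 by simp
   next
    note m = D.phase_distance_integrable[OF order_refl]
    have e: "\<bar>u \<epsilon> r 0 - step_profile \<rho>0 r\<bar> * r ^ N = r ^ N * \<bar>u \<epsilon> r 0 - D.phase 0 r\<bar>" for r
    proof -
     have "r * I 0 < 1 \<longleftrightarrow> r < \<rho>0" using \<rho>0 unfolding I_def R0 by (simp add: field_simps)
     then show ?thesis by (simp add: step_profile_def)
    qed
    show "integrable (lebesgue_on {0<..<1}) (%r. \<bar>u \<epsilon> r 0 - step_profile \<rho>0 r\<bar> * r ^ N)"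
     unfolding e using m rmeas_integrable[OF borel_measurable_integrable[OF m]] by simp
   qed
   then show ?thesis using D.phase_distance_eq[OF order_refl T0] by simp
  qed
  finally have X0: "D.excess 0 <= B * L * d \<epsilon>" .
  have \<delta>0: "0 <= \<delta> \<epsilon>" using A \<tau>_pos[OF \<epsilon>] by (simp add: \<delta>_def)
  have "2 * (D.energy 0 - c0 + 2 * D.excess 0 + \<delta> \<epsilon> * D.energy 0 + 2 * (\<delta> \<epsilon> * c0)) * exp (14 * A^2 * (A + 1) * T) <= S \<epsilon>"
   unfolding S_def using E0 X0 \<delta>0 by (intro mult_right_mono mult_left_mono add_mono diff_mono order_refl) auto
  then have SB: "D.excess t <= S \<epsilon>" "D.energy t <= S \<epsilon> + c0"
   using D.main_estimate[OF small[unfolded \<delta>_def] t] unfolding \<delta>_def c0_def by linarith+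
  let ?q = "exp ((real N + 1) * (1 - I T))"
  have "(LINT r|lebesgue_on {0..1}. \<bar>u \<epsilon> r t - step_profile (R t) r\<bar> * r ^ (n - 1)) = (LINT r|rmeas N. \<bar>u \<epsilon> r t - D.phase t r\<bar>)"
   using D.phase_distance_eq[OF t] unfolding N_def[symmetric] .
  also have "\<dots> <= \<eta> + (C + 1) * (2 * \<alpha>) + K / (\<alpha> * ?q) * D.excess t + K / ?q * (\<epsilon> * D.energy t)"
   by (rule D.phase_distance_le[OF t \<alpha> K \<eta> _ _ K1 K2]) (use geo(2)[OF t] in \<open>auto simp: C_def\<close>)
  also have "\<dots> <= \<eta> + (C + 1) * (2 * \<alpha>) + K / (\<alpha> * ?q) * S \<epsilon> + K / ?q * (\<epsilon> * (S \<epsilon> + c0))"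
   using SB \<alpha> K \<epsilon> by (intro add_mono mult_left_mono order_refl) auto
  finally show ?thesis .
 qed
 let ?\<phi> = "%\<epsilon> t. LINT r|lebesgue_on {0..1}. \<bar>u \<epsilon> r t - step_profile (R t) r\<bar> * r ^ (n - 1)"
 have "((%\<epsilon>. LINT t|lebesgue_on {0..T}. ?\<phi> \<epsilon> t) \<longlongrightarrow> 0) (at_right 0)"
 proof (rule tendstoI)
  fix e :: real assume e: "0 < e"
  \<comment> \<open>The allowance per time, giving \<open>e / 2\<close> after integration over
    \<open>[0, T]\<close>. One quarter of \<open>e'\<close> goes to the layer through
    \<open>\<alpha>\<close>, one quarter is \<open>\<eta>\<close>, and half is left for the terms
    that vanish with \<open>\<epsilon>\<close>.\<close>
  define e' where "e' = e / (2 * T)"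
  have e': "0 < e'" using e T by (simp add: e'_def)
  define \<alpha> where "\<alpha> = e' / (8 * (C + 1))"
  have C: "0 < C + 1" by (simp add: C_def)
  have dv: "c * (2 * (e' / (8 * c))) = e' / 4" if "c ~= 0" for c using that by simp
  have \<alpha>: "0 < \<alpha>" "(C + 1) * (2 * \<alpha>) = e' / 4"
   using e' C dv[of "C + 1"] unfolding \<alpha>_def by (auto intro!: divide_pos_pos)
  have \<eta>: "0 < e' / 4" using e' by simp
  obtain K1 where K1: "0 <= K1" "!!x. \<bar>x\<bar> <= C ==> \<bar>x + 1\<bar> <= e' / 4 + K1 * (\<bar>W.well_potential x\<bar> + F x)"
   using W.distance_from_wells(1)[OF \<eta>, of C] by blast
  obtain K2 where K2: "0 <= K2" "!!x. \<bar>x\<bar> <= C ==> \<bar>x - 1\<bar> <= e' / 4 + K2 * (\<bar>W.well_potential x - min_energy F\<bar> + F x)"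
   using W.distance_from_wells(2)[OF \<eta>, of C] by blast
  define K where "K = K1 + K2"
  have K0: "0 <= K" using K1 K2 by (simp add: K_def)
  have K1': "\<bar>x + 1\<bar> <= e' / 4 + K * (\<bar>W.well_potential x\<bar> + F x)" if "\<bar>x\<bar> <= C" for x
  proof -
   have "K1 * (\<bar>W.well_potential x\<bar> + F x) <= K * (\<bar>W.well_potential x\<bar> + F x)"
    using K2(1) W.F_nonneg[of x] by (intro mult_right_mono) (auto simp: K_def)
   then show ?thesis using K1(2)[OF that] by linarith
  qed
  have K2': "\<bar>x - 1\<bar> <= e' / 4 + K * (\<bar>W.well_potential x - min_energy F\<bar> + F x)" if "\<bar>x\<bar> <= C" for x
  proof -
   have "K2 * (\<bar>W.well_potential x - min_energy F\<bar> + F x) <= K * (\<bar>W.well_potential x - min_energy F\<bar> + F x)"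
    using K1(1) W.F_nonneg[of x] by (intro mult_right_mono) (auto simp: K_def)
   then show ?thesis using K2(2)[OF that] by linarith
  qed
  let ?q = "exp ((real N + 1) * (1 - I T))"
  have id: "((%\<epsilon>::real. \<epsilon>) \<longlongrightarrow> 0) (at_right 0)" by (intro tendsto_intros)
  have "((%\<epsilon>. K / (\<alpha> * ?q) * S \<epsilon> + K / ?q * (\<epsilon> * (S \<epsilon> + c0))) \<longlongrightarrow> K / (\<alpha> * ?q) * 0 + K / ?q * (0 * (0 + c0))) (at_right 0)"
   by (intro tendsto_add tendsto_mult tendsto_const S_lim id)
  then have lim: "((%\<epsilon>. K / (\<alpha> * ?q) * S \<epsilon> + K / ?q * (\<epsilon> * (S \<epsilon> + c0))) \<longlongrightarrow> 0) (at_right 0)" by simp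
  have ev1: "eventually (%\<epsilon>. K / (\<alpha> * ?q) * S \<epsilon> + K / ?q * (\<epsilon> * (S \<epsilon> + c0)) < e' / 2) (at_right 0)"
   by (rule order_tendstoD(2)[OF lim]) (use e' in simp)
  have ev2: "eventually (%\<epsilon>. \<delta> \<epsilon> < 1 / 2) (at_right 0)" by (rule order_tendstoD(2)[OF \<delta>_lim]) simp
  have ev3: "eventually (%\<epsilon>. \<epsilon> \<in> {0<..<\<epsilon>0}) (at_right 0)" by (rule eventually_at_right_real[OF \<epsilon>0])
  show "eventually (%\<epsilon>. dist (LINT t|lebesgue_on {0..T}. ?\<phi> \<epsilon> t) 0 < e) (at_right 0)"
   using ev1 ev2 ev3
  proof eventually_elim
   case (elim \<epsilon>)
   have b: "0 <= ?\<phi> \<epsilon> t & ?\<phi> \<epsilon> t <= e'" if t: "0 <= t" "t <= T" for t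
   proof
    show "0 <= ?\<phi> \<epsilon> t" by (intro integral_nonneg_AE AE_I2) simp
    have "?\<phi> \<epsilon> t <= e' / 4 + (C + 1) * (2 * \<alpha>) + K / (\<alpha> * ?q) * S \<epsilon> + K / ?q * (\<epsilon> * (S \<epsilon> + c0))"
     by (rule step[OF _ _ _ t \<alpha>(1) K0 less_imp_le[OF \<eta>] K1' K2']) (use elim in auto)
    then show "?\<phi> \<epsilon> t <= e'" using elim(1) unfolding \<alpha>(2) by linarith
   qed
   note le = lebesgue_integral_nonneg_le[where \<phi>="?\<phi> \<epsilon>", OF less_imp_le[OF T(1)] less_imp_le[OF e'] b]
   have "e' * T < e" using e T by (simp add: e'_def)
   then show ?case using le by (simp add: dist_real_def)
  qed
 qed
 then show ?thesis unfolding R_eq .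
qed

end
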